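(* Every simple polygon $X$ in the plane $\mathbb{R}^2$ has an inscribed square; that is, there exist four points of $X$ which are the vertices of a (non-degenerate) square.
   Context: A simple polygon $X=[x_1\ldots x_n]$ in $\mathbb{R}^2$ ($n\ge 3$) is the closed piecewise linear curve with vertices $x_1,\dots,x_n\in\mathbb{R}^2$ formed by the union of the segments (edges) $[x_1,x_2],[x_2,x_3],\dots,[x_{n-1},x_n],[x_n,x_1]$, assumed to have no self-intersections (i.e. it is a Jordan curve). Here $X$ denotes the curve itself, not the region it bounds. A square is inscribed into $X$ if all four of its vertices lie on the curve $X$; the sides and interior of the square are not required to lie inside the region bounded by $X$. Squares are non-degenerate, i.e. have positive side length. *)

theory Defs
  imports "HOL-Analysis.Analysis"
begin

text \<open>The broken line through the listed points, parametrised over the unit interval.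
  The value on the empty list is a dummy.\<close>

fun broken_line :: "'a::real_normed_vector list \<Rightarrow> real \<Rightarrow> 'a" where
  "broken_line [] = linepath 0 0"
| "broken_line [x] = linepath x x"
| "broken_line [x, y] = linepath x y"
| "broken_line (x # y # z # zs) = linepath x y +++ broken_line (y # z # zs)"

definition closed_polygon_path :: "'a::real_normed_vector list \<Rightarrow> real \<Rightarrow> 'a" where
  "closed_polygon_path xs = broken_line (xs @ [hd xs])"

definition polygon_curve :: "'a::real_normed_vector list \<Rightarrow> 'a set" where
  "polygon_curve xs =
     (\<Union>i<length xs. closed_segment (xs ! i) (xs ! (Suc i mod length xs)))"

text \<open>Having no self-intersections refers to the traversal of the edges in order:
  it is a Jordan curve, that is, injective up to its coinciding end points.
  This excludes repeated vertices and backtracking edges, but permits consecutive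
  edges forming a straight angle.\<close>

definition simple_polygon :: "'a::real_normed_vector list \<Rightarrow> bool" where
  "simple_polygon xs \<longleftrightarrow> length xs \<ge> 3 \<and> simple_path (closed_polygon_path xs)"

text \<open>The vertices are listed in cyclic order.\<close>

definition is_square :: "real^2 \<Rightarrow> real^2 \<Rightarrow> real^2 \<Rightarrow> real^2 \<Rightarrow> bool" where
  "is_square a b c d \<longleftrightarrow>
     dist a b > 0 \<and> dist b c = dist a b \<and> dist c d = dist a b \<and> dist d a = dist a b \<and>
     orthogonal (b - a) (d - a) \<and> orthogonal (c - b) (a - b) \<and>
     orthogonal (d - c) (b - c) \<and> orthogonal (a - d) (c - d)"

lemma pathstart_broken_line [simp]: "xs \<noteq> [] \<Longrightarrow> pathstart (broken_line xs) = hd xs"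
  by (induction xs rule: broken_line.induct) auto

lemma pathfinish_broken_line [simp]: "xs \<noteq> [] \<Longrightarrow> pathfinish (broken_line xs) = last xs"
  by (induction xs rule: broken_line.induct) auto

lemma path_broken_line [simp]: "path (broken_line xs)"
  by (induction xs rule: broken_line.induct) (auto simp: path_def[of "\<lambda>_. x" for x])

lemma path_image_broken_line:
  "length xs \<ge> 2 \<Longrightarrow>
    path_image (broken_line xs) = (\<Union>i<length xs - 1. closed_segment (xs ! i) (xs ! Suc i))"
proof (induction xs rule: broken_line.induct)
  case (4 x y z zs)
  have "{..<length (x # y # z # zs) - 1} = insert 0 (Suc ` {..<length (y # z # zs) - 1})"
    by (auto simp: lessThan_Suc_eq_insert_0)
  with 4 show ?case
    by (simp add: path_image_join)
qed (auto simp: lessThan_Suc)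

lemma closed_polygon_path_closed:
  "xs \<noteq> [] \<Longrightarrow> pathfinish (closed_polygon_path xs) = pathstart (closed_polygon_path xs)"
  by (simp add: closed_polygon_path_def)

lemma path_image_closed_polygon_path:
  assumes "xs \<noteq> []"
  shows "path_image (closed_polygon_path xs) = polygon_curve xs"
proof -
  have "(xs @ [hd xs]) ! Suc i = xs ! (Suc i mod length xs)" if "i < length xs" for i
    using that assms by (cases "Suc i = length xs") (auto simp: nth_append hd_conv_nth)
  moreover have "length (xs @ [hd xs]) \<ge> 2"
    using assms by (cases xs) auto
  ultimately show ?thesis
    unfolding closed_polygon_path_def polygon_curve_def
    by (subst path_image_broken_line) (auto simp: nth_append)
qed

end

theory Submission
  imports Defs "HOL-Computational_Algebra.Polynomial"
begin

text \<open>The proof follows the classical parity argument for inscribed squares, carried out entirely for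
straight lines so that it becomes linear algebra plus a finite bookkeeping of signs.

Describe a polygon by the lines \<open>Im p = \<sigma> i * Re p + h i\<close> through its edges: the slopes \<open>\<sigma>\<close>
stay fixed and the offsets \<open>h\<close> move. A square with centre \<open>y\<close> has corners \<open>y + \<i>^j * w\<close>; for
four given lines, one per corner, the pair \<open>(y, w)\<close> solves a regular linear system. Hence a
polygon with generic lines has finitely many inscribed squares with corners on at least three
edges, one candidate for each 4-tuple of edges up to rotation. The polygon in question may cross itself: this
is essential, because lines will be pushed across each other. The quantity with constant
parity is the number of inscribed squares plus the number of crossings of nonadjacent edges that meet at an
obtuse angle (measured between the directions of travel); a crossing is treated as the
degenerate square of the tuple \<open>[a, b, a, b]\<close>.

Theorem \<open>odd_square_count\<close> says that this number is odd, by induction on the number of edges.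
The last line is moved parallel to itself. The count can change only at two kinds of events.
When a corner of a square of positive size reaches a vertex of the polygon, the tuples that
change status come in pairs: a tuple and the one that uses the neighbouring edge at this corner (\<open>partner\<close>).
If three lines become concurrent, a whole family of squares on these three lines shrinks to a point
and grows again on the other side; when a vertex passes through an edge
(\<open>vertex_event_even\<close>) the changes among nine squares and two crossings cancel modulo two,
and when an edge shrinks to a point (\<open>short_edge_event_sum\<close>) the count among the squares on
the three lines involved is even both before and after. So the parity is constant along the sweep
(\<open>sweep_parity_invariant\<close>). The sweep ends where the moving edge has almost shrunk
to a point; it then carries an even number of squares and can be deleted (\<open>remove_line\<close>). A triangle has one or
three inscribed squares, according to whether it is obtuse or acute (\<open>triangle_odd\<close>).

Generic lines are dense (\<open>slopes_perturbation\<close>, \<open>generic_offsets\<close>), so every closed polygon is a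
limit of polygons that have a counted tuple, and compactness gives a square, possibly of
size zero, for some tuple on the polygon itself (\<open>inscribed_tuple\<close>). In a simple polygon nonadjacent edges are disjoint and
no three edges meet; this excludes crossings and squares of size zero, and what remains is a
genuine inscribed square.\<close>

section \<open>Squares with their corners on given lines\<close>

text \<open>A square is encoded by its centre and half of a diagonal, so that the corners depend linearly on the
  pair and the turn by a right angle acts on the second component alone.\<close>
definition corner :: "complex \<times> complex \<Rightarrow> nat \<Rightarrow> complex" where
  "corner z j = fst z + \<i> ^ j * snd z"

definition dev :: "(nat \<Rightarrow> real) \<Rightarrow> (nat \<Rightarrow> real) \<Rightarrow> nat \<Rightarrow> complex \<Rightarrow> real" where
  "dev s h i p = Im p - s i * Re p - h i"

lemma ii_cubed: "\<i> ^ 3 = - \<i>"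
  by (simp add: power3_eq_cube)

lemma Re_corner:
  "Re (corner z 0) = Re (fst z) + Re (snd z)" "Re (corner z (Suc 0)) = Re (fst z) - Im (snd z)"
  "Re (corner z 2) = Re (fst z) - Re (snd z)" "Re (corner z 3) = Re (fst z) + Im (snd z)"
  by (simp_all add: corner_def ii_cubed)

lemma Im_corner:
  "Im (corner z 0) = Im (fst z) + Im (snd z)" "Im (corner z (Suc 0)) = Im (fst z) + Re (snd z)"
  "Im (corner z 2) = Im (fst z) - Im (snd z)" "Im (corner z 3) = Im (fst z) - Re (snd z)"
  by (simp_all add: corner_def ii_cubed)

lemmas corner_simps = Re_corner Im_corner

lemma all_less_4: "(\<forall>j<4. P j) \<longleftrightarrow> P 0 \<and> P (Suc 0) \<and> P 2 \<and> P (3::nat)"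
  by (auto simp: numeral_eq_Suc less_Suc_eq)

text \<open>Solving for the square with two neighbouring corners on one line \<open>x\<close> and one each on two others. The
  positions of the corners relative to the triangle of the three lines are proportional to \<open>D\<close>, which
  vanishes when the lines are concurrent, with coefficients that depend only on the cotangents \<open>p\<close>, \<open>q\<close>
  of the angles on \<open>x\<close>.\<close>
lemma corners_formula_xxyz:
  fixes sx sy sz hx hy hz :: real
  assumes ne: "sx \<noteq> sy" "sy \<noteq> sz" "sx \<noteq> sz"
    and c0: "Im (corner z 0) - sx * Re (corner z 0) = hx"
    and c1: "Im (corner z (Suc 0)) - sx * Re (corner z (Suc 0)) = hx"
    and c2: "Im (corner z 2) - sy * Re (corner z 2) = hy"
    and c3: "Im (corner z 3) - sz * Re (corner z 3) = hz"
    and p: "p = - (1 + sz* sx) / (sx - sz)" and q: "q = - (1 + sx* sy) / (sy - sx)"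
    and D: "D = - ((sz-sy)*hx + (sx-sz)*hy + (sy-sx)*hz)"
  shows "(1+p+q) * ((sy-sx) * (Im (corner z 0) - sz * Re (corner z 0) - hz)) = p * D"
    "(1+p+q) * ((sy-sx) * (Im (corner z (Suc 0)) - sz * Re (corner z (Suc 0)) - hz)) = (1+p) * D"
    "(1+p+q) * ((sy-sx) * (Im (corner z 2) - sz * Re (corner z 2) - hz)) = D"
    "(1+p+q) * ((sx-sz) * (Im (corner z 3) - sy * Re (corner z 3) - hy)) = D"
proof -
  have pq: "p * (sx - sz) = - (1 + sz* sx)" "q * (sy - sx) = -(1 + sx* sy)"
    using ne by (simp_all add: p q)
  obtain a b c d where z: "Re (fst z) = a" "Im (fst z) = b" "Re (snd z) = c" "Im (snd z) = d" by blast
  have hx: "hx = b + d - sx * (a+c)" and hy: "hy = b - d - sy * (a - c)" and hz: "hz = b - c - sz*(a+d)"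
    and e: "d + b - sx*(a+c) = b+c - sx*(a-d)"
    using c0 c1 c2 c3 by (simp_all add: corner_simps z)
  have cd: "d - c = sx * (c + d)" using e by (simp add: algebra_simps)
  have nz: "(sx - sz) * (sy - sx) \<noteq> 0" using ne by simp
  have X: "(sx - sz) * (sy - sx) * (1+p+q) = (sx - sz) * (sy - sx) - (1+sz* sx)*(sy-sx) - (1+sx* sy)*(sx-sz)"
    using pq by algebra
  have *: "L * V = R * W" if "(sx - sz) * (sy - sx) * L * V = (sx - sz) * (sy - sx) * R * W" for L V R W :: real
    using that nz by simp
  have **: "L * V = W" if "(sx - sz) * (sy - sx) * L * V = (sx - sz) * (sy - sx) * W" for L V W :: real
    using that nz by simp
  show "(1+p+q) * ((sy-sx) * (Im (corner z 0) - sz * Re (corner z 0) - hz)) = p * D"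
    apply (rule *) unfolding X D hx hy hz corner_simps z using pq cd by algebra
  show "(1+p+q) * ((sy-sx) * (Im (corner z (Suc 0)) - sz * Re (corner z (Suc 0)) - hz)) = (1+p) * D"
    apply (rule *) unfolding X D hx hy hz corner_simps z using pq cd by algebra
  show "(1+p+q) * ((sy-sx) * (Im (corner z 2) - sz * Re (corner z 2) - hz)) = D"
    apply (rule **) unfolding X D hx hy hz corner_simps z using cd by algebra
  show "(1+p+q) * ((sx-sz) * (Im (corner z 3) - sy * Re (corner z 3) - hy)) = D"
    apply (rule **) unfolding X D hx hy hz corner_simps z using cd by algebra
qed

text \<open>The square on the other side of the line \<open>x\<close>: the order of the two remaining corners is reversed.\<close>
lemma corners_formula_xxzy:
  fixes sx sy sz hx hy hz :: real
  assumes ne: "sx \<noteq> sy" "sy \<noteq> sz" "sx \<noteq> sz"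
    and c0: "Im (corner z 0) - sx * Re (corner z 0) = hx"
    and c1: "Im (corner z (Suc 0)) - sx * Re (corner z (Suc 0)) = hx"
    and c2: "Im (corner z 2) - sz * Re (corner z 2) = hz"
    and c3: "Im (corner z 3) - sy * Re (corner z 3) = hy"
    and p: "p = - (1 + sz * sx) / (sx - sz)" and q: "q = - (1 + sx * sy) / (sy - sx)"
    and D: "D = - ((sz-sy)*hx + (sx-sz)*hy + (sy-sx)*hz)"
  shows "(1-p-q) * ((sy-sx) * (Im (corner z 0) - sz * Re (corner z 0) - hz)) = (1-p) * D"
    "(1-p-q) * ((sy-sx) * (Im (corner z (Suc 0)) - sz * Re (corner z (Suc 0)) - hz)) = - p * D"
    "(1-p-q) * ((sx-sz) * (Im (corner z 2) - sy * Re (corner z 2) - hy)) = D"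
    "(1-p-q) * ((sy-sx) * (Im (corner z 3) - sz * Re (corner z 3) - hz)) = D"
proof -
  have pq: "p * (sx - sz) = - (1 + sz * sx)" "q * (sy - sx) = -(1 + sx * sy)"
    using ne by (simp_all add: p q)
  obtain a b c d where z: "Re (fst z) = a" "Im (fst z) = b" "Re (snd z) = c" "Im (snd z) = d" by blast
  have hx: "hx = b + d - sx * (a+c)" and hz: "hz = b - d - sz * (a - c)" and hy: "hy = b - c - sy*(a+d)"
    and e: "d + b - sx*(a+c) = b+c - sx*(a-d)"
    using c0 c1 c2 c3 by (simp_all add: corner_simps z)
  have cd: "d - c = sx * (c + d)" using e by (simp add: algebra_simps)
  have nz: "(sx - sz) * (sy - sx) \<noteq> 0" using ne by simp
  have X: "(sx - sz) * (sy - sx) * (1-p-q) = (sx - sz) * (sy - sx) + (1+sz * sx)*(sy-sx) + (1+sx * sy)*(sx-sz)"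
    using pq by algebra
  have *: "L * V = R * W" if "(sx - sz) * (sy - sx) * L * V = (sx - sz) * (sy - sx) * R * W" for L V R W :: real
    using that nz by simp
  have **: "L * V = W" if "(sx - sz) * (sy - sx) * L * V = (sx - sz) * (sy - sx) * W" for L V W :: real
    using that nz by simp
  show "(1-p-q) * ((sy-sx) * (Im (corner z 0) - sz * Re (corner z 0) - hz)) = (1-p) * D"
    apply (rule *) unfolding X D hx hy hz corner_simps z using pq cd by algebra
  show "(1-p-q) * ((sy-sx) * (Im (corner z (Suc 0)) - sz * Re (corner z (Suc 0)) - hz)) = - p * D"
    apply (rule *) unfolding X D hx hy hz corner_simps z using pq cd by algebra
  show "(1-p-q) * ((sx-sz) * (Im (corner z 2) - sy * Re (corner z 2) - hy)) = D"
    apply (rule **) unfolding X D hx hy hz corner_simps z using cd by algebra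
  show "(1-p-q) * ((sy-sx) * (Im (corner z 3) - sz * Re (corner z 3) - hz)) = D"
    apply (rule **) unfolding X D hx hy hz corner_simps z using cd by algebra
qed

text \<open>Here opposite corners lie on the same line, so this line carries a diagonal of the square.\<close>
lemma corners_formula_xyxz:
  fixes sx sy sz hx hy hz :: real
  assumes ne: "sx \<noteq> sy" "sy \<noteq> sz" "sx \<noteq> sz"
    and c0: "Im (corner z 0) - sx * Re (corner z 0) = hx"
    and c1: "Im (corner z (Suc 0)) - sy * Re (corner z (Suc 0)) = hy"
    and c2: "Im (corner z 2) - sx * Re (corner z 2) = hx"
    and c3: "Im (corner z 3) - sz * Re (corner z 3) = hz"
    and p: "p = - (1 + sz * sx) / (sx - sz)" and q: "q = - (1 + sx * sy) / (sy - sx)"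
    and D: "D = - ((sz-sy)*hx + (sx-sz)*hy + (sy-sx)*hz)"
  shows "(p-q) * ((sy-sx) * (Im (corner z 0) - sz * Re (corner z 0) - hz)) = (p-1) * D"
    "(p-q) * ((sy-sx) * (Im (corner z (Suc 0)) - sz * Re (corner z (Suc 0)) - hz)) = 2 * p * D"
    "(p-q) * ((sy-sx) * (Im (corner z 2) - sz * Re (corner z 2) - hz)) = (1+p) * D"
    "(p-q) * ((sx-sz) * (Im (corner z 3) - sy * Re (corner z 3) - hy)) = - 2 * q * D"
proof -
  have pq: "p * (sx - sz) = - (1 + sz * sx)" "q * (sy - sx) = -(1 + sx * sy)"
    using ne by (simp_all add: p q)
  obtain a b c d where z: "Re (fst z) = a" "Im (fst z) = b" "Re (snd z) = c" "Im (snd z) = d" by blast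
  have hx: "hx = b + d - sx * (a+c)" and hy: "hy = b + c - sy * (a - d)" and hz: "hz = b - c - sz*(a+d)"
    and e: "b + d - sx*(a+c) = b-d - sx*(a-c)"
    using c0 c1 c2 c3 by (simp_all add: corner_simps z)
  have cd: "d = sx * c" using e by (simp add: algebra_simps)
  have nz: "(sx - sz) * (sy - sx) \<noteq> 0" using ne by simp
  have X: "(sx - sz) * (sy - sx) * (p-q) = (1+sx * sy)*(sx-sz) - (1+sz * sx)*(sy-sx)"
    using pq by algebra
  have *: "L * V = R * W" if "(sx - sz) * (sy - sx) * L * V = (sx - sz) * (sy - sx) * R * W" for L V R W :: real
    using that nz by simp
  show "(p-q) * ((sy-sx) * (Im (corner z 0) - sz * Re (corner z 0) - hz)) = (p-1) * D"
    apply (rule *) unfolding X D hx hy hz corner_simps z using pq cd by algebra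
  show "(p-q) * ((sy-sx) * (Im (corner z (Suc 0)) - sz * Re (corner z (Suc 0)) - hz)) = 2 * p * D"
    apply (rule *) unfolding X D hx hy hz corner_simps z using pq cd by algebra
  show "(p-q) * ((sy-sx) * (Im (corner z 2) - sz * Re (corner z 2) - hz)) = (1+p) * D"
    apply (rule *) unfolding X D hx hy hz corner_simps z using pq cd by algebra
  show "(p-q) * ((sx-sz) * (Im (corner z 3) - sy * Re (corner z 3) - hy)) = - 2 * q * D"
    apply (rule *) unfolding X D hx hy hz corner_simps z using pq cd by algebra
qed

section \<open>Parity of sign conditions\<close>

lemma pos_mult_iff: "x \<noteq> 0 \<Longrightarrow> y \<noteq> 0 \<Longrightarrow> 0 < x * y \<longleftrightarrow> (0 < x \<longleftrightarrow> 0 < y)" for x y :: real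
  by (auto simp: zero_less_mult_iff)

lemma neg_mult_iff: "x \<noteq> 0 \<Longrightarrow> y \<noteq> 0 \<Longrightarrow> x * y < 0 \<longleftrightarrow> \<not> (0 < x \<longleftrightarrow> 0 < y)" for x y :: real
  by (auto simp: mult_less_0_iff)

lemma neg_pos_iff: "x \<noteq> 0 \<Longrightarrow> 0 < - x \<longleftrightarrow> \<not> 0 < x" for x :: real
  by auto

lemmas sign_iff = pos_mult_iff neg_mult_iff neg_pos_iff

lemma all_same_sign2:
  fixes X Y k :: real
  assumes "k \<noteq> 0"
  shows "of_bool (0 < X * k \<and> 0 < Y * k) + of_bool (0 < - (X * k) \<and> 0 < - (Y * k))
    = (of_bool (0 < X * Y) :: nat)"
  using assms by (cases "0 < k"; cases X "0::real" rule: linorder_cases; cases Y "0::real" rule: linorder_cases)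
    (simp_all add: zero_less_mult_iff mult_less_0_iff)

lemma all_same_sign3:
  fixes X Y Z k :: real
  assumes "k \<noteq> 0"
  shows "of_bool (0 < X * k \<and> 0 < Y * k \<and> 0 < Z * k) + of_bool (0 < - (X * k) \<and> 0 < - (Y * k) \<and> 0 < - (Z * k))
    = (of_bool (0 < X * Y \<and> 0 < X * Z) :: nat)"
  using assms by (cases "0 < k"; cases X "0::real" rule: linorder_cases; cases Y "0::real" rule: linorder_cases;
      cases Z "0::real" rule: linorder_cases)
    (simp_all add: zero_less_mult_iff mult_less_0_iff)

text \<open>Replacing \<open>D\<close> by \<open>- D\<close> reverses all signs at once, so exactly one of the two values of \<open>D\<close> is
  admissible if the remaining factors agree in sign, and none otherwise.\<close>
lemma two_signs:
  fixes x y D d m n :: real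
  assumes "D \<noteq> 0" "d \<noteq> 0"
  shows "of_bool (0 < x * (m * D / d) \<and> 0 < y * (n * D / d))
       + of_bool (0 < x * (m * - D / d) \<and> 0 < y * (n * - D / d))
       = (of_bool (0 < (x * m) * (y * n)) :: nat)"
proof -
  define k where "k = D / d"
  have k: "k \<noteq> 0" using assms by (simp add: k_def)
  have e: "x * (m * D / d) = (x * m) * k" "y * (n * D / d) = (y * n) * k"
    "x * (m * - D / d) = - ((x * m) * k)" "y * (n * - D / d) = - ((y * n) * k)"
    by (simp_all add: k_def)
  show ?thesis unfolding e by (rule all_same_sign2[OF k])
qed

lemma three_signs:
  fixes x y z D d m n l :: real
  assumes "D \<noteq> 0" "d \<noteq> 0"
  shows "of_bool (0 < x * (m * D / d) \<and> 0 < y * (n * D / d) \<and> 0 < z * (l * D / d))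
       + of_bool (0 < x * (m * - D / d) \<and> 0 < y * (n * - D / d) \<and> 0 < z * (l * - D / d))
       = (of_bool (0 < (x * m) * (y * n) \<and> 0 < (x * m) * (z * l)) :: nat)"
proof -
  define k where "k = D / d"
  have k: "k \<noteq> 0" using assms by (simp add: k_def)
  have e: "x * (m * D / d) = (x * m) * k" "y * (n * D / d) = (y * n) * k" "z * (l * D / d) = (z * l) * k"
    "x * (m * - D / d) = - ((x * m) * k)" "y * (n * - D / d) = - ((y * n) * k)" "z * (l * - D / d) = - ((z * l) * k)"
    by (simp_all add: k_def)
  show ?thesis unfolding e by (rule all_same_sign3[OF k])
qed

text \<open>The three squares that have two corners on one edge at the moving vertex contribute, modulo two, only
  the sign of a single product; this is what later cancels against the corresponding term of the other
  edge.\<close>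
lemma triple_parity:
  fixes a b e r :: real
  assumes "a \<noteq> 0" "b \<noteq> 0" "e \<noteq> 0" "e \<noteq> 1" "e \<noteq> -1" "r \<noteq> 0"
  shows "even (of_bool (0 < (a * (1 + e)) * (a * e) \<and> 0 < (a * (1 + e)) * (b * r))
     + of_bool (0 < (a * - e) * (a * (1 - e)) \<and> 0 < (a * - e) * (b * - r))
     + of_bool (0 < (a * (1 - e)) * (a * - (1 + e)) \<and> 0 < (a * (1 - e)) * (b * - r))
     + of_bool (0 < a * b * (e * r)) :: nat)"
proof -
  have nz: "1 + e \<noteq> 0" "1 - e \<noteq> 0" "- e \<noteq> 0" "- (1 + e) \<noteq> 0" "- r \<noteq> 0"
    using assms by auto
  have imp: "\<not> 0 < e \<or> 0 < 1 + e" "0 < 1 - e \<or> 0 < e" by auto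
  have m: "x * y \<noteq> 0" if "x \<noteq> 0" "y \<noteq> 0" for x y :: real using that by simp
  note S = sign_iff m assms(1,2,3,6) nz not_False_eq_True
  have 1: "0 < (a * (1 + e)) * (a * e) \<longleftrightarrow> (0 < 1 + e \<longleftrightarrow> 0 < e)"
    "0 < (a * - e) * (a * (1 - e)) \<longleftrightarrow> \<not> (0 < e \<longleftrightarrow> 0 < 1 - e)"
    "0 < (a * (1 - e)) * (a * - (1 + e)) \<longleftrightarrow> \<not> (0 < 1 - e \<longleftrightarrow> 0 < 1 + e)"
    by (simp only: S; blast)+
  define A B R where "A = (0 < a)" and "B = (0 < b)" and "R = (0 < r)"
  have 2: "0 < (a * (1 + e)) * (b * r) \<longleftrightarrow> ((A \<longleftrightarrow> 0 < 1 + e) \<longleftrightarrow> (B \<longleftrightarrow> R))"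
    "0 < (a * - e) * (b * - r) \<longleftrightarrow> ((A \<longleftrightarrow> \<not> 0 < e) \<longleftrightarrow> (B \<longleftrightarrow> \<not> R))"
    "0 < (a * (1 - e)) * (b * - r) \<longleftrightarrow> ((A \<longleftrightarrow> 0 < 1 - e) \<longleftrightarrow> (B \<longleftrightarrow> \<not> R))"
    "0 < a * b * (e * r) \<longleftrightarrow> ((A \<longleftrightarrow> B) \<longleftrightarrow> (0 < e \<longleftrightarrow> R))"
    unfolding A_def B_def R_def by (simp_all only: S)
  show ?thesis
    unfolding 1 2 using imp
    by (cases A; cases B; cases R; cases "0 < e"; cases "0 < 1 + e"; cases "0 < 1 - e") simp_all
qed

text \<open>A vertex, the meeting point of the edges on lines \<open>f\<close> and \<open>g\<close>, is close to the interior of the edge on \<open>e\<close>. The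
  arguments \<open>e\<close>, \<open>f\<close>, \<open>g\<close> here are the cotangents of the angles opposite to the respective lines, and \<open>a\<close>, \<open>b\<close>
  carry the signs that tell on which side of the vertex the edges on \<open>f\<close> and \<open>g\<close> extend. The first nine summands
  are the squares on the three lines in the order of \<open>three_line_patterns\<close> below, the last two are the obtuse crossings
  of the edge on \<open>e\<close> with the two edges at the vertex.\<close>
definition vertex_count :: "real \<Rightarrow> real \<Rightarrow> real \<Rightarrow> real \<Rightarrow> real \<Rightarrow> real \<Rightarrow> real \<Rightarrow> nat" where
  "vertex_count a b v e f g D = of_bool (0 < a * (1 * D / (1 + f + g)) \<and> 0 < b * (1 * D / (1 + f + g)))
      + of_bool (0 < a * (1 * D / (1 - f - g)) \<and> 0 < b * (1 * D / (1 - f - g)))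
      + of_bool (0 < a * ((2 * f) * D / (f - g)) \<and> 0 < b * ((- 2 * g) * D / (f - g)))
      + of_bool (0 < a * ((1 + e) * D / (1 + g + e)) \<and> 0 < a * (e * D / (1 + g + e)) \<and> 0 < b * ((e + g) * D / (1 + g + e)))
      + of_bool (0 < a * (- e * D / (1 - g - e)) \<and> 0 < a * ((1 - e) * D / (1 - g - e)) \<and> 0 < b * (- (e + g) * D / (1 - g - e)))
      + of_bool (0 < a * ((1 - e) * D / (g - e)) \<and> 0 < a * (- (1 + e) * D / (g - e)) \<and> 0 < b * (- (e + g) * D / (g - e)))
      + of_bool (0 < b * ((1 + e) * D / (1 + e + f)) \<and> 0 < b * (e * D / (1 + e + f)) \<and> 0 < a * ((e + f) * D / (1 + e + f)))
      + of_bool (0 < b * (- e * D / (1 - e - f)) \<and> 0 < b * ((1 - e) * D / (1 - e - f)) \<and> 0 < a * (- (e + f) * D / (1 - e - f)))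
      + of_bool (0 < b * ((1 - e) * D / (f - e)) \<and> 0 < b * (- (1 + e) * D / (f - e)) \<and> 0 < a * (- (e + f) * D / (f - e)))
      + of_bool (0 < a * D \<and> v * (a * g) < 0) + of_bool (0 < b * D \<and> v * (b * f) < 0)"

text \<open>The sum of the counts before (\<open>D\<close>) and after (\<open>- D\<close>) the vertex passes through the edge. The two squares
  on \<open>e, e, f, g\<close> contribute equally; the triples with two corners on \<open>f\<close> or on \<open>g\<close> reduce by
  \<open>triple_parity\<close> to the same sign, because \<open>(e + f) * (e + g) = 1 + e^2\<close> is positive; and the square with a
  diagonal on \<open>e\<close> cancels against the two crossings.\<close>
lemma vertex_count_even:
  fixes a b v D e f g :: real
  assumes nz: "a \<noteq> 0" "b \<noteq> 0" "v \<noteq> 0" "D \<noteq> 0" "e \<noteq> 0" "f \<noteq> 0" "g \<noteq> 0"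
    and ne: "e \<noteq> 1" "e \<noteq> -1" "f \<noteq> 1" "f \<noteq> -1" "g \<noteq> 1" "g \<noteq> -1"
    and den: "1 + f + g \<noteq> 0" "1 - f - g \<noteq> 0" "f - g \<noteq> 0" "1 + g + e \<noteq> 0" "1 - g - e \<noteq> 0" "g - e \<noteq> 0"
      "1 + e + f \<noteq> 0" "1 - e - f \<noteq> 0" "f - e \<noteq> 0"
    and cot: "e * f + f * g + g * e = 1"
  shows "even (vertex_count a b v e f g D + vertex_count a b v e f g (- D))"
proof -
  define N where "N = vertex_count a b v e f g"
  have prod: "(e + f) * (e + g) = 1 + e\<^sup>2" using cot by algebra
  have pos: "0 < (e + f) * (e + g)" unfolding prod by (simp add: add_pos_nonneg)
  then have nz2: "e + f \<noteq> 0" "e + g \<noteq> 0" by auto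
  have t: "of_bool (0 < x * D \<and> P) + of_bool (0 < x * - D \<and> P) = (of_bool P :: nat)" if "x \<noteq> 0" for x P
    using that nz(4) by (auto simp: zero_less_mult_iff mult_less_0_iff)
  define T1 :: "real \<Rightarrow> nat" where "T1 = (\<lambda>D. of_bool (0 < a * (1 * D / (1 + f + g)) \<and> 0 < b * (1 * D / (1 + f + g))))"
  have r1: "T1 D + T1 (- D) = of_bool (0 < (a * 1) * (b * 1))"
    unfolding T1_def by (rule two_signs[OF nz(4) den(1)])
  define T2 :: "real \<Rightarrow> nat" where "T2 = (\<lambda>D. of_bool (0 < a * (1 * D / (1 - f - g)) \<and> 0 < b * (1 * D / (1 - f - g))))"
  have r2: "T2 D + T2 (- D) = of_bool (0 < (a * 1) * (b * 1))"
    unfolding T2_def by (rule two_signs[OF nz(4) den(2)])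
  define T3 :: "real \<Rightarrow> nat" where "T3 = (\<lambda>D. of_bool (0 < a * ((2 * f) * D / (f - g)) \<and> 0 < b * ((- 2 * g) * D / (f - g))))"
  have r3: "T3 D + T3 (- D) = of_bool (0 < (a * (2 * f)) * (b * (- 2 * g)))"
    unfolding T3_def by (rule two_signs[OF nz(4) den(3)])
  define T4 :: "real \<Rightarrow> nat" where "T4 = (\<lambda>D. of_bool (0 < a * ((1 + e) * D / (1 + g + e)) \<and> 0 < a * (e * D / (1 + g + e)) \<and> 0 < b * ((e + g) * D / (1 + g + e))))"
  have r4: "T4 D + T4 (- D) = of_bool (0 < (a * (1 + e)) * (a * e) \<and> 0 < (a * (1 + e)) * (b * (e + g)))"
    unfolding T4_def by (rule three_signs[OF nz(4) den(4)])
  define T5 :: "real \<Rightarrow> nat" where "T5 = (\<lambda>D. of_bool (0 < a * (- e * D / (1 - g - e)) \<and> 0 < a * ((1 - e) * D / (1 - g - e)) \<and> 0 < b * (- (e + g) * D / (1 - g - e))))"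
  have r5: "T5 D + T5 (- D) = of_bool (0 < (a * - e) * (a * (1 - e)) \<and> 0 < (a * - e) * (b * - (e + g)))"
    unfolding T5_def by (rule three_signs[OF nz(4) den(5)])
  define T6 :: "real \<Rightarrow> nat" where "T6 = (\<lambda>D. of_bool (0 < a * ((1 - e) * D / (g - e)) \<and> 0 < a * (- (1 + e) * D / (g - e)) \<and> 0 < b * (- (e + g) * D / (g - e))))"
  have r6: "T6 D + T6 (- D) = of_bool (0 < (a * (1 - e)) * (a * - (1 + e)) \<and> 0 < (a * (1 - e)) * (b * - (e + g)))"
    unfolding T6_def by (rule three_signs[OF nz(4) den(6)])
  define T7 :: "real \<Rightarrow> nat" where "T7 = (\<lambda>D. of_bool (0 < b * ((1 + e) * D / (1 + e + f)) \<and> 0 < b * (e * D / (1 + e + f)) \<and> 0 < a * ((e + f) * D / (1 + e + f))))"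
  have r7: "T7 D + T7 (- D) = of_bool (0 < (b * (1 + e)) * (b * e) \<and> 0 < (b * (1 + e)) * (a * (e + f)))"
    unfolding T7_def by (rule three_signs[OF nz(4) den(7)])
  define T8 :: "real \<Rightarrow> nat" where "T8 = (\<lambda>D. of_bool (0 < b * (- e * D / (1 - e - f)) \<and> 0 < b * ((1 - e) * D / (1 - e - f)) \<and> 0 < a * (- (e + f) * D / (1 - e - f))))"
  have r8: "T8 D + T8 (- D) = of_bool (0 < (b * - e) * (b * (1 - e)) \<and> 0 < (b * - e) * (a * - (e + f)))"
    unfolding T8_def by (rule three_signs[OF nz(4) den(8)])
  define T9 :: "real \<Rightarrow> nat" where "T9 = (\<lambda>D. of_bool (0 < b * ((1 - e) * D / (f - e)) \<and> 0 < b * (- (1 + e) * D / (f - e)) \<and> 0 < a * (- (e + f) * D / (f - e))))"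
  have r9: "T9 D + T9 (- D) = of_bool (0 < (b * (1 - e)) * (b * - (1 + e)) \<and> 0 < (b * (1 - e)) * (a * - (e + f)))"
    unfolding T9_def by (rule three_signs[OF nz(4) den(9)])
  define T10 :: "real \<Rightarrow> nat" where "T10 = (\<lambda>D. of_bool (0 < a * D \<and> v * (a * g) < 0))"
  have r10: "T10 D + T10 (- D) = of_bool (v * (a * g) < 0)"
    unfolding T10_def by (rule t[OF nz(1)])
  define T11 :: "real \<Rightarrow> nat" where "T11 = (\<lambda>D. of_bool (0 < b * D \<and> v * (b * f) < 0))"
  have r11: "T11 D + T11 (- D) = of_bool (v * (b * f) < 0)"
    unfolding T11_def by (rule t[OF nz(2)])
  have "N D + N (- D) = (T1 D + T1 (- D)) + (T2 D + T2 (- D)) + (T3 D + T3 (- D)) + (T4 D + T4 (- D)) + (T5 D + T5 (- D)) + (T6 D + T6 (- D)) + (T7 D + T7 (- D)) + (T8 D + T8 (- D)) + (T9 D + T9 (- D)) + (T10 D + T10 (- D)) + (T11 D + T11 (- D))"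
    unfolding N_def vertex_count_def T1_def T2_def T3_def T4_def T5_def T6_def T7_def T8_def T9_def T10_def T11_def by (simp only: add_ac)
  also have "\<dots> = of_bool (0 < (a * 1) * (b * 1)) + of_bool (0 < (a * 1) * (b * 1)) + of_bool (0 < (a * (2 * f)) * (b * (- 2 * g)))
    + (of_bool (0 < (a * (1 + e)) * (a * e) \<and> 0 < (a * (1 + e)) * (b * (e + g)))
     + of_bool (0 < (a * - e) * (a * (1 - e)) \<and> 0 < (a * - e) * (b * - (e + g)))
     + of_bool (0 < (a * (1 - e)) * (a * - (1 + e)) \<and> 0 < (a * (1 - e)) * (b * - (e + g))))
    + (of_bool (0 < (b * (1 + e)) * (b * e) \<and> 0 < (b * (1 + e)) * (a * (e + f)))
     + of_bool (0 < (b * - e) * (b * (1 - e)) \<and> 0 < (b * - e) * (a * - (e + f)))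
     + of_bool (0 < (b * (1 - e)) * (b * - (1 + e)) \<and> 0 < (b * (1 - e)) * (a * - (e + f))))
    + (of_bool (v * (a * g) < 0) + of_bool (v * (b * f) < 0))"
    unfolding r1 r2 r3 r4 r5 r6 r7 r8 r9 r10 r11 by (simp only: add_ac)
  finally have sum: "N D + N (- D) = of_bool (0 < (a * 1) * (b * 1)) + of_bool (0 < (a * 1) * (b * 1)) + of_bool (0 < (a * (2 * f)) * (b * (- 2 * g)))
    + (of_bool (0 < (a * (1 + e)) * (a * e) \<and> 0 < (a * (1 + e)) * (b * (e + g)))
     + of_bool (0 < (a * - e) * (a * (1 - e)) \<and> 0 < (a * - e) * (b * - (e + g)))
     + of_bool (0 < (a * (1 - e)) * (a * - (1 + e)) \<and> 0 < (a * (1 - e)) * (b * - (e + g))))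
    + (of_bool (0 < (b * (1 + e)) * (b * e) \<and> 0 < (b * (1 + e)) * (a * (e + f)))
     + of_bool (0 < (b * - e) * (b * (1 - e)) \<and> 0 < (b * - e) * (a * - (e + f)))
     + of_bool (0 < (b * (1 - e)) * (b * - (1 + e)) \<and> 0 < (b * (1 - e)) * (a * - (e + f))))
    + (of_bool (v * (a * g) < 0) + of_bool (v * (b * f) < 0))" .
  have e1: "even (of_bool (0 < (a * (1 + e)) * (a * e) \<and> 0 < (a * (1 + e)) * (b * (e + g)))
     + of_bool (0 < (a * - e) * (a * (1 - e)) \<and> 0 < (a * - e) * (b * - (e + g)))
     + of_bool (0 < (a * (1 - e)) * (a * - (1 + e)) \<and> 0 < (a * (1 - e)) * (b * - (e + g)))
     + of_bool (0 < a * b * (e * (e + g))) :: nat)"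
    using triple_parity[of a b e "e + g"] nz ne nz2 by blast
  have e2: "even (of_bool (0 < (b * (1 + e)) * (b * e) \<and> 0 < (b * (1 + e)) * (a * (e + f)))
     + of_bool (0 < (b * - e) * (b * (1 - e)) \<and> 0 < (b * - e) * (a * - (e + f)))
     + of_bool (0 < (b * (1 - e)) * (b * - (1 + e)) \<and> 0 < (b * (1 - e)) * (a * - (e + f)))
     + of_bool (0 < b * a * (e * (e + f))) :: nat)"
    using triple_parity[of b a e "e + f"] nz ne nz2 by blast
  have m: "x * y \<noteq> 0" if "x \<noteq> 0" "y \<noteq> 0" for x y :: real using that by simp
  have "0 < e + f \<longleftrightarrow> 0 < e + g" using pos pos_mult_iff[OF nz2] by blast
  then have e3: "0 < a * b * (e * (e + g)) \<longleftrightarrow> 0 < b * a * (e * (e + f))"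
    by (simp only: sign_iff m nz nz2 not_False_eq_True) blast
  have e4: "even (of_bool (0 < (a * (2 * f)) * (b * (- 2 * g))) + (of_bool (v * (a * g) < 0) + of_bool (v * (b * f) < 0)) :: nat)"
  proof -
    have c: "(2::real) \<noteq> 0" "- 2 \<noteq> (0::real)" "(0::real) < 2 \<longleftrightarrow> True" "(0::real) < - 2 \<longleftrightarrow> False" by auto
    define A B V F G where "A = (0 < a)" and "B = (0 < b)" and "V = (0 < v)" and "F = (0 < f)" and "G = (0 < g)"
    have 1: "0 < (a * (2 * f)) * (b * (- 2 * g)) \<longleftrightarrow> ((A \<longleftrightarrow> F) \<longleftrightarrow> \<not> (B \<longleftrightarrow> G))"
      "v * (a * g) < 0 \<longleftrightarrow> \<not> (V \<longleftrightarrow> (A \<longleftrightarrow> G))" "v * (b * f) < 0 \<longleftrightarrow> \<not> (V \<longleftrightarrow> (B \<longleftrightarrow> F))"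
      unfolding A_def B_def V_def F_def G_def
      by (simp only: sign_iff m nz c not_False_eq_True; blast)+
    show ?thesis unfolding 1 by (cases A; cases B; cases V; cases F; cases G) simp_all
  qed
  have comb: "even (t + t + z + X + Y + w)" if "even (X + u)" "even (Y + u)" "even (z + w)" for t z X Y w u :: nat
    using that by auto
  show ?thesis unfolding N_def[symmetric] sum by (rule comb[OF e1 _ e4]) (use e2 in \<open>simp only: e3\<close>)
qed

text \<open>The propositional core of the next parity statement: \<open>A\<close>, \<open>B\<close>, \<open>S\<close>, \<open>F\<close>, \<open>G\<close> stand for the positivity of the
  corresponding lower case letters, \<open>F1\<close>, \<open>G1\<close> for being larger than one, \<open>F2\<close>, \<open>G2\<close> for being less than minus one.\<close>
lemma short_edge_boolean_parity:
  assumes "\<not> F1 \<or> \<not> G1 \<or> \<not> S" "\<not> F \<or> \<not> G \<or> F1 \<or> G1 \<or> S" "S \<or> F" "S \<or> G" "\<not> F1 \<or> F" "\<not> G1 \<or> G" "F \<or> G"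
  shows "even (of_bool (B \<and> (if A then G else G2)) + of_bool False + of_bool (\<not> S \<and> G1 \<and> A \<and> B)
      + of_bool (F \<and> G \<and> A \<and> B) + of_bool (F1 \<and> G1 \<and> A \<and> B) + of_bool (F2 \<and> A \<and> \<not> B \<or> G2 \<and> \<not> A \<and> B)
      + of_bool (A \<and> (if B then F else F2)) + of_bool False + of_bool (\<not> S \<and> F1 \<and> A \<and> B) + of_bool (A \<and> B \<and> S) :: nat)"
proof (cases "A \<and> B")
  case True
  then have AB: "A = True" "B = True" by auto
  show ?thesis unfolding AB
    using assms by (cases S; cases F; cases G; cases F1; cases G1) simp_all
next
  case False
  then show ?thesis by (cases A; cases B; cases F2; cases G2) simp_all
qed

text \<open>The edge on \<open>s\<close> between its neighbours on \<open>f\<close> and \<open>g\<close> is about to shrink to a point. As in \<open>vertex_count\<close>, the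
  letters are cotangents of the triangle of the three lines; the area has been absorbed into \<open>a\<close> and \<open>b\<close>. The last
  summand is the crossing of the edges on \<open>f\<close> and \<open>g\<close>.\<close>
definition short_edge_count :: "real \<Rightarrow> real \<Rightarrow> real \<Rightarrow> real \<Rightarrow> real \<Rightarrow> nat" where
  "short_edge_count a b f s g = of_bool (0 < a * ((1 + g) / (1 + s + g)) \<and> 0 < a * (g / (1 + s + g)) \<and> 0 < ((s + g) / (1 + s + g)) * (1 / (1 + s + g)) \<and> 0 < b * (1 / (1 + s + g)))
   + of_bool (0 < a * (- g / (1 - s - g)) \<and> 0 < a * ((1 - g) / (1 - s - g)) \<and> 0 < b * (1 / (1 - s - g)) \<and> 0 < (- (s + g) / (1 - s - g)) * (1 / (1 - s - g)))
   + of_bool (0 < a * ((1 - g) / (s - g)) \<and> 0 < a * (- (1 + g) / (s - g)) \<and> 0 < (- (s + g) / (s - g)) * (2 * s / (s - g)) \<and> 0 < b * (- 2 * g / (s - g)))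
   + of_bool (0 < (g / (1 + g + f)) * ((1 + f) / (1 + g + f)) \<and> 0 < ((1 + g) / (1 + g + f)) * (f / (1 + g + f)) \<and> 0 < b * ((f + g) / (1 + g + f)) \<and> 0 < a * ((f + g) / (1 + g + f)))
   + of_bool (0 < ((1 - g) / (1 - g - f)) * (- f / (1 - g - f)) \<and> 0 < (- g / (1 - g - f)) * ((1 - f) / (1 - g - f)) \<and> 0 < a * (- (f + g) / (1 - g - f)) \<and> 0 < b * (- (f + g) / (1 - g - f)))
   + of_bool (0 < ((g - 1) / (g - f)) * ((1 - f) / (g - f)) \<and> 0 < b * (- (f + g) / (g - f)) \<and> 0 < ((1 + g) / (g - f)) * (- (1 + f) / (g - f)) \<and> 0 < a * ((f + g) / (g - f)))
   + of_bool (0 < b * (f / (1 + f + s)) \<and> 0 < b * ((1 + f) / (1 + f + s)) \<and> 0 < a * (1 / (1 + f + s)) \<and> 0 < (1 / (1 + f + s)) * ((f + s) / (1 + f + s)))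
   + of_bool (0 < b * ((1 - f) / (1 - f - s)) \<and> 0 < b * (- f / (1 - f - s)) \<and> 0 < (1 / (1 - f - s)) * (- (f + s) / (1 - f - s)) \<and> 0 < a * (1 / (1 - f - s)))
   + of_bool (0 < b * ((f - 1) / (f - s)) \<and> 0 < a * (2 * f / (f - s)) \<and> 0 < b * ((1 + f) / (f - s)) \<and> 0 < (- 2 * s / (f - s)) * ((f + s) / (f - s)))
   + of_bool (0 < a \<and> 0 < b \<and> f * g < 1)"

lemma short_edge_count_even_positive:
  fixes a b f s g :: real
  assumes nz: "a \<noteq> 0" "b \<noteq> 0" "f \<noteq> 0" "s \<noteq> 0" "g \<noteq> 0"
    and ne: "f \<noteq> 1" "f \<noteq> -1" "s \<noteq> 1" "s \<noteq> -1" "g \<noteq> 1" "g \<noteq> -1"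
    and den: "1 + s + g \<noteq> 0" "1 - s - g \<noteq> 0" "s - g \<noteq> 0" "1 + g + f \<noteq> 0" "1 - g - f \<noteq> 0" "g - f \<noteq> 0"
      "1 + f + s \<noteq> 0" "1 - f - s \<noteq> 0" "f - s \<noteq> 0"
    and cot: "f * s + s * g + g * f = 1"
    and pos: "f + g > 0"
  shows "even (short_edge_count a b f s g)"
proof -
  have "(s + g) * (f + g) = 1 + g\<^sup>2" "(s + f) * (f + g) = 1 + f\<^sup>2" "s * (f + g) = 1 - f * g"
    using cot by algebra+
  then have "0 < (s + g) * (f + g)" "0 < (s + f) * (f + g)" and sfg: "s * (f + g) = 1 - f * g"
    by (simp_all add: add_pos_nonneg)
  then have sg: "0 < s + g" and sf: "0 < f + s" using pos by (simp_all add: zero_less_mult_iff)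
  have d: "0 < 1 + s + g" "0 < 1 + g + f" "0 < 1 + f + s" using sg sf pos by linarith+
  have fg: "f * g < 1 \<longleftrightarrow> 0 < s"
    using sfg pos by (smt (verit) mult_pos_pos mult_nonpos_nonneg)
  have sq: "0 < (x / d) * (y / d) \<longleftrightarrow> 0 < x * y" if "d \<noteq> 0" for x y d :: real
    using that by (auto simp: zero_less_mult_iff zero_less_divide_iff)
  have b1: "(0 < a * ((1 + g) / (1 + s + g)) \<and> 0 < a * (g / (1 + s + g)) \<and> 0 < ((s + g) / (1 + s + g)) * (1 / (1 + s + g)) \<and> 0 < b * (1 / (1 + s + g)))
      \<longleftrightarrow> 0 < b \<and> (if 0 < a then 0 < g else g < -1)"
    unfolding sq[OF den(1)] using d sg nz by (auto simp: zero_less_mult_iff zero_less_divide_iff mult_less_0_iff divide_less_0_iff)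
  have b2: "(0 < a * (- g / (1 - s - g)) \<and> 0 < a * ((1 - g) / (1 - s - g)) \<and> 0 < b * (1 / (1 - s - g)) \<and> 0 < (- (s + g) / (1 - s - g)) * (1 / (1 - s - g)))
      \<longleftrightarrow> False"
    unfolding sq[OF den(2)] using sg by (auto simp: zero_less_mult_iff zero_less_divide_iff mult_less_0_iff divide_less_0_iff)
  have b3: "(0 < a * ((1 - g) / (s - g)) \<and> 0 < a * (- (1 + g) / (s - g)) \<and> 0 < (- (s + g) / (s - g)) * (2 * s / (s - g)) \<and> 0 < b * (- 2 * g / (s - g)))
      \<longleftrightarrow> s < 0 \<and> 1 < g \<and> 0 < a \<and> 0 < b"
    unfolding sq[OF den(3)] using sg by (auto simp: zero_less_mult_iff zero_less_divide_iff mult_less_0_iff divide_less_0_iff)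
  have b4: "(0 < (g / (1 + g + f)) * ((1 + f) / (1 + g + f)) \<and> 0 < ((1 + g) / (1 + g + f)) * (f / (1 + g + f)) \<and> 0 < b * ((f + g) / (1 + g + f)) \<and> 0 < a * ((f + g) / (1 + g + f)))
      \<longleftrightarrow> 0 < f \<and> 0 < g \<and> 0 < a \<and> 0 < b"
    unfolding sq[OF den(4)] using d pos nz by (auto simp: zero_less_mult_iff zero_less_divide_iff mult_less_0_iff divide_less_0_iff)
  have b5: "(0 < ((1 - g) / (1 - g - f)) * (- f / (1 - g - f)) \<and> 0 < (- g / (1 - g - f)) * ((1 - f) / (1 - g - f)) \<and> 0 < a * (- (f + g) / (1 - g - f)) \<and> 0 < b * (- (f + g) / (1 - g - f)))
      \<longleftrightarrow> 1 < f \<and> 1 < g \<and> 0 < a \<and> 0 < b"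
    unfolding sq[OF den(5)] using pos nz by (auto simp: zero_less_mult_iff zero_less_divide_iff mult_less_0_iff divide_less_0_iff)
  have b6: "(0 < ((g - 1) / (g - f)) * ((1 - f) / (g - f)) \<and> 0 < b * (- (f + g) / (g - f)) \<and> 0 < ((1 + g) / (g - f)) * (- (1 + f) / (g - f)) \<and> 0 < a * ((f + g) / (g - f)))
      \<longleftrightarrow> (f < -1 \<and> 0 < a \<and> b < 0) \<or> (g < -1 \<and> a < 0 \<and> 0 < b)"
    unfolding sq[OF den(6)] using pos nz by (auto simp: zero_less_mult_iff zero_less_divide_iff mult_less_0_iff divide_less_0_iff)
  have b7: "(0 < b * (f / (1 + f + s)) \<and> 0 < b * ((1 + f) / (1 + f + s)) \<and> 0 < a * (1 / (1 + f + s)) \<and> 0 < (1 / (1 + f + s)) * ((f + s) / (1 + f + s)))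
      \<longleftrightarrow> 0 < a \<and> (if 0 < b then 0 < f else f < -1)"
    unfolding sq[OF den(7)] using d sf nz by (auto simp: zero_less_mult_iff zero_less_divide_iff mult_less_0_iff divide_less_0_iff)
  have b8: "(0 < b * ((1 - f) / (1 - f - s)) \<and> 0 < b * (- f / (1 - f - s)) \<and> 0 < (1 / (1 - f - s)) * (- (f + s) / (1 - f - s)) \<and> 0 < a * (1 / (1 - f - s)))
      \<longleftrightarrow> False"
    unfolding sq[OF den(8)] using sf by (auto simp: zero_less_mult_iff zero_less_divide_iff mult_less_0_iff divide_less_0_iff)
  have b9: "(0 < b * ((f - 1) / (f - s)) \<and> 0 < a * (2 * f / (f - s)) \<and> 0 < b * ((1 + f) / (f - s)) \<and> 0 < (- 2 * s / (f - s)) * ((f + s) / (f - s)))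
      \<longleftrightarrow> s < 0 \<and> 1 < f \<and> 0 < a \<and> 0 < b"
    unfolding sq[OF den(9)] using sf by (auto simp: zero_less_mult_iff zero_less_divide_iff mult_less_0_iff divide_less_0_iff)
  define A B S F G F1 G1 F2 G2 where "A = (0 < a)" and "B = (0 < b)" and "S = (0 < s)" and "F = (0 < f)" and "G = (0 < g)"
    and "F1 = (1 < f)" and "G1 = (1 < g)" and "F2 = (f < -1)" and "G2 = (g < -1)"
  note defs = this
  have neg: "a < 0 \<longleftrightarrow> \<not> A" "b < 0 \<longleftrightarrow> \<not> B" "s < 0 \<longleftrightarrow> \<not> S" using nz by (auto simp: defs)
  have B1: "\<not> F1 \<or> \<not> G1 \<or> \<not> S"
    using fg less_1_mult[of f g] unfolding defs by linarith
  have B2: "\<not> F \<or> \<not> G \<or> F1 \<or> G1 \<or> S"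
    using fg ne mult_strict_mono[of f 1 g 1] unfolding defs by linarith
  have B3: "S \<or> F" "S \<or> G" "\<not> F1 \<or> F" "\<not> G1 \<or> G" "F \<or> G"
    using sf sg pos nz unfolding defs by linarith+
  show ?thesis
    unfolding short_edge_count_def b1 b2 b3 b4 b5 b6 b7 b8 b9 fg neg defs[symmetric]
    by (rule short_edge_boolean_parity[OF B1 B2 B3])
qed

text \<open>Either all three numbers have the same sign or exactly one differs from the others. For the cotangents of the
  angles of a triangle, these are the acute and the obtuse case.\<close>
lemma odd_positive_products:
  fixes x y z :: real
  assumes nz: "x \<noteq> 0" "y \<noteq> 0" "z \<noteq> 0"
  shows "odd (of_bool (0 < x * y) + of_bool (0 < y * z) + of_bool (0 < z * x) :: nat)"
proof -
  consider "0 < x" "0 < y" | "0 < y" "0 < z" | "0 < x" "0 < z" | "x < 0" "y < 0" | "y < 0" "z < 0" | "x < 0" "z < 0"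
    using nz by linarith
  then show ?thesis
    using nz by cases (auto simp: zero_less_mult_iff)
qed

section \<open>Incidences as linear conditions\<close>

text \<open>The part of \<open>dev\<close> at the corner \<open>j\<close> that is linear in the square; corner \<open>j\<close> lies on line \<open>i\<close> when it equals \<open>h i\<close>.\<close>
definition lin :: "(nat \<Rightarrow> real) \<Rightarrow> nat \<Rightarrow> nat \<Rightarrow> complex \<times> complex \<Rightarrow> real" where
  "lin \<sigma> j i z = Im (corner z j) - \<sigma> i * Re (corner z j)"

lemma dev_corner: "dev \<sigma> h i (corner z j) = lin \<sigma> j i z - h i"
  by (simp add: dev_def lin_def)

lemma corner_add: "corner (z + z') j = corner z j + corner z' j"
  and corner_scaleR: "corner (r *\<^sub>R z) j = r *\<^sub>R corner z j"
  by (simp_all add: corner_def algebra_simps)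

lemma lin_add: "lin \<sigma> j i (z + z') = lin \<sigma> j i z + lin \<sigma> j i z'"
  and lin_scaleR: "lin \<sigma> j i (r *\<^sub>R z) = r * lin \<sigma> j i z"
  by (simp_all add: lin_def corner_add corner_scaleR algebra_simps)

lemma linear_lin: "linear (lin \<sigma> j i)"
  by (rule linearI) (simp_all add: lin_add lin_scaleR)

lemma two_lines_zero:
  fixes c d :: real
  assumes "a * c + b * d = 0" "a' * c + b' * d = 0" "a * b' - a' * b \<noteq> 0"
  shows "c = 0 \<and> d = 0"
proof -
  have "(a * b' - a' * b) * c = 0" "(a * b' - a' * b) * d = 0" using assms(1,2) by algebra+
  then show ?thesis using assms(3) by simp
qed

lemma less_4_cases:
  assumes "j < (4::nat)" obtains "j = 0" | "j = Suc 0" | "j = 2" | "j = 3"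
  using assms by (auto simp: numeral_eq_Suc less_Suc_eq)

text \<open>If the corners \<open>j\<close> and \<open>j'\<close> lie on parallels to a line of slope \<open>s\<close> then the direction of the half
  diagonal is determined; these are the coefficients of the linear equation it satisfies.\<close>
definition chord_coefficients :: "nat \<Rightarrow> nat \<Rightarrow> real \<Rightarrow> real \<times> real" where
  "chord_coefficients j j' s = (if {j, j'} = {0, 2} then (-s, 1) else if {j, j'} = {1, 3} then (1, s)
     else if {j, j'} = {0, 1} \<or> {j, j'} = {2, 3} then (-1 - s, 1 - s) else (1 - s, 1 + s))"

lemma chord_equation:
  assumes "j < 4" "j' < 4" "j \<noteq> j'" "lin \<sigma> j i z = lin \<sigma> j' i z"
  shows "fst (chord_coefficients j j' (\<sigma> i)) * Re (snd z) + snd (chord_coefficients j j' (\<sigma> i)) * Im (snd z) = 0"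
  using assms(1)
proof (cases rule: less_4_cases)
  case 1 from assms(2) show ?thesis
    by (cases rule: less_4_cases) (use assms 1 in \<open>simp_all add: chord_coefficients_def lin_def corner_simps doubleton_eq_iff algebra_simps\<close>)
next
  case 2 from assms(2) show ?thesis
    by (cases rule: less_4_cases) (use assms 2 in \<open>simp_all add: chord_coefficients_def lin_def corner_simps doubleton_eq_iff algebra_simps\<close>)
next
  case 3 from assms(2) show ?thesis
    by (cases rule: less_4_cases) (use assms 3 in \<open>simp_all add: chord_coefficients_def lin_def corner_simps doubleton_eq_iff algebra_simps\<close>)
next
  case 4 from assms(2) show ?thesis
    by (cases rule: less_4_cases) (use assms 4 in \<open>simp_all add: chord_coefficients_def lin_def corner_simps doubleton_eq_iff algebra_simps\<close>)
qed

lemma chord_coefficients_cases: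
  "chord_coefficients j j' s \<in> {(-s, 1), (1, s), (-1 - s, 1 - s), (1 - s, 1 + s)}"
  by (auto simp: chord_coefficients_def)

lemma complex_zeroI: "Re w = 0 \<Longrightarrow> Im w = 0 \<Longrightarrow> w = 0"
  by (simp add: complex_eq_iff)

lemma three_corners_on_line:
  assumes "j < 4" "k < 4" "l < 4" "j \<noteq> k" "j \<noteq> l" "k \<noteq> l"
    and "lin \<sigma> j i z = lin \<sigma> k i z" "lin \<sigma> j i z = lin \<sigma> l i z"
  shows "snd z = 0"
proof -
  note c = chord_equation[OF assms(1,2,4,7)] chord_equation[OF assms(1,3,5,8)]
  have "1 + \<sigma> i * \<sigma> i > 0" by (simp add: add_pos_nonneg)
  then have sq: "\<sigma> i * \<sigma> i \<noteq> - 1" "- 1 \<noteq> \<sigma> i * \<sigma> i" "1 + \<sigma> i * \<sigma> i \<noteq> 0" "2 + \<sigma> i * (\<sigma> i * 2) \<noteq> 0" by auto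
  have "fst (chord_coefficients j k (\<sigma> i)) * snd (chord_coefficients j l (\<sigma> i)) - fst (chord_coefficients j l (\<sigma> i)) * snd (chord_coefficients j k (\<sigma> i)) \<noteq> 0"
    using assms(1)
  proof (cases rule: less_4_cases)
    case 1 from assms(2) show ?thesis
      by (cases rule: less_4_cases; use assms(3) in \<open>cases rule: less_4_cases\<close>)
        (use assms(4-6) 1 sq in \<open>auto simp: chord_coefficients_def doubleton_eq_iff algebra_simps\<close>)
  next
    case 2 from assms(2) show ?thesis
      by (cases rule: less_4_cases; use assms(3) in \<open>cases rule: less_4_cases\<close>)
        (use assms(4-6) 2 sq in \<open>auto simp: chord_coefficients_def doubleton_eq_iff algebra_simps\<close>)
  next
    case 3 from assms(2) show ?thesis
      by (cases rule: less_4_cases; use assms(3) in \<open>cases rule: less_4_cases\<close>)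
        (use assms(4-6) 3 sq in \<open>auto simp: chord_coefficients_def doubleton_eq_iff algebra_simps\<close>)
  next
    case 4 from assms(2) show ?thesis
      by (cases rule: less_4_cases; use assms(3) in \<open>cases rule: less_4_cases\<close>)
        (use assms(4-6) 4 sq in \<open>auto simp: chord_coefficients_def doubleton_eq_iff algebra_simps\<close>)
  qed
  from two_lines_zero[OF c this] show ?thesis by (auto intro: complex_zeroI)
qed

text \<open>Sides and diagonals of a square only make angles that are multiples of 45 degrees. Two lines whose angle is not
  such a multiple cannot both contain a side or diagonal unless the square is a point.\<close>
lemma two_chords:
  assumes "j < 4" "j' < 4" "j \<noteq> j'" "k < 4" "k' < 4" "k \<noteq> k'"
    and "lin \<sigma> j a z = lin \<sigma> j' a z" "lin \<sigma> k b z = lin \<sigma> k' b z"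
    and ne: "\<sigma> a \<noteq> \<sigma> b" "1 + \<sigma> a * \<sigma> b \<noteq> 0" "1 + \<sigma> a * \<sigma> b \<noteq> \<sigma> a - \<sigma> b" "1 + \<sigma> a * \<sigma> b \<noteq> \<sigma> b - \<sigma> a"
  shows "snd z = 0"
proof -
  note c = chord_equation[OF assms(1,2,3,7)] chord_equation[OF assms(4,5,6,8)]
  have "fst (chord_coefficients j j' (\<sigma> a)) * snd (chord_coefficients k k' (\<sigma> b)) - fst (chord_coefficients k k' (\<sigma> b)) * snd (chord_coefficients j j' (\<sigma> a)) \<noteq> 0"
    using chord_coefficients_cases[of j j' "\<sigma> a"] chord_coefficients_cases[of k k' "\<sigma> b"] ne
    by (auto simp: algebra_simps)
  from two_lines_zero[OF c this] show ?thesis by (auto intro: complex_zeroI)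
qed

text \<open>Four real equations in four real unknowns.\<close>
lemma tuple_system_solvable:
  assumes reg: "\<And>z. (\<forall>j<4. lin \<sigma> j (\<tau> ! j) z = 0) \<Longrightarrow> z = 0"
  shows "\<exists>!z. \<forall>j<4. lin \<sigma> j (\<tau> ! j) z = r j"
proof -
  define F where "F z = (Complex (lin \<sigma> 0 (\<tau>!0) z) (lin \<sigma> 1 (\<tau>!1) z), Complex (lin \<sigma> 2 (\<tau>!2) z) (lin \<sigma> 3 (\<tau>!3) z))" for z
  have lin: "linear F"
    by (rule linearI) (auto simp: F_def lin_add lin_scaleR complex_eq_iff)
  have F: "F z = (Complex (r 0) (r 1), Complex (r 2) (r 3)) \<longleftrightarrow> (\<forall>j<4. lin \<sigma> j (\<tau> ! j) z = r j)" for z r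
    by (auto simp: F_def all_less_4)
  have "inj F"
    unfolding linear_injective_0[OF lin]
  proof (intro allI impI)
    fix z assume "F z = 0"
    then have "F z = (Complex 0 0, Complex 0 0)" by (simp add: zero_prod_def complex_eq_iff)
    with F[of z "\<lambda>_. 0"] have "\<forall>j<4. lin \<sigma> j (\<tau> ! j) z = 0" by simp
    then show "z = 0" by (rule reg)
  qed
  moreover then have "surj F" by (intro linear_injective_imp_surjective[OF lin]) simp_all
  ultimately have "\<exists>!z. F z = (Complex (r 0) (r 1), Complex (r 2) (r 3))"
    by (metis bij_def bij_pointE)
  then show ?thesis unfolding F .
qed

lemma crossing_system_regular:
  assumes "\<sigma> a \<noteq> \<sigma> b" "1 + \<sigma> a * \<sigma> b \<noteq> 0"
    and "lin \<sigma> 0 a z = 0" "lin \<sigma> 1 b z = 0" "lin \<sigma> 2 a z = 0" "lin \<sigma> 3 b z = 0"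
  shows "z = 0"
proof -
  have "snd z = 0"
  proof -
    have "fst (chord_coefficients 0 2 (\<sigma> a)) * Re (snd z) + snd (chord_coefficients 0 2 (\<sigma> a)) * Im (snd z) = 0"
      "fst (chord_coefficients 1 3 (\<sigma> b)) * Re (snd z) + snd (chord_coefficients 1 3 (\<sigma> b)) * Im (snd z) = 0"
      by (rule chord_equation; use assms in simp)+
    then have "- \<sigma> a * Re (snd z) + 1 * Im (snd z) = 0" "1 * Re (snd z) + \<sigma> b * Im (snd z) = 0"
      by (simp_all add: chord_coefficients_def doubleton_eq_iff)
    from two_lines_zero[OF this] show ?thesis using assms(2) by (auto intro!: complex_zeroI)
  qed
  moreover have "- \<sigma> a * Re (fst z) + 1 * Im (fst z) = 0" "- \<sigma> b * Re (fst z) + 1 * Im (fst z) = 0"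
    using assms(3,4) calculation by (simp_all add: lin_def corner_simps)
  from two_lines_zero[OF this] have "fst z = 0" using assms(1) by (auto intro!: complex_zeroI)
  ultimately show ?thesis by (simp add: prod_eq_iff)
qed

section \<open>Tuples of lines and genericity\<close>

definition nxt :: "nat \<Rightarrow> nat \<Rightarrow> nat" where "nxt m i = (if Suc i = m then 0 else Suc i)"
definition prv :: "nat \<Rightarrow> nat \<Rightarrow> nat" where "prv m i = (if i = 0 then m - 1 else i - 1)"
definition adjacent :: "nat \<Rightarrow> nat \<Rightarrow> nat \<Rightarrow> bool" where "adjacent m i j \<longleftrightarrow> nxt m i = j \<or> nxt m j = i"

definition crossing :: "nat list \<Rightarrow> bool" where
  "crossing \<tau> \<longleftrightarrow> \<tau> ! 0 = \<tau> ! 2 \<and> \<tau> ! 1 = \<tau> ! 3 \<and> \<tau> ! 0 \<noteq> \<tau> ! 1"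

text \<open>The lines through the four corners of a square, in order. A square with opposite corners on the same of two lines degenerates
  to their intersection; it is admitted as the stand-in for a crossing of two edges that are not neighbours.\<close>
definition tuples :: "nat \<Rightarrow> nat list set" where
  "tuples m = {\<tau>. length \<tau> = 4 \<and> set \<tau> \<subseteq> {..<m} \<and>
     (3 \<le> card (set \<tau>) \<or> (crossing \<tau> \<and> \<not> adjacent m (\<tau> ! 0) (\<tau> ! 1)))}"

lemma length4_obtain:
  assumes "length \<tau> = 4" obtains a b c d where "\<tau> = [a, b, c, d]"
  using assms by (auto simp: numeral_eq_Suc length_Suc_conv)

lemma crossing_iff: "length \<tau> = 4 \<Longrightarrow> crossing \<tau> \<longleftrightarrow> (\<exists>a b. a \<noteq> b \<and> \<tau> = [a, b, a, b])"
  by (elim length4_obtain) (auto simp: crossing_def)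

definition rot :: "complex \<times> complex \<Rightarrow> complex \<times> complex" where
  "rot z = (fst z, \<i> * snd z)"

lemma corner_rot:
  "corner (rot z) 0 = corner z (Suc 0)" "corner (rot z) (Suc 0) = corner z 2"
  "corner (rot z) 2 = corner z 3" "corner (rot z) 3 = corner z 0"
  by (simp_all add: rot_def corner_def ii_cubed)

lemma crossing_rotate1: "length \<tau> = 4 \<Longrightarrow> crossing (rotate1 \<tau>) \<longleftrightarrow> crossing \<tau>"
  by (erule length4_obtain) (auto simp: crossing_def)

text \<open>Conditions on the directions alone. They make the linear system of every tuple regular, and they exclude
  that one square uses two different lines for two of its sides or diagonals.\<close>
locale slopes =
  fixes \<sigma> :: "nat \<Rightarrow> real" and n :: nat
  assumes slopes_distinct: "\<And>i j. i < n \<Longrightarrow> j < n \<Longrightarrow> i \<noteq> j \<Longrightarrow> \<sigma> i \<noteq> \<sigma> j"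
    and not_perpendicular: "\<And>i j. i < n \<Longrightarrow> j < n \<Longrightarrow> i \<noteq> j \<Longrightarrow> 1 + \<sigma> i * \<sigma> j \<noteq> 0"
    and not_diagonal: "\<And>i j. i < n \<Longrightarrow> j < n \<Longrightarrow> i \<noteq> j \<Longrightarrow> 1 + \<sigma> i * \<sigma> j \<noteq> \<sigma> i - \<sigma> j"
    and regular: "\<And>\<tau> z. length \<tau> = 4 \<Longrightarrow> set \<tau> \<subseteq> {..<n} \<Longrightarrow> 3 \<le> card (set \<tau>) \<Longrightarrow>
      (\<forall>j<4. lin \<sigma> j (\<tau> ! j) z = 0) \<Longrightarrow> z = 0"
begin

definition generic :: "(nat \<Rightarrow> real) \<Rightarrow> bool" where
  "generic h \<longleftrightarrow>
    (\<forall>J \<subseteq> {..<4} \<times> {..<n}. card J = 5 \<longrightarrow> inj_on snd J \<longrightarrow>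
      \<not> (\<exists>z. \<forall>(j, i)\<in>J. lin \<sigma> j i z = h i)) \<and>
    (\<forall>J \<subseteq> {..<4} \<times> {..<n}. card J = 4 \<longrightarrow> inj_on snd J \<longrightarrow>
      (\<forall>j<4. \<forall>k<4. \<forall>a<n. j \<noteq> k \<longrightarrow>
        \<not> (\<exists>z. (\<forall>(j, i)\<in>J. lin \<sigma> j i z = h i) \<and> lin \<sigma> j a z = lin \<sigma> k a z))) \<and>
    (\<forall>a<n. \<forall>b<n. \<forall>c<n. a \<noteq> b \<longrightarrow> a \<noteq> c \<longrightarrow> b \<noteq> c \<longrightarrow>
      \<not> (\<exists>p. dev \<sigma> h a p = 0 \<and> dev \<sigma> h b p = 0 \<and> dev \<sigma> h c p = 0))"

lemma generic_distinct_lines: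
  assumes "generic h" "J \<subseteq> {..<4} \<times> {..<n}" "card J = 5" "inj_on snd J"
    "\<And>j i. (j, i) \<in> J \<Longrightarrow> lin \<sigma> j i z = h i"
  shows False
proof -
  have "\<forall>(j, i)\<in>J. lin \<sigma> j i z = h i" using assms(5) by auto
  then show False using assms(1-4) unfolding generic_def by meson
qed

lemma generic_parallel_chord:
  assumes "generic h" "J \<subseteq> {..<4} \<times> {..<n}" "card J = 4" "inj_on snd J"
    "\<And>j i. (j, i) \<in> J \<Longrightarrow> lin \<sigma> j i z = h i"
    "j < 4" "k < 4" "a < n" "j \<noteq> k" "lin \<sigma> j a z = lin \<sigma> k a z"
  shows False
proof -
  have "\<forall>(j, i)\<in>J. lin \<sigma> j i z = h i" using assms(5) by auto
  then show False using assms(1-4,6-10) unfolding generic_def by meson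
qed

lemma generic_not_concurrent:
  assumes "generic h" "a < n" "b < n" "c < n" "a \<noteq> b" "a \<noteq> c" "b \<noteq> c"
    "dev \<sigma> h a p = 0" "dev \<sigma> h b p = 0" "dev \<sigma> h c p = 0"
  shows False
  using assms unfolding generic_def by meson

lemma not_diagonal': "i < n \<Longrightarrow> j < n \<Longrightarrow> i \<noteq> j \<Longrightarrow> 1 + \<sigma> i * \<sigma> j \<noteq> \<sigma> j - \<sigma> i"
  using not_diagonal[of j i] by (simp add: mult.commute)

lemma two_repeats:
  assumes "j < 4" "j' < 4" "j \<noteq> j'" "k < 4" "k' < 4" "k \<noteq> k'" "a < n" "b < n" "a \<noteq> b"
    and "lin \<sigma> j a z = lin \<sigma> j' a z" "lin \<sigma> k b z = lin \<sigma> k' b z"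
  shows "snd z = 0"
  using two_chords[OF assms(1-6,10,11)] slopes_distinct not_perpendicular not_diagonal not_diagonal' assms(7-9)
  by blast

lemma not_inj_snd:
  assumes "\<not> inj_on snd J"
  obtains j j' i where "(j, i) \<in> J" "(j', i) \<in> J" "j \<noteq> j'"
proof -
  from assms obtain x y where "x \<in> J" "y \<in> J" "snd x = snd y" "x \<noteq> y" unfolding inj_on_def by blast
  then show ?thesis using that[of "fst x" "snd x" "fst y"] by (cases x; cases y) auto
qed

text \<open>A generic square of positive size has no more incidences than its four unknowns can satisfy. Repeated lines
  are dealt with by the parallel chord condition, or by \<open>two_repeats\<close> and \<open>three_corners_on_line\<close>.\<close>
lemma five_incidences:
  assumes g: "generic h" and J: "J \<subseteq> {..<4} \<times> {..<n}" "card J = 5"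
    and z: "\<And>j i. (j, i) \<in> J \<Longrightarrow> lin \<sigma> j i z = h i"
  shows "snd z = 0"
proof (cases "inj_on snd J")
  case True
  then show ?thesis using generic_distinct_lines[OF g J _ z] by blast
next
  case False
  then obtain j j' i where 1: "(j, i) \<in> J" "(j', i) \<in> J" "j \<noteq> j'" by (rule not_inj_snd)
  have lt: "j < 4" "j' < 4" "i < n" using 1 J by auto
  define J' where "J' = J - {(j', i)}"
  have J': "J' \<subseteq> {..<4} \<times> {..<n}" "card J' = 4" and sub: "J' \<subseteq> J" and notin: "(j', i) \<notin> J'"
    using J 1 by (auto simp: J'_def)
  have par: "lin \<sigma> j i z = lin \<sigma> j' i z" using z[OF 1(1)] z[OF 1(2)] by simp
  show ?thesis
  proof (cases "inj_on snd J'")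
    case True
    show ?thesis using generic_parallel_chord[OF g J' True _ lt 1(3) par] z sub by blast
  next
    case False
    then obtain k k' i' where 2: "(k, i') \<in> J'" "(k', i') \<in> J'" "k \<noteq> k'" by (rule not_inj_snd)
    have lt': "k < 4" "k' < 4" "i' < n" using 2 J' by auto
    have par': "lin \<sigma> k i' z = lin \<sigma> k' i' z" using z[OF subsetD[OF sub 2(1)]] z[OF subsetD[OF sub 2(2)]] by simp
    show ?thesis
    proof (cases "i = i'")
      case False
      then show ?thesis using two_repeats[OF lt(1,2) 1(3) lt'(1,2) 2(3) lt(3) lt'(3)] par par' by blast
    next
      case True
      have "(k, i) \<in> J'" "(k', i) \<in> J'" using 2 True by simp_all
      then have "\<exists>l. l \<noteq> j \<and> (l, i) \<in> J' \<and> l < 4" using 2(3) lt'(1,2) by (cases "k = j") auto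
      then obtain l where l: "l \<noteq> j" "(l, i) \<in> J'" "l < 4" by blast
      then have "l \<noteq> j'" using notin by auto
      moreover have "lin \<sigma> j i z = lin \<sigma> l i z" using z[OF 1(1)] z[OF subsetD[OF sub l(2)]] by simp
      ultimately show ?thesis
        using three_corners_on_line[of j j' l \<sigma> i z] lt l 1(3) par by simp
    qed
  qed
qed

text \<open>Freeing one offset costs at most one incidence: while the line \<open>M\<close> moves, a square of positive size may have five
  incidences, but not six.\<close>
lemma six_incidences:
  assumes g: "generic h" and J: "J \<subseteq> {..<4} \<times> {..<n}" "6 \<le> card J" and M: "M < n"
    and z: "\<And>j i. (j, i) \<in> J \<Longrightarrow> lin \<sigma> j i z = (h(M := t)) i"
  shows "snd z = 0"
proof -
  define J0 where "J0 = {x \<in> J. snd x \<noteq> M}"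
  define J1 where "J1 = {x \<in> J. snd x = M}"
  have fin: "finite J" using J by (meson finite_SigmaI finite_lessThan finite_subset)
  have "J0 \<union> J1 = J" "J0 \<inter> J1 = {}" by (auto simp: J0_def J1_def)
  then have card: "card J0 + card J1 \<ge> 6" using fin J by (metis card_Un_disjoint finite_Un)
  have z0: "lin \<sigma> j i z = h i" if "(j, i) \<in> J0" for j i
    using z[of j i] that by (auto simp: J0_def)
  have z1: "lin \<sigma> j M z = t" if "(j, M) \<in> J1" for j
    using z[of j M] that by (auto simp: J1_def)
  have J0: "J0 \<subseteq> {..<4} \<times> {..<n}" using J by (auto simp: J0_def)
  have finJ: "finite J0" "finite J1" using fin by (auto simp: J0_def J1_def)
  consider "card J0 \<ge> 5" | "card J0 = 4" "card J1 \<ge> 2" | "card J1 \<ge> 3" using card by linarith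
  then show ?thesis
  proof cases
    case 1
    then obtain K where "K \<subseteq> J0" "card K = 5" by (meson obtain_subset_with_card_n)
    then show ?thesis using five_incidences[OF g, of K z] J0 z0 by (meson subset_trans subsetD)
  next
    case 2
    obtain K where K: "K \<subseteq> J1" "card K = 2" using 2 by (meson obtain_subset_with_card_n)
    then obtain x y where xy: "K = {x, y}" "x \<noteq> y" by (meson card_2_iff)
    define k k' where "k = fst x" and "k' = fst y"
    have "x \<in> J1" "y \<in> J1" using xy K by auto
    then have "x = (k, M)" "y = (k', M)" by (auto simp: k_def k'_def J1_def prod_eq_iff)
    then have kk: "(k, M) \<in> J1" "(k', M) \<in> J1" "k \<noteq> k'"
      using \<open>x \<in> J1\<close> \<open>y \<in> J1\<close> xy by auto
    have lt: "k < 4" "k' < 4" using kk J by (auto simp: J1_def)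
    have par: "lin \<sigma> k M z = lin \<sigma> k' M z" using z1[OF kk(1)] z1[OF kk(2)] by simp
    show ?thesis
    proof (cases "inj_on snd J0")
      case True
      show ?thesis using generic_parallel_chord[OF g J0 2(1) True z0 lt M kk(3) par] by blast
    next
      case False
      then obtain j j' i where 1: "(j, i) \<in> J0" "(j', i) \<in> J0" "j \<noteq> j'" by (rule not_inj_snd)
      have "i \<noteq> M" "j < 4" "j' < 4" "i < n" using 1 J0 by (auto simp: J0_def)
      moreover have "lin \<sigma> j i z = lin \<sigma> j' i z" using z0[OF 1(1)] z0[OF 1(2)] by simp
      ultimately show ?thesis using two_repeats[of j j' k k' i M z] lt 1(3) kk(3) par M by simp
    qed
  next
    case 3
    obtain K where K: "K \<subseteq> J1" "card K = 3" using 3 by (meson obtain_subset_with_card_n)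
    then obtain x y w where xy: "K = {x, y, w}" "x \<noteq> y" "x \<noteq> w" "y \<noteq> w" by (metis card_3_iff)
    have sn: "snd x = M" "snd y = M" "snd w = M" using K xy unfolding J1_def by auto
    define a b c where "a = fst x" and "b = fst y" and "c = fst w"
    have m: "x \<in> J1" "y \<in> J1" "w \<in> J1" using xy K by auto
    have e: "x = (a, M)" "y = (b, M)" "w = (c, M)" using sn by (simp_all add: a_def b_def c_def prod_eq_iff)
    have "(a, M) \<in> J1" "(b, M) \<in> J1" "(c, M) \<in> J1" using m e by auto
    moreover have "a \<noteq> b" "a \<noteq> c" "b \<noteq> c" using e xy by auto
    moreover have "a < 4" "b < 4" "c < 4" using calculation J by (auto simp: J1_def)
    ultimately show ?thesis using three_corners_on_line[of a b c \<sigma> M z] z1 by simp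
  qed
qed

definition sol :: "(nat \<Rightarrow> real) \<Rightarrow> nat list \<Rightarrow> complex \<times> complex" where
  "sol h \<tau> = (THE z. \<forall>j<4. lin \<sigma> j (\<tau> ! j) z = h (\<tau> ! j))"

definition solvable :: "nat list \<Rightarrow> bool" where
  "solvable \<tau> \<longleftrightarrow> length \<tau> = 4 \<and> set \<tau> \<subseteq> {..<n} \<and> (3 \<le> card (set \<tau>) \<or> crossing \<tau>)"

lemma solvable_regular:
  assumes "solvable \<tau>" "\<forall>j<4. lin \<sigma> j (\<tau> ! j) z = 0"
  shows "z = 0"
proof (cases "3 \<le> card (set \<tau>)")
  case True then show ?thesis using regular assms unfolding solvable_def by blast
next
  case False
  then obtain a b where ab: "a \<noteq> b" "\<tau> = [a, b, a, b]" using assms(1) crossing_iff unfolding solvable_def by auto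
  then have "a < n" "b < n" using assms(1) by (auto simp: solvable_def)
  then show ?thesis
    using crossing_system_regular[of \<sigma> a b z] slopes_distinct not_perpendicular ab assms(2) by (simp add: all_less_4)
qed

lemma solvable_ex1: "solvable \<tau> \<Longrightarrow> \<exists>!z. \<forall>j<4. lin \<sigma> j (\<tau> ! j) z = r j"
  by (rule tuple_system_solvable) (rule solvable_regular)

lemma sol_incident: "solvable \<tau> \<Longrightarrow> j < 4 \<Longrightarrow> lin \<sigma> j (\<tau> ! j) (sol h \<tau>) = h (\<tau> ! j)"
  using theI'[OF solvable_ex1[of \<tau> "\<lambda>j. h (\<tau> ! j)"]] unfolding sol_def by blast

lemma sol_unique: "solvable \<tau> \<Longrightarrow> (\<And>j. j < 4 \<Longrightarrow> lin \<sigma> j (\<tau> ! j) z = h (\<tau> ! j)) \<Longrightarrow> z = sol h \<tau>"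
  using solvable_ex1[of \<tau> "\<lambda>j. h (\<tau> ! j)"] sol_incident by blast

text \<open>By Cramer's rule the square of a tuple moves uniformly with the line \<open>M\<close>.\<close>
lemma sol_affine:
  assumes "solvable \<tau>"
  obtains A B where "\<And>t. sol (h(M := t)) \<tau> = A + t *\<^sub>R B"
proof -
  obtain B where B: "\<forall>j<4. lin \<sigma> j (\<tau> ! j) B = (if \<tau> ! j = M then 1 else 0)"
    using solvable_ex1[OF assms, of "\<lambda>j. if \<tau> ! j = M then 1 else 0"] by blast
  have "sol (h(M := t)) \<tau> = sol (h(M := 0)) \<tau> + t *\<^sub>R B" for t
    by (rule sol_unique[OF assms, symmetric]) (simp add: lin_add lin_scaleR sol_incident[OF assms] B)
  then show ?thesis by (rule that)
qed

lemma tuples_solvable: "\<tau> \<in> tuples m \<Longrightarrow> m \<le> n \<Longrightarrow> solvable \<tau>"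
  by (auto simp: tuples_def solvable_def)

text \<open>The line \<open>a\<close> would contain one diagonal and \<open>b\<close> the other, but \<open>a\<close> and \<open>b\<close> are not perpendicular.\<close>
lemma sol_crossing:
  assumes "a < n" "b < n" "a \<noteq> b"
  shows "snd (sol h [a, b, a, b]) = 0"
proof -
  have "solvable [a, b, a, b]" using assms by (simp add: solvable_def crossing_def)
  then have s: "\<forall>j<4. lin \<sigma> j ([a, b, a, b] ! j) (sol h [a, b, a, b]) = h ([a, b, a, b] ! j)"
    using sol_incident by blast
  then have "lin \<sigma> 0 a (sol h [a, b, a, b]) = lin \<sigma> 2 a (sol h [a, b, a, b])"
    "lin \<sigma> (Suc 0) b (sol h [a, b, a, b]) = lin \<sigma> 3 b (sol h [a, b, a, b])"
    unfolding all_less_4 by simp_all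
  then show ?thesis using two_repeats[of 0 2 "Suc 0" 3 a b] assms by simp
qed

lemma solvable_rotate1: "solvable \<tau> \<Longrightarrow> solvable (rotate1 \<tau>)"
  by (simp add: solvable_def crossing_rotate1)

lemma sol_rotate1:
  assumes "solvable \<tau>"
  shows "sol h (rotate1 \<tau>) = rot (sol h \<tau>)"
proof -
  have "length \<tau> = 4" using assms by (simp add: solvable_def)
  then obtain a b c d where t: "\<tau> = [a, b, c, d]" by (rule length4_obtain)
  have s: "\<forall>j<4. lin \<sigma> j (\<tau> ! j) (sol h \<tau>) = h (\<tau> ! j)" using sol_incident[OF assms] by blast
  have "\<forall>j<4. lin \<sigma> j (rotate1 \<tau> ! j) (rot (sol h \<tau>)) = h (rotate1 \<tau> ! j)"
    using s unfolding t all_less_4 by (simp add: lin_def corner_rot)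
  then show ?thesis by (intro sol_unique[symmetric] solvable_rotate1 assms) blast
qed

end

section \<open>Squares on three lines\<close>

text \<open>Reflection in a line: it changes the sign of all cotangents and exchanges the patterns \<open>[x, x, y, z]\<close> and
  \<open>[x, x, z, y]\<close>.\<close>
lemma short_edge_count_uminus: "short_edge_count a b (- f) (- s) (- g) = short_edge_count a b f s g"
proof -
  have dens: "1 + - s + - g = 1 - s - g" "1 - - s - - g = 1 + s + g" "- s - - g = - (s - g)"
    "1 + - g + - f = 1 - g - f" "1 - - g - - f = 1 + g + f" "- g - - f = - (g - f)"
    "1 + - f + - s = 1 - f - s" "1 - - f - - s = 1 + f + s" "- f - - s = - (f - s)" by simp_all
  have nums: "1 + - x = 1 - x" "1 - - x = 1 + x" "- x + - y = - (x + y)" "- (- x) = x" "- 2 * - x = - (- 2 * x)" "2 * - x = - (2 * x)"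
    "- x - 1 = - (1 + x)" "- x - y = - (x + y)" "1 + x - - y = 1 + x + y" for x y :: real by simp_all
  have div: "x / - d = - (x / d)" "- x / d = - (x / d)" "- 2 * x / d = - (2 * x / d)" "- (- x) = x" "- x * - y = x * y" "- x * y = - (x * y)" "x * - y = - (x * y)" for x y d :: real by simp_all
  have m: "(g - 1) / d = - ((1 - g) / d)" "(f - 1) / d = - ((1 - f) / d)" for d by (simp_all add: minus_divide_left)
  have e1: "(0 < a * ((1 + (- g)) / (1 + (- s) + (- g))) \<and> 0 < a * ((- g) / (1 + (- s) + (- g))) \<and> 0 < (((- s) + (- g)) / (1 + (- s) + (- g))) * (1 / (1 + (- s) + (- g))) \<and> 0 < b * (1 / (1 + (- s) + (- g)))) \<longleftrightarrow> (0 < a * (- g / (1 - s - g)) \<and> 0 < a * ((1 - g) / (1 - s - g)) \<and> 0 < b * (1 / (1 - s - g)) \<and> 0 < (- (s + g) / (1 - s - g)) * (1 / (1 - s - g)))"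
    by (simp only: dens nums div m conj_ac mult_ac add_uminus_conv_diff add.commute[of _ 1])
  have e2: "(0 < a * (- (- g) / (1 - (- s) - (- g))) \<and> 0 < a * ((1 - (- g)) / (1 - (- s) - (- g))) \<and> 0 < b * (1 / (1 - (- s) - (- g))) \<and> 0 < (- ((- s) + (- g)) / (1 - (- s) - (- g))) * (1 / (1 - (- s) - (- g)))) \<longleftrightarrow> (0 < a * ((1 + g) / (1 + s + g)) \<and> 0 < a * (g / (1 + s + g)) \<and> 0 < ((s + g) / (1 + s + g)) * (1 / (1 + s + g)) \<and> 0 < b * (1 / (1 + s + g)))"
    by (simp only: dens nums div m conj_ac mult_ac add_uminus_conv_diff add.commute[of _ 1])
  have e3: "(0 < a * ((1 - (- g)) / ((- s) - (- g))) \<and> 0 < a * (- (1 + (- g)) / ((- s) - (- g))) \<and> 0 < (- ((- s) + (- g)) / ((- s) - (- g))) * (2 * (- s) / ((- s) - (- g))) \<and> 0 < b * (- 2 * (- g) / ((- s) - (- g)))) \<longleftrightarrow> (0 < a * ((1 - g) / (s - g)) \<and> 0 < a * (- (1 + g) / (s - g)) \<and> 0 < (- (s + g) / (s - g)) * (2 * s / (s - g)) \<and> 0 < b * (- 2 * g / (s - g)))"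
    by (simp only: dens nums div m conj_ac mult_ac add_uminus_conv_diff add.commute[of _ 1])
  have e4: "(0 < ((- g) / (1 + (- g) + (- f))) * ((1 + (- f)) / (1 + (- g) + (- f))) \<and> 0 < ((1 + (- g)) / (1 + (- g) + (- f))) * ((- f) / (1 + (- g) + (- f))) \<and> 0 < b * (((- f) + (- g)) / (1 + (- g) + (- f))) \<and> 0 < a * (((- f) + (- g)) / (1 + (- g) + (- f)))) \<longleftrightarrow> (0 < ((1 - g) / (1 - g - f)) * (- f / (1 - g - f)) \<and> 0 < (- g / (1 - g - f)) * ((1 - f) / (1 - g - f)) \<and> 0 < a * (- (f + g) / (1 - g - f)) \<and> 0 < b * (- (f + g) / (1 - g - f)))"
    by (simp only: dens nums div m conj_ac mult_ac add_uminus_conv_diff add.commute[of _ 1])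
  have e5: "(0 < ((1 - (- g)) / (1 - (- g) - (- f))) * (- (- f) / (1 - (- g) - (- f))) \<and> 0 < (- (- g) / (1 - (- g) - (- f))) * ((1 - (- f)) / (1 - (- g) - (- f))) \<and> 0 < a * (- ((- f) + (- g)) / (1 - (- g) - (- f))) \<and> 0 < b * (- ((- f) + (- g)) / (1 - (- g) - (- f)))) \<longleftrightarrow> (0 < (g / (1 + g + f)) * ((1 + f) / (1 + g + f)) \<and> 0 < ((1 + g) / (1 + g + f)) * (f / (1 + g + f)) \<and> 0 < b * ((f + g) / (1 + g + f)) \<and> 0 < a * ((f + g) / (1 + g + f)))"
    by (simp only: dens nums div m conj_ac mult_ac add_uminus_conv_diff add.commute[of _ 1])
  have e6: "(0 < (((- g) - 1) / ((- g) - (- f))) * ((1 - (- f)) / ((- g) - (- f))) \<and> 0 < b * (- ((- f) + (- g)) / ((- g) - (- f))) \<and> 0 < ((1 + (- g)) / ((- g) - (- f))) * (- (1 + (- f)) / ((- g) - (- f))) \<and> 0 < a * (((- f) + (- g)) / ((- g) - (- f)))) \<longleftrightarrow> (0 < ((g - 1) / (g - f)) * ((1 - f) / (g - f)) \<and> 0 < b * (- (f + g) / (g - f)) \<and> 0 < ((1 + g) / (g - f)) * (- (1 + f) / (g - f)) \<and> 0 < a * ((f + g) / (g - f)))"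
    by (simp only: dens nums div m conj_ac mult_ac add_uminus_conv_diff add.commute[of _ 1])
  have e7: "(0 < b * ((- f) / (1 + (- f) + (- s))) \<and> 0 < b * ((1 + (- f)) / (1 + (- f) + (- s))) \<and> 0 < a * (1 / (1 + (- f) + (- s))) \<and> 0 < (1 / (1 + (- f) + (- s))) * (((- f) + (- s)) / (1 + (- f) + (- s)))) \<longleftrightarrow> (0 < b * ((1 - f) / (1 - f - s)) \<and> 0 < b * (- f / (1 - f - s)) \<and> 0 < (1 / (1 - f - s)) * (- (f + s) / (1 - f - s)) \<and> 0 < a * (1 / (1 - f - s)))"
    by (simp only: dens nums div m conj_ac mult_ac add_uminus_conv_diff add.commute[of _ 1])
  have e8: "(0 < b * ((1 - (- f)) / (1 - (- f) - (- s))) \<and> 0 < b * (- (- f) / (1 - (- f) - (- s))) \<and> 0 < (1 / (1 - (- f) - (- s))) * (- ((- f) + (- s)) / (1 - (- f) - (- s))) \<and> 0 < a * (1 / (1 - (- f) - (- s)))) \<longleftrightarrow> (0 < b * (f / (1 + f + s)) \<and> 0 < b * ((1 + f) / (1 + f + s)) \<and> 0 < a * (1 / (1 + f + s)) \<and> 0 < (1 / (1 + f + s)) * ((f + s) / (1 + f + s)))"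
    by (simp only: dens nums div m conj_ac mult_ac add_uminus_conv_diff add.commute[of _ 1])
  have e9: "(0 < b * (((- f) - 1) / ((- f) - (- s))) \<and> 0 < a * (2 * (- f) / ((- f) - (- s))) \<and> 0 < b * ((1 + (- f)) / ((- f) - (- s))) \<and> 0 < (- 2 * (- s) / ((- f) - (- s))) * (((- f) + (- s)) / ((- f) - (- s)))) \<longleftrightarrow> (0 < b * ((f - 1) / (f - s)) \<and> 0 < a * (2 * f / (f - s)) \<and> 0 < b * ((1 + f) / (f - s)) \<and> 0 < (- 2 * s / (f - s)) * ((f + s) / (f - s)))"
    by (simp only: dens nums div m conj_ac mult_ac add_uminus_conv_diff add.commute[of _ 1])
  show ?thesis
    unfolding short_edge_count_def e1 e2 e3 e4 e5 e6 e7 e8 e9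
    unfolding minus_mult_minus by (simp only: add_ac)
qed

lemma short_edge_count_even:
  fixes a b f s g :: real
  assumes nz: "a \<noteq> 0" "b \<noteq> 0" "f \<noteq> 0" "s \<noteq> 0" "g \<noteq> 0"
    and ne: "f \<noteq> 1" "f \<noteq> -1" "s \<noteq> 1" "s \<noteq> -1" "g \<noteq> 1" "g \<noteq> -1"
    and den: "1 + s + g \<noteq> 0" "1 - s - g \<noteq> 0" "s - g \<noteq> 0" "1 + g + f \<noteq> 0" "1 - g - f \<noteq> 0" "g - f \<noteq> 0"
      "1 + f + s \<noteq> 0" "1 - f - s \<noteq> 0" "f - s \<noteq> 0"
    and cot: "f * s + s * g + g * f = 1"
  shows "even (short_edge_count a b f s g)"
proof -
  have "f + g \<noteq> 0"
  proof
    assume "f + g = 0"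
    then have "g = - f" by simp
    then have "- (f * f) = 1" using cot by (simp add: algebra_simps)
    then show False by (smt (verit) zero_le_square)
  qed
  then consider "f + g > 0" | "- f + - g > 0" by linarith
  then show ?thesis
  proof cases
    case 1 then show ?thesis using short_edge_count_even_positive assms by blast
  next
    case 2
    have "even (short_edge_count a b (- f) (- s) (- g))"
      by (rule short_edge_count_even_positive[OF _ _ _ _ _ _ _ _ _ _ _ _ _ _ _ _ _ _ _ _ _ 2]) (use assms in \<open>auto simp: algebra_simps\<close>)
    then show ?thesis by (simp only: short_edge_count_uminus)
  qed
qed

text \<open>The nine ways, up to rotation, in which four corners can be distributed over three lines so that every line is
  used.\<close>
definition three_line_patterns :: "nat \<Rightarrow> nat \<Rightarrow> nat \<Rightarrow> nat list list" where
  "three_line_patterns x y z = [[x, x, y, z], [x, x, z, y], [x, y, x, z], [y, y, z, x], [y, y, x, z], [y, z, y, x],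
     [z, z, x, y], [z, z, y, x], [z, x, z, y]]"

context slopes
begin

text \<open>The cotangent of the angle from line \<open>c\<close> to line \<open>b\<close>.\<close>
definition cot :: "nat \<Rightarrow> nat \<Rightarrow> real" where
  "cot b c = - (1 + \<sigma> b * \<sigma> c) / (\<sigma> c - \<sigma> b)"

text \<open>Proportional to the signed size of the triangle formed by the three lines; zero means concurrency.\<close>
definition area :: "(nat \<Rightarrow> real) \<Rightarrow> nat \<Rightarrow> nat \<Rightarrow> nat \<Rightarrow> real" where
  "area h x y z = - ((\<sigma> z - \<sigma> y) * h x + (\<sigma> x - \<sigma> z) * h y + (\<sigma> y - \<sigma> x) * h z)"

text \<open>The weighted deviations from the three lines are barycentric coordinates of \<open>p\<close>, so their sum does not depend on
  \<open>p\<close>.\<close>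
lemma bary_sum:
  "(\<sigma> z - \<sigma> y) * dev \<sigma> h x p + (\<sigma> x - \<sigma> z) * dev \<sigma> h y p + (\<sigma> y - \<sigma> x) * dev \<sigma> h z p = area h x y z"
  by (simp add: area_def dev_def algebra_simps)

lemma cot_nonzero: "b < n \<Longrightarrow> c < n \<Longrightarrow> b \<noteq> c \<Longrightarrow> cot b c \<noteq> 0"
  using slopes_distinct[of b c] not_perpendicular[of b c] by (simp add: cot_def)

lemma cot_not_one: "b < n \<Longrightarrow> c < n \<Longrightarrow> b \<noteq> c \<Longrightarrow> cot b c \<noteq> 1"
  and cot_not_minus_one: "b < n \<Longrightarrow> c < n \<Longrightarrow> b \<noteq> c \<Longrightarrow> cot b c \<noteq> - 1"
  using slopes_distinct[of b c] not_diagonal[of b c] not_diagonal'[of b c]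
  by (auto simp: cot_def field_simps)

text \<open>The three angles add up to a multiple of two right angles.\<close>
lemma cot_identity:
  assumes "x < n" "y < n" "z < n" "x \<noteq> y" "y \<noteq> z" "x \<noteq> z"
  shows "cot y z * cot z x + cot z x * cot x y + cot x y * cot y z = 1"
proof -
  have "\<sigma> z - \<sigma> y \<noteq> 0" "\<sigma> x - \<sigma> z \<noteq> 0" "\<sigma> y - \<sigma> x \<noteq> 0"
    using slopes_distinct[of x y] slopes_distinct[of y z] slopes_distinct[of x z] assms by auto
  moreover define P Q R where "P = cot y z" and "Q = cot z x" and "R = cot x y"
  ultimately have "P * (\<sigma> z - \<sigma> y) = - (1 + \<sigma> y * \<sigma> z)" "Q * (\<sigma> x - \<sigma> z) = - (1 + \<sigma> z * \<sigma> x)"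
    "R * (\<sigma> y - \<sigma> x) = - (1 + \<sigma> x * \<sigma> y)" by (simp_all add: cot_def)
  then have "(\<sigma> z - \<sigma> y) * (\<sigma> x - \<sigma> z) * (\<sigma> y - \<sigma> x) * (P * Q + Q * R + R * P) = (\<sigma> z - \<sigma> y) * (\<sigma> x - \<sigma> z) * (\<sigma> y - \<sigma> x)"
    by algebra
  then show ?thesis
    using \<open>\<sigma> z - \<sigma> y \<noteq> 0\<close> \<open>\<sigma> x - \<sigma> z \<noteq> 0\<close> \<open>\<sigma> y - \<sigma> x \<noteq> 0\<close> by (simp add: P_def Q_def R_def)
qed

lemma incident_dev: "solvable \<tau> \<Longrightarrow> j < 4 \<Longrightarrow> dev \<sigma> h (\<tau> ! j) (corner (sol h \<tau>) j) = 0"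
  by (simp add: dev_corner sol_incident)

lemma divide_eqI: "d \<noteq> 0 \<Longrightarrow> d * x = y \<Longrightarrow> x = y / (d::real)"
  by (simp add: field_simps)

lemma corners_xxyz:
  assumes lt: "x < n" "y < n" "z < n" "x \<noteq> y" "y \<noteq> z" "x \<noteq> z" and D: "area h x y z \<noteq> 0"
  defines "p \<equiv> cot z x" and "q \<equiv> cot x y" and "D \<equiv> area h x y z" and "w \<equiv> sol h [x, x, y, z]"
  shows "1 + p + q \<noteq> 0"
    "(\<sigma> y - \<sigma> x) * dev \<sigma> h z (corner w 0) = p * D / (1 + p + q)"
    "(\<sigma> x - \<sigma> z) * dev \<sigma> h y (corner w 0) = (1 + q) * D / (1 + p + q)"
    "(\<sigma> y - \<sigma> x) * dev \<sigma> h z (corner w (Suc 0)) = (1 + p) * D / (1 + p + q)"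
    "(\<sigma> x - \<sigma> z) * dev \<sigma> h y (corner w (Suc 0)) = q * D / (1 + p + q)"
    "(\<sigma> y - \<sigma> x) * dev \<sigma> h z (corner w 2) = 1 * D / (1 + p + q)"
    "(\<sigma> z - \<sigma> y) * dev \<sigma> h x (corner w 2) = (p + q) * D / (1 + p + q)"
    "(\<sigma> x - \<sigma> z) * dev \<sigma> h y (corner w 3) = 1 * D / (1 + p + q)"
    "(\<sigma> z - \<sigma> y) * dev \<sigma> h x (corner w 3) = (p + q) * D / (1 + p + q)"
proof -
  have sv: "solvable [x, x, y, z]" using lt by (simp add: solvable_def)
  have inc: "dev \<sigma> h x (corner w 0) = 0" "dev \<sigma> h x (corner w (Suc 0)) = 0" "dev \<sigma> h y (corner w 2) = 0" "dev \<sigma> h z (corner w 3) = 0"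
    using incident_dev[OF sv, of 0 h] incident_dev[OF sv, of "Suc 0" h] incident_dev[OF sv, of 2 h] incident_dev[OF sv, of 3 h]
    by (simp_all add: w_def)
  have ne: "\<sigma> x \<noteq> \<sigma> y" "\<sigma> y \<noteq> \<sigma> z" "\<sigma> x \<noteq> \<sigma> z" using slopes_distinct lt by blast+
  note S = corners_formula_xxyz[OF ne, of w "h x" "h y" "h z" p q D]
  have S': "(1+p+q) * ((\<sigma> y - \<sigma> x) * dev \<sigma> h z (corner w 0)) = p * D"
    "(1+p+q) * ((\<sigma> y - \<sigma> x) * dev \<sigma> h z (corner w (Suc 0))) = (1+p) * D"
    "(1+p+q) * ((\<sigma> y - \<sigma> x) * dev \<sigma> h z (corner w 2)) = D"
    "(1+p+q) * ((\<sigma> x - \<sigma> z) * dev \<sigma> h y (corner w 3)) = D"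
    unfolding dev_def by (rule S; use inc in \<open>simp add: dev_def p_def q_def D_def cot_def area_def\<close>)+
  show nz: "1 + p + q \<noteq> 0" using S'(3) D by (auto simp: D_def)
  show 1: "(\<sigma> y - \<sigma> x) * dev \<sigma> h z (corner w 0) = p * D / (1 + p + q)"
    "(\<sigma> y - \<sigma> x) * dev \<sigma> h z (corner w (Suc 0)) = (1 + p) * D / (1 + p + q)"
    "(\<sigma> y - \<sigma> x) * dev \<sigma> h z (corner w 2) = 1 * D / (1 + p + q)"
    "(\<sigma> x - \<sigma> z) * dev \<sigma> h y (corner w 3) = 1 * D / (1 + p + q)"
    by (rule divide_eqI[OF nz]; simp only: S' mult_1)+
  have g: "(\<sigma> x - \<sigma> z) * dev \<sigma> h y (corner w 0) = D - (\<sigma> y - \<sigma> x) * dev \<sigma> h z (corner w 0)"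
    "(\<sigma> x - \<sigma> z) * dev \<sigma> h y (corner w (Suc 0)) = D - (\<sigma> y - \<sigma> x) * dev \<sigma> h z (corner w (Suc 0))"
    "(\<sigma> z - \<sigma> y) * dev \<sigma> h x (corner w 2) = D - (\<sigma> y - \<sigma> x) * dev \<sigma> h z (corner w 2)"
    "(\<sigma> z - \<sigma> y) * dev \<sigma> h x (corner w 3) = D - (\<sigma> x - \<sigma> z) * dev \<sigma> h y (corner w 3)"
    using bary_sum[of z y h x "corner w 0"] bary_sum[of z y h x "corner w (Suc 0)"]
      bary_sum[of z y h x "corner w 2"] bary_sum[of z y h x "corner w 3"] inc by (simp_all add: D_def)
  show "(\<sigma> x - \<sigma> z) * dev \<sigma> h y (corner w 0) = (1 + q) * D / (1 + p + q)"
    "(\<sigma> x - \<sigma> z) * dev \<sigma> h y (corner w (Suc 0)) = q * D / (1 + p + q)"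
    "(\<sigma> z - \<sigma> y) * dev \<sigma> h x (corner w 2) = (p + q) * D / (1 + p + q)"
    "(\<sigma> z - \<sigma> y) * dev \<sigma> h x (corner w 3) = (p + q) * D / (1 + p + q)"
    unfolding g 1 using nz by (simp_all add: field_simps)
qed

lemma corners_xxzy:
  assumes lt: "x < n" "y < n" "z < n" "x \<noteq> y" "y \<noteq> z" "x \<noteq> z" and D: "area h x y z \<noteq> 0"
  defines "p \<equiv> cot z x" and "q \<equiv> cot x y" and "D \<equiv> area h x y z" and "w \<equiv> sol h [x, x, z, y]"
  shows "1 - p - q \<noteq> 0"
    "(\<sigma> y - \<sigma> x) * dev \<sigma> h z (corner w 0) = (1 - p) * D / (1 - p - q)"
    "(\<sigma> x - \<sigma> z) * dev \<sigma> h y (corner w 0) = - q * D / (1 - p - q)"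
    "(\<sigma> y - \<sigma> x) * dev \<sigma> h z (corner w (Suc 0)) = - p * D / (1 - p - q)"
    "(\<sigma> x - \<sigma> z) * dev \<sigma> h y (corner w (Suc 0)) = (1 - q) * D / (1 - p - q)"
    "(\<sigma> x - \<sigma> z) * dev \<sigma> h y (corner w 2) = 1 * D / (1 - p - q)"
    "(\<sigma> z - \<sigma> y) * dev \<sigma> h x (corner w 2) = - (p + q) * D / (1 - p - q)"
    "(\<sigma> y - \<sigma> x) * dev \<sigma> h z (corner w 3) = 1 * D / (1 - p - q)"
    "(\<sigma> z - \<sigma> y) * dev \<sigma> h x (corner w 3) = - (p + q) * D / (1 - p - q)"
proof -
  have sv: "solvable [x, x, z, y]" using lt by (simp add: solvable_def)
  have inc: "dev \<sigma> h x (corner w 0) = 0" "dev \<sigma> h x (corner w (Suc 0)) = 0" "dev \<sigma> h z (corner w 2) = 0" "dev \<sigma> h y (corner w 3) = 0"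
    using incident_dev[OF sv, of 0 h] incident_dev[OF sv, of "Suc 0" h] incident_dev[OF sv, of 2 h] incident_dev[OF sv, of 3 h]
    by (simp_all add: w_def)
  have ne: "\<sigma> x \<noteq> \<sigma> y" "\<sigma> y \<noteq> \<sigma> z" "\<sigma> x \<noteq> \<sigma> z" using slopes_distinct lt by blast+
  note S = corners_formula_xxzy[OF ne, of w "h x" "h z" "h y" p q D]
  have S': "(1-p-q) * ((\<sigma> y - \<sigma> x) * dev \<sigma> h z (corner w 0)) = (1-p) * D"
    "(1-p-q) * ((\<sigma> y - \<sigma> x) * dev \<sigma> h z (corner w (Suc 0))) = - p * D"
    "(1-p-q) * ((\<sigma> x - \<sigma> z) * dev \<sigma> h y (corner w 2)) = D"
    "(1-p-q) * ((\<sigma> y - \<sigma> x) * dev \<sigma> h z (corner w 3)) = D"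
    unfolding dev_def by (rule S; use inc in \<open>simp add: dev_def p_def q_def D_def cot_def area_def\<close>)+
  show nz: "1 - p - q \<noteq> 0" using S'(3) D by (auto simp: D_def)
  show 1: "(\<sigma> y - \<sigma> x) * dev \<sigma> h z (corner w 0) = (1 - p) * D / (1 - p - q)"
    "(\<sigma> y - \<sigma> x) * dev \<sigma> h z (corner w (Suc 0)) = - p * D / (1 - p - q)"
    "(\<sigma> x - \<sigma> z) * dev \<sigma> h y (corner w 2) = 1 * D / (1 - p - q)"
    "(\<sigma> y - \<sigma> x) * dev \<sigma> h z (corner w 3) = 1 * D / (1 - p - q)"
    by (rule divide_eqI[OF nz]; simp only: S' mult_1)+
  have g: "(\<sigma> x - \<sigma> z) * dev \<sigma> h y (corner w 0) = D - (\<sigma> y - \<sigma> x) * dev \<sigma> h z (corner w 0)"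
    "(\<sigma> x - \<sigma> z) * dev \<sigma> h y (corner w (Suc 0)) = D - (\<sigma> y - \<sigma> x) * dev \<sigma> h z (corner w (Suc 0))"
    "(\<sigma> z - \<sigma> y) * dev \<sigma> h x (corner w 2) = D - (\<sigma> x - \<sigma> z) * dev \<sigma> h y (corner w 2)"
    "(\<sigma> z - \<sigma> y) * dev \<sigma> h x (corner w 3) = D - (\<sigma> y - \<sigma> x) * dev \<sigma> h z (corner w 3)"
    using bary_sum[of z y h x "corner w 0"] bary_sum[of z y h x "corner w (Suc 0)"]
      bary_sum[of z y h x "corner w 2"] bary_sum[of z y h x "corner w 3"] inc by (simp_all add: D_def)
  show "(\<sigma> x - \<sigma> z) * dev \<sigma> h y (corner w 0) = - q * D / (1 - p - q)"
    "(\<sigma> x - \<sigma> z) * dev \<sigma> h y (corner w (Suc 0)) = (1 - q) * D / (1 - p - q)"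
    "(\<sigma> z - \<sigma> y) * dev \<sigma> h x (corner w 2) = - (p + q) * D / (1 - p - q)"
    "(\<sigma> z - \<sigma> y) * dev \<sigma> h x (corner w 3) = - (p + q) * D / (1 - p - q)"
    unfolding g 1 using nz by (simp_all add: field_simps)
qed

lemma corners_xyxz:
  assumes lt: "x < n" "y < n" "z < n" "x \<noteq> y" "y \<noteq> z" "x \<noteq> z" and D: "area h x y z \<noteq> 0"
  defines "p \<equiv> cot z x" and "q \<equiv> cot x y" and "D \<equiv> area h x y z" and "w \<equiv> sol h [x, y, x, z]"
  shows "p - q \<noteq> 0"
    "(\<sigma> y - \<sigma> x) * dev \<sigma> h z (corner w 0) = (p - 1) * D / (p - q)"
    "(\<sigma> x - \<sigma> z) * dev \<sigma> h y (corner w 0) = (1 - q) * D / (p - q)"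
    "(\<sigma> y - \<sigma> x) * dev \<sigma> h z (corner w (Suc 0)) = 2 * p * D / (p - q)"
    "(\<sigma> z - \<sigma> y) * dev \<sigma> h x (corner w (Suc 0)) = - (p + q) * D / (p - q)"
    "(\<sigma> y - \<sigma> x) * dev \<sigma> h z (corner w 2) = (1 + p) * D / (p - q)"
    "(\<sigma> x - \<sigma> z) * dev \<sigma> h y (corner w 2) = - (1 + q) * D / (p - q)"
    "(\<sigma> x - \<sigma> z) * dev \<sigma> h y (corner w 3) = - 2 * q * D / (p - q)"
    "(\<sigma> z - \<sigma> y) * dev \<sigma> h x (corner w 3) = (p + q) * D / (p - q)"
proof -
  have "set [x, y, x, z] = {x, y, z}" by auto
  then have sv: "solvable [x, y, x, z]" using lt unfolding solvable_def by simp
  have inc: "dev \<sigma> h x (corner w 0) = 0" "dev \<sigma> h y (corner w (Suc 0)) = 0" "dev \<sigma> h x (corner w 2) = 0" "dev \<sigma> h z (corner w 3) = 0"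
    using incident_dev[OF sv, of 0 h] incident_dev[OF sv, of "Suc 0" h] incident_dev[OF sv, of 2 h] incident_dev[OF sv, of 3 h]
    by (simp_all add: w_def)
  have ne: "\<sigma> x \<noteq> \<sigma> y" "\<sigma> y \<noteq> \<sigma> z" "\<sigma> x \<noteq> \<sigma> z" using slopes_distinct lt by blast+
  note S = corners_formula_xyxz[OF ne, of w "h x" "h y" "h z" p q D]
  have S': "(p-q) * ((\<sigma> y - \<sigma> x) * dev \<sigma> h z (corner w 0)) = (p-1) * D"
    "(p-q) * ((\<sigma> y - \<sigma> x) * dev \<sigma> h z (corner w (Suc 0))) = 2 * p * D"
    "(p-q) * ((\<sigma> y - \<sigma> x) * dev \<sigma> h z (corner w 2)) = (1+p) * D"
    "(p-q) * ((\<sigma> x - \<sigma> z) * dev \<sigma> h y (corner w 3)) = - 2 * q * D"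
    unfolding dev_def by (rule S; use inc in \<open>simp add: dev_def p_def q_def D_def cot_def area_def\<close>)+
  have "p \<noteq> 0" using cot_nonzero[of z x] lt by (simp add: p_def)
  then show nz: "p - q \<noteq> 0" using S'(2) D by (auto simp: D_def)
  show 1: "(\<sigma> y - \<sigma> x) * dev \<sigma> h z (corner w 0) = (p - 1) * D / (p - q)"
    "(\<sigma> y - \<sigma> x) * dev \<sigma> h z (corner w (Suc 0)) = 2 * p * D / (p - q)"
    "(\<sigma> y - \<sigma> x) * dev \<sigma> h z (corner w 2) = (1 + p) * D / (p - q)"
    "(\<sigma> x - \<sigma> z) * dev \<sigma> h y (corner w 3) = - 2 * q * D / (p - q)"
    by (rule divide_eqI[OF nz]; simp only: S' mult_1)+
  have g: "(\<sigma> x - \<sigma> z) * dev \<sigma> h y (corner w 0) = D - (\<sigma> y - \<sigma> x) * dev \<sigma> h z (corner w 0)"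
    "(\<sigma> z - \<sigma> y) * dev \<sigma> h x (corner w (Suc 0)) = D - (\<sigma> y - \<sigma> x) * dev \<sigma> h z (corner w (Suc 0))"
    "(\<sigma> x - \<sigma> z) * dev \<sigma> h y (corner w 2) = D - (\<sigma> y - \<sigma> x) * dev \<sigma> h z (corner w 2)"
    "(\<sigma> z - \<sigma> y) * dev \<sigma> h x (corner w 3) = D - (\<sigma> x - \<sigma> z) * dev \<sigma> h y (corner w 3)"
    using bary_sum[of z y h x "corner w 0"] bary_sum[of z y h x "corner w (Suc 0)"]
      bary_sum[of z y h x "corner w 2"] bary_sum[of z y h x "corner w 3"] inc by (simp_all add: D_def)
  show "(\<sigma> x - \<sigma> z) * dev \<sigma> h y (corner w 0) = (1 - q) * D / (p - q)"
    "(\<sigma> z - \<sigma> y) * dev \<sigma> h x (corner w (Suc 0)) = - (p + q) * D / (p - q)"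
    "(\<sigma> x - \<sigma> z) * dev \<sigma> h y (corner w 2) = - (1 + q) * D / (p - q)"
    "(\<sigma> z - \<sigma> y) * dev \<sigma> h x (corner w 3) = (p + q) * D / (p - q)"
    unfolding g 1 using nz by (simp_all add: field_simps)
qed

text \<open>The formulas for the corners turn the nine geometric conditions into the sign conditions of \<open>vertex_count\<close>. The
  edge on \<open>e\<close> imposes no condition (\<open>Qe\<close>) because its end points stay away; each edge at the vertex is a ray (\<open>Qf\<close>, \<open>Qg\<close>).\<close>
lemma vertex_count_eq:
  fixes Q :: "nat \<Rightarrow> complex \<Rightarrow> bool"
  assumes lt: "e < n" "f < n" "g < n" "e \<noteq> f" "f \<noteq> g" "e \<noteq> g" and D: "area h e f g \<noteq> 0"
    and Qe: "\<And>p. Q e p"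
    and Qf: "\<And>p. Q f p \<longleftrightarrow> 0 < a * ((\<sigma> f - \<sigma> e) * dev \<sigma> h g p)"
    and Qg: "\<And>p. Q g p \<longleftrightarrow> 0 < b * ((\<sigma> e - \<sigma> g) * dev \<sigma> h f p)"
    and K: "\<And>\<tau>. \<tau> \<in> set (three_line_patterns e f g) \<Longrightarrow> K \<tau> \<longleftrightarrow> (\<forall>j<4. Q (\<tau> ! j) (corner (sol h \<tau>) j))"
    and X: "X \<longleftrightarrow> 0 < a * area h e f g \<and> v * (a * cot e f) < 0"
    and Y: "Y \<longleftrightarrow> 0 < b * area h e f g \<and> v * (b * cot g e) < 0"
  shows "sum_list (map (\<lambda>\<tau>. of_bool (K \<tau>)) (three_line_patterns e f g)) + of_bool X + of_bool Y
    = vertex_count a b v (cot f g) (cot g e) (cot e f) (area h e f g)"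
proof -
  have ac: "area h f g e = area h e f g" "area h g e f = area h e f g" by (simp_all add: area_def)
  then have D': "area h f g e \<noteq> 0" "area h g e f \<noteq> 0" using D by simp_all
  have KQ: "K [x, y, z, w] \<longleftrightarrow> Q x (corner (sol h [x, y, z, w]) 0) \<and> Q y (corner (sol h [x, y, z, w]) (Suc 0))
      \<and> Q z (corner (sol h [x, y, z, w]) 2) \<and> Q w (corner (sol h [x, y, z, w]) 3)"
    if "[x, y, z, w] \<in> set (three_line_patterns e f g)" for x y z w
    using K[OF that] by (simp add: all_less_4)
  have m: "[e, e, f, g] \<in> set (three_line_patterns e f g)" "[e, e, g, f] \<in> set (three_line_patterns e f g)" "[e, f, e, g] \<in> set (three_line_patterns e f g)"
    "[f, f, g, e] \<in> set (three_line_patterns e f g)" "[f, f, e, g] \<in> set (three_line_patterns e f g)" "[f, g, f, e] \<in> set (three_line_patterns e f g)"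
    "[g, g, e, f] \<in> set (three_line_patterns e f g)" "[g, g, f, e] \<in> set (three_line_patterns e f g)" "[g, e, g, f] \<in> set (three_line_patterns e f g)"
    by (simp_all add: three_line_patterns_def)
  have ne: "f \<noteq> e" "g \<noteq> f" "g \<noteq> e" using lt by auto
  note c = corners_xxyz(2-)[OF lt(1-6) D] corners_xxzy(2-)[OF lt(1-6) D] corners_xyxz(2-)[OF lt(1-6) D]
    corners_xxyz(2-)[OF lt(2,3,1,5) ne(3) ne(1) D'(1)] corners_xxzy(2-)[OF lt(2,3,1,5) ne(3) ne(1) D'(1)]
    corners_xyxz(2-)[OF lt(2,3,1,5) ne(3) ne(1) D'(1)]
    corners_xxyz(2-)[OF lt(3,1,2) ne(3) lt(4) ne(2) D'(2)] corners_xxzy(2-)[OF lt(3,1,2) ne(3) lt(4) ne(2) D'(2)]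
    corners_xyxz(2-)[OF lt(3,1,2) ne(3) lt(4) ne(2) D'(2)]
  have flip: "(cot f g - 1) * r / (cot f g - cot g e) = (1 - cot f g) * r / (cot g e - cot f g)"
    "(1 + cot f g) * r / (cot f g - cot g e) = - (1 + cot f g) * r / (cot g e - cot f g)"
    "(cot f g + cot g e) * r / (cot f g - cot g e) = - (cot f g + cot g e) * r / (cot g e - cot f g)" for r
    by (metis minus_diff_eq minus_divide_divide minus_mult_left)+
  define N where "N = area h e f g"
  have k: "K [e, e, f, g] \<longleftrightarrow> 0 < a * (1 * N / (1 + cot g e + cot e f)) \<and> 0 < b * (1 * N / (1 + cot g e + cot e f))"
    "K [e, e, g, f] \<longleftrightarrow> 0 < a * (1 * N / (1 - cot g e - cot e f)) \<and> 0 < b * (1 * N / (1 - cot g e - cot e f))"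
    "K [e, f, e, g] \<longleftrightarrow> 0 < a * ((2 * cot g e) * N / (cot g e - cot e f)) \<and> 0 < b * ((- 2 * cot e f) * N / (cot g e - cot e f))"
    "K [f, f, g, e] \<longleftrightarrow> 0 < a * ((1 + cot f g) * N / (1 + cot e f + cot f g)) \<and> 0 < a * (cot f g * N / (1 + cot e f + cot f g)) \<and> 0 < b * ((cot f g + cot e f) * N / (1 + cot e f + cot f g))"
    "K [f, f, e, g] \<longleftrightarrow> 0 < a * (- cot f g * N / (1 - cot e f - cot f g)) \<and> 0 < a * ((1 - cot f g) * N / (1 - cot e f - cot f g)) \<and> 0 < b * (- (cot f g + cot e f) * N / (1 - cot e f - cot f g))"
    "K [f, g, f, e] \<longleftrightarrow> 0 < a * ((1 - cot f g) * N / (cot e f - cot f g)) \<and> 0 < a * (- (1 + cot f g) * N / (cot e f - cot f g)) \<and> 0 < b * (- (cot f g + cot e f) * N / (cot e f - cot f g))"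
    "K [g, g, e, f] \<longleftrightarrow> 0 < b * ((1 + cot f g) * N / (1 + cot f g + cot g e)) \<and> 0 < b * (cot f g * N / (1 + cot f g + cot g e)) \<and> 0 < a * ((cot f g + cot g e) * N / (1 + cot f g + cot g e))"
    "K [g, g, f, e] \<longleftrightarrow> 0 < b * (- cot f g * N / (1 - cot f g - cot g e)) \<and> 0 < b * ((1 - cot f g) * N / (1 - cot f g - cot g e)) \<and> 0 < a * (- (cot f g + cot g e) * N / (1 - cot f g - cot g e))"
    "K [g, e, g, f] \<longleftrightarrow> 0 < b * ((1 - cot f g) * N / (cot g e - cot f g)) \<and> 0 < b * (- (1 + cot f g) * N / (cot g e - cot f g)) \<and> 0 < a * (- (cot f g + cot g e) * N / (cot g e - cot f g))"
    by (simp_all only: KQ m Qe Qf Qg c ac N_def simp_thms add.commute[of "cot e f" "cot f g"] flip)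
      (auto simp only: )
  show ?thesis
    unfolding three_line_patterns_def list.map sum_list_simps k X Y vertex_count_def N_def[symmetric] by (simp only: add_ac add_0_right)
qed
text \<open>The edges on \<open>f\<close> and \<open>g\<close> are rays that start near the vanishing edge, and the edge on \<open>s\<close> is the segment that the
  other two lines cut out.\<close>
lemma short_edge_count_eq:
  fixes Q :: "nat \<Rightarrow> complex \<Rightarrow> bool"
  assumes lt: "f < n" "s < n" "g < n" "f \<noteq> s" "s \<noteq> g" "f \<noteq> g" and D: "area h f s g \<noteq> 0"
    and Qf: "\<And>p. Q f p \<longleftrightarrow> 0 < a * ((\<sigma> f - \<sigma> g) * dev \<sigma> h s p)"
    and Qg: "\<And>p. Q g p \<longleftrightarrow> 0 < b * ((\<sigma> f - \<sigma> g) * dev \<sigma> h s p)"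
    and Qs: "\<And>p. Q s p \<longleftrightarrow> 0 < ((\<sigma> g - \<sigma> s) * dev \<sigma> h f p) * ((\<sigma> s - \<sigma> f) * dev \<sigma> h g p)"
    and K: "\<And>\<tau>. \<tau> \<in> set (three_line_patterns f s g) \<Longrightarrow> K \<tau> \<longleftrightarrow> (\<forall>j<4. Q (\<tau> ! j) (corner (sol h \<tau>) j))"
    and X: "X \<longleftrightarrow> 0 < a * area h f s g \<and> 0 < b * area h f s g \<and> cot s g * cot f s < 1"
  shows "sum_list (map (\<lambda>\<tau>. of_bool (K \<tau>)) (three_line_patterns f s g)) + of_bool X
    = short_edge_count (a * area h f s g) (b * area h f s g) (cot s g) (cot g f) (cot f s)"
proof -
  have ac: "area h s g f = area h f s g" "area h g f s = area h f s g" by (simp_all add: area_def)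
  then have D': "area h s g f \<noteq> 0" "area h g f s \<noteq> 0" using D by simp_all
  have KQ: "K [x, y, z, w] \<longleftrightarrow> Q x (corner (sol h [x, y, z, w]) 0) \<and> Q y (corner (sol h [x, y, z, w]) (Suc 0))
      \<and> Q z (corner (sol h [x, y, z, w]) 2) \<and> Q w (corner (sol h [x, y, z, w]) 3)"
    if "[x, y, z, w] \<in> set (three_line_patterns f s g)" for x y z w
    using K[OF that] by (simp add: all_less_4)
  have m: "[f, f, s, g] \<in> set (three_line_patterns f s g)"
    "[f, f, g, s] \<in> set (three_line_patterns f s g)"
    "[f, s, f, g] \<in> set (three_line_patterns f s g)"
    "[s, s, g, f] \<in> set (three_line_patterns f s g)"
    "[s, s, f, g] \<in> set (three_line_patterns f s g)"
    "[s, g, s, f] \<in> set (three_line_patterns f s g)"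
    "[g, g, f, s] \<in> set (three_line_patterns f s g)"
    "[g, g, s, f] \<in> set (three_line_patterns f s g)"
    "[g, f, g, s] \<in> set (three_line_patterns f s g)"
    by (simp_all add: three_line_patterns_def)
  have ne: "s \<noteq> f" "g \<noteq> s" "g \<noteq> f" using lt by auto
  note c = corners_xxyz(2-)[OF lt(1-6) D] corners_xxzy(2-)[OF lt(1-6) D] corners_xyxz(2-)[OF lt(1-6) D]
    corners_xxyz(2-)[OF lt(2,3,1,5) ne(3) ne(1) D'(1)] corners_xxzy(2-)[OF lt(2,3,1,5) ne(3) ne(1) D'(1)]
    corners_xyxz(2-)[OF lt(2,3,1,5) ne(3) ne(1) D'(1)]
    corners_xxyz(2-)[OF lt(3,1,2) ne(3) lt(4) ne(2) D'(2)] corners_xxzy(2-)[OF lt(3,1,2) ne(3) lt(4) ne(2) D'(2)]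
    corners_xyxz(2-)[OF lt(3,1,2) ne(3) lt(4) ne(2) D'(2)]
  define N where "N = area h f s g"
  have N: "N \<noteq> 0" using D by (simp add: N_def)
  have tr: "a * (r * N / d) = (a * N) * (r / d)" "b * (r * N / d) = (b * N) * (r / d)" for r d by simp_all
  have tr2: "0 < (r * N / d) * (r' * N / d) \<longleftrightarrow> 0 < (r / d) * (r' / d)" for r r' d
  proof -
    have "(r * N / d) * (r' * N / d) = (N * N) * ((r / d) * (r' / d))" by simp
    moreover have "0 < N * N" using N by (simp add: zero_less_mult_iff linorder_neq_iff disj_commute)
    ultimately show ?thesis by (simp only: zero_less_mult_iff) auto
  qed
  have k: "K [f, f, s, g] \<longleftrightarrow> 0 < (a * N) * ((1 + cot f s) / (1 + cot g f + cot f s)) \<and> 0 < (a * N) * (cot f s / (1 + cot g f + cot f s)) \<and> 0 < ((cot g f + cot f s) / (1 + cot g f + cot f s)) * (1 / (1 + cot g f + cot f s)) \<and> 0 < (b * N) * (1 / (1 + cot g f + cot f s))"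
    "K [f, f, g, s] \<longleftrightarrow> 0 < (a * N) * (- cot f s / (1 - cot g f - cot f s)) \<and> 0 < (a * N) * ((1 - cot f s) / (1 - cot g f - cot f s)) \<and> 0 < (b * N) * (1 / (1 - cot g f - cot f s)) \<and> 0 < (- (cot g f + cot f s) / (1 - cot g f - cot f s)) * (1 / (1 - cot g f - cot f s))"
    "K [f, s, f, g] \<longleftrightarrow> 0 < (a * N) * ((1 - cot f s) / (cot g f - cot f s)) \<and> 0 < (a * N) * (- (1 + cot f s) / (cot g f - cot f s)) \<and> 0 < (- (cot g f + cot f s) / (cot g f - cot f s)) * (2 * cot g f / (cot g f - cot f s)) \<and> 0 < (b * N) * (- 2 * cot f s / (cot g f - cot f s))"
    "K [s, s, g, f] \<longleftrightarrow> 0 < (cot f s / (1 + cot f s + cot s g)) * ((1 + cot s g) / (1 + cot f s + cot s g)) \<and> 0 < ((1 + cot f s) / (1 + cot f s + cot s g)) * (cot s g / (1 + cot f s + cot s g)) \<and> 0 < (b * N) * ((cot s g + cot f s) / (1 + cot f s + cot s g)) \<and> 0 < (a * N) * ((cot s g + cot f s) / (1 + cot f s + cot s g))"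
    "K [s, s, f, g] \<longleftrightarrow> 0 < ((1 - cot f s) / (1 - cot f s - cot s g)) * (- cot s g / (1 - cot f s - cot s g)) \<and> 0 < (- cot f s / (1 - cot f s - cot s g)) * ((1 - cot s g) / (1 - cot f s - cot s g)) \<and> 0 < (a * N) * (- (cot s g + cot f s) / (1 - cot f s - cot s g)) \<and> 0 < (b * N) * (- (cot s g + cot f s) / (1 - cot f s - cot s g))"
    "K [s, g, s, f] \<longleftrightarrow> 0 < ((cot f s - 1) / (cot f s - cot s g)) * ((1 - cot s g) / (cot f s - cot s g)) \<and> 0 < (b * N) * (- (cot s g + cot f s) / (cot f s - cot s g)) \<and> 0 < ((1 + cot f s) / (cot f s - cot s g)) * (- (1 + cot s g) / (cot f s - cot s g)) \<and> 0 < (a * N) * ((cot s g + cot f s) / (cot f s - cot s g))"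
    "K [g, g, f, s] \<longleftrightarrow> 0 < (b * N) * (cot s g / (1 + cot s g + cot g f)) \<and> 0 < (b * N) * ((1 + cot s g) / (1 + cot s g + cot g f)) \<and> 0 < (a * N) * (1 / (1 + cot s g + cot g f)) \<and> 0 < (1 / (1 + cot s g + cot g f)) * ((cot s g + cot g f) / (1 + cot s g + cot g f))"
    "K [g, g, s, f] \<longleftrightarrow> 0 < (b * N) * ((1 - cot s g) / (1 - cot s g - cot g f)) \<and> 0 < (b * N) * (- cot s g / (1 - cot s g - cot g f)) \<and> 0 < (1 / (1 - cot s g - cot g f)) * (- (cot s g + cot g f) / (1 - cot s g - cot g f)) \<and> 0 < (a * N) * (1 / (1 - cot s g - cot g f))"
    "K [g, f, g, s] \<longleftrightarrow> 0 < (b * N) * ((cot s g - 1) / (cot s g - cot g f)) \<and> 0 < (a * N) * (2 * cot s g / (cot s g - cot g f)) \<and> 0 < (b * N) * ((1 + cot s g) / (cot s g - cot g f)) \<and> 0 < (- 2 * cot g f / (cot s g - cot g f)) * ((cot s g + cot g f) / (cot s g - cot g f))"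
    apply (simp_all only: KQ m Qs Qf Qg c ac N_def[symmetric] tr tr2 simp_thms add.commute[of "cot s g" "cot f s"])
    apply (simp_all only: mult.commute[of "_ / _" "_ / _"] conj_ac)?
    done
  show ?thesis
    unfolding three_line_patterns_def list.map sum_list_simps k X short_edge_count_def N_def[symmetric] by (simp only: add_ac add_0_right)
qed

text \<open>A triangle has an inscribed square with a side on the edge \<open>x\<close> exactly if both angles at \<open>x\<close> are acute. A
  diagonal of an inscribed square never lies on an edge.\<close>
lemma triangle_tuples:
  fixes Q :: "nat \<Rightarrow> complex \<Rightarrow> bool"
  assumes lt: "x < n" "y < n" "z < n" "x \<noteq> y" "y \<noteq> z" "x \<noteq> z" and D: "area h x y z \<noteq> 0"
    and Qx: "\<And>p. Q x p \<longleftrightarrow> 0 < ((\<sigma> x - \<sigma> z) * dev \<sigma> h y p) * ((\<sigma> y - \<sigma> x) * dev \<sigma> h z p)"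
    and Qy: "\<And>p. Q y p \<longleftrightarrow> 0 < ((\<sigma> y - \<sigma> x) * dev \<sigma> h z p) * ((\<sigma> z - \<sigma> y) * dev \<sigma> h x p)"
    and Qz: "\<And>p. Q z p \<longleftrightarrow> 0 < ((\<sigma> z - \<sigma> y) * dev \<sigma> h x p) * ((\<sigma> x - \<sigma> z) * dev \<sigma> h y p)"
  shows "(\<forall>j<4. Q ([x, x, y, z] ! j) (corner (sol h [x, x, y, z]) j)) \<longleftrightarrow> 0 < cot z x \<and> 0 < cot x y"
    "(\<forall>j<4. Q ([x, x, z, y] ! j) (corner (sol h [x, x, z, y]) j)) \<longleftrightarrow> cot z x < 0 \<and> cot x y < 0"
    "\<not> (\<forall>j<4. Q ([x, y, x, z] ! j) (corner (sol h [x, y, x, z]) j))"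
proof -
  define p q N where "p = cot z x" and "q = cot x y" and "N = area h x y z"
  have N: "N \<noteq> 0" using D by (simp add: N_def)
  have tr2: "0 < (r * N / d) * (r' * N / d) \<longleftrightarrow> 0 < r * r'" if "d \<noteq> 0" for r r' d
  proof -
    have "(r * N / d) * (r' * N / d) = (N / d * (N / d)) * (r * r')" by simp
    moreover have "0 < N / d * (N / d)" using N that by (simp add: zero_less_mult_iff zero_less_divide_iff divide_less_0_iff) linarith
    moreover have "0 < K * R \<longleftrightarrow> 0 < R" if "0 < K" for K R :: real using that by (simp add: zero_less_mult_iff)
    ultimately show ?thesis by metis
  qed
  note c1 = corners_xxyz[OF lt D, folded p_def q_def N_def] and c2 = corners_xxzy[OF lt D, folded p_def q_def N_def]
    and c3 = corners_xyxz[OF lt D, folded p_def q_def N_def]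
  note R = all_less_4 Qx Qy Qz nth_Cons_0 nth_Cons_Suc numeral_2_eq_2 numeral_3_eq_3
  have "(\<forall>j<4. Q ([x, x, y, z] ! j) (corner (sol h [x, x, y, z]) j)) \<longleftrightarrow>
      0 < (1 + q) * p \<and> 0 < q * (1 + p) \<and> 0 < 1 * (p + q) \<and> 0 < (p + q) * 1"
    by (simp only: R c1(2-)[unfolded numeral_2_eq_2 numeral_3_eq_3] tr2[OF c1(1)])
  also have "\<dots> \<longleftrightarrow> 0 < p \<and> 0 < q" by (auto simp: zero_less_mult_iff)
  finally show "(\<forall>j<4. Q ([x, x, y, z] ! j) (corner (sol h [x, x, y, z]) j)) \<longleftrightarrow> 0 < cot z x \<and> 0 < cot x y"
    by (simp only: p_def q_def)
  have "(\<forall>j<4. Q ([x, x, z, y] ! j) (corner (sol h [x, x, z, y]) j)) \<longleftrightarrow>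
      0 < - q * (1 - p) \<and> 0 < (1 - q) * - p \<and> 0 < - (p + q) * 1 \<and> 0 < 1 * - (p + q)"
    by (simp only: R c2(2-)[unfolded numeral_2_eq_2 numeral_3_eq_3] tr2[OF c2(1)])
  also have "\<dots> \<longleftrightarrow> p < 0 \<and> q < 0" by (auto simp: zero_less_mult_iff mult_less_0_iff)
  finally show "(\<forall>j<4. Q ([x, x, z, y] ! j) (corner (sol h [x, x, z, y]) j)) \<longleftrightarrow> cot z x < 0 \<and> cot x y < 0"
    by (simp only: p_def q_def)
  have "(\<forall>j<4. Q ([x, y, x, z] ! j) (corner (sol h [x, y, x, z]) j)) \<longleftrightarrow>
      0 < (1 - q) * (p - 1) \<and> 0 < 2 * p * - (p + q) \<and> 0 < - (1 + q) * (1 + p) \<and> 0 < (p + q) * (- 2 * q)"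
    by (simp only: R c3(2-)[unfolded numeral_2_eq_2 numeral_3_eq_3] tr2[OF c3(1)])
  also have "\<dots> \<longleftrightarrow> False" by (auto simp: zero_less_mult_iff mult_less_0_iff)
  finally show "\<not> (\<forall>j<4. Q ([x, y, x, z] ! j) (corner (sol h [x, y, x, z]) j))" by simp
qed

end

section \<open>Counting squares up to rotation, and the triangle\<close>

lemma even_involution:
  assumes "finite S" "\<And>x. x \<in> S \<Longrightarrow> f x \<in> S" "\<And>x. x \<in> S \<Longrightarrow> f (f x) = x" "\<And>x. x \<in> S \<Longrightarrow> f x \<noteq> x"
  shows "even (card S)"
  using assms
proof (induction "card S" arbitrary: S rule: less_induct)
  case less
  show ?case
  proof (cases "S = {}")
    case False
    then obtain x where x: "x \<in> S" by blast
    define S' where "S' = S - {x, f x}"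
    have sub: "{x, f x} \<subseteq> S" using x less.prems(2) by blast
    have c2: "card {x, f x} = 2" using less.prems(4)[OF x] by simp
    have cS: "card S' = card S - 2" unfolding S'_def using card_Diff_subset[of "{x, f x}" S] sub c2 by simp
    have ge: "2 \<le> card S" using card_mono[OF less.prems(1) sub] c2 by simp
    have inS: "f y \<in> S'" if "y \<in> S'" for y
    proof -
      have y: "y \<in> S" "y \<noteq> x" "y \<noteq> f x" using that by (auto simp: S'_def)
      have "f y \<noteq> x" using less.prems(3)[OF y(1)] y(3) by auto
      moreover have "f y \<noteq> f x" using less.prems(3)[OF y(1)] less.prems(3)[OF x] y(2) by auto
      ultimately show ?thesis using less.prems(2)[OF y(1)] by (simp add: S'_def)
    qed
    have "even (card S')"
    proof (rule less.hyps)
      show "card S' < card S" using cS ge by simp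
      show "finite S'" using less.prems(1) by (simp add: S'_def)
      show "f y \<in> S'" if "y \<in> S'" for y by (rule inS[OF that])
      show "f (f y) = y" "f y \<noteq> y" if "y \<in> S'" for y using that less.prems(3,4) by (simp_all add: S'_def)
    qed
    then show ?thesis using cS ge by simp
  qed simp
qed

lemma card_as_sum: "finite S \<Longrightarrow> card {x \<in> S. P x} = (\<Sum>x\<in>S. of_bool (P x))"
  by (simp add: sum.If_cases of_bool_def Int_def)

lemma parity_symmetric_difference:
  assumes "finite S"
  shows "even (card {x \<in> S. P x} + card {x \<in> S. Q x}) \<longleftrightarrow> even (card {x \<in> S. P x \<noteq> Q x})"
proof -
  have "even (\<Sum>x\<in>S. of_bool (P x) + of_bool (Q x) + of_bool (P x \<noteq> Q x) :: nat)"
    by (rule dvd_sum) auto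
  then have "even (card {x \<in> S. P x} + card {x \<in> S. Q x} + card {x \<in> S. P x \<noteq> Q x})"
    unfolding card_as_sum[OF assms] sum.distrib .
  then show ?thesis by simp
qed

text \<open>Rotating the tuple only renames the corners of the square, so squares correspond to these classes.\<close>
definition cyc :: "'a list \<Rightarrow> 'a list set" where
  "cyc \<tau> = set (map (\<lambda>k. rotate k \<tau>) [0..<4])"

lemma cyc4: "cyc [a, b, c, d] = {[a, b, c, d], [b, c, d, a], [c, d, a, b], [d, a, b, c]}"
proof -
  have "[0..<4] = [0, 1, 2, 3::nat]" by code_simp
  moreover have "rotate 2 xs = rotate1 (rotate1 xs)" "rotate 3 xs = rotate1 (rotate1 (rotate1 xs))" for xs :: "'a list"
    by (simp_all add: numeral_eq_Suc)
  ultimately show ?thesis by (simp add: cyc_def)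
qed

lemma cyc_rotate1: "length \<tau> = 4 \<Longrightarrow> cyc (rotate1 \<tau>) = cyc \<tau>"
  by (erule length4_obtain) (auto simp: cyc4)

lemma cyc_self: "length \<tau> = 4 \<Longrightarrow> \<tau> \<in> cyc \<tau>"
  by (erule length4_obtain) (simp add: cyc4)

lemma cyc_cases:
  assumes "length \<tau> = 4" "\<tau>' \<in> cyc \<tau>"
  shows "\<tau>' \<in> {\<tau>, rotate1 \<tau>, rotate1 (rotate1 \<tau>), rotate1 (rotate1 (rotate1 \<tau>))}"
  using assms by (elim length4_obtain) (auto simp: cyc4)

lemma cyc_eq: "length \<tau> = 4 \<Longrightarrow> \<tau>' \<in> cyc \<tau> \<Longrightarrow> cyc \<tau>' = cyc \<tau>"
  using cyc_cases[of \<tau> \<tau>'] by (auto simp: cyc_rotate1)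

lemma cyc_map: "cyc (map f \<tau>) = map f ` cyc \<tau>"
  by (simp add: cyc_def rotate_map image_image)

definition lines :: "nat list set \<Rightarrow> nat set" where "lines c = (\<Union>\<tau>\<in>c. set \<tau>)"

lemma lines_cyc: "length \<tau> = 4 \<Longrightarrow> lines (cyc \<tau>) = set \<tau>"
  by (erule length4_obtain) (auto simp: cyc4 lines_def)

text \<open>All classes of tuples on three given lines: nine patterns that use every line, and three crossings.\<close>
definition class_representatives :: "nat \<Rightarrow> nat \<Rightarrow> nat \<Rightarrow> nat list list" where
  "class_representatives x y z = three_line_patterns x y z @ [[x, y, x, y], [z, x, z, x], [y, z, y, z]]"

lemma class_representatives_map: "class_representatives (f 0) (f 1) (f 2) = map (map f) (class_representatives 0 1 2)"
  by (simp add: class_representatives_def three_line_patterns_def)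

text \<open>It suffices to inspect the 81 words over three letters.\<close>
lemma class_representatives_exhaust_012:
  "\<forall>\<nu>\<in>set (List.n_lists 4 [0, 1, 2]). 3 \<le> length (remdups \<nu>) \<or> (\<nu> ! 0 = \<nu> ! 2 \<and> \<nu> ! 1 = \<nu> ! 3 \<and> \<nu> ! 0 \<noteq> \<nu> ! 1)
     \<longrightarrow> list_ex (\<lambda>\<mu>. \<mu> \<in> cyc \<nu>) (class_representatives 0 1 2)"
  by code_simp

lemma class_representatives_distinct_012: "distinct (map cyc (class_representatives 0 1 2))"
  by code_simp

lemma class_representatives_in_012: "\<forall>\<mu>\<in>set (class_representatives 0 1 2). \<forall>\<nu>\<in>cyc \<mu>. set \<nu> \<subseteq> {0, 1, 2}"
  by code_simp

lemma three_letters: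
  assumes "x \<noteq> y" "y \<noteq> z" "x \<noteq> (z::nat)"
  obtains f :: "nat \<Rightarrow> nat" where "f 0 = x" "f 1 = y" "f 2 = z" "inj_on f {0, 1, 2}"
  by (rule that[of "\<lambda>i. if i = 0 then x else if i = 1 then y else z"]) (use assms in \<open>auto simp: inj_on_def\<close>)

lemma class_representatives_exhaust:
  assumes xyz: "x \<noteq> y" "y \<noteq> z" "x \<noteq> z" and "length \<tau> = 4" "set \<tau> \<subseteq> {x, y, z}" and t: "3 \<le> card (set \<tau>) \<or> crossing \<tau>"
  shows "\<exists>\<mu>\<in>set (class_representatives x y z). \<mu> \<in> cyc \<tau>"
proof -
  obtain f :: "nat \<Rightarrow> nat" where f: "f 0 = x" "f 1 = y" "f 2 = z" "inj_on f {0, 1, 2}" using xyz by (rule three_letters)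
  have "\<forall>v\<in>set \<tau>. \<exists>i\<in>{0,1,2}. f i = v" using assms(5) f(1-3) by auto
  then obtain g where g: "\<And>v. v \<in> set \<tau> \<Longrightarrow> g v \<in> {0,1,2} \<and> f (g v) = v" by metis
  define \<nu> where "\<nu> = map g \<tau>"
  have \<tau>: "\<tau> = map f \<nu>" using g by (simp add: \<nu>_def map_idI)
  have sub: "set \<nu> \<subseteq> {0, 1, 2}" using g unfolding \<nu>_def by fastforce
  have len: "length \<nu> = 4" using assms(4) by (simp add: \<nu>_def)
  then have mem: "\<nu> \<in> set (List.n_lists 4 [0, 1, 2])" using sub by (auto simp: set_n_lists)
  moreover have "card (set \<tau>) = card (set \<nu>)"
    unfolding \<tau> set_map by (rule card_image) (rule inj_on_subset[OF f(4) sub])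
  moreover have "crossing \<tau> \<longleftrightarrow> \<nu> ! 0 = \<nu> ! 2 \<and> \<nu> ! 1 = \<nu> ! 3 \<and> \<nu> ! 0 \<noteq> \<nu> ! 1"
  proof -
    have "\<nu> ! j \<in> {0, 1, 2}" if "j < 4" for j using sub len that nth_mem by (metis subsetD)
    then have "f (\<nu> ! i) = f (\<nu> ! j) \<longleftrightarrow> \<nu> ! i = \<nu> ! j" if "i < 4" "j < 4" for i j
      using inj_on_eq_iff[OF f(4)] that by blast
    then show ?thesis using len by (simp add: crossing_def \<tau>)
  qed
  ultimately have "list_ex (\<lambda>\<mu>. \<mu> \<in> cyc \<nu>) (class_representatives 0 1 2)"
    using bspec[OF class_representatives_exhaust_012 mem] t unfolding length_remdups_card_conv by metis
  then obtain \<mu> where "\<mu> \<in> set (class_representatives 0 1 2)" "\<mu> \<in> cyc \<nu>" by (auto simp: list_ex_iff)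
  then have "map f \<mu> \<in> set (class_representatives x y z)" "map f \<mu> \<in> cyc \<tau>"
    using class_representatives_map[of f] f(1-3) by (auto simp: \<tau> cyc_map)
  then show ?thesis by blast
qed

lemma class_representatives_distinct:
  assumes xyz: "x \<noteq> y" "y \<noteq> z" "x \<noteq> z"
  shows "distinct (map cyc (class_representatives x y z))"
proof -
  obtain f :: "nat \<Rightarrow> nat" where f: "f 0 = x" "f 1 = y" "f 2 = z" "inj_on f {0, 1, 2}" using xyz by (rule three_letters)
  have "map cyc (class_representatives x y z) = map ((`) (map f)) (map cyc (class_representatives 0 1 2))"
    using class_representatives_map[of f] f(1-3) by (simp add: cyc_map)
  moreover have "inj_on ((`) (map f)) (set (map cyc (class_representatives 0 1 2)))"
  proof (rule inj_on_image)
    have "\<Union> (set (map cyc (class_representatives 0 1 2))) \<subseteq> {\<nu>. set \<nu> \<subseteq> {0, 1, 2}}" using class_representatives_in_012 by auto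
    moreover have "inj_on (map f) {\<nu>. set \<nu> \<subseteq> {0, 1, 2}}"
      by (rule inj_onI, rule map_inj_on, assumption, rule inj_on_subset[OF f(4)]) auto
    ultimately show "inj_on (map f) (\<Union> (set (map cyc (class_representatives 0 1 2))))" by (rule inj_on_subset[rotated])
  qed
  ultimately show ?thesis using class_representatives_distinct_012 by (simp only: distinct_map)
qed

lemma card_filter_list: "distinct xs \<Longrightarrow> card {x \<in> set xs. P x} = sum_list (map (\<lambda>x. of_bool (P x)) xs)"
  by (simp add: card_as_sum sum_list_distinct_conv_sum_set)

lemma tuples_rotate1: "\<tau> \<in> tuples m \<Longrightarrow> rotate1 \<tau> \<in> tuples m"
proof -
  assume t: "\<tau> \<in> tuples m"
  then have len: "length \<tau> = 4" by (simp add: tuples_def)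
  have "adjacent m (rotate1 \<tau> ! 0) (rotate1 \<tau> ! 1) \<longleftrightarrow> adjacent m (\<tau> ! 0) (\<tau> ! 1)" if "crossing \<tau>"
    using that unfolding crossing_iff[OF len] by (auto simp: adjacent_def)
  then show ?thesis using t len by (auto simp: tuples_def crossing_rotate1)
qed

lemma finite_tuples: "finite (tuples m)"
  by (rule finite_subset[OF _ finite_lists_length_eq[of "{..<m}" 4]]) (auto simp: tuples_def)

context slopes
begin

text \<open>For a point \<open>p\<close> of line \<open>i\<close>, the deviation from a neighbouring line divided by the difference of slopes is the
  difference of real parts between \<open>p\<close> and the common vertex. So the condition says that \<open>p\<close> lies strictly
  between the two vertices on line \<open>i\<close>.\<close>
definition in_edge :: "nat \<Rightarrow> (nat \<Rightarrow> real) \<Rightarrow> nat \<Rightarrow> complex \<Rightarrow> bool" where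
  "in_edge m h i p \<longleftrightarrow> dev \<sigma> h (prv m i) p * dev \<sigma> h (nxt m i) p * ((\<sigma> i - \<sigma> (prv m i)) * (\<sigma> i - \<sigma> (nxt m i))) < 0"

text \<open>For a point \<open>p\<close> of line \<open>i\<close>, positive if and only if it lies to the right of the first vertex of edge \<open>i\<close>. For \<open>p\<close>
  in the edge this means that the edge is traversed from left to right.\<close>
definition travel :: "nat \<Rightarrow> (nat \<Rightarrow> real) \<Rightarrow> nat \<Rightarrow> complex \<Rightarrow> real" where
  "travel m h i p = dev \<sigma> h (prv m i) p * (\<sigma> i - \<sigma> (prv m i))"

text \<open>A crossing is counted only if the directions in which the two edges are traversed make an obtuse
  angle; \<open>1 + \<sigma> a * \<sigma> b\<close> is the inner product of the direction vectors that point to the right.\<close>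
definition counted :: "nat \<Rightarrow> (nat \<Rightarrow> real) \<Rightarrow> nat list \<Rightarrow> bool" where
  "counted m h \<tau> \<longleftrightarrow> (\<forall>j<4. in_edge m h (\<tau> ! j) (corner (sol h \<tau>) j)) \<and>
     (crossing \<tau> \<longrightarrow> travel m h (\<tau> ! 0) (fst (sol h \<tau>)) * travel m h (\<tau> ! 1) (fst (sol h \<tau>)) * (1 + \<sigma> (\<tau> ! 0) * \<sigma> (\<tau> ! 1)) < 0)"

definition classes :: "nat \<Rightarrow> nat list set set" where "classes m = cyc ` tuples m"

definition counted_class :: "nat \<Rightarrow> (nat \<Rightarrow> real) \<Rightarrow> nat list set \<Rightarrow> bool" where
  "counted_class m h c \<longleftrightarrow> (\<exists>\<tau>\<in>c. counted m h \<tau>)"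

definition square_count :: "nat \<Rightarrow> (nat \<Rightarrow> real) \<Rightarrow> nat" where
  "square_count m h = card {c \<in> classes m. counted_class m h c}"

lemma counted_rotate1:
  assumes "solvable \<tau>"
  shows "counted m h (rotate1 \<tau>) \<longleftrightarrow> counted m h \<tau>"
proof -
  have "length \<tau> = 4" using assms by (simp add: solvable_def)
  then obtain a b c d where t: "\<tau> = [a, b, c, d]" by (rule length4_obtain)
  have f: "fst (rot z) = fst z" for z by (simp add: rot_def)
  define Z where "Z = sol h [a, b, c, d]"
  have s: "sol h (rotate1 [a, b, c, d]) = rot Z" using sol_rotate1[OF assms] by (simp add: t Z_def)
  show ?thesis unfolding t counted_def all_less_4 s Z_def[symmetric]
    by (simp add: corner_rot f crossing_def) (auto simp: ac_simps)
qed

lemma counted_class_cyc: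
  assumes "solvable \<tau>"
  shows "counted_class m h (cyc \<tau>) \<longleftrightarrow> counted m h \<tau>"
proof -
  have len: "length \<tau> = 4" using assms by (simp add: solvable_def)
  note s1 = solvable_rotate1[OF assms] and s2 = solvable_rotate1[OF solvable_rotate1[OF assms]]
  have "counted m h \<tau>' \<longleftrightarrow> counted m h \<tau>" if "\<tau>' \<in> cyc \<tau>" for \<tau>'
    using cyc_cases[OF len that] counted_rotate1[OF assms] counted_rotate1[OF s1] counted_rotate1[OF s2] by auto
  then show ?thesis using cyc_self[OF len] unfolding counted_class_def by blast
qed

lemma finite_classes: "finite (classes m)"
  by (simp add: classes_def finite_tuples)

lemma card_classes_within:
  assumes mn: "m \<le> n" and xyz: "x < m" "y < m" "z < m" "x \<noteq> y" "y \<noteq> z" "x \<noteq> z"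
  shows "card {c \<in> classes m. lines c \<subseteq> {x, y, z} \<and> counted_class m h c}
    = sum_list (map (\<lambda>\<tau>. of_bool (\<tau> \<in> tuples m \<and> counted m h \<tau>)) (class_representatives x y z))"
proof -
  have inj: "inj_on cyc (set (class_representatives x y z))" and dist: "distinct (class_representatives x y z)"
    using class_representatives_distinct[OF xyz(4-6)] by (simp_all add: distinct_map)
  have "{c \<in> classes m. lines c \<subseteq> {x, y, z} \<and> counted_class m h c} = cyc ` {\<tau> \<in> set (class_representatives x y z). \<tau> \<in> tuples m \<and> counted m h \<tau>}"
    (is "?L = ?R")
  proof
    show "?L \<subseteq> ?R"
    proof
      fix c assume "c \<in> ?L"
      then obtain \<tau> where t: "\<tau> \<in> tuples m" "c = cyc \<tau>" "lines (cyc \<tau>) \<subseteq> {x, y, z}" "counted_class m h (cyc \<tau>)"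
        by (auto simp: classes_def)
      have len: "length \<tau> = 4" using t(1) by (simp add: tuples_def)
      have "set \<tau> \<subseteq> {x, y, z}" using t(3) lines_cyc[OF len] by simp
      moreover have "3 \<le> card (set \<tau>) \<or> crossing \<tau>" using t(1) by (auto simp: tuples_def)
      ultimately obtain \<mu> where mu: "\<mu> \<in> set (class_representatives x y z)" "\<mu> \<in> cyc \<tau>"
        using class_representatives_exhaust[OF xyz(4-6) len] by blast
      have "\<mu> \<in> tuples m" using cyc_cases[OF len mu(2)] t(1) tuples_rotate1 by auto
      moreover have "cyc \<mu> = cyc \<tau>" by (rule cyc_eq[OF len mu(2)])
      ultimately have "counted m h \<mu>" using counted_class_cyc[OF tuples_solvable[OF _ mn]] t(4) by metis
      then show "c \<in> ?R" using mu \<open>\<mu> \<in> tuples m\<close> \<open>cyc \<mu> = cyc \<tau>\<close> t(2) by auto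
    qed
    show "?R \<subseteq> ?L"
    proof
      fix c assume "c \<in> ?R"
      then obtain \<tau> where t: "\<tau> \<in> set (class_representatives x y z)" "\<tau> \<in> tuples m" "counted m h \<tau>" "c = cyc \<tau>" by blast
      have "set \<tau> \<subseteq> {x, y, z}" using t(1) by (auto simp: class_representatives_def three_line_patterns_def)
      moreover have "lines c = set \<tau>" using t by (simp add: lines_cyc tuples_def)
      moreover have "counted_class m h c" using t counted_class_cyc[OF tuples_solvable[OF t(2) mn]] by simp
      ultimately show "c \<in> ?L" using t by (auto simp: classes_def)
    qed
  qed
  then show ?thesis using card_image[OF inj_on_subset[OF inj], of "{\<tau> \<in> set (class_representatives x y z). \<tau> \<in> tuples m \<and> counted m h \<tau>}"]
      card_filter_list[OF dist] by auto
qed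

lemma pattern_tuples:
  assumes "x < m" "y < m" "z < m" "x \<noteq> y" "y \<noteq> z" "x \<noteq> z" "\<tau> \<in> set (three_line_patterns x y z)"
  shows "\<tau> \<in> tuples m" "\<not> crossing \<tau>"
proof -
  have s: "set \<tau> = {x, y, z}" using assms(7) by (auto simp: three_line_patterns_def)
  then have "card (set \<tau>) = 3" using assms by simp
  moreover have "length \<tau> = 4" using assms(7) by (auto simp: three_line_patterns_def)
  ultimately show "\<tau> \<in> tuples m" using s assms unfolding tuples_def by auto
  show "\<not> crossing \<tau>" using assms by (auto simp: three_line_patterns_def crossing_def)
qed

lemma sum_class_representatives:
  assumes "x < m" "y < m" "z < m" "x \<noteq> y" "y \<noteq> z" "x \<noteq> z"
  shows "sum_list (map (\<lambda>\<tau>. of_bool (\<tau> \<in> tuples m \<and> counted m h \<tau>)) (class_representatives x y z))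
    = sum_list (map (\<lambda>\<tau>. of_bool (counted m h \<tau>)) (three_line_patterns x y z))
      + of_bool (\<not> adjacent m x y \<and> counted m h [x, y, x, y]) + of_bool (\<not> adjacent m z x \<and> counted m h [z, x, z, x])
      + (of_bool (\<not> adjacent m y z \<and> counted m h [y, z, y, z]) :: nat)"
proof -
  have "sum_list (map (\<lambda>\<tau>. of_bool (\<tau> \<in> tuples m \<and> counted m h \<tau>)) (three_line_patterns x y z)) = (sum_list (map (\<lambda>\<tau>. of_bool (counted m h \<tau>)) (three_line_patterns x y z)) :: nat)"
    by (rule arg_cong[where f = sum_list]) (use pattern_tuples[OF assms] in simp)
  moreover have "[a, b, a, b] \<in> tuples m \<longleftrightarrow> \<not> adjacent m a b" if "a < m" "b < m" "a \<noteq> b" for a b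
  proof -
    have "set [a, b, a, b] = {a, b}" by auto
    then have "card (set [a, b, a, b]) = 2" using that by simp
    then show ?thesis using that unfolding tuples_def by (simp add: crossing_def)
  qed
  ultimately show ?thesis using assms by (simp add: class_representatives_def)
qed

lemma in_edge_3:
  "in_edge 3 h 0 p \<longleftrightarrow> 0 < ((\<sigma> 0 - \<sigma> 2) * dev \<sigma> h 1 p) * ((\<sigma> 1 - \<sigma> 0) * dev \<sigma> h 2 p)"
  "in_edge 3 h 1 p \<longleftrightarrow> 0 < ((\<sigma> 1 - \<sigma> 0) * dev \<sigma> h 2 p) * ((\<sigma> 2 - \<sigma> 1) * dev \<sigma> h 0 p)"
  "in_edge 3 h 2 p \<longleftrightarrow> 0 < ((\<sigma> 2 - \<sigma> 1) * dev \<sigma> h 0 p) * ((\<sigma> 0 - \<sigma> 2) * dev \<sigma> h 1 p)"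
proof -
  have n: "X < 0 \<longleftrightarrow> 0 < Y" if "Y = - X" for X Y :: real using that by simp
  show "in_edge 3 h 0 p \<longleftrightarrow> 0 < ((\<sigma> 0 - \<sigma> 2) * dev \<sigma> h 1 p) * ((\<sigma> 1 - \<sigma> 0) * dev \<sigma> h 2 p)"
    "in_edge 3 h 1 p \<longleftrightarrow> 0 < ((\<sigma> 1 - \<sigma> 0) * dev \<sigma> h 2 p) * ((\<sigma> 2 - \<sigma> 1) * dev \<sigma> h 0 p)"
    "in_edge 3 h 2 p \<longleftrightarrow> 0 < ((\<sigma> 2 - \<sigma> 1) * dev \<sigma> h 0 p) * ((\<sigma> 0 - \<sigma> 2) * dev \<sigma> h 1 p)"
    unfolding in_edge_def by (rule n; simp add: prv_def nxt_def numeral_2_eq_2 numeral_3_eq_3; algebra)+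
qed

text \<open>With three edges there are no crossings, and the squares correspond to the edges with two acute angles.\<close>
lemma triangle_odd:
  assumes n: "3 \<le> n" and g: "generic h"
  shows "odd (square_count 3 h)"
proof -
  have lt: "0 < n" "1 < n" "2 < n" "(0::nat) \<noteq> 1" "1 \<noteq> (2::nat)" "(0::nat) \<noteq> 2" using n by auto
  have l3: "0 < (3::nat)" "1 < (3::nat)" "2 < (3::nat)" by auto
  have D: "area h 0 1 2 \<noteq> 0"
  proof
    assume a: "area h 0 1 2 = 0"
    define t where "t = sol h [0, 1, 0, 1]"
    have sv: "solvable [0, 1, 0, 1]" using lt by (simp add: solvable_def crossing_def)
    have "snd t = 0" unfolding t_def by (rule sol_crossing) (use lt in auto)
    then have "corner t j = fst t" for j by (simp add: corner_def)
    then have z: "dev \<sigma> h 0 (fst t) = 0" "dev \<sigma> h 1 (fst t) = 0"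
      using incident_dev[OF sv, of 0 h] incident_dev[OF sv, of 1 h] by (simp_all add: t_def)
    then have "(\<sigma> 1 - \<sigma> 0) * dev \<sigma> h 2 (fst t) = 0" using bary_sum[of 2 1 h 0 "fst t"] a by simp
    then have "dev \<sigma> h 2 (fst t) = 0" using slopes_distinct[of 0 1] lt by simp
    then show False using generic_not_concurrent[OF g lt(1-4) lt(6,5)] z by blast
  qed
  have adj: "adjacent 3 0 1" "adjacent 3 2 0" "adjacent 3 1 2" by (auto simp: adjacent_def nxt_def)
  have "lines c \<subseteq> {0, 1, 2}" if c: "c \<in> classes 3" for c
  proof -
    obtain \<tau> where t: "\<tau> \<in> tuples 3" "c = cyc \<tau>" using c unfolding classes_def by blast
    then have "lines c = set \<tau>" "set \<tau> \<subseteq> {..<3}" by (simp_all add: lines_cyc tuples_def)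
    moreover have "{..<3} = {0, 1, 2::nat}" by auto
    ultimately show ?thesis by simp
  qed
  then have "square_count 3 h = card {c \<in> classes 3. lines c \<subseteq> {0, 1, 2} \<and> counted_class 3 h c}"
    unfolding square_count_def by (intro arg_cong[where f = card]) auto
  also have "\<dots> = sum_list (map (\<lambda>\<tau>. of_bool (counted 3 h \<tau>)) (three_line_patterns 0 1 2))"
    unfolding card_classes_within[OF n l3 lt(4-6)] sum_class_representatives[OF l3 lt(4-6)] by (simp add: adj[simplified])
  also have "map (\<lambda>\<tau>. of_bool (counted 3 h \<tau>)) (three_line_patterns 0 1 2)
      = map (\<lambda>\<tau>. of_bool (\<forall>j<4. in_edge 3 h (\<tau> ! j) (corner (sol h \<tau>) j))) (three_line_patterns 0 1 2)"
    using pattern_tuples(2)[OF l3 lt(4-6)] by (auto simp: counted_def)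
  also have "sum_list \<dots> = of_bool (0 < cot 0 1 * cot 1 2) + of_bool (0 < cot 1 2 * cot 2 0) + (of_bool (0 < cot 2 0 * cot 0 1) :: nat)"
  proof -
    have D': "area h 1 2 0 \<noteq> 0" "area h 2 0 1 \<noteq> 0" using D by (simp_all add: area_def)
    have b: "of_bool (0 < p \<and> 0 < q) + of_bool (p < 0 \<and> q < 0) = (of_bool (0 < p * q) :: nat)" for p q :: real
      by (auto simp: zero_less_mult_iff)
    note T1 = triangle_tuples[OF lt D in_edge_3]
      and T2 = triangle_tuples[OF lt(2,3,1,5) lt(6)[symmetric] lt(4)[symmetric] D'(1) in_edge_3(2,3,1)]
      and T3 = triangle_tuples[OF lt(3,1,2) lt(6)[symmetric] lt(4) lt(5)[symmetric] D'(2) in_edge_3(3,1,2)]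
    show ?thesis unfolding three_line_patterns_def list.map sum_list_simps b[symmetric] T1(1,2) T2(1,2) T3(1,2)
      using T1(3) T2(3) T3(3) by (simp add: add_ac conj_commute)
  qed
  also have "odd \<dots>"
    using odd_positive_products[of "cot 0 1" "cot 1 2" "cot 2 0"] cot_nonzero lt by (simp add: ac_simps)
  finally show ?thesis .
qed

end

section \<open>Three nearly concurrent lines of a polygon\<close>

text \<open>Far from the three concurrent lines the sign \<open>c\<close> of a deviation is constant and can replace it.\<close>
lemma neg_subst: "0 < c * x \<Longrightarrow> x * y < 0 \<longleftrightarrow> c * y < 0" for c x y :: real
  by (auto simp: zero_less_mult_iff mult_less_0_iff)

lemma pattern_in_classes: "\<tau> \<in> set (three_line_patterns x y z) \<Longrightarrow> \<tau> \<in> set (class_representatives x y z)"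
  by (simp add: class_representatives_def)

lemma pattern_members: "\<tau> \<in> set (three_line_patterns x y z) \<Longrightarrow> length \<tau> = 4 \<and> set \<tau> = {x, y, z}"
  by (auto simp: three_line_patterns_def)

lemma nxt_less: "i < m \<Longrightarrow> nxt m i < m" and prv_less: "i < m \<Longrightarrow> prv m i < m"
  by (auto simp: nxt_def prv_def)

lemma prv_nxt: "i < m \<Longrightarrow> prv m (nxt m i) = i" and nxt_prv: "i < m \<Longrightarrow> nxt m (prv m i) = i"
  by (auto simp: nxt_def prv_def)

lemma nxt_neq: "2 \<le> m \<Longrightarrow> nxt m i \<noteq> i" and prv_neq: "2 \<le> m \<Longrightarrow> i < m \<Longrightarrow> prv m i \<noteq> i"
  by (auto simp: nxt_def prv_def)

lemma prv_neq_nxt: "3 \<le> m \<Longrightarrow> i < m \<Longrightarrow> prv m i \<noteq> nxt m i"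
  by (auto simp: nxt_def prv_def split: if_splits)

lemma adjacent_sym: "adjacent m i j \<longleftrightarrow> adjacent m j i"
  by (auto simp: adjacent_def)

lemma adjacent_nxt: "adjacent m i (nxt m i)" and adjacent_prv: "i < m \<Longrightarrow> adjacent m i (prv m i)"
  by (simp_all add: adjacent_def nxt_prv)

context slopes
begin

text \<open>The assumption \<open>near\<close> says that all squares on the three lines are so small that no other line separates them
  from the point of concurrency, where the deviations have the signs of \<open>c\<close>. Hence every end point that is not
  formed by two of the three lines can be evaluated there. If the edge on \<open>e\<close> does not pass through this
  point (\<open>Be\<close> fails), nothing is counted.\<close>
lemma vertex_event_sum:
  assumes m: "m \<le> n" "3 \<le> m" and lt: "e < m" "f < m" "g < m" "e \<noteq> f" "f \<noteq> g" "e \<noteq> g"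
    and g: "g = nxt m f" and na: "\<not> adjacent m e f" "\<not> adjacent m g e"
    and D: "area h e f g \<noteq> 0"
    and near: "\<And>\<tau> i j. \<tau> \<in> set (class_representatives e f g) \<Longrightarrow> i < m \<Longrightarrow> i \<notin> {e, f, g} \<Longrightarrow> j < 4 \<Longrightarrow> 0 < c i * dev \<sigma> h i (corner (sol h \<tau>) j)"
  defines "Be \<equiv> c (prv m e) * c (nxt m e) * ((\<sigma> e - \<sigma> (prv m e)) * (\<sigma> e - \<sigma> (nxt m e))) < 0"
    and "a \<equiv> - c (prv m f) * ((\<sigma> f - \<sigma> (prv m f)) * (\<sigma> f - \<sigma> g)) / (\<sigma> f - \<sigma> e)"
    and "b \<equiv> - c (nxt m g) * ((\<sigma> g - \<sigma> f) * (\<sigma> g - \<sigma> (nxt m g))) / (\<sigma> e - \<sigma> g)"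
    and "v \<equiv> c (prv m e) * (\<sigma> e - \<sigma> (prv m e)) / (\<sigma> f - \<sigma> g)"
  shows "sum_list (map (\<lambda>\<tau>. of_bool (\<tau> \<in> tuples m \<and> counted m h \<tau>)) (class_representatives e f g))
    = (if Be then vertex_count a b v (cot f g) (cot g e) (cot e f) (area h e f g) else 0)"
proof -
  have ltn: "e < n" "f < n" "g < n" using lt m by auto
  have adj: "adjacent m f g" using g by (simp add: adjacent_def)
  have pg: "prv m g = f" using g prv_nxt lt by simp
  have na3: "\<not> adjacent m e f" "\<not> adjacent m f e" "\<not> adjacent m e g" "\<not> adjacent m g e"
    using na adjacent_sym[of m] by blast+
  have "prv m e \<noteq> f" "prv m e \<noteq> g" "nxt m e \<noteq> f" "nxt m e \<noteq> g" "prv m f \<noteq> e" "nxt m g \<noteq> e"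
    using na3 adjacent_nxt[of m e] adjacent_nxt[of m g] adjacent_prv[OF lt(1)] adjacent_prv[OF lt(2)] by auto
  moreover have "prv m e \<noteq> e" "nxt m e \<noteq> e" "prv m f \<noteq> f" "nxt m g \<noteq> g"
    using prv_neq[of m] nxt_neq[of m] m lt by auto
  moreover have "prv m f \<noteq> g" "nxt m g \<noteq> f" using prv_neq_nxt[OF m(2) lt(2)] prv_neq_nxt[OF m(2) lt(3)] g pg by auto
  ultimately have out: "prv m e \<notin> {e, f, g}" "nxt m e \<notin> {e, f, g}" "prv m f \<notin> {e, f, g}" "nxt m g \<notin> {e, f, g}" by auto
  have ltm: "prv m e < m" "nxt m e < m" "prv m f < m" "nxt m g < m"
    using lt by (simp_all add: nxt_less prv_less)
  have ne: "\<sigma> f - \<sigma> e \<noteq> 0" "\<sigma> e - \<sigma> g \<noteq> 0" "\<sigma> f - \<sigma> g \<noteq> 0"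
    using slopes_distinct[of f e] slopes_distinct[of e g] slopes_distinct[of f g] ltn lt by auto
  define ph where "ph = - c (prv m f) * ((\<sigma> f - \<sigma> (prv m f)) * (\<sigma> f - \<sigma> g))"
  define pg' where "pg' = - c (nxt m g) * ((\<sigma> g - \<sigma> f) * (\<sigma> g - \<sigma> (nxt m g)))"
  have a: "a * ((\<sigma> f - \<sigma> e) * y) = ph * y" and b: "b * ((\<sigma> e - \<sigma> g) * y) = pg' * y" for y
    using ne by (simp_all add: a_def b_def ph_def pg'_def)
  define Q where "Q i p \<longleftrightarrow> (if i = e then True else if i = f then 0 < a * ((\<sigma> f - \<sigma> e) * dev \<sigma> h g p)
      else 0 < b * ((\<sigma> e - \<sigma> g) * dev \<sigma> h f p))" for i p
  have Q: "Q e p" "Q f p \<longleftrightarrow> 0 < a * ((\<sigma> f - \<sigma> e) * dev \<sigma> h g p)" "Q g p \<longleftrightarrow> 0 < b * ((\<sigma> e - \<sigma> g) * dev \<sigma> h f p)" for p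
    using lt by (auto simp: Q_def)
  have ie: "in_edge m h e p \<longleftrightarrow> Be" if "0 < c (prv m e) * dev \<sigma> h (prv m e) p" "0 < c (nxt m e) * dev \<sigma> h (nxt m e) p" for p
  proof -
    define k where "k = (\<sigma> e - \<sigma> (prv m e)) * (\<sigma> e - \<sigma> (nxt m e))"
    have "in_edge m h e p \<longleftrightarrow> dev \<sigma> h (prv m e) p * (dev \<sigma> h (nxt m e) p * k) < 0"
      by (simp add: in_edge_def k_def mult.assoc)
    also have "\<dots> \<longleftrightarrow> c (prv m e) * (dev \<sigma> h (nxt m e) p * k) < 0" by (rule neg_subst[OF that(1)])
    also have "\<dots> \<longleftrightarrow> dev \<sigma> h (nxt m e) p * (c (prv m e) * k) < 0" by (simp only: mult.left_commute)
    also have "\<dots> \<longleftrightarrow> c (nxt m e) * (c (prv m e) * k) < 0" by (rule neg_subst[OF that(2)])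
    finally show ?thesis by (simp add: Be_def k_def ac_simps)
  qed
  have if': "in_edge m h f p \<longleftrightarrow> 0 < ph * dev \<sigma> h g p" if "0 < c (prv m f) * dev \<sigma> h (prv m f) p" for p
  proof -
    define k where "k = (\<sigma> f - \<sigma> (prv m f)) * (\<sigma> f - \<sigma> g)"
    have "in_edge m h f p \<longleftrightarrow> dev \<sigma> h (prv m f) p * (dev \<sigma> h g p * k) < 0"
      by (simp add: in_edge_def k_def mult.assoc g)
    also have "\<dots> \<longleftrightarrow> c (prv m f) * (dev \<sigma> h g p * k) < 0" by (rule neg_subst[OF that(1)])
    finally show ?thesis unfolding ph_def k_def[symmetric] by (simp add: ac_simps)
  qed
  have ig: "in_edge m h g p \<longleftrightarrow> 0 < pg' * dev \<sigma> h f p" if "0 < c (nxt m g) * dev \<sigma> h (nxt m g) p" for p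
  proof -
    define k where "k = (\<sigma> g - \<sigma> f) * (\<sigma> g - \<sigma> (nxt m g))"
    have "in_edge m h g p \<longleftrightarrow> dev \<sigma> h (nxt m g) p * (dev \<sigma> h f p * k) < 0"
      by (simp add: in_edge_def k_def pg ac_simps)
    also have "\<dots> \<longleftrightarrow> c (nxt m g) * (dev \<sigma> h f p * k) < 0" by (rule neg_subst[OF that(1)])
    finally show ?thesis unfolding pg'_def k_def[symmetric] by (simp add: ac_simps)
  qed
  have edge: "in_edge m h i (corner (sol h \<tau>) j) \<longleftrightarrow> (i = e \<longrightarrow> Be) \<and> Q i (corner (sol h \<tau>) j)"
    if "\<tau> \<in> set (class_representatives e f g)" "j < 4" "i \<in> {e, f, g}" for \<tau> i j
    using that(3) ie[OF near[OF that(1) ltm(1) out(1) that(2)] near[OF that(1) ltm(2) out(2) that(2)]]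
      if'[OF near[OF that(1) ltm(3) out(3) that(2)]] ig[OF near[OF that(1) ltm(4) out(4) that(2)]] Q lt(4-6)
    unfolding a b by auto
  have three_line_patterns: "counted m h \<tau> \<longleftrightarrow> Be \<and> (\<forall>j<4. Q (\<tau> ! j) (corner (sol h \<tau>) j))" if t: "\<tau> \<in> set (three_line_patterns e f g)" for \<tau>
  proof -
    have mem: "\<tau> ! j \<in> {e, f, g}" if "j < 4" for j using pattern_members[OF t] that nth_mem[of j \<tau>] by simp
    have "e \<in> set \<tau>" using pattern_members[OF t] by simp
    then obtain j0 where "j0 < 4" "\<tau> ! j0 = e" using pattern_members[OF t] by (metis in_set_conv_nth)
    moreover have "counted m h \<tau> \<longleftrightarrow> (\<forall>j<4. (\<tau> ! j = e \<longrightarrow> Be) \<and> Q (\<tau> ! j) (corner (sol h \<tau>) j))"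
      using edge[OF pattern_in_classes[OF t] _ mem] pattern_tuples(2)[OF lt t] by (simp add: counted_def)
    ultimately show ?thesis by blast
  qed
  have flat: "corner (sol h [p, q, p, q]) j = fst (sol h [p, q, p, q])" if "p < m" "q < m" "p \<noteq> q" for p q j
    using sol_crossing[of p q h] that m by (simp add: corner_def)
  have inc: "dev \<sigma> h p (fst (sol h [p, q, p, q])) = 0" "dev \<sigma> h q (fst (sol h [p, q, p, q])) = 0" if "p < m" "q < m" "p \<noteq> q" for p q
    using incident_dev[of "[p, q, p, q]" 0 h] incident_dev[of "[p, q, p, q]" 1 h] flat[OF that] that m
    by (simp_all add: solvable_def crossing_def)
  have cnt: "counted m h [p, q, p, q] \<longleftrightarrow> in_edge m h p (fst (sol h [p, q, p, q])) \<and> in_edge m h q (fst (sol h [p, q, p, q]))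
      \<and> travel m h p (fst (sol h [p, q, p, q])) * travel m h q (fst (sol h [p, q, p, q])) * (1 + \<sigma> p * \<sigma> q) < 0"
    if "p < m" "q < m" "p \<noteq> q" for p q
    using that by (auto simp: counted_def all_less_4 flat[OF that] crossing_def)
  have X: "counted m h [e, f, e, f] \<longleftrightarrow> Be \<and> (0 < a * area h e f g \<and> v * (a * cot e f) < 0)"
  proof -
    define O' where "O' = fst (sol h [e, f, e, f])"
    have t: "[e, f, e, f] \<in> set (class_representatives e f g)" by (simp add: class_representatives_def)
    have z: "dev \<sigma> h e O' = 0" "dev \<sigma> h f O' = 0" using inc[of e f] lt by (simp_all add: O'_def)
    have ar: "(\<sigma> f - \<sigma> e) * dev \<sigma> h g O' = area h e f g" using bary_sum[of g f h e O'] z by simp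
    have nr: "0 < c i * dev \<sigma> h i O'" if "i < m" "i \<notin> {e, f, g}" for i
      using near[OF t that, of 0] flat[of e f 0] lt by (simp add: O'_def)
    have f: "in_edge m h f O' \<longleftrightarrow> 0 < a * area h e f g"
      using if'[OF nr[OF ltm(3) out(3)]] a[of "dev \<sigma> h g O'"] ar by simp
    have e: "in_edge m h e O' \<longleftrightarrow> Be" by (rule ie[OF nr[OF ltm(1) out(1)] nr[OF ltm(2) out(2)]])
    have "travel m h e O' * travel m h f O' * (1 + \<sigma> e * \<sigma> f) < 0 \<longleftrightarrow>
        dev \<sigma> h (prv m e) O' * ((\<sigma> e - \<sigma> (prv m e)) * (dev \<sigma> h (prv m f) O' * ((\<sigma> f - \<sigma> (prv m f)) * (1 + \<sigma> e * \<sigma> f)))) < 0"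
      by (simp add: travel_def ac_simps)
    also have "\<dots> \<longleftrightarrow> c (prv m e) * ((\<sigma> e - \<sigma> (prv m e)) * (dev \<sigma> h (prv m f) O' * ((\<sigma> f - \<sigma> (prv m f)) * (1 + \<sigma> e * \<sigma> f)))) < 0"
      by (rule neg_subst[OF nr[OF ltm(1) out(1)]])
    also have "\<dots> \<longleftrightarrow> dev \<sigma> h (prv m f) O' * (c (prv m e) * (\<sigma> e - \<sigma> (prv m e)) * ((\<sigma> f - \<sigma> (prv m f)) * (1 + \<sigma> e * \<sigma> f))) < 0"
      by (simp only: ac_simps)
    also have "\<dots> \<longleftrightarrow> c (prv m f) * (c (prv m e) * (\<sigma> e - \<sigma> (prv m e)) * ((\<sigma> f - \<sigma> (prv m f)) * (1 + \<sigma> e * \<sigma> f))) < 0"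
      by (rule neg_subst[OF nr[OF ltm(3) out(3)]])
    also have "c (prv m f) * (c (prv m e) * (\<sigma> e - \<sigma> (prv m e)) * ((\<sigma> f - \<sigma> (prv m f)) * (1 + \<sigma> e * \<sigma> f)))
        = ((\<sigma> f - \<sigma> e)\<^sup>2) * (v * (a * cot e f))"
    proof -
      have "v * (\<sigma> f - \<sigma> g) = c (prv m e) * (\<sigma> e - \<sigma> (prv m e))"
        "a * (\<sigma> f - \<sigma> e) = - c (prv m f) * ((\<sigma> f - \<sigma> (prv m f)) * (\<sigma> f - \<sigma> g))"
        "cot e f * (\<sigma> f - \<sigma> e) = - (1 + \<sigma> e * \<sigma> f)"
        using ne by (simp_all add: v_def a_def cot_def)
      then show ?thesis unfolding power2_eq_square by algebra
    qed
    also have "\<dots> < 0 \<longleftrightarrow> v * (a * cot e f) < 0"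
    proof -
      have "0 < (\<sigma> f - \<sigma> e)\<^sup>2" using ne(1) by simp
      then show ?thesis by (simp add: mult_less_0_iff)
    qed
    finally show ?thesis using cnt[of e f] lt f e by (simp add: O'_def)
  qed
  have Y: "counted m h [g, e, g, e] \<longleftrightarrow> Be \<and> (0 < b * area h e f g \<and> v * (b * cot g e) < 0)"
  proof -
    define O' where "O' = fst (sol h [g, e, g, e])"
    have t: "[g, e, g, e] \<in> set (class_representatives e f g)" by (simp add: class_representatives_def)
    have z: "dev \<sigma> h e O' = 0" "dev \<sigma> h g O' = 0" using inc[of g e] lt by (simp_all add: O'_def)
    have ar: "(\<sigma> e - \<sigma> g) * dev \<sigma> h f O' = area h e f g" using bary_sum[of g f h e O'] z by simp
    have nr: "0 < c i * dev \<sigma> h i O'" if "i < m" "i \<notin> {e, f, g}" for i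
      using near[OF t that, of 0] flat[of g e 0] lt by (simp add: O'_def)
    have g': "in_edge m h g O' \<longleftrightarrow> 0 < pg' * dev \<sigma> h f O'" by (rule ig[OF nr[OF ltm(4) out(4)]])
    have g2: "0 < pg' * dev \<sigma> h f O' \<longleftrightarrow> 0 < b * area h e f g" using b[of "dev \<sigma> h f O'"] ar by simp
    have e: "in_edge m h e O' \<longleftrightarrow> Be" by (rule ie[OF nr[OF ltm(1) out(1)] nr[OF ltm(2) out(2)]])
    have "travel m h g O' * travel m h e O' * (1 + \<sigma> g * \<sigma> e) < 0 \<longleftrightarrow> v * (b * cot g e) < 0" if pos: "0 < pg' * dev \<sigma> h f O'"
    proof -
      have "travel m h g O' * travel m h e O' * (1 + \<sigma> g * \<sigma> e) < 0 \<longleftrightarrow>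
          dev \<sigma> h (prv m e) O' * ((\<sigma> e - \<sigma> (prv m e)) * (dev \<sigma> h f O' * ((\<sigma> g - \<sigma> f) * (1 + \<sigma> g * \<sigma> e)))) < 0"
        by (simp add: travel_def pg ac_simps)
      also have "\<dots> \<longleftrightarrow> c (prv m e) * ((\<sigma> e - \<sigma> (prv m e)) * (dev \<sigma> h f O' * ((\<sigma> g - \<sigma> f) * (1 + \<sigma> g * \<sigma> e)))) < 0"
        by (rule neg_subst[OF nr[OF ltm(1) out(1)]])
      also have "\<dots> \<longleftrightarrow> dev \<sigma> h f O' * (c (prv m e) * (\<sigma> e - \<sigma> (prv m e)) * ((\<sigma> g - \<sigma> f) * (1 + \<sigma> g * \<sigma> e))) < 0"
        by (simp only: ac_simps)
      also have "\<dots> \<longleftrightarrow> pg' * (c (prv m e) * (\<sigma> e - \<sigma> (prv m e)) * ((\<sigma> g - \<sigma> f) * (1 + \<sigma> g * \<sigma> e))) < 0"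
        by (rule neg_subst[OF pos])
      also have "pg' * (c (prv m e) * (\<sigma> e - \<sigma> (prv m e)) * ((\<sigma> g - \<sigma> f) * (1 + \<sigma> g * \<sigma> e)))
          = (((\<sigma> e - \<sigma> g) * (\<sigma> f - \<sigma> g))\<^sup>2) * (v * (b * cot g e))"
      proof -
        have "v * (\<sigma> f - \<sigma> g) = c (prv m e) * (\<sigma> e - \<sigma> (prv m e))" "b * (\<sigma> e - \<sigma> g) = pg'"
          "cot g e * (\<sigma> e - \<sigma> g) = - (1 + \<sigma> g * \<sigma> e)"
          using ne by (simp_all add: v_def b_def pg'_def cot_def)
        then show ?thesis unfolding power2_eq_square by algebra
      qed
      also have "\<dots> < 0 \<longleftrightarrow> v * (b * cot g e) < 0"
      proof -
        have "0 < ((\<sigma> e - \<sigma> g) * (\<sigma> f - \<sigma> g))\<^sup>2" using ne by simp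
        then show ?thesis by (simp add: mult_less_0_iff)
      qed
      finally show ?thesis .
    qed
    then show ?thesis using cnt[of g e] lt g' g2 e by (auto simp: O'_def)
  qed
  have na': "\<not> adjacent m e f" "\<not> adjacent m g e" "adjacent m f g" using na adj by auto
  have "sum_list (map (\<lambda>\<tau>. of_bool (\<tau> \<in> tuples m \<and> counted m h \<tau>)) (class_representatives e f g))
      = sum_list (map (\<lambda>\<tau>. of_bool (counted m h \<tau>)) (three_line_patterns e f g)) + of_bool (counted m h [e, f, e, f]) + (of_bool (counted m h [g, e, g, e]) :: nat)"
    unfolding sum_class_representatives[OF lt] using na' by simp
  also have "\<dots> = (if Be then vertex_count a b v (cot f g) (cot g e) (cot e f) (area h e f g) else 0)"
  proof (cases Be)
    case True
    show ?thesis using vertex_count_eq[OF ltn lt(4-6) D Q, of "counted m h" "counted m h [e, f, e, f]" v "counted m h [g, e, g, e]"] three_line_patterns X Y True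
      by simp
  next
    case False
    have "map (\<lambda>\<tau>. of_bool (counted m h \<tau>) :: nat) (three_line_patterns e f g) = map (\<lambda>_. 0) (three_line_patterns e f g)" using three_line_patterns False by simp
    then show ?thesis using X Y False by (simp add: three_line_patterns_def)
  qed
  finally show ?thesis .
qed

text \<open>The same localisation for three consecutive edges. Since the middle one shrinks, both of its
  end points belong to the small triangle.\<close>
lemma short_edge_event_sum:
  assumes m: "m \<le> n" "3 \<le> m" and lt: "f < m" "s < m" "g < m" "f \<noteq> s" "s \<noteq> g" "f \<noteq> g"
    and s: "s = nxt m f" and g: "g = nxt m s" and na: "\<not> adjacent m f g"
    and D: "area h f s g \<noteq> 0"
    and near: "\<And>\<tau> i j. \<tau> \<in> set (class_representatives f s g) \<Longrightarrow> i < m \<Longrightarrow> i \<notin> {f, s, g} \<Longrightarrow> j < 4 \<Longrightarrow> 0 < c i * dev \<sigma> h i (corner (sol h \<tau>) j)"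
  shows "even (sum_list (map (\<lambda>\<tau>. of_bool (\<tau> \<in> tuples m \<and> counted m h \<tau>)) (class_representatives f s g)) :: nat)"
proof -
  have ltn: "f < n" "s < n" "g < n" using lt m by auto
  have na3: "\<not> adjacent m f g" "\<not> adjacent m g f" using na adjacent_sym[of m] by blast+
  have adj: "adjacent m f s" "adjacent m s g" using s g by (simp_all add: adjacent_def)
  have ps: "prv m s = f" and pg: "prv m g = s" using s g prv_nxt lt by auto
  have "prv m f \<noteq> g" "nxt m g \<noteq> f" using na3 adjacent_nxt[of m g] adjacent_prv[OF lt(1)] by auto
  moreover have "prv m f \<noteq> f" "nxt m g \<noteq> g" using prv_neq[of m] nxt_neq[of m] m lt by auto
  moreover have "prv m f \<noteq> s" "nxt m g \<noteq> s" using prv_neq_nxt[OF m(2) lt(1)] prv_neq_nxt[OF m(2) lt(3)] s pg by auto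
  ultimately have out: "prv m f \<notin> {f, s, g}" "nxt m g \<notin> {f, s, g}" by auto
  have ltm: "prv m f < m" "nxt m g < m" using lt by (simp_all add: nxt_less prv_less)
  have ne: "\<sigma> f - \<sigma> g \<noteq> 0" "\<sigma> g - \<sigma> s \<noteq> 0" "\<sigma> s - \<sigma> f \<noteq> 0" "\<sigma> f - \<sigma> s \<noteq> 0"
    using slopes_distinct[of f g] slopes_distinct[of s g] slopes_distinct[of s f] ltn lt by auto
  define ph where "ph = - c (prv m f) * ((\<sigma> f - \<sigma> (prv m f)) * (\<sigma> f - \<sigma> s))"
  define pg' where "pg' = - c (nxt m g) * ((\<sigma> g - \<sigma> s) * (\<sigma> g - \<sigma> (nxt m g)))"
  define a b where "a = ph / (\<sigma> f - \<sigma> g)" and "b = pg' / (\<sigma> f - \<sigma> g)"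
  have a: "a * ((\<sigma> f - \<sigma> g) * y) = ph * y" and b: "b * ((\<sigma> f - \<sigma> g) * y) = pg' * y" for y
    using ne by (simp_all add: a_def b_def)
  define Q where "Q i p \<longleftrightarrow> (if i = f then 0 < a * ((\<sigma> f - \<sigma> g) * dev \<sigma> h s p)
      else if i = g then 0 < b * ((\<sigma> f - \<sigma> g) * dev \<sigma> h s p)
      else 0 < ((\<sigma> g - \<sigma> s) * dev \<sigma> h f p) * ((\<sigma> s - \<sigma> f) * dev \<sigma> h g p))" for i p
  have Q: "Q f p \<longleftrightarrow> 0 < a * ((\<sigma> f - \<sigma> g) * dev \<sigma> h s p)" "Q g p \<longleftrightarrow> 0 < b * ((\<sigma> f - \<sigma> g) * dev \<sigma> h s p)"
    "Q s p \<longleftrightarrow> 0 < ((\<sigma> g - \<sigma> s) * dev \<sigma> h f p) * ((\<sigma> s - \<sigma> f) * dev \<sigma> h g p)" for p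
    using lt by (auto simp: Q_def)
  have if': "in_edge m h f p \<longleftrightarrow> 0 < ph * dev \<sigma> h s p" if "0 < c (prv m f) * dev \<sigma> h (prv m f) p" for p
  proof -
    define k where "k = (\<sigma> f - \<sigma> (prv m f)) * (\<sigma> f - \<sigma> s)"
    have "in_edge m h f p \<longleftrightarrow> dev \<sigma> h (prv m f) p * (dev \<sigma> h s p * k) < 0"
      by (simp add: in_edge_def k_def mult.assoc s)
    also have "\<dots> \<longleftrightarrow> c (prv m f) * (dev \<sigma> h s p * k) < 0" by (rule neg_subst[OF that(1)])
    finally show ?thesis unfolding ph_def k_def[symmetric] by (simp add: ac_simps)
  qed
  have ig: "in_edge m h g p \<longleftrightarrow> 0 < pg' * dev \<sigma> h s p" if "0 < c (nxt m g) * dev \<sigma> h (nxt m g) p" for p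
  proof -
    define k where "k = (\<sigma> g - \<sigma> s) * (\<sigma> g - \<sigma> (nxt m g))"
    have "in_edge m h g p \<longleftrightarrow> dev \<sigma> h (nxt m g) p * (dev \<sigma> h s p * k) < 0"
      by (simp add: in_edge_def k_def pg ac_simps)
    also have "\<dots> \<longleftrightarrow> c (nxt m g) * (dev \<sigma> h s p * k) < 0" by (rule neg_subst[OF that(1)])
    finally show ?thesis unfolding pg'_def k_def[symmetric] by (simp add: ac_simps)
  qed
  have iS: "in_edge m h s p \<longleftrightarrow> Q s p" for p
  proof -
    have n: "X < 0 \<longleftrightarrow> 0 < Y" if "Y = - X" for X Y :: real using that by simp
    show ?thesis unfolding in_edge_def Q(3) ps g[symmetric] by (rule n) algebra
  qed
  have edge: "in_edge m h i (corner (sol h \<tau>) j) \<longleftrightarrow> Q i (corner (sol h \<tau>) j)"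
    if "\<tau> \<in> set (class_representatives f s g)" "j < 4" "i \<in> {f, s, g}" for \<tau> i j
    using that(3) if'[OF near[OF that(1) ltm(1) out(1) that(2)]] ig[OF near[OF that(1) ltm(2) out(2) that(2)]] Q(1,2) iS
    unfolding a b by auto
  have three_line_patterns: "counted m h \<tau> \<longleftrightarrow> (\<forall>j<4. Q (\<tau> ! j) (corner (sol h \<tau>) j))" if t: "\<tau> \<in> set (three_line_patterns f s g)" for \<tau>
  proof -
    have mem: "\<tau> ! j \<in> {f, s, g}" if "j < 4" for j using pattern_members[OF t] that nth_mem[of j \<tau>] by simp
    show ?thesis
      using edge[OF pattern_in_classes[OF t] _ mem] pattern_tuples(2)[OF lt t] by (simp add: counted_def)
  qed
  have X: "counted m h [g, f, g, f] \<longleftrightarrow> 0 < a * area h f s g \<and> 0 < b * area h f s g \<and> cot s g * cot f s < 1"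
  proof -
    define O' where "O' = fst (sol h [g, f, g, f])"
    have sv: "solvable [g, f, g, f]" using lt ltn by (simp add: solvable_def crossing_def)
    have flat: "corner (sol h [g, f, g, f]) j = O'" for j
      using sol_crossing[of g f h] ltn lt by (simp add: corner_def O'_def)
    have t: "[g, f, g, f] \<in> set (class_representatives f s g)" by (simp add: class_representatives_def)
    have z: "dev \<sigma> h g O' = 0" "dev \<sigma> h f O' = 0"
      using incident_dev[OF sv, of 0 h] incident_dev[OF sv, of 1 h] by (simp_all add: flat)
    have ar: "(\<sigma> f - \<sigma> g) * dev \<sigma> h s O' = area h f s g" using bary_sum[of g s h f O'] z by simp
    have nr: "0 < c i * dev \<sigma> h i O'" if "i < m" "i \<notin> {f, s, g}" for i
      using near[OF t that, of 0] flat by simp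
    have f: "in_edge m h f O' \<longleftrightarrow> 0 < ph * dev \<sigma> h s O'" by (rule if'[OF nr[OF ltm(1) out(1)]])
    have g': "in_edge m h g O' \<longleftrightarrow> 0 < pg' * dev \<sigma> h s O'" by (rule ig[OF nr[OF ltm(2) out(2)]])
    have fg: "0 < ph * dev \<sigma> h s O' \<longleftrightarrow> 0 < a * area h f s g" "0 < pg' * dev \<sigma> h s O' \<longleftrightarrow> 0 < b * area h f s g"
      using a[of "dev \<sigma> h s O'"] b[of "dev \<sigma> h s O'"] ar by simp_all
    have "travel m h g O' * travel m h f O' * (1 + \<sigma> g * \<sigma> f) < 0 \<longleftrightarrow> cot s g * cot f s < 1"
      if p1: "0 < ph * dev \<sigma> h s O'" and p2: "0 < pg' * dev \<sigma> h s O'"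
    proof -
      have "0 < (ph * dev \<sigma> h s O') * (pg' * dev \<sigma> h s O')" using p1 p2 by simp
      also have "\<dots> = (dev \<sigma> h s O')\<^sup>2 * (pg' * ph)" by (simp add: power2_eq_square)
      finally have pp: "0 < pg' * ph" by (simp add: zero_less_mult_iff)
      have "travel m h g O' * travel m h f O' * (1 + \<sigma> g * \<sigma> f) < 0 \<longleftrightarrow>
          dev \<sigma> h (prv m f) O' * ((\<sigma> f - \<sigma> (prv m f)) * (dev \<sigma> h s O' * ((\<sigma> g - \<sigma> s) * (1 + \<sigma> g * \<sigma> f)))) < 0"
        by (simp add: travel_def pg ac_simps)
      also have "\<dots> \<longleftrightarrow> c (prv m f) * ((\<sigma> f - \<sigma> (prv m f)) * (dev \<sigma> h s O' * ((\<sigma> g - \<sigma> s) * (1 + \<sigma> g * \<sigma> f)))) < 0"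
        by (rule neg_subst[OF nr[OF ltm(1) out(1)]])
      also have "\<dots> \<longleftrightarrow> dev \<sigma> h s O' * (c (prv m f) * (\<sigma> f - \<sigma> (prv m f)) * ((\<sigma> g - \<sigma> s) * (1 + \<sigma> g * \<sigma> f))) < 0"
        by (simp only: ac_simps)
      also have "\<dots> \<longleftrightarrow> pg' * (c (prv m f) * (\<sigma> f - \<sigma> (prv m f)) * ((\<sigma> g - \<sigma> s) * (1 + \<sigma> g * \<sigma> f))) < 0"
        by (rule neg_subst[OF p2])
      finally have 1: "travel m h g O' * travel m h f O' * (1 + \<sigma> g * \<sigma> f) < 0 \<longleftrightarrow>
        pg' * (c (prv m f) * (\<sigma> f - \<sigma> (prv m f)) * ((\<sigma> g - \<sigma> s) * (1 + \<sigma> g * \<sigma> f))) < 0" .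
      have "cot s g * (\<sigma> g - \<sigma> s) = - (1 + \<sigma> s * \<sigma> g)" "cot f s * (\<sigma> s - \<sigma> f) = - (1 + \<sigma> f * \<sigma> s)"
        using ne by (simp_all add: cot_def)
      then have 2: "(1 - cot s g * cot f s) * ((\<sigma> g - \<sigma> s) * (\<sigma> f - \<sigma> s)) = (1 + (\<sigma> s)\<^sup>2) * (1 + \<sigma> g * \<sigma> f)"
        unfolding power2_eq_square by algebra
      have "(\<sigma> f - \<sigma> s)\<^sup>2 * ((1 + (\<sigma> s)\<^sup>2) * (pg' * (c (prv m f) * (\<sigma> f - \<sigma> (prv m f)) * ((\<sigma> g - \<sigma> s) * (1 + \<sigma> g * \<sigma> f)))))
         = ((\<sigma> f - \<sigma> s) * (\<sigma> g - \<sigma> s))\<^sup>2 * ((pg' * ph) * (cot s g * cot f s - 1))"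
        using 2 unfolding ph_def power2_eq_square by algebra
      moreover have "0 < (\<sigma> f - \<sigma> s)\<^sup>2" "0 < 1 + (\<sigma> s)\<^sup>2" "0 < ((\<sigma> f - \<sigma> s) * (\<sigma> g - \<sigma> s))\<^sup>2"
        using ne by (simp_all add: add_pos_nonneg)
      moreover have "K * (L * X) < 0 \<longleftrightarrow> X < 0" if "0 < K" "0 < L" for K L X :: real using that by (simp add: mult_less_0_iff)
      moreover have "K * X < 0 \<longleftrightarrow> X < 0" if "0 < K" for K X :: real using that by (simp add: mult_less_0_iff)
      ultimately have "pg' * (c (prv m f) * (\<sigma> f - \<sigma> (prv m f)) * ((\<sigma> g - \<sigma> s) * (1 + \<sigma> g * \<sigma> f))) < 0 \<longleftrightarrow> cot s g * cot f s - 1 < 0"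
        using pp by metis
      then show ?thesis using 1 by simp
    qed
    moreover have "counted m h [g, f, g, f] \<longleftrightarrow> in_edge m h g O' \<and> in_edge m h f O' \<and> travel m h g O' * travel m h f O' * (1 + \<sigma> g * \<sigma> f) < 0"
      using lt by (auto simp: counted_def all_less_4 flat crossing_def O'_def[symmetric])
    ultimately show ?thesis using f g' fg by blast
  qed
  have na': "\<not> adjacent m g f" "adjacent m f s" "adjacent m s g" using na3 adj by auto
  have "sum_list (map (\<lambda>\<tau>. of_bool (\<tau> \<in> tuples m \<and> counted m h \<tau>)) (class_representatives f s g))
      = sum_list (map (\<lambda>\<tau>. of_bool (counted m h \<tau>)) (three_line_patterns f s g)) + (of_bool (counted m h [g, f, g, f]) :: nat)"
    unfolding sum_class_representatives[OF lt] using na' by simp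
  also have "\<dots> = short_edge_count (a * area h f s g) (b * area h f s g) (cot s g) (cot g f) (cot f s)"
    by (rule short_edge_count_eq[OF ltn lt(4-6) D Q(1) Q(2) Q(3) three_line_patterns X])
  finally have eq: "sum_list (map (\<lambda>\<tau>. of_bool (\<tau> \<in> tuples m \<and> counted m h \<tau>)) (class_representatives f s g))
      = short_edge_count (a * area h f s g) (b * area h f s g) (cot s g) (cot g f) (cot f s)" .
  have ne': "s \<noteq> f" "g \<noteq> s" "g \<noteq> f" using lt by auto
  have ac: "area h s g f = area h f s g" "area h g f s = area h f s g" by (simp_all add: area_def)
  then have D': "area h s g f \<noteq> 0" "area h g f s \<noteq> 0" using D by simp_all
  have t0: "[f, f, s, g] \<in> set (class_representatives f s g)" by (simp add: class_representatives_def three_line_patterns_def)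
  have "c (prv m f) \<noteq> 0" "c (nxt m g) \<noteq> 0"
    using near[OF t0 ltm(1) out(1), of 0] near[OF t0 ltm(2) out(2), of 0] by auto
  moreover have "\<sigma> f \<noteq> \<sigma> (prv m f)" "\<sigma> g \<noteq> \<sigma> (nxt m g)"
    using slopes_distinct[of f "prv m f"] slopes_distinct[of g "nxt m g"] ltn ltm m out by auto
  ultimately have ab: "a * area h f s g \<noteq> 0" "b * area h f s g \<noteq> 0"
    using D ne by (simp_all add: a_def b_def ph_def pg'_def)
  show ?thesis unfolding eq
    by (rule short_edge_count_even[OF ab])
      (use cot_nonzero cot_not_one cot_not_minus_one ltn lt ne' corners_xxyz(1)[OF ltn lt(4-6) D]
        corners_xxzy(1)[OF ltn lt(4-6) D] corners_xyxz(1)[OF ltn lt(4-6) D]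
        corners_xxyz(1)[OF ltn(2,3,1) lt(5) ne'(3) ne'(1) D'(1)] corners_xxzy(1)[OF ltn(2,3,1) lt(5) ne'(3) ne'(1) D'(1)]
        corners_xyxz(1)[OF ltn(2,3,1) lt(5) ne'(3) ne'(1) D'(1)]
        corners_xxyz(1)[OF ltn(3,1,2) ne'(3) lt(4) ne'(2) D'(2)] corners_xxzy(1)[OF ltn(3,1,2) ne'(3) lt(4) ne'(2) D'(2)]
        corners_xyxz(1)[OF ltn(3,1,2) ne'(3) lt(4) ne'(2) D'(2)] cot_identity[OF ltn lt(4-6)]
        in \<open>simp_all add: ac_simps\<close>)
qed

lemma vertex_event_even:
  assumes ltn: "e < n" "f < n" "g < n" "e \<noteq> f" "f \<noteq> g" "e \<noteq> g" and D: "area h e f g \<noteq> 0"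
    and nz: "a \<noteq> 0" "b \<noteq> 0" "v \<noteq> 0"
  shows "even (vertex_count a b v (cot f g) (cot g e) (cot e f) D' + vertex_count a b v (cot f g) (cot g e) (cot e f) (- D'))"
proof (cases "D' = 0")
  case False
  have ne: "f \<noteq> e" "g \<noteq> f" "g \<noteq> e" using ltn by auto
  have ac: "area h f g e = area h e f g" "area h g e f = area h e f g" by (simp_all add: area_def)
  then have D'': "area h f g e \<noteq> 0" "area h g e f \<noteq> 0" using D by simp_all
  show ?thesis
    by (rule vertex_count_even[OF nz False])
      (use cot_nonzero cot_not_one cot_not_minus_one ltn ne corners_xxyz(1)[OF ltn D]
        corners_xxzy(1)[OF ltn D] corners_xyxz(1)[OF ltn D]
        corners_xxyz(1)[OF ltn(2,3,1,5) ne(3) ne(1) D''(1)] corners_xxzy(1)[OF ltn(2,3,1,5) ne(3) ne(1) D''(1)]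
        corners_xyxz(1)[OF ltn(2,3,1,5) ne(3) ne(1) D''(1)]
        corners_xxyz(1)[OF ltn(3,1,2) ne(3) ltn(4) ne(2) D''(2)] corners_xxzy(1)[OF ltn(3,1,2) ne(3) ltn(4) ne(2) D''(2)]
        corners_xyxz(1)[OF ltn(3,1,2) ne(3) ltn(4) ne(2) D''(2)] cot_identity[OF ltn]
        in \<open>simp_all add: ac_simps\<close>)
qed simp

end

section \<open>Moving one line parallel to itself\<close>

lemma nxt3_neq: "4 \<le> m \<Longrightarrow> i < m \<Longrightarrow> nxt m (nxt m (nxt m i)) \<noteq> i"
  by (auto simp: nxt_def split: if_splits)

lemma consecutive_not_adjacent:
  assumes "4 \<le> m" "f < m"
  shows "\<not> adjacent m f (nxt m (nxt m f))"
proof -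
  have "nxt m f \<noteq> nxt m (nxt m f)" using nxt_neq[of m "nxt m f"] assms by auto
  then show ?thesis using nxt3_neq[OF assms] by (auto simp: adjacent_def)
qed

text \<open>The possible positions of three concurrent lines in a polygon with at least four edges: no two consecutive, exactly two consecutive, or three
  consecutive.\<close>
lemma triple_adjacency_cases:
  assumes m: "4 \<le> m" and lt: "x < m" "y < m" "z < m" "x \<noteq> y" "y \<noteq> z" "x \<noteq> z"
  obtains "\<And>i j. i \<in> {x, y, z} \<Longrightarrow> j \<in> {x, y, z} \<Longrightarrow> i \<noteq> j \<Longrightarrow> \<not> adjacent m i j"
  | e f g where "{e, f, g} = {x, y, z}" "e \<noteq> f" "f \<noteq> g" "e \<noteq> g" "g = nxt m f" "\<not> adjacent m e f" "\<not> adjacent m g e"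
  | f s g where "{f, s, g} = {x, y, z}" "f \<noteq> s" "s \<noteq> g" "f \<noteq> g" "s = nxt m f" "g = nxt m s" "\<not> adjacent m f g"
proof (cases "\<forall>i\<in>{x, y, z}. \<forall>j\<in>{x, y, z}. i \<noteq> j \<longrightarrow> \<not> adjacent m i j")
  case True
  then show ?thesis using that(1) by blast
next
  case False
  then obtain i j where ij: "i \<in> {x, y, z}" "j \<in> {x, y, z}" "i \<noteq> j" "adjacent m i j" by blast
  obtain f g where fg: "{f, g} = {i, j}" "g = nxt m f"
    using ij(4) unfolding adjacent_def by (elim disjE) (blast, metis insert_commute)
  then have fgm: "f \<in> {x, y, z}" "g \<in> {x, y, z}" "f \<noteq> g" using ij by (auto simp: doubleton_eq_iff)
  then obtain e where e: "{e, f, g} = {x, y, z}" "e \<noteq> f" "e \<noteq> g" using lt(4-6) by auto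
  have ltm: "e < m" "f < m" "g < m" using e(1) lt(1-3) by auto
  show ?thesis
  proof (cases "adjacent m e f")
    case True
    then have ef: "f = nxt m e" using e fg by (auto simp: adjacent_def)
    have "\<not> adjacent m e g" using consecutive_not_adjacent[OF m ltm(1)] ef fg(2) by simp
    then show ?thesis by (rule that(3)[OF e(1) e(2) fgm(3) e(3) ef fg(2)])
  next
    case na: False
    show ?thesis
    proof (cases "adjacent m g e")
      case True
      then have ge: "e = nxt m g" using e fg prv_nxt[OF ltm(1)] prv_nxt[OF ltm(2)] by (auto simp: adjacent_def)
      have "\<not> adjacent m f e" using na adjacent_sym by blast
      moreover have "{f, g, e} = {x, y, z}" using e(1) by (simp add: insert_commute)
      ultimately show ?thesis using that(3)[OF _ fgm(3) e(3)[symmetric] e(2)[symmetric] fg(2) ge] by blast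
    next
      case False
      then show ?thesis by (rule that(2)[OF e(1) e(2) fgm(3) e(3) fg(2) na])
    qed
  qed
qed

lemma tuples_nth: "\<tau> \<in> tuples m \<Longrightarrow> j < 4 \<Longrightarrow> \<tau> ! j < m"
proof -
  assume t: "\<tau> \<in> tuples m" and j: "j < 4"
  then have "\<tau> ! j \<in> set \<tau>" "set \<tau> \<subseteq> {..<m}" by (simp_all add: tuples_def)
  then show ?thesis by blast
qed

lemma tuples_length: "\<tau> \<in> tuples m \<Longrightarrow> length \<tau> = 4"
  by (simp add: tuples_def)

text \<open>The line \<open>M\<close> moves through its parallels, \<open>t0\<close> is the instant under investigation, and \<open>h\<close> is a generic reference
  position.\<close>
locale sweep = slopes +
  fixes m M :: nat and h :: "nat \<Rightarrow> real" and t0 :: real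
  assumes m: "m \<le> n" "4 \<le> m" and M: "M < m" and generic: "generic h"
begin

definition H :: "real \<Rightarrow> nat \<Rightarrow> real" where "H t = h(M := t)"

abbreviation Z :: "nat list \<Rightarrow> complex \<times> complex" where "Z \<tau> \<equiv> sol (H t0) \<tau>"

lemma H_self: "H (h M) = h" by (simp add: H_def)

lemma dev_H: "i \<noteq> M \<Longrightarrow> dev \<sigma> (H t) i p = dev \<sigma> h i p"
  by (simp add: H_def dev_def)

lemma solv: "\<tau> \<in> tuples m \<Longrightarrow> solvable \<tau>" using tuples_solvable m by blast

lemma dev_affine:
  assumes "solvable \<tau>"
  obtains \<alpha> \<beta> where "\<And>t. dev \<sigma> (H t) k (corner (sol (H t) \<tau>) j) = \<alpha> + \<beta> * t"
proof -
  obtain A B where AB: "\<And>t. sol (h(M := t)) \<tau> = A + t *\<^sub>R B" using sol_affine[OF assms] by blast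
  have "dev \<sigma> (H t) k (corner (sol (H t) \<tau>) j) = (lin \<sigma> j k A - (if k = M then 0 else h k)) + (lin \<sigma> j k B - (if k = M then 1 else 0)) * t" for t
    unfolding dev_corner H_def AB lin_add lin_scaleR by (simp add: algebra_simps)
  then show ?thesis by (rule that)
qed

text \<open>Deviations that are nonzero at \<open>t0\<close> keep their sign nearby, simultaneously for all corners and lines.\<close>
lemma near_sgn:
  assumes "solvable \<tau>"
  shows "\<forall>\<^sub>F t in nhds t0. \<forall>j\<in>{..<4}. \<forall>k\<in>{..<m}. dev \<sigma> (H t0) k (corner (Z \<tau>) j) \<noteq> 0 \<longrightarrow>
    sgn (dev \<sigma> (H t) k (corner (sol (H t) \<tau>) j)) = sgn (dev \<sigma> (H t0) k (corner (Z \<tau>) j))"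
proof (intro eventually_ball_finite ballI)
  fix j k :: nat
  obtain \<alpha> \<beta> where f: "\<And>t. dev \<sigma> (H t) k (corner (sol (H t) \<tau>) j) = \<alpha> + \<beta> * t"
    using dev_affine[OF assms] by blast
  have c: "((\<lambda>t. \<alpha> + \<beta> * t) \<longlongrightarrow> \<alpha> + \<beta> * t0) (nhds t0)" by (intro tendsto_intros) (rule filterlim_ident)
  consider "\<alpha> + \<beta> * t0 = 0" | "\<alpha> + \<beta> * t0 > 0" | "\<alpha> + \<beta> * t0 < 0" by linarith
  then show "\<forall>\<^sub>F t in nhds t0. dev \<sigma> (H t0) k (corner (Z \<tau>) j) \<noteq> 0 \<longrightarrow>
    sgn (dev \<sigma> (H t) k (corner (sol (H t) \<tau>) j)) = sgn (dev \<sigma> (H t0) k (corner (Z \<tau>) j))"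
    unfolding f
  proof cases
    case 2 show "\<forall>\<^sub>F t in nhds t0. \<alpha> + \<beta> * t0 \<noteq> 0 \<longrightarrow> sgn (\<alpha> + \<beta> * t) = sgn (\<alpha> + \<beta> * t0)"
      using order_tendstoD(1)[OF c 2] by eventually_elim (use 2 in simp)
  next
    case 3 show "\<forall>\<^sub>F t in nhds t0. \<alpha> + \<beta> * t0 \<noteq> 0 \<longrightarrow> sgn (\<alpha> + \<beta> * t) = sgn (\<alpha> + \<beta> * t0)"
      using order_tendstoD(2)[OF c 3] by eventually_elim (use 3 in simp)
  qed simp
qed simp_all

lemma sgn_eventually_constant:
  fixes \<alpha> \<beta> :: real
  shows "\<exists>r. \<forall>\<^sub>F t in at_right t0. sgn (\<alpha> + \<beta> * t) = r" "\<exists>r. \<forall>\<^sub>F t in at_left t0. sgn (\<alpha> + \<beta> * t) = r"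
proof -
  have c: "((\<lambda>t. \<alpha> + \<beta> * t) \<longlongrightarrow> \<alpha> + \<beta> * t0) (at t0 within S)" for S by (intro tendsto_intros)
  have pm: "\<exists>r. \<forall>\<^sub>F t in at t0 within S. sgn (\<alpha> + \<beta> * t) = r" if "\<alpha> + \<beta> * t0 \<noteq> 0" for S
  proof (cases "\<alpha> + \<beta> * t0 > 0")
    case True
    have "\<forall>\<^sub>F t in at t0 within S. sgn (\<alpha> + \<beta> * t) = 1"
      using order_tendstoD(1)[OF c True] by eventually_elim simp
    then show ?thesis by blast
  next
    case False
    have "\<forall>\<^sub>F t in at t0 within S. sgn (\<alpha> + \<beta> * t) = -1"
    proof -
      have "\<alpha> + \<beta> * t0 < 0" using False that by simp
      from order_tendstoD(2)[OF c this] show ?thesis by eventually_elim simp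
    qed
    then show ?thesis by blast
  qed
  have z: "\<alpha> + \<beta> * t = \<beta> * (t - t0)" if "\<alpha> + \<beta> * t0 = 0" for t using that by (simp add: algebra_simps)
  show "\<exists>r. \<forall>\<^sub>F t in at_right t0. sgn (\<alpha> + \<beta> * t) = r"
  proof (cases "\<alpha> + \<beta> * t0 = 0")
    case True
    have "\<forall>\<^sub>F t in at_right t0. sgn (\<alpha> + \<beta> * t) = sgn \<beta>"
      unfolding z[OF True] using eventually_at_right_less[of t0] by eventually_elim (simp add: sgn_mult)
    then show ?thesis by blast
  qed (rule pm)
  show "\<exists>r. \<forall>\<^sub>F t in at_left t0. sgn (\<alpha> + \<beta> * t) = r"
  proof (cases "\<alpha> + \<beta> * t0 = 0")
    case True
    have "\<forall>\<^sub>F t in at_left t0. t < t0" by (simp add: eventually_at_filter)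
    then have "\<forall>\<^sub>F t in at_left t0. sgn (\<alpha> + \<beta> * t) = - sgn \<beta>"
      unfolding z[OF True] by eventually_elim (simp add: sgn_mult)
    then show ?thesis by blast
  qed (rule pm)
qed

lemma in_edge_sgn:
  "in_edge m h' i p \<longleftrightarrow> sgn (dev \<sigma> h' (prv m i) p) * sgn (dev \<sigma> h' (nxt m i) p) * sgn ((\<sigma> i - \<sigma> (prv m i)) * (\<sigma> i - \<sigma> (nxt m i))) = -1"
  unfolding in_edge_def sgn_mult[symmetric] sgn_1_neg ..

lemma crossing_flat:
  assumes "solvable \<tau>" "crossing \<tau>"
  shows "corner (sol h' \<tau>) j = fst (sol h' \<tau>)"
proof -
  have "length \<tau> = 4" using assms by (simp add: solvable_def)
  then obtain a b where ab: "a \<noteq> b" "\<tau> = [a, b, a, b]" using assms(2) crossing_iff by blast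
  then show ?thesis using sol_crossing[of a b h'] assms(1) by (simp add: solvable_def corner_def)
qed

text \<open>Whether a tuple is counted depends only on the signs of the deviations from the neighbouring lines.\<close>
lemma counted_by_sgn:
  assumes t: "\<tau> \<in> tuples m"
    and eq: "\<And>j k. j < 4 \<Longrightarrow> k < m \<Longrightarrow> k = prv m (\<tau> ! j) \<or> k = nxt m (\<tau> ! j) \<Longrightarrow>
      sgn (dev \<sigma> h1 k (corner (sol h1 \<tau>) j)) = sgn (dev \<sigma> h2 k (corner (sol h2 \<tau>) j))"
  shows "counted m h1 \<tau> \<longleftrightarrow> counted m h2 \<tau>"
proof -
  have lt: "\<tau> ! j < m" if "j < 4" for j using tuples_nth[OF t that] .
  have 1: "in_edge m h1 (\<tau> ! j) (corner (sol h1 \<tau>) j) \<longleftrightarrow> in_edge m h2 (\<tau> ! j) (corner (sol h2 \<tau>) j)" if "j < 4" for j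
    unfolding in_edge_sgn using eq[OF that prv_less[OF lt[OF that]]] eq[OF that nxt_less[OF lt[OF that]]] by simp
  have 2: "travel m h1 (\<tau> ! 0) (fst (sol h1 \<tau>)) * travel m h1 (\<tau> ! 1) (fst (sol h1 \<tau>)) * (1 + \<sigma> (\<tau> ! 0) * \<sigma> (\<tau> ! 1)) < 0 \<longleftrightarrow>
     travel m h2 (\<tau> ! 0) (fst (sol h2 \<tau>)) * travel m h2 (\<tau> ! 1) (fst (sol h2 \<tau>)) * (1 + \<sigma> (\<tau> ! 0) * \<sigma> (\<tau> ! 1)) < 0"
    if c: "crossing \<tau>"
  proof -
    have "sgn (travel m h1 (\<tau> ! j) (fst (sol h1 \<tau>))) = sgn (travel m h2 (\<tau> ! j) (fst (sol h2 \<tau>)))" if "j < 4" for j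
      using eq[OF that prv_less[OF lt[OF that]]] crossing_flat[OF solv[OF t] c] by (simp add: travel_def sgn_mult)
    from this[of 0] this[of 1] show ?thesis
      unfolding sgn_1_neg[symmetric] sgn_mult by simp
  qed
  show ?thesis unfolding counted_def using 1 2 by blast
qed

lemma counted_eventually_constant:
  assumes t: "\<tau> \<in> tuples m"
  shows "\<exists>b. \<forall>\<^sub>F t in at_right t0. counted m (H t) \<tau> = b" "\<exists>b. \<forall>\<^sub>F t in at_left t0. counted m (H t) \<tau> = b"
proof -
  have *: "\<exists>b. \<forall>\<^sub>F t in F. counted m (H t) \<tau> = b"
    if F: "\<And>\<alpha> \<beta> :: real. \<exists>r. \<forall>\<^sub>F t in F. sgn (\<alpha> + \<beta> * t) = r" for F
  proof -
    have "\<exists>r. \<forall>\<^sub>F t in F. sgn (dev \<sigma> (H t) k (corner (sol (H t) \<tau>) j)) = r" for j k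
      by (rule dev_affine[OF solv[OF t], of k j]) (use F in simp)
    then have "\<forall>j k. \<exists>r. \<forall>\<^sub>F t in F. sgn (dev \<sigma> (H t) k (corner (sol (H t) \<tau>) j)) = r" by blast
    then obtain r where r: "\<And>j k. \<forall>\<^sub>F t in F. sgn (dev \<sigma> (H t) k (corner (sol (H t) \<tau>) j)) = r j k"
      unfolding choice_iff by blast
    then have ev: "\<forall>\<^sub>F t in F. \<forall>j\<in>{..<4}. \<forall>k\<in>{..<m}. sgn (dev \<sigma> (H t) k (corner (sol (H t) \<tau>) j)) = r j k"
      by (intro eventually_ball_finite ballI r) simp_all
    define G where "G t \<longleftrightarrow> (\<forall>j\<in>{..<4}. \<forall>k\<in>{..<m}. sgn (dev \<sigma> (H t) k (corner (sol (H t) \<tau>) j)) = r j k)" for t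
    have same: "counted m (H t) \<tau> \<longleftrightarrow> counted m (H t') \<tau>" if "G t" "G t'" for t t'
      by (rule counted_by_sgn[OF t]) (use that in \<open>auto simp: G_def\<close>)
    have "\<forall>\<^sub>F t in F. counted m (H t) \<tau> = (\<exists>t'. G t' \<and> counted m (H t') \<tau>)"
      using ev unfolding G_def[symmetric] by eventually_elim (use same in blast)
    then show ?thesis by blast
  qed
  show "\<exists>b. \<forall>\<^sub>F t in at_right t0. counted m (H t) \<tau> = b" "\<exists>b. \<forall>\<^sub>F t in at_left t0. counted m (H t) \<tau> = b"
    by (rule *[OF sgn_eventually_constant(1)], rule *[OF sgn_eventually_constant(2)])
qed

text \<open>The incidences at \<open>t0\<close> that may change the status of \<open>\<tau>\<close>: the corner \<open>j\<close> is at the end of its edge that is cut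
  off by line \<open>k\<close>.\<close>
definition zeros :: "nat list \<Rightarrow> (nat \<times> nat) set" where
  "zeros \<tau> = {(j, k). j < 4 \<and> (k = prv m (\<tau> ! j) \<or> k = nxt m (\<tau> ! j)) \<and> dev \<sigma> (H t0) k (corner (Z \<tau>) j) = 0}"

lemma no_zeros_steady:
  assumes t: "\<tau> \<in> tuples m" and z: "zeros \<tau> = {}"
  shows "\<forall>\<^sub>F t in nhds t0. counted m (H t) \<tau> = counted m (H t0) \<tau>"
  using near_sgn[OF solv[OF t]]
proof eventually_elim
  case (elim t)
  show ?case by (rule counted_by_sgn[OF t]) (use elim z in \<open>auto simp: zeros_def\<close>)
qed

lemma card_tuple_incidences:
  assumes "length \<tau> = 4"
  shows "card ((\<lambda>i. (i, \<tau> ! i)) ` {..<4}) = 4"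
  by (subst card_image) (auto simp: inj_on_def)

lemma zeros_bounds:
  assumes "\<tau> \<in> tuples m" "(j, k) \<in> zeros \<tau>"
  shows "j < 4" "k < m" "k \<noteq> \<tau> ! j" "lin \<sigma> j k (Z \<tau>) = H t0 k"
proof -
  show j: "j < 4" using assms by (simp add: zeros_def)
  have lt: "\<tau> ! j < m" using tuples_nth assms(1) j by blast
  have k: "k = prv m (\<tau> ! j) \<or> k = nxt m (\<tau> ! j)" using assms(2) by (simp add: zeros_def)
  then show "k < m" using nxt_less[OF lt] prv_less[OF lt] by auto
  show "k \<noteq> \<tau> ! j" using k nxt_neq[of m "\<tau> ! j"] prv_neq[OF _ lt] m by auto
  show "lin \<sigma> j k (Z \<tau>) = H t0 k" using assms(2) by (simp add: zeros_def dev_corner)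
qed

text \<open>Two such incidences in addition to the four of the tuple would make six.\<close>
lemma zeros_unique:
  assumes t: "\<tau> \<in> tuples m" and w: "snd (Z \<tau>) \<noteq> 0" and z: "(j, k) \<in> zeros \<tau>" "(j', k') \<in> zeros \<tau>"
  shows "j' = j \<and> k' = k"
proof (rule ccontr)
  assume ne: "\<not> (j' = j \<and> k' = k)"
  define J0 where "J0 = (\<lambda>i. (i, \<tau> ! i)) ` {..<4}"
  define J where "J = insert (j, k) (insert (j', k') J0)"
  note b = zeros_bounds[OF t z(1)] and b' = zeros_bounds[OF t z(2)]
  have "card J0 = 4" unfolding J0_def by (rule card_tuple_incidences[OF tuples_length[OF t]])
  moreover have "finite J0" by (simp add: J0_def)
  moreover have "(j, k) \<notin> J0" "(j', k') \<notin> J0" using b b' by (auto simp: J0_def)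
  ultimately have "card J = 6" using ne by (auto simp: J_def card_insert_if)
  moreover have "J \<subseteq> {..<4} \<times> {..<n}" using b b' tuples_nth[OF t] m by (force simp: J_def J0_def)
  moreover have "lin \<sigma> i l (Z \<tau>) = (h(M := t0)) l" if "(i, l) \<in> J" for i l
    using that b b' sol_incident[OF solv[OF t], of _ "H t0"] by (auto simp: J_def J0_def H_def)
  ultimately show False using six_incidences[OF generic, of J M "Z \<tau>" t0] w M m by simp
qed

lemma generic_tuple_nondegenerate:
  assumes s: "solvable \<tau>" "3 \<le> card (set \<tau>)"
  shows "snd (sol h \<tau>) \<noteq> 0"
proof
  assume z: "snd (sol h \<tau>) = 0"
  define p where "p = fst (sol h \<tau>)"
  have len: "length \<tau> = 4" using s by (simp add: solvable_def)
  have d: "dev \<sigma> h i p = 0" if i: "i \<in> set \<tau>" for i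
  proof -
    obtain j where "j < 4" "\<tau> ! j = i" using i len by (metis in_set_conv_nth)
    then show ?thesis using incident_dev[OF s(1), of j h] z by (simp add: corner_def p_def)
  qed
  obtain S where S: "S \<subseteq> set \<tau>" "card S = 3" using s(2) by (meson obtain_subset_with_card_n)
  then obtain a b c where abc: "S = {a, b, c}" "a \<noteq> b" "a \<noteq> c" "b \<noteq> c" by (metis card_3_iff)
  have "a \<in> set \<tau>" "b \<in> set \<tau>" "c \<in> set \<tau>" using S abc by auto
  moreover then have "a < n" "b < n" "c < n" using s(1) by (auto simp: solvable_def)
  ultimately show False using generic_not_concurrent[OF generic _ _ _ abc(2-4), of p] d by blast
qed

lemma nondegenerate_tuple:
  assumes t: "\<tau> \<in> tuples m" and w: "snd (Z \<tau>) \<noteq> 0"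
  shows "\<not> crossing \<tau>" "3 \<le> card (set \<tau>)"
proof -
  show "\<not> crossing \<tau>"
  proof
    assume c: "crossing \<tau>"
    have "corner (Z \<tau>) 0 = fst (Z \<tau>)" by (rule crossing_flat[OF solv[OF t] c])
    then show False using w by (simp add: corner_def)
  qed
  then show "3 \<le> card (set \<tau>)" using t by (auto simp: tuples_def)
qed

text \<open>If the deviation vanished identically then the corner would still be at the vertex in the generic position \<open>h\<close>.\<close>
lemma zero_simple_root:
  assumes t: "\<tau> \<in> tuples m" and w: "snd (Z \<tau>) \<noteq> 0" and z: "(j, k) \<in> zeros \<tau>"
  obtains \<beta> where "\<beta> \<noteq> 0" "\<And>t. dev \<sigma> (H t) k (corner (sol (H t) \<tau>) j) = \<beta> * (t - t0)"
proof -
  obtain \<alpha> \<beta> where f: "\<And>t. dev \<sigma> (H t) k (corner (sol (H t) \<tau>) j) = \<alpha> + \<beta> * t"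
    using dev_affine[OF solv[OF t]] by blast
  have "\<alpha> + \<beta> * t0 = 0" using z f[of t0] by (simp add: zeros_def)
  then have f': "dev \<sigma> (H t) k (corner (sol (H t) \<tau>) j) = \<beta> * (t - t0)" for t unfolding f by (simp add: algebra_simps)
  have "\<beta> \<noteq> 0"
  proof
    assume "\<beta> = 0"
    then have "dev \<sigma> h k (corner (sol h \<tau>) j) = 0" using f'[of "h M"] by (simp add: H_self)
    then have l: "lin \<sigma> j k (sol h \<tau>) = h k" by (simp add: dev_corner)
    define J0 where "J0 = (\<lambda>i. (i, \<tau> ! i)) ` {..<4}"
    define J where "J = insert (j, k) J0"
    note b = zeros_bounds[OF t z]
    have "card J0 = 4" unfolding J0_def by (rule card_tuple_incidences[OF tuples_length[OF t]])
    moreover have "finite J0" "(j, k) \<notin> J0" using b by (auto simp: J0_def)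
    ultimately have "card J = 5" by (auto simp: J_def card_insert_if)
    moreover have "J \<subseteq> {..<4} \<times> {..<n}" using b tuples_nth[OF t] m by (force simp: J_def J0_def)
    moreover have "lin \<sigma> i x (sol h \<tau>) = h x" if "(i, x) \<in> J" for i x
      using that l sol_incident[OF solv[OF t], of _ h] by (auto simp: J_def J0_def)
    ultimately have "snd (sol h \<tau>) = 0" using five_incidences[OF generic] by blast
    then show False using generic_tuple_nondegenerate[OF solv[OF t]] nondegenerate_tuple[OF t w] by blast
  qed
  then show ?thesis using f' by (rule that)
qed

definition rest_inside :: "nat list \<Rightarrow> nat \<Rightarrow> bool" where
  "rest_inside \<tau> j \<longleftrightarrow> (\<forall>i<4. i \<noteq> j \<longrightarrow> in_edge m (H t0) (\<tau> ! i) (corner (Z \<tau>) i))"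

lemma shift_filter:
  assumes "\<forall>\<^sub>F t in nhds t0. P t"
  shows "\<forall>\<^sub>F s in at_right 0. P (t0 + s)" "\<forall>\<^sub>F s in at_right 0. P (t0 - s)"
proof -
  have "((\<lambda>s. t0 + s) \<longlongrightarrow> t0 + 0) (at_right 0)" "((\<lambda>s. t0 - s) \<longlongrightarrow> t0 - 0) (at_right 0)" by (intro tendsto_intros)+
  then show "\<forall>\<^sub>F s in at_right 0. P (t0 + s)" "\<forall>\<^sub>F s in at_right 0. P (t0 - s)"
    using assms by (auto simp: filterlim_iff)
qed

text \<open>The corner \<open>j\<close> crosses the vertex with nonzero speed while the other corners stay inside or outside their edges.\<close>
lemma regular_flip:
  assumes t: "\<tau> \<in> tuples m" and w: "snd (Z \<tau>) \<noteq> 0" and z: "(j, k) \<in> zeros \<tau>"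
  shows "\<forall>\<^sub>F s in at_right 0. (counted m (H (t0 + s)) \<tau> \<noteq> counted m (H (t0 - s)) \<tau>) = rest_inside \<tau> j"
proof -
  obtain \<beta> where \<beta>: "\<beta> \<noteq> 0" "\<And>t. dev \<sigma> (H t) k (corner (sol (H t) \<tau>) j) = \<beta> * (t - t0)"
    using zero_simple_root[OF t w z] by blast
  note b = zeros_bounds[OF t z]
  have lt: "\<tau> ! j < m" using tuples_nth[OF t b(1)] .
  define l where "l = (if k = prv m (\<tau> ! j) then nxt m (\<tau> ! j) else prv m (\<tau> ! j))"
  have kl: "(k = prv m (\<tau> ! j) \<and> l = nxt m (\<tau> ! j)) \<or> (k = nxt m (\<tau> ! j) \<and> l = prv m (\<tau> ! j))"
    using z by (auto simp: l_def zeros_def)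
  have "l \<noteq> k" using prv_neq_nxt[of m "\<tau> ! j"] lt m kl by auto
  then have l0: "dev \<sigma> (H t0) l (corner (Z \<tau>) j) \<noteq> 0"
    using zeros_unique[OF t w z, of j l] kl b(1) by (auto simp: zeros_def)
  have lm: "l < m" using kl nxt_less[OF lt] prv_less[OF lt] by auto
  define kap where "kap = (\<sigma> (\<tau> ! j) - \<sigma> (prv m (\<tau> ! j))) * (\<sigma> (\<tau> ! j) - \<sigma> (nxt m (\<tau> ! j)))"
  have kap: "kap \<noteq> 0"
    using slopes_distinct[of "\<tau> ! j" "prv m (\<tau> ! j)"] slopes_distinct[of "\<tau> ! j" "nxt m (\<tau> ! j)"]
      lt m nxt_less[OF lt] prv_less[OF lt] nxt_neq[of m "\<tau> ! j"] prv_neq[of m "\<tau> ! j"] by (auto simp: kap_def)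
  have ie: "in_edge m h' (\<tau> ! j) p \<longleftrightarrow> sgn (dev \<sigma> h' k p) * (sgn (dev \<sigma> h' l p) * sgn kap) = -1" for h' p
    unfolding in_edge_sgn kap_def[symmetric] using kl by (auto simp: ac_simps)
  define X where "X = sgn (dev \<sigma> (H t0) l (corner (Z \<tau>) j)) * sgn kap"
  have X: "X = 1 \<or> X = -1" using l0 kap by (auto simp: X_def sgn_if)
  have other: "in_edge m (H t') (\<tau> ! i) (corner (sol (H t') \<tau>) i) \<longleftrightarrow> in_edge m (H t0) (\<tau> ! i) (corner (Z \<tau>) i)"
    if i: "i < 4" "i \<noteq> j" and near: "\<forall>j\<in>{..<4}. \<forall>k\<in>{..<m}. dev \<sigma> (H t0) k (corner (Z \<tau>) j) \<noteq> 0 \<longrightarrow>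
      sgn (dev \<sigma> (H t') k (corner (sol (H t') \<tau>) j)) = sgn (dev \<sigma> (H t0) k (corner (Z \<tau>) j))" for i t'
  proof -
    have lt: "\<tau> ! i < m" using tuples_nth[OF t i(1)] .
    have "dev \<sigma> (H t0) k' (corner (Z \<tau>) i) \<noteq> 0" if "k' = prv m (\<tau> ! i) \<or> k' = nxt m (\<tau> ! i)" for k'
      using zeros_unique[OF t w z, of i k'] that i by (auto simp: zeros_def)
    then show ?thesis using near i prv_less[OF lt] nxt_less[OF lt] unfolding in_edge_sgn by auto
  qed
  note ev = shift_filter[OF near_sgn[OF solv[OF t]]]
  have pos: "\<forall>\<^sub>F s in at_right (0::real). 0 < s" by (rule eventually_at_right_less)
  show ?thesis using ev(1) ev(2) pos
  proof eventually_elim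
    case (elim s)
    have cnt: "counted m h' \<tau> \<longleftrightarrow> in_edge m h' (\<tau> ! j) (corner (sol h' \<tau>) j) \<and> (\<forall>i<4. i \<noteq> j \<longrightarrow> in_edge m h' (\<tau> ! i) (corner (sol h' \<tau>) i))" for h'
      using nondegenerate_tuple[OF t w] b(1) by (auto simp: counted_def)
    have 1: "in_edge m (H (t0 + s)) (\<tau> ! j) (corner (sol (H (t0 + s)) \<tau>) j) \<longleftrightarrow> sgn \<beta> * X = -1"
      using elim(1,3) b(1) lm l0 unfolding ie \<beta>(2) X_def by (simp add: sgn_mult)
    have 2: "in_edge m (H (t0 - s)) (\<tau> ! j) (corner (sol (H (t0 - s)) \<tau>) j) \<longleftrightarrow> - sgn \<beta> * X = -1"
      using elim(2,3) b(1) lm l0 unfolding ie \<beta>(2) X_def by (simp add: sgn_mult)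
    have 3: "(sgn \<beta> * X = -1) \<noteq> (- sgn \<beta> * X = -1)" using X \<beta>(1) by (auto simp: sgn_if)
    have 4: "(\<forall>i<4. i \<noteq> j \<longrightarrow> in_edge m (H (t0 + s)) (\<tau> ! i) (corner (sol (H (t0 + s)) \<tau>) i)) \<longleftrightarrow> rest_inside \<tau> j"
      "(\<forall>i<4. i \<noteq> j \<longrightarrow> in_edge m (H (t0 - s)) (\<tau> ! i) (corner (sol (H (t0 - s)) \<tau>) i)) \<longleftrightarrow> rest_inside \<tau> j"
      using other[OF _ _ elim(1)] other[OF _ _ elim(2)] unfolding rest_inside_def by auto
    show ?case unfolding cnt 1 2 4 using 3 by blast
  qed
qed

end

section \<open>Squares with a corner passing a vertex\<close>

lemma triple_members:
  assumes "{x, y, z} = {i. i < m \<and> P i}"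
  shows "x < m" "y < m" "z < (m::nat)" "P x" "P y" "P z"
proof -
  have "x \<in> {i. i < m \<and> P i}" "y \<in> {i. i < m \<and> P i}" "z \<in> {i. i < m \<and> P i}"
    unfolding assms[symmetric] by simp_all
  then show "x < m" "y < m" "z < (m::nat)" "P x" "P y" "P z" by simp_all
qed

context slopes
begin

lemma three_lines_in_tuple:
  assumes len: "length \<tau> = 4" and sub: "set \<tau> \<subseteq> {..<n}" and w: "snd z \<noteq> 0"
    and inc: "\<And>j. j < 4 \<Longrightarrow> lin \<sigma> j (\<tau> ! j) z = r (\<tau> ! j)"
  shows "3 \<le> card (set \<tau>)"
proof -
  obtain a b c d where t: "\<tau> = [a, b, c, d]" using len by (rule length4_obtain)
  have lt: "a < n" "b < n" "c < n" "d < n" using sub by (auto simp: t)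
  have three: False if "j < 4" "k < 4" "l < 4" "j \<noteq> k" "j \<noteq> l" "k \<noteq> l" "\<tau> ! k = \<tau> ! j" "\<tau> ! l = \<tau> ! j" for j k l
  proof -
    have "lin \<sigma> j (\<tau> ! j) z = lin \<sigma> k (\<tau> ! j) z" "lin \<sigma> j (\<tau> ! j) z = lin \<sigma> l (\<tau> ! j) z"
      using inc[OF that(1)] inc[OF that(2)] inc[OF that(3)] that(7,8) by simp_all
    from three_corners_on_line[OF that(1-6) this] w show False by blast
  qed
  have pairs: False if "j < 4" "k < 4" "l < 4" "i < 4" "j \<noteq> k" "l \<noteq> i" "\<tau> ! k = \<tau> ! j" "\<tau> ! i = \<tau> ! l" "\<tau> ! j \<noteq> \<tau> ! l" for j k l i
  proof -
    have "lin \<sigma> j (\<tau> ! j) z = lin \<sigma> k (\<tau> ! j) z" "lin \<sigma> l (\<tau> ! l) z = lin \<sigma> i (\<tau> ! l) z"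
      using inc[OF that(1)] inc[OF that(2)] inc[OF that(3)] inc[OF that(4)] that(7,8) by simp_all
    moreover have "\<tau> ! j < n" "\<tau> ! l < n" using sub that(1,3) len nth_mem by (metis lessThan_iff subsetD)+
    ultimately have "snd z = 0" using two_repeats[OF that(1,2,5,3,4,6) _ _ that(9)] by blast
    then show False using w by blast
  qed
  have n3: "\<not> (b = a \<and> c = a)" "\<not> (b = a \<and> d = a)" "\<not> (c = a \<and> d = a)" "\<not> (c = b \<and> d = b)"
    using three[of 0 "Suc 0" 2] three[of 0 "Suc 0" 3] three[of 0 2 3] three[of "Suc 0" 2 3] unfolding t by (simp_all, blast+)
  have n2: "\<not> (b = a \<and> d = c \<and> a \<noteq> c)" "\<not> (c = a \<and> d = b \<and> a \<noteq> b)" "\<not> (d = a \<and> c = b \<and> a \<noteq> b)"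
    using pairs[of 0 "Suc 0" 2 3] pairs[of 0 2 "Suc 0" 3] pairs[of 0 3 "Suc 0" 2] unfolding t by (simp_all, blast+)
  show ?thesis unfolding t
    by (cases "a = b"; cases "a = c"; cases "a = d"; cases "b = c"; cases "b = d"; cases "c = d") (use n3 n2 in \<open>auto simp: card_insert_if\<close>)
qed

end

context sweep
begin

text \<open>At a corner that has reached the vertex, the edge is replaced by the other edge at this vertex.\<close>
definition partner :: "nat list \<Rightarrow> nat list" where
  "partner \<tau> = (case (THE x. x \<in> zeros \<tau>) of (j, k) \<Rightarrow> \<tau>[j := k])"

definition regular_flipping :: "nat list \<Rightarrow> bool" where
  "regular_flipping \<tau> \<longleftrightarrow> \<tau> \<in> tuples m \<and> snd (Z \<tau>) \<noteq> 0 \<and> (\<exists>(j, k)\<in>zeros \<tau>. rest_inside \<tau> j)"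

lemma partner_eq:
  assumes "\<tau> \<in> tuples m" "snd (Z \<tau>) \<noteq> 0" "(j, k) \<in> zeros \<tau>"
  shows "partner \<tau> = \<tau>[j := k]"
proof -
  have "(THE x. x \<in> zeros \<tau>) = (j, k)"
  proof (intro the_equality)
    fix x assume "x \<in> zeros \<tau>"
    then show "x = (j, k)" using zeros_unique[OF assms, of "fst x" "snd x"] by (cases x) simp
  qed (rule assms(3))
  then show ?thesis by (simp add: partner_def)
qed

text \<open>At \<open>t0\<close> both tuples have the same square. The new line is one of the neighbours, so the replacement
  can be undone; the multisets differ, so the partner lies in a different class.\<close>
lemma partner_involution:
  assumes r: "regular_flipping \<tau>"
  shows "regular_flipping (partner \<tau>)" "partner (partner \<tau>) = \<tau>" "mset (partner \<tau>) \<noteq> mset \<tau>"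
proof -
  obtain j k where t: "\<tau> \<in> tuples m" and w: "snd (Z \<tau>) \<noteq> 0" and z: "(j, k) \<in> zeros \<tau>" and ri: "rest_inside \<tau> j"
    using r by (auto simp: regular_flipping_def)
  note b = zeros_bounds[OF t z]
  have len: "length \<tau> = 4" by (rule tuples_length[OF t])
  define \<tau>' where "\<tau>' = \<tau>[j := k]"
  have p: "partner \<tau> = \<tau>'" using partner_eq[OF t w z] by (simp add: \<tau>'_def)
  have len': "length \<tau>' = 4" using len by (simp add: \<tau>'_def)
  have nth': "\<tau>' ! i = (if i = j then k else \<tau> ! i)" if "i < 4" for i
    using that len by (simp add: \<tau>'_def nth_list_update)
  have inc: "lin \<sigma> i (\<tau>' ! i) (Z \<tau>) = H t0 (\<tau>' ! i)" if "i < 4" for i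
    using nth'[OF that] b(4) sol_incident[OF solv[OF t] that, of "H t0"] by simp
  have "set \<tau> \<subseteq> {..<m}" using t by (simp add: tuples_def)
  then have sub: "set \<tau>' \<subseteq> {..<m}" unfolding \<tau>'_def using b(2) set_update_subset_insert[of \<tau> j k] by auto
  have "3 \<le> card (set \<tau>')"
    by (rule three_lines_in_tuple[OF len' _ w inc]) (use sub m in auto)
  then have t': "\<tau>' \<in> tuples m" using len' sub by (simp add: tuples_def)
  have Z': "Z \<tau>' = Z \<tau>" by (rule sol_unique[OF solv[OF t'], symmetric]) (rule inc)
  have lt: "\<tau> ! j < m" using tuples_nth[OF t b(1)] .
  have nb: "\<tau> ! j = prv m k \<or> \<tau> ! j = nxt m k"
    using z prv_nxt[OF lt] nxt_prv[OF lt] by (auto simp: zeros_def)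
  have "dev \<sigma> (H t0) (\<tau> ! j) (corner (Z \<tau>) j) = 0" by (rule incident_dev[OF solv[OF t] b(1)])
  then have z': "(j, \<tau> ! j) \<in> zeros \<tau>'" using nb b(1) nth'[OF b(1)] by (auto simp: zeros_def Z')
  have ri': "rest_inside \<tau>' j" using ri nth' by (auto simp: rest_inside_def Z')
  have w': "snd (Z \<tau>') \<noteq> 0" using w Z' by simp
  show "regular_flipping (partner \<tau>)" unfolding p regular_flipping_def using t' w' z' ri' by auto
  have "partner \<tau>' = \<tau>'[j := \<tau> ! j]" by (rule partner_eq[OF t' w' z'])
  then show "partner (partner \<tau>) = \<tau>" using len b(1) by (simp add: p \<tau>'_def)
  have "mset \<tau>' = mset \<tau> - {#\<tau> ! j#} + {#k#}" using len b(1) by (simp add: \<tau>'_def mset_update)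
  then have "count (mset \<tau>') k = Suc (count (mset \<tau>) k)" using b(3) by simp
  then show "mset (partner \<tau>) \<noteq> mset \<tau>" unfolding p by auto
qed

lemma regular_flipping_rotate1:
  assumes r: "regular_flipping \<tau>"
  shows "regular_flipping (rotate1 \<tau>)" "partner (rotate1 \<tau>) = rotate1 (partner \<tau>)"
proof -
  obtain j k where t: "\<tau> \<in> tuples m" and w: "snd (Z \<tau>) \<noteq> 0" and z: "(j, k) \<in> zeros \<tau>" and ri: "rest_inside \<tau> j"
    using r by (auto simp: regular_flipping_def)
  note b = zeros_bounds[OF t z]
  obtain a0 a1 a2 a3 where tt: "\<tau> = [a0, a1, a2, a3]" using tuples_length[OF t] by (rule length4_obtain)
  have t': "rotate1 \<tau> \<in> tuples m" by (rule tuples_rotate1[OF t])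
  have Z': "Z (rotate1 \<tau>) = rot (Z \<tau>)" by (rule sol_rotate1[OF solv[OF t]])
  have w': "snd (Z (rotate1 \<tau>)) \<noteq> 0" using w by (simp add: Z' rot_def)
  have "\<exists>j'. (j', k) \<in> zeros (rotate1 \<tau>) \<and> rest_inside (rotate1 \<tau>) j' \<and> (rotate1 \<tau>)[j' := k] = rotate1 (\<tau>[j := k])"
    using b(1)
  proof (cases rule: less_4_cases)
    case 1 show ?thesis using z ri unfolding 1
      by (intro exI[of _ 3]) (simp add: zeros_def rest_inside_def all_less_4 Z'[unfolded tt, simplified] corner_rot tt)
  next
    case 2 show ?thesis using z ri unfolding 2
      by (intro exI[of _ 0]) (simp add: zeros_def rest_inside_def all_less_4 Z'[unfolded tt, simplified] corner_rot tt)
  next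
    case 3 show ?thesis using z ri unfolding 3
      by (intro exI[of _ "Suc 0"]) (simp add: zeros_def rest_inside_def all_less_4 Z'[unfolded tt, simplified] corner_rot tt)
  next
    case 4 show ?thesis using z ri unfolding 4
      by (intro exI[of _ 2]) (simp add: zeros_def rest_inside_def all_less_4 Z'[unfolded tt, simplified] corner_rot tt)
  qed
  then obtain j' where j': "(j', k) \<in> zeros (rotate1 \<tau>)" "rest_inside (rotate1 \<tau>) j'" "(rotate1 \<tau>)[j' := k] = rotate1 (\<tau>[j := k])"
    by blast
  show "regular_flipping (rotate1 \<tau>)" unfolding regular_flipping_def using t' w' j'(1,2) by blast
  show "partner (rotate1 \<tau>) = rotate1 (partner \<tau>)"
    unfolding partner_eq[OF t' w' j'(1)] partner_eq[OF t w z] by (rule j'(3))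
qed

definition regular_classes :: "nat list set set" where
  "regular_classes = cyc ` {\<tau>. regular_flipping \<tau>}"

lemma regular_classes_sub: "regular_classes \<subseteq> classes m"
  by (auto simp: regular_classes_def classes_def regular_flipping_def)

lemma partner_cyc:
  assumes r: "regular_flipping \<tau>"
  shows "partner ` cyc \<tau> = cyc (partner \<tau>)"
proof -
  note r1 = regular_flipping_rotate1(1)[OF r] note r2 = regular_flipping_rotate1(1)[OF r1]
  have l: "length \<tau> = 4" "length (partner \<tau>) = 4"
    using r partner_involution(1)[OF r] by (auto simp: regular_flipping_def tuples_length)
  have c: "cyc \<tau> = {\<tau>, rotate1 \<tau>, rotate1 (rotate1 \<tau>), rotate1 (rotate1 (rotate1 \<tau>))}" if "length \<tau> = 4" for \<tau> :: "nat list"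
    using that by (elim length4_obtain) (simp add: cyc4)
  show ?thesis unfolding c[OF l(1)] c[OF l(2)]
    by (simp add: regular_flipping_rotate1(2)[OF r] regular_flipping_rotate1(2)[OF r1] regular_flipping_rotate1(2)[OF r2])
qed

text \<open>The tuples whose status changes at a square of positive size come in pairs.\<close>
lemma even_regular_classes: "even (card regular_classes)"
proof (rule even_involution[where f = "\<lambda>c. partner ` c"])
  show "finite regular_classes" using finite_subset[OF regular_classes_sub finite_classes] .
  fix c assume "c \<in> regular_classes"
  then obtain \<tau> where r: "regular_flipping \<tau>" and c: "c = cyc \<tau>" by (auto simp: regular_classes_def)
  note r' = partner_involution(1)[OF r]
  have l: "length \<tau> = 4" using r by (auto simp: regular_flipping_def tuples_length)
  have l': "length (partner \<tau>) = 4" using r' by (auto simp: regular_flipping_def tuples_length)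
  have e: "partner ` c = cyc (partner \<tau>)" unfolding c by (rule partner_cyc[OF r])
  show "partner ` c \<in> regular_classes" unfolding e regular_classes_def using r' by blast
  have "partner ` (partner ` c) = cyc \<tau>" by (simp only: e partner_cyc[OF r'] partner_involution(2)[OF r])
  then show "partner ` (partner ` c) = c" by (simp only: c)
  show "partner ` c \<noteq> c"
  proof
    assume "partner ` c = c"
    then have "partner \<tau> \<in> cyc \<tau>" using cyc_self[OF l'] e c by simp
    moreover have "mset (rotate1 xs) = mset xs" for xs :: "nat list" by (cases xs) simp_all
    ultimately have "mset (partner \<tau>) = mset \<tau>" using cyc_cases[OF l, of "partner \<tau>"] by auto
    then show False using partner_involution(3)[OF r] by blast
  qed
qed

definition differs :: "real \<Rightarrow> nat list set \<Rightarrow> bool" where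
  "differs s c \<longleftrightarrow> counted_class m (H (t0 + s)) c \<noteq> counted_class m (H (t0 - s)) c"

lemma differs_cyc: "\<tau> \<in> tuples m \<Longrightarrow> differs s (cyc \<tau>) \<longleftrightarrow> counted m (H (t0 + s)) \<tau> \<noteq> counted m (H (t0 - s)) \<tau>"
  by (simp add: differs_def counted_class_cyc solv)

lemma steady_differs:
  assumes t: "\<tau> \<in> tuples m" and z: "zeros \<tau> = {}"
  shows "\<forall>\<^sub>F s in at_right 0. \<not> differs s (cyc \<tau>)"
  using shift_filter[OF no_zeros_steady[OF t z]]
  by eventually_elim (simp add: differs_cyc[OF t])

lemma regular_class_iff:
  assumes t: "\<tau> \<in> tuples m"
  shows "cyc \<tau> \<in> regular_classes \<longleftrightarrow> regular_flipping \<tau>"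
proof
  assume "cyc \<tau> \<in> regular_classes"
  then obtain \<tau>' where r: "regular_flipping \<tau>'" "cyc \<tau> = cyc \<tau>'" by (auto simp: regular_classes_def)
  have "length \<tau>' = 4" using r by (auto simp: regular_flipping_def tuples_length)
  moreover have "\<tau> \<in> cyc \<tau>'" using cyc_self[OF tuples_length[OF t]] r by simp
  ultimately have "\<tau> \<in> {\<tau>', rotate1 \<tau>', rotate1 (rotate1 \<tau>'), rotate1 (rotate1 (rotate1 \<tau>'))}" by (rule cyc_cases)
  then show "regular_flipping \<tau>" using r(1) regular_flipping_rotate1(1) by auto
qed (auto simp: regular_classes_def)

lemma regular_differs:
  assumes t: "\<tau> \<in> tuples m" and w: "snd (Z \<tau>) \<noteq> 0"
  shows "\<forall>\<^sub>F s in at_right 0. differs s (cyc \<tau>) = (cyc \<tau> \<in> regular_classes)"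
proof -
  note mem = regular_class_iff[OF t]
  show ?thesis
  proof (cases "zeros \<tau> = {}")
    case True
    then have "\<not> regular_flipping \<tau>" by (auto simp: regular_flipping_def)
    then show ?thesis using steady_differs[OF t True] mem by simp
  next
    case False
    then obtain j k where z: "(j, k) \<in> zeros \<tau>" by auto
    have "regular_flipping \<tau> \<longleftrightarrow> rest_inside \<tau> j"
    proof
      assume "regular_flipping \<tau>"
      then obtain j' k' where "(j', k') \<in> zeros \<tau>" "rest_inside \<tau> j'" by (auto simp: regular_flipping_def)
      then show "rest_inside \<tau> j" using zeros_unique[OF t w z] by blast
    qed (use t w z in \<open>auto simp: regular_flipping_def\<close>)
    then show ?thesis using regular_flip[OF t w z] mem differs_cyc[OF t] by simp
  qed
qed

section \<open>Three lines passing through a common point\<close>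

text \<open>Sets of exactly three lines through a common point at time \<open>t0\<close>, given as the set of all lines through this
  point.\<close>
definition concurrent :: "nat set set" where
  "concurrent = {T. card T = 3 \<and> (\<exists>y. T = {i. i < m \<and> dev \<sigma> (H t0) i y = 0})}"

lemma finite_concurrent: "finite concurrent"
  by (rule finite_subset[of _ "Pow {..<m}"]) (auto simp: concurrent_def)

lemma card_concurrent: "card {i. i < m \<and> dev \<sigma> (H t0) i y = 0} \<le> 3"
proof (rule ccontr)
  define T where "T = {i. i < m \<and> dev \<sigma> (H t0) i y = 0}"
  assume "\<not> card {i. i < m \<and> dev \<sigma> (H t0) i y = 0} \<le> 3"
  then have "4 \<le> card T" unfolding T_def[symmetric] by simp
  then have "3 \<le> card (T - {M})" by (cases "M \<in> T") simp_all
  then obtain S where S: "S \<subseteq> T - {M}" "card S = 3" by (meson obtain_subset_with_card_n)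
  then obtain a b c where abc: "S = {a, b, c}" "a \<noteq> b" "a \<noteq> c" "b \<noteq> c" by (metis card_3_iff)
  have "a < n" "b < n" "c < n" using S abc m by (auto simp: T_def)
  moreover have "dev \<sigma> h a y = 0" "dev \<sigma> h b y = 0" "dev \<sigma> h c y = 0"
    using S abc dev_H by (auto simp: T_def)
  ultimately show False using generic_not_concurrent[OF generic _ _ _ abc(2-4)] by blast
qed

lemma degenerate_lines:
  assumes t: "\<tau> \<in> tuples m" and w: "snd (Z \<tau>) = 0"
  shows "i \<in> set \<tau> \<Longrightarrow> dev \<sigma> (H t0) i (fst (Z \<tau>)) = 0"
proof -
  assume "i \<in> set \<tau>"
  then obtain j where "j < 4" "\<tau> ! j = i" using tuples_length[OF t] by (metis in_set_conv_nth)
  then show ?thesis using incident_dev[OF solv[OF t], of j "H t0"] w by (simp add: corner_def)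
qed

text \<open>If the square of the tuple is a point at time \<open>t0\<close> and one of the neighbouring lines passes through this point, then three
  lines meet there.\<close>
lemma degenerate_no_zeros:
  assumes t: "\<tau> \<in> tuples m" and w: "snd (Z \<tau>) = 0" and T: "\<not> (\<exists>T\<in>concurrent. set \<tau> \<subseteq> T)"
  shows "zeros \<tau> = {}"
proof (rule ccontr)
  assume "zeros \<tau> \<noteq> {}"
  then obtain j k where z: "(j, k) \<in> zeros \<tau>" by auto
  note b = zeros_bounds[OF t z]
  define y where "y = fst (Z \<tau>)"
  have cor: "corner (Z \<tau>) i = y" for i using w by (simp add: corner_def y_def)
  define T where "T = {i. i < m \<and> dev \<sigma> (H t0) i y = 0}"
  have sub: "set \<tau> \<subseteq> T" using degenerate_lines[OF t w] t by (auto simp: T_def y_def tuples_def)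
  have kT: "k \<in> T" using z b(2) by (auto simp: T_def zeros_def cor)
  have fin: "finite T" by (simp add: T_def)
  have "3 \<le> card T"
  proof (cases "3 \<le> card (set \<tau>)")
    case True then show ?thesis using card_mono[OF fin sub] by simp
  next
    case False
    then have c: "crossing \<tau>" "\<not> adjacent m (\<tau> ! 0) (\<tau> ! 1)" using t by (auto simp: tuples_def)
    obtain p q where pq: "p \<noteq> q" "\<tau> = [p, q, p, q]" using c(1) crossing_iff[OF tuples_length[OF t]] by blast
    have lt: "\<tau> ! j < m" by (rule tuples_nth[OF t b(1)])
    have nk: "adjacent m (\<tau> ! j) k" using z adjacent_nxt adjacent_prv[OF lt] by (auto simp: zeros_def)
    have tj: "\<tau> ! j \<in> {p, q}" using b(1) by (cases rule: less_4_cases) (auto simp: pq)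
    have na: "\<not> adjacent m p q" "\<not> adjacent m q p" using c(2) adjacent_sym by (auto simp: pq)
    have "k \<noteq> p" "k \<noteq> q" using nk tj na b(3) by auto
    then have "card {p, q, k} = 3" using pq by simp
    moreover have "{p, q, k} \<subseteq> T" using sub kT pq by auto
    ultimately show ?thesis using card_mono[OF fin] by metis
  qed
  moreover have "card T \<le> 3" unfolding T_def by (rule card_concurrent)
  ultimately have "T \<in> concurrent" unfolding concurrent_def T_def by auto
  then show False using T sub by blast
qed

lemma concurrent_point_unique:
  assumes "a < m" "b < m" "a \<noteq> b" "dev \<sigma> h' a y = 0" "dev \<sigma> h' b y = 0" "dev \<sigma> h' a y' = 0" "dev \<sigma> h' b y' = 0"
  shows "y = y'"
proof -
  have "\<sigma> a \<noteq> \<sigma> b" using slopes_distinct assms(1-3) m by auto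
  moreover have e: "Im y - Im y' = \<sigma> a * (Re y - Re y')" "Im y - Im y' = \<sigma> b * (Re y - Re y')"
    using assms(4-7) by (simp_all add: dev_def algebra_simps)
  ultimately have "Re y - Re y' = 0" by auto
  then show ?thesis using e by (simp add: complex_eq_iff)
qed

lemma concurrent_unique:
  assumes t: "\<tau> \<in> tuples m" and "T \<in> concurrent" "T' \<in> concurrent" "set \<tau> \<subseteq> T" "set \<tau> \<subseteq> T'"
  shows "T = T'"
proof -
  obtain y y' where y: "T = {i. i < m \<and> dev \<sigma> (H t0) i y = 0}" "T' = {i. i < m \<and> dev \<sigma> (H t0) i y' = 0}"
    using assms by (auto simp: concurrent_def)
  have "\<exists>a\<in>set \<tau>. \<exists>b\<in>set \<tau>. a \<noteq> b"
  proof (rule ccontr)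
    assume "\<not> ?thesis"
    then have eq: "\<And>a b. a \<in> set \<tau> \<Longrightarrow> b \<in> set \<tau> \<Longrightarrow> a = b" by blast
    have m0: "\<tau> ! j \<in> set \<tau>" if "j < 4" for j using that tuples_length[OF t] by simp
    have "\<not> crossing \<tau>" using eq[OF m0[of 0] m0[of 1]] by (simp add: crossing_def)
    moreover have "set \<tau> = {\<tau> ! 0}" using eq m0[of 0] by auto
    then have "card (set \<tau>) = 1" by simp
    ultimately show False using t by (simp add: tuples_def)
  qed
  then obtain a b where "a \<in> set \<tau>" "b \<in> set \<tau>" "a \<noteq> b" by blast
  then have "y = y'" using concurrent_point_unique[of a b "H t0" y y'] assms(4,5) y by auto
  then show ?thesis by (simp add: y)
qed

lemma within_concurrent:
  assumes T: "T = {i. i < m \<and> dev \<sigma> (H t0) i y = 0}" and t: "solvable \<tau>" and sub: "set \<tau> \<subseteq> T"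
  shows "Z \<tau> = (y, 0)"
proof (rule sol_unique[OF t, symmetric])
  fix j :: nat assume j: "j < 4"
  have "\<tau> ! j \<in> T" using sub nth_mem[of j \<tau>] j t by (auto simp: solvable_def)
  then have "dev \<sigma> (H t0) (\<tau> ! j) (corner (y, 0) j) = 0" using T by (simp add: corner_def)
  then show "lin \<sigma> j (\<tau> ! j) (y, 0) = H t0 (\<tau> ! j)" by (simp add: dev_corner)
qed

text \<open>One of the three lines moves and the other two do not, so the triangle changes its orientation with nonzero speed.\<close>
lemma area_H:
  assumes "x < m" "y < m" "z < m" "x \<noteq> y" "y \<noteq> z" "x \<noteq> z" "M \<in> {x, y, z}"
    and p: "dev \<sigma> (H t0) x p = 0" "dev \<sigma> (H t0) y p = 0" "dev \<sigma> (H t0) z p = 0"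
  obtains \<kappa> where "\<kappa> \<noteq> 0" "\<And>s. area (H (t0 + s)) x y z = \<kappa> * s"
proof -
  have 0: "area (H t0) x y z = 0" using bary_sum[of z y "H t0" x p] p by simp
  define \<kappa> where "\<kappa> = - (if M = x then \<sigma> z - \<sigma> y else if M = y then \<sigma> x - \<sigma> z else \<sigma> y - \<sigma> x)"
  have "area (H (t0 + s)) x y z = area (H t0) x y z + \<kappa> * s" for s
    using assms(4-7) by (auto simp: area_def H_def \<kappa>_def algebra_simps)
  moreover have "\<kappa> \<noteq> 0"
    using slopes_distinct[of x y] slopes_distinct[of y z] slopes_distinct[of x z] assms(1-6) m by (auto simp: \<kappa>_def)
  ultimately show ?thesis using 0 that by simp
qed

lemma class_representatives_solvable:
  assumes "x < n" "y < n" "z < n" "x \<noteq> y" "y \<noteq> z" "x \<noteq> z" "\<tau> \<in> set (class_representatives x y z)"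
  shows "solvable \<tau>" "set \<tau> \<subseteq> {x, y, z}"
proof -
  show "set \<tau> \<subseteq> {x, y, z}" using assms(7) by (auto simp: class_representatives_def three_line_patterns_def)
  show "solvable \<tau>"
  proof (cases "\<tau> \<in> set (three_line_patterns x y z)")
    case True
    have "\<tau> \<in> tuples n" by (rule pattern_tuples(1)[OF assms(1-6) True])
    then show ?thesis by (rule tuples_solvable) simp
  next
    case False
    then have "\<tau> \<in> {[x, y, x, y], [z, x, z, x], [y, z, y, z]}" using assms(7) by (auto simp: class_representatives_def)
    then show ?thesis using assms by (auto simp: solvable_def crossing_def)
  qed
qed

lemma class_representatives_near:
  assumes T: "{x, y, z} = {i. i < m \<and> dev \<sigma> (H t0) i p = 0}" and ne: "x \<noteq> y" "y \<noteq> z" "x \<noteq> z"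
  shows "\<forall>\<^sub>F t in nhds t0. \<forall>\<tau>\<in>set (class_representatives x y z). \<forall>j\<in>{..<4}. \<forall>i\<in>{..<m} - {x, y, z}.
    0 < dev \<sigma> (H t0) i p * dev \<sigma> (H t) i (corner (sol (H t) \<tau>) j)"
proof (rule eventually_ball_finite, simp, intro ballI)
  have lt: "x < n" "y < n" "z < n" using triple_members(1-3)[OF T] m by simp_all
  fix \<tau> assume t: "\<tau> \<in> set (class_representatives x y z)"
  note tw = class_representatives_solvable[OF lt ne t]
  have c: "corner (Z \<tau>) j = p" for j using within_concurrent[OF T tw] by (simp add: corner_def)
  show "\<forall>\<^sub>F t in nhds t0. \<forall>j\<in>{..<4}. \<forall>i\<in>{..<m} - {x, y, z}. 0 < dev \<sigma> (H t0) i p * dev \<sigma> (H t) i (corner (sol (H t) \<tau>) j)"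
    using near_sgn[OF tw(1)]
  proof eventually_elim
    case (elim t)
    show ?case
    proof (intro ballI)
      fix j i assume j: "j \<in> {..<4::nat}" and i: "i \<in> {..<m} - {x, y, z}"
      have "i \<notin> {i. i < m \<and> dev \<sigma> (H t0) i p = 0}" using i unfolding T by blast
      then have nz: "dev \<sigma> (H t0) i p \<noteq> 0" using i by simp
      then have "sgn (dev \<sigma> (H t) i (corner (sol (H t) \<tau>) j)) = sgn (dev \<sigma> (H t0) i p)" using elim j i unfolding c by blast
      then have "sgn (dev \<sigma> (H t0) i p * dev \<sigma> (H t) i (corner (sol (H t) \<tau>) j)) = 1"
        using nz by (simp add: sgn_mult)
      then show "0 < dev \<sigma> (H t0) i p * dev \<sigma> (H t) i (corner (sol (H t) \<tau>) j)" by (simp only: sgn_1_pos)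
    qed
  qed
qed

lemma concurrent_M:
  assumes "card T = 3" and T: "T = {i. i < m \<and> dev \<sigma> (H t0) i p = 0}"
  shows "M \<in> T"
proof (rule ccontr)
  assume "M \<notin> T"
  obtain a b c where abc: "T = {a, b, c}" "a \<noteq> b" "a \<noteq> c" "b \<noteq> c" using assms(1) by (metis card_3_iff)
  have mem: "a \<in> T" "b \<in> T" "c \<in> T" unfolding abc(1) by simp_all
  then have nM: "a \<noteq> M" "b \<noteq> M" "c \<noteq> M" using \<open>M \<notin> T\<close> by blast+
  have "i < n \<and> dev \<sigma> h i p = 0" if "i \<in> T" "i \<noteq> M" for i
    using that(1) m dev_H[OF that(2)] unfolding T by simp
  from this[OF mem(1) nM(1)] this[OF mem(2) nM(2)] this[OF mem(3) nM(3)]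
  show False using generic_not_concurrent[OF generic _ _ _ abc(2-4)] by blast
qed

lemma short_edge_even:
  assumes T: "{f, s, g} = {i. i < m \<and> dev \<sigma> (H t0) i p = 0}" and ne: "f \<noteq> s" "s \<noteq> g" "f \<noteq> g"
    and c: "s = nxt m f" "g = nxt m s" "\<not> adjacent m f g"
  shows "\<forall>\<^sub>F t in at t0. even (card {c \<in> classes m. lines c \<subseteq> {f, s, g} \<and> counted_class m (H t) c})"
proof -
  note lt = triple_members(1-3)[OF T] and p = triple_members(4-6)[OF T]
  have "M \<in> {f, s, g}" by (rule concurrent_M[OF _ T]) (use ne in simp)
  then obtain \<kappa> where \<kappa>: "\<kappa> \<noteq> 0" "\<And>r. area (H (t0 + r)) f s g = \<kappa> * r" using area_H[OF lt ne] p by blast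
  have ne0: "\<forall>\<^sub>F t in at t0. t \<noteq> t0" by (simp add: eventually_at_filter)
  have nr: "\<forall>\<^sub>F t in at t0. \<forall>\<tau>\<in>set (class_representatives f s g). \<forall>j\<in>{..<4}. \<forall>i\<in>{..<m} - {f, s, g}.
      0 < dev \<sigma> (H t0) i p * dev \<sigma> (H t) i (corner (sol (H t) \<tau>) j)"
    using class_representatives_near[OF T ne] unfolding eventually_at_filter by (rule eventually_mono) simp
  show ?thesis using ne0 nr
  proof eventually_elim
    case (elim t)
    have D: "area (H t) f s g \<noteq> 0" using \<kappa>(2)[of "t - t0"] \<kappa>(1) elim(1) by simp
    show ?case unfolding card_classes_within[OF m(1) lt ne]
      by (rule short_edge_event_sum[OF m(1) _ lt ne c D, of "\<lambda>i. dev \<sigma> (H t0) i p"]) (use elim(2) m in auto)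
  qed
qed

text \<open>Three cases according to the position of the three edges in the polygon. If no two of them are consecutive
  then no end point of an edge is near and nothing changes; the other two cases are the events counted
  above.\<close>
lemma concurrent_even:
  assumes T: "T \<in> concurrent"
  shows "\<forall>\<^sub>F s in at_right 0. even (card {c \<in> classes m. lines c \<subseteq> T \<and> differs s c})"
proof -
  obtain p where T: "T = {i. i < m \<and> dev \<sigma> (H t0) i p = 0}" "card T = 3" using assms by (auto simp: concurrent_def)
  obtain x y z where xyz: "T = {x, y, z}" "x \<noteq> y" "x \<noteq> z" "y \<noteq> z" using T(2) by (metis card_3_iff)
  note lt = triple_members(1-3)[OF T(1)[unfolded xyz(1)]]
  have MT: "M \<in> T" by (rule concurrent_M[OF T(2,1)])
  have sym: "even (card {c \<in> classes m. lines c \<subseteq> T \<and> differs s c})"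
    if "even (card {c \<in> classes m. lines c \<subseteq> T \<and> counted_class m (H (t0 + s)) c}
      + card {c \<in> classes m. lines c \<subseteq> T \<and> counted_class m (H (t0 - s)) c})" for s
  proof -
    define S where "S = {c \<in> classes m. lines c \<subseteq> T}"
    have S: "{c \<in> S. P c} = {c \<in> classes m. lines c \<subseteq> T \<and> P c}" for P by (auto simp: S_def)
    have fin: "finite S" using finite_classes by (simp add: S_def)
    show ?thesis using that parity_symmetric_difference[OF fin] unfolding differs_def S[symmetric] by blast
  qed
  show ?thesis
  proof (rule triple_adjacency_cases[OF m(2) lt xyz(2,4,3)])
    assume na: "\<And>i j. i \<in> {x, y, z} \<Longrightarrow> j \<in> {x, y, z} \<Longrightarrow> i \<noteq> j \<Longrightarrow> \<not> adjacent m i j"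
    have "\<forall>\<^sub>F s in at_right 0. \<forall>c\<in>{c \<in> classes m. lines c \<subseteq> T}. \<not> differs s c"
    proof (intro eventually_ball_finite ballI)
      fix c assume "c \<in> {c \<in> classes m. lines c \<subseteq> T}"
      then obtain \<tau> where t: "\<tau> \<in> tuples m" "c = cyc \<tau>" "set \<tau> \<subseteq> T" by (auto simp: classes_def lines_cyc tuples_length)
      have z: "Z \<tau> = (p, 0)" by (rule within_concurrent[OF T(1) solv[OF t(1)] t(3)])
      have "zeros \<tau> = {}"
      proof (rule ccontr)
        assume "zeros \<tau> \<noteq> {}"
        then obtain j k where jk: "(j, k) \<in> zeros \<tau>" by auto
        note b = zeros_bounds[OF t(1) jk]
        have "k \<in> T" using jk b(2) z by (auto simp: zeros_def T(1) corner_def)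
        moreover have "\<tau> ! j \<in> T" using t(3) b(1) tuples_length[OF t(1)] nth_mem by (metis subsetD)
        moreover have "adjacent m (\<tau> ! j) k"
          using jk adjacent_nxt adjacent_prv[OF tuples_nth[OF t(1) b(1)]] by (auto simp: zeros_def)
        ultimately show False using na b(3) xyz(1) by auto
      qed
      then show "\<forall>\<^sub>F s in at_right 0. \<not> differs s c" using steady_differs[OF t(1)] t(2) by simp
    qed (simp add: finite_classes)
    then show ?thesis by eventually_elim (smt (verit) Collect_empty_eq card.empty even_zero mem_Collect_eq)
  next
    fix e f g assume efg: "{e, f, g} = {x, y, z}" "e \<noteq> f" "f \<noteq> g" "e \<noteq> g" "g = nxt m f" "\<not> adjacent m e f" "\<not> adjacent m g e"
    have T': "{e, f, g} = {i. i < m \<and> dev \<sigma> (H t0) i p = 0}" "T = {e, f, g}"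
      using trans[OF efg(1) trans[OF xyz(1)[symmetric] T(1)]] trans[OF xyz(1) efg(1)[symmetric]] .
    note lt' = triple_members(1-3)[OF T'(1)] and p = triple_members(4-6)[OF T'(1)]
    obtain \<kappa> where \<kappa>: "\<kappa> \<noteq> 0" "\<And>r. area (H (t0 + r)) e f g = \<kappa> * r"
      using area_H[OF lt' efg(2,3,4)] p MT T'(2) by blast
    define c where "c i = dev \<sigma> (H t0) i p" for i
    define Be where "Be \<longleftrightarrow> c (prv m e) * c (nxt m e) * ((\<sigma> e - \<sigma> (prv m e)) * (\<sigma> e - \<sigma> (nxt m e))) < 0"
    define a b v where "a = - c (prv m f) * ((\<sigma> f - \<sigma> (prv m f)) * (\<sigma> f - \<sigma> g)) / (\<sigma> f - \<sigma> e)"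
      and "b = - c (nxt m g) * ((\<sigma> g - \<sigma> f) * (\<sigma> g - \<sigma> (nxt m g))) / (\<sigma> e - \<sigma> g)"
      and "v = c (prv m e) * (\<sigma> e - \<sigma> (prv m e)) / (\<sigma> f - \<sigma> g)"
    have m3: "3 \<le> m" using m by simp
    have S: "card {c \<in> classes m. lines c \<subseteq> T \<and> counted_class m (H t) c}
        = (if Be then vertex_count a b v (cot f g) (cot g e) (cot e f) (area (H t) e f g) else 0)"
      if "t \<noteq> t0" and nr: "\<forall>\<tau>\<in>set (class_representatives e f g). \<forall>j\<in>{..<4}. \<forall>i\<in>{..<m} - {e, f, g}.
        0 < dev \<sigma> (H t0) i p * dev \<sigma> (H t) i (corner (sol (H t) \<tau>) j)" for t
    proof -
      have D: "area (H t) e f g \<noteq> 0" using \<kappa>(2)[of "t - t0"] \<kappa>(1) that(1) by simp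
      show ?thesis unfolding T'(2) card_classes_within[OF m(1) lt' efg(2,3,4)] Be_def a_def b_def v_def
        by (rule vertex_event_sum[OF m(1) m3 lt' efg(2,3,4,5,6,7) D]) (use nr in \<open>auto simp: c_def\<close>)
    qed
    have pos: "\<forall>\<^sub>F s in at_right (0::real). 0 < s" by (rule eventually_at_right_less)
    note ev = shift_filter[OF class_representatives_near[OF T'(1) efg(2,3,4)]]
    have pg: "prv m g = f" using efg(5) prv_nxt lt' by simp
    have out: "c i \<noteq> 0" if "i < m" "i \<notin> {e, f, g}" for i using that unfolding T'(1) c_def by simp
    have fe: "\<not> adjacent m f e" "\<not> adjacent m e g" using efg(6,7) adjacent_sym by blast+
    have "prv m e \<noteq> f" "prv m e \<noteq> g" "prv m f \<noteq> e" "nxt m g \<noteq> e"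
      using efg(6,7) fe adjacent_nxt[of m g] adjacent_prv[OF lt'(1)] adjacent_prv[OF lt'(2)] by auto
    moreover have "prv m f \<noteq> g" "nxt m g \<noteq> f" using prv_neq_nxt[OF m3 lt'(2)] prv_neq_nxt[OF m3 lt'(3)] efg(5) pg by auto
    moreover have nn: "prv m e \<noteq> e" "prv m f \<noteq> f" "nxt m g \<noteq> g" using prv_neq[of m] nxt_neq[of m] m lt' by auto
    ultimately have "c (prv m e) \<noteq> 0" "c (prv m f) \<noteq> 0" "c (nxt m g) \<noteq> 0"
      using out nxt_less prv_less lt' by auto
    moreover have "\<sigma> e \<noteq> \<sigma> (prv m e)" "\<sigma> f \<noteq> \<sigma> (prv m f)" "\<sigma> g \<noteq> \<sigma> (nxt m g)" "\<sigma> f \<noteq> \<sigma> g" "\<sigma> f \<noteq> \<sigma> e" "\<sigma> e \<noteq> \<sigma> g"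
      using slopes_distinct[of e "prv m e"] slopes_distinct[of f "prv m f"] slopes_distinct[of g "nxt m g"]
        slopes_distinct[of f g] slopes_distinct[of f e] slopes_distinct[of e g]
        nn efg(2-4) lt' m prv_less[OF lt'(1)] prv_less[OF lt'(2)] nxt_less[OF lt'(3)] by auto
    ultimately have nz: "a \<noteq> 0" "b \<noteq> 0" "v \<noteq> 0" by (simp_all add: a_def b_def v_def)
    have "area (H (t0 + 1)) e f g \<noteq> 0" using \<kappa> by simp
    moreover have ltn: "e < n" "f < n" "g < n" using lt' m by auto
    ultimately have E: "even (vertex_count a b v (cot f g) (cot g e) (cot e f) r + vertex_count a b v (cot f g) (cot g e) (cot e f) (- r))" for r
      using vertex_event_even[OF ltn efg(2,3,4) _ nz] by blast
    show ?thesis using ev(1) ev(2) pos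
    proof eventually_elim
      case (elim s)
      have 1: "area (H (t0 + s)) e f g = \<kappa> * s" "area (H (t0 - s)) e f g = - (\<kappa> * s)" using \<kappa>(2)[of s] \<kappa>(2)[of "- s"] by simp_all
      show ?case
        by (rule sym) (use S[OF _ elim(1)] S[OF _ elim(2)] elim(3) E[of "\<kappa> * s"] in \<open>simp add: 1\<close>)
    qed
  next
    fix f s' g assume fsg: "{f, s', g} = {x, y, z}" "f \<noteq> s'" "s' \<noteq> g" "f \<noteq> g" "s' = nxt m f" "g = nxt m s'" "\<not> adjacent m f g"
    have T': "{f, s', g} = {i. i < m \<and> dev \<sigma> (H t0) i p = 0}" "T = {f, s', g}"
      using trans[OF fsg(1) trans[OF xyz(1)[symmetric] T(1)]] trans[OF xyz(1) fsg(1)[symmetric]] .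
    have at: "\<forall>\<^sub>F t in at t0. even (card {c \<in> classes m. lines c \<subseteq> T \<and> counted_class m (H t) c})"
      unfolding T'(2) by (rule short_edge_even[OF T'(1) fsg(2-7)])
    then have nh: "\<forall>\<^sub>F t in nhds t0. t \<noteq> t0 \<longrightarrow> even (card {c \<in> classes m. lines c \<subseteq> T \<and> counted_class m (H t) c})"
      by (simp add: eventually_at_filter)
    have pos: "\<forall>\<^sub>F s in at_right (0::real). 0 < s" by (rule eventually_at_right_less)
    show ?thesis using shift_filter[OF nh] pos
      by eventually_elim (rule sym, simp)
  qed
qed

end

section \<open>The parity is unchanged by a sweep\<close>

context sweep
begin

text \<open>The classes that differ before and after \<open>t0\<close> split into those at squares of positive size, which are
  paired, and for each concurrent triple an even number of others.\<close>
lemma symmetric_parity: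
  "\<forall>\<^sub>F s in at_right 0. even (square_count m (H (t0 + s)) + square_count m (H (t0 - s)))"
proof -
  define conc where "conc c \<longleftrightarrow> (\<exists>T\<in>concurrent. lines c \<subseteq> T)" for c
  have A: "\<forall>\<^sub>F s in at_right 0. \<forall>c\<in>classes m. \<not> conc c \<longrightarrow> (differs s c \<longleftrightarrow> c \<in> regular_classes)"
  proof (rule eventually_ball_finite[OF finite_classes], rule ballI)
    fix c assume "c \<in> classes m"
    then obtain \<tau> where t: "\<tau> \<in> tuples m" "c = cyc \<tau>" by (auto simp: classes_def)
    have l: "lines c = set \<tau>" unfolding t(2) by (rule lines_cyc[OF tuples_length[OF t(1)]])
    show "\<forall>\<^sub>F s in at_right 0. \<not> conc c \<longrightarrow> (differs s c \<longleftrightarrow> c \<in> regular_classes)"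
    proof (cases "snd (Z \<tau>) = 0")
      case False
      show ?thesis using regular_differs[OF t(1) False] unfolding t(2) by eventually_elim simp
    next
      case True
      show ?thesis
      proof (cases "conc c")
        case False
        then have z: "zeros \<tau> = {}" using degenerate_no_zeros[OF t(1) True] l by (simp add: conc_def)
        have nr: "c \<notin> regular_classes" using regular_class_iff[OF t(1)] True t(2) by (simp add: regular_flipping_def)
        show ?thesis using steady_differs[OF t(1) z] unfolding t(2)[symmetric] by eventually_elim (simp add: nr)
      qed simp
    qed
  qed
  have B: "\<forall>\<^sub>F s in at_right 0. \<forall>T\<in>concurrent. even (card {c \<in> classes m. lines c \<subseteq> T \<and> differs s c})"
    by (rule eventually_ball_finite[OF finite_concurrent]) (simp add: concurrent_even)
  have reg: "\<not> conc c" if c: "c \<in> regular_classes" for c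
  proof
    assume "conc c"
    then obtain T where T: "T \<in> concurrent" "lines c \<subseteq> T" by (auto simp: conc_def)
    then obtain y where y: "T = {i. i < m \<and> dev \<sigma> (H t0) i y = 0}" by (auto simp: concurrent_def)
    obtain \<tau> where r: "regular_flipping \<tau>" "c = cyc \<tau>" using c by (auto simp: regular_classes_def)
    then have t: "\<tau> \<in> tuples m" by (simp add: regular_flipping_def)
    have "set \<tau> \<subseteq> T" using T(2) r(2) lines_cyc[OF tuples_length[OF t]] by simp
    then have "Z \<tau> = (y, 0)" by (rule within_concurrent[OF y solv[OF t]])
    then show False using r(1) by (simp add: regular_flipping_def)
  qed
  show ?thesis using A B
  proof eventually_elim
    case (elim s)
    define D where "D T = {c \<in> classes m. lines c \<subseteq> T \<and> differs s c}" for T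
    have fin: "finite (D T)" for T using finite_classes by (simp add: D_def)
    have disj: "D T \<inter> D T' = {}" if "T \<in> concurrent" "T' \<in> concurrent" "T \<noteq> T'" for T T'
    proof (rule ccontr)
      assume "D T \<inter> D T' \<noteq> {}"
      then obtain c where c: "c \<in> classes m" "lines c \<subseteq> T" "lines c \<subseteq> T'" by (auto simp: D_def)
      then obtain \<tau> where t: "\<tau> \<in> tuples m" "c = cyc \<tau>" by (auto simp: classes_def)
      then have "set \<tau> \<subseteq> T" "set \<tau> \<subseteq> T'" using c lines_cyc[OF tuples_length[OF t(1)]] by simp_all
      then show False using concurrent_unique[OF t(1)] that by blast
    qed
    have "{c \<in> classes m. differs s c} = regular_classes \<union> (\<Union>T\<in>concurrent. D T)"
    proof (intro equalityI subsetI)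
      fix c assume "c \<in> {c \<in> classes m. differs s c}"
      then show "c \<in> regular_classes \<union> (\<Union>T\<in>concurrent. D T)"
        using elim(1) by (cases "conc c") (auto simp: conc_def D_def)
    next
      fix c assume "c \<in> regular_classes \<union> (\<Union>T\<in>concurrent. D T)"
      then show "c \<in> {c \<in> classes m. differs s c}"
        using elim(1) reg regular_classes_sub by (auto simp: D_def)
    qed
    moreover have "regular_classes \<inter> (\<Union>T\<in>concurrent. D T) = {}"
      using reg by (auto simp: D_def conc_def)
    moreover have "finite regular_classes" using finite_subset[OF regular_classes_sub finite_classes] .
    moreover have "finite (\<Union>T\<in>concurrent. D T)" using finite_concurrent fin by simp
    ultimately have "card {c \<in> classes m. differs s c} = card regular_classes + card (\<Union>T\<in>concurrent. D T)"
      by (simp add: card_Un_disjoint)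
    also have "card (\<Union>T\<in>concurrent. D T) = (\<Sum>T\<in>concurrent. card (D T))"
      by (rule card_UN_disjoint) (use finite_concurrent fin disj in auto)
    finally have "even (card {c \<in> classes m. differs s c})"
      using even_regular_classes elim(2) by (simp add: D_def dvd_sum)
    then show ?case
      using parity_symmetric_difference[OF finite_classes[of m]] unfolding differs_def square_count_def by blast
  qed
qed

lemma square_count_eventually_constant:
  "\<exists>N. \<forall>\<^sub>F t in at_right t0. square_count m (H t) = N" "\<exists>N. \<forall>\<^sub>F t in at_left t0. square_count m (H t) = N"
proof -
  have *: "\<exists>N. \<forall>\<^sub>F t in F. square_count m (H t) = N"
    if F: "\<And>\<tau>. \<tau> \<in> tuples m \<Longrightarrow> \<exists>b. \<forall>\<^sub>F t in F. counted m (H t) \<tau> = b" for F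
  proof -
    have "\<exists>b. \<forall>\<^sub>F t in F. counted_class m (H t) c = b" if "c \<in> classes m" for c
      using that F counted_class_cyc[OF solv] by (auto simp: classes_def)
    then obtain b where b: "\<And>c. c \<in> classes m \<Longrightarrow> \<forall>\<^sub>F t in F. counted_class m (H t) c = b c" by metis
    then have "\<forall>\<^sub>F t in F. \<forall>c\<in>classes m. counted_class m (H t) c = b c"
      by (intro eventually_ball_finite[OF finite_classes]) blast
    then have "\<forall>\<^sub>F t in F. square_count m (H t) = card {c \<in> classes m. b c}"
      by eventually_elim (simp add: square_count_def cong: conj_cong)
    then show ?thesis by blast
  qed
  show "\<exists>N. \<forall>\<^sub>F t in at_right t0. square_count m (H t) = N" "\<exists>N. \<forall>\<^sub>F t in at_left t0. square_count m (H t) = N"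
    by (rule *, rule counted_eventually_constant, assumption)+
qed

text \<open>The count is constant on either side of \<open>t0\<close>; comparing \<open>t0 + s\<close> with \<open>t0 - s\<close> links the two sides.\<close>
lemma parity_eventually_constant:
  "\<exists>b. \<forall>\<^sub>F t in at t0. odd (square_count m (H t)) = b"
proof -
  obtain N N' where N: "\<forall>\<^sub>F t in at_right t0. square_count m (H t) = N" "\<forall>\<^sub>F t in at_left t0. square_count m (H t) = N'"
    using square_count_eventually_constant by blast
  have "\<forall>\<^sub>F s in at_right 0. square_count m (H (t0 + s)) = N"
    using N(1) unfolding eventually_at_right_to_0[of _ t0] by (simp add: add.commute)
  moreover have "\<forall>\<^sub>F s in at_right 0. square_count m (H (t0 - s)) = N'"
    using N(2) unfolding eventually_at_left_to_right eventually_at_right_to_0[of _ "- t0"] by simp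
  ultimately have "\<forall>\<^sub>F s in at_right (0::real). even (N + N')"
    using symmetric_parity by eventually_elim simp
  then have "even (N + N')" by simp
  then have "\<forall>\<^sub>F t in at t0. odd (square_count m (H t)) = odd N"
    unfolding eventually_at_split using N by (auto elim!: eventually_mono)
  then show ?thesis by blast
qed

end

section \<open>Removing a line\<close>

context slopes
begin

lemma generic_corner_off_lines:
  assumes g: "generic h" and s: "solvable \<tau>" and c: "3 \<le> card (set \<tau>)" and jk: "j < 4" "k < n" "k \<noteq> \<tau> ! j"
  shows "dev \<sigma> h k (corner (sol h \<tau>) j) \<noteq> 0"
proof
  assume z: "dev \<sigma> h k (corner (sol h \<tau>) j) = 0"
  have len: "length \<tau> = 4" and sub: "set \<tau> \<subseteq> {..<n}" using s by (simp_all add: solvable_def)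
  define J0 where "J0 = (\<lambda>i. (i, \<tau> ! i)) ` {..<4}"
  define J where "J = insert (j, k) J0"
  have "card J0 = 4" unfolding J0_def by (subst card_image) (auto simp: inj_on_def)
  moreover have "finite J0" "(j, k) \<notin> J0" using jk by (auto simp: J0_def)
  ultimately have "card J = 5" by (auto simp: J_def card_insert_if)
  moreover have "J \<subseteq> {..<4} \<times> {..<n}"
  proof -
    have "\<tau> ! i < n" if "i < 4" for i using sub len that nth_mem by (metis lessThan_iff subsetD)
    then show ?thesis using jk by (auto simp: J_def J0_def)
  qed
  moreover have "lin \<sigma> i x (sol h \<tau>) = h x" if "(i, x) \<in> J" for i x
    using that z sol_incident[OF s, of _ h] by (auto simp: J_def J0_def dev_corner)
  ultimately have w: "snd (sol h \<tau>) = 0" using five_incidences[OF g] by blast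
  have d: "dev \<sigma> h i (fst (sol h \<tau>)) = 0" if i: "i \<in> set \<tau>" for i
  proof -
    obtain j where "j < 4" "\<tau> ! j = i" using i len by (metis in_set_conv_nth)
    then show ?thesis using incident_dev[OF s, of j h] w by (simp add: corner_def)
  qed
  obtain S where S: "S \<subseteq> set \<tau>" "card S = 3" using c by (meson obtain_subset_with_card_n)
  then obtain a b c where abc: "S = {a, b, c}" "a \<noteq> b" "a \<noteq> c" "b \<noteq> c" by (metis card_3_iff)
  have "a \<in> set \<tau>" "b \<in> set \<tau>" "c \<in> set \<tau>" using S abc by auto
  then show False using generic_not_concurrent[OF g _ _ _ abc(2-4)] d sub by blast
qed

text \<open>In the generic position no counted configuration has a corner at the end of an edge. For a crossing the
  third line through its point would violate the concurrency condition.\<close>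
lemma generic_off_neighbours:
  assumes g: "generic h" and mn: "m \<le> n" and t: "\<tau> \<in> tuples m" and jk: "j < 4" "k < n" "k \<noteq> \<tau> ! j"
    and adj: "crossing \<tau> \<Longrightarrow> adjacent m (\<tau> ! j) k"
  shows "dev \<sigma> h k (corner (sol h \<tau>) j) \<noteq> 0"
proof (cases "3 \<le> card (set \<tau>)")
  case True
  then show ?thesis using generic_corner_off_lines[OF g tuples_solvable[OF t mn] _ jk] by blast
next
  case False
  then have c: "crossing \<tau>" "\<not> adjacent m (\<tau> ! 0) (\<tau> ! 1)" using t by (auto simp: tuples_def)
  then obtain p q where pq: "p \<noteq> q" "\<tau> = [p, q, p, q]" using crossing_iff[OF tuples_length[OF t]] by blast
  have s: "solvable \<tau>" by (rule tuples_solvable[OF t mn])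
  have lt: "p < n" "q < n" using s pq by (auto simp: solvable_def)
  have flat: "corner (sol h \<tau>) i = fst (sol h \<tau>)" for i using sol_crossing[OF lt pq(1)] pq(2) by (simp add: corner_def)
  have d: "dev \<sigma> h p (fst (sol h \<tau>)) = 0" "dev \<sigma> h q (fst (sol h \<tau>)) = 0"
    using incident_dev[OF s, of 0 h] incident_dev[OF s, of 1 h] by (simp_all add: flat[unfolded pq(2)] pq(2))
  have tj: "\<tau> ! j \<in> {p, q}" using jk(1) by (cases rule: less_4_cases) (auto simp: pq)
  have "\<not> adjacent m p q" "\<not> adjacent m q p" using c(2) adjacent_sym by (auto simp: pq)
  then have "k \<noteq> p" "k \<noteq> q" using adj[OF c(1)] tj jk(3) by auto
  then show ?thesis using generic_not_concurrent[OF g lt jk(2) pq(1)] d unfolding flat by blast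
qed

lemma in_edge_travel:
  "in_edge m h i p \<longleftrightarrow> sgn (travel m h i p) * sgn (dev \<sigma> h (nxt m i) p * (\<sigma> i - \<sigma> (nxt m i))) = -1"
  unfolding in_edge_def travel_def sgn_mult[symmetric] sgn_1_neg by (simp add: ac_simps)

lemma counted_agree:
  assumes s: "solvable \<tau>" and eq: "sol h1 \<tau> = sol h2 \<tau>"
    and o: "\<And>j. j < 4 \<Longrightarrow> sgn (travel m1 h1 (\<tau> ! j) (corner (sol h1 \<tau>) j)) = sgn (travel m2 h2 (\<tau> ! j) (corner (sol h1 \<tau>) j))"
    and x: "\<And>j. j < 4 \<Longrightarrow> sgn (dev \<sigma> h1 (nxt m1 (\<tau> ! j)) (corner (sol h1 \<tau>) j) * (\<sigma> (\<tau> ! j) - \<sigma> (nxt m1 (\<tau> ! j))))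
      = sgn (dev \<sigma> h2 (nxt m2 (\<tau> ! j)) (corner (sol h1 \<tau>) j) * (\<sigma> (\<tau> ! j) - \<sigma> (nxt m2 (\<tau> ! j))))"
  shows "counted m1 h1 \<tau> \<longleftrightarrow> counted m2 h2 \<tau>"
proof -
  have 1: "in_edge m1 h1 (\<tau> ! j) (corner (sol h1 \<tau>) j) \<longleftrightarrow> in_edge m2 h2 (\<tau> ! j) (corner (sol h2 \<tau>) j)" if "j < 4" for j
    unfolding in_edge_travel eq[symmetric] o[OF that] x[OF that] ..
  have 2: "travel m1 h1 (\<tau> ! 0) (fst (sol h1 \<tau>)) * travel m1 h1 (\<tau> ! 1) (fst (sol h1 \<tau>)) * (1 + \<sigma> (\<tau> ! 0) * \<sigma> (\<tau> ! 1)) < 0 \<longleftrightarrow>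
     travel m2 h2 (\<tau> ! 0) (fst (sol h2 \<tau>)) * travel m2 h2 (\<tau> ! 1) (fst (sol h2 \<tau>)) * (1 + \<sigma> (\<tau> ! 0) * \<sigma> (\<tau> ! 1)) < 0"
    if c: "crossing \<tau>"
  proof -
    have "length \<tau> = 4" using s by (simp add: solvable_def)
    then obtain p q where pq: "p \<noteq> q" "\<tau> = [p, q, p, q]" using crossing_iff c by blast
    then have "p < n" "q < n" using s by (auto simp: solvable_def)
    then have flat: "corner (sol h1 \<tau>) j = fst (sol h1 \<tau>)" for j using sol_crossing[of p q h1] pq by (simp add: corner_def)
    show ?thesis using o[of 0] o[of 1] unfolding flat eq[symmetric] sgn_1_neg[symmetric] sgn_mult by simp
  qed
  show ?thesis unfolding counted_def using 1 2 by blast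
qed

text \<open>Let the edge on line \<open>M\<close> approach the vertex \<open>q\<close> where the lines \<open>M - 1\<close> and \<open>0\<close> meet. Tuples on these three
  lines are even in number. Any other tuple using \<open>M\<close> would need a corner on the tiny edge, hence at \<open>q\<close> in
  the limit, and is not counted. The remaining tuples do not involve \<open>M\<close>; the edges on \<open>M - 1\<close> and \<open>0\<close> now end near \<open>q\<close>,
  which is the vertex they have in the polygon without \<open>M\<close>. The crossing of \<open>M - 1\<close> and \<open>0\<close> is not a tuple any
  more, since these edges have become neighbours.\<close>
lemma remove_line:
  assumes g: "generic h" and Mn: "3 \<le> M" "Suc M \<le> n"
  shows "\<exists>t1. \<forall>\<^sub>F t in at t1. odd (square_count (Suc M) (h(M := t))) = odd (square_count M h)"
proof -
  \<comment> \<open>The crossing of the lines \<open>M - 1\<close> and \<open>0\<close>, and the moment when line \<open>M\<close> passes through it.\<close>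
  define q where "q = fst (sol h [M - 1, 0, M - 1, 0])"
  define t1 where "t1 = Im q - \<sigma> M * Re q"
  interpret sweep \<sigma> n "Suc M" M h t1 by unfold_locales (use Mn g in auto)
  have lt: "M - 1 < n" "(0::nat) < n" "M < n" "M - 1 \<noteq> 0" "M - 1 \<noteq> M" "M \<noteq> 0" using Mn by auto
  have sv: "solvable [M - 1, 0, M - 1, 0]" using lt by (simp add: solvable_def crossing_def)
  have flat: "corner (sol h [M - 1, 0, M - 1, 0]) j = q" for j using sol_crossing[OF lt(1,2,4), of h] by (simp add: corner_def q_def)
  have q: "dev \<sigma> h (M - 1) q = 0" "dev \<sigma> h 0 q = 0"
    using incident_dev[OF sv, of 0 h] incident_dev[OF sv, of 1 h] by (simp_all add: flat[simplified])
  have qM: "dev \<sigma> (H t1) M q = 0" by (simp add: dev_def H_def t1_def)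
  define T where "T = {M - 1, M, 0}"
  have T: "{M - 1, M, 0} = {i. i < Suc M \<and> dev \<sigma> (H t1) i q = 0}"
  proof (intro equalityI subsetI)
    fix i assume i: "i \<in> {i. i < Suc M \<and> dev \<sigma> (H t1) i q = 0}"
    show "i \<in> {M - 1, M, 0}"
    proof (rule ccontr)
      assume n: "i \<notin> {M - 1, M, 0}"
      then have "dev \<sigma> h i q = 0" "i < n" using i dev_H[of i t1 q] Mn by auto
      then show False using generic_not_concurrent[OF g lt(1,2) _ lt(4), of i q] n q by auto
    qed
  next
    fix i assume "i \<in> {M - 1, M, 0}"
    then show "i \<in> {i. i < Suc M \<and> dev \<sigma> (H t1) i q = 0}" using q qM dev_H[of "M - 1" t1 q] dev_H[of 0 t1 q] lt by auto
  qed
  have nx: "M = nxt (Suc M) (M - 1)" "0 = nxt (Suc M) M" "\<not> adjacent (Suc M) (M - 1) 0"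
    using Mn by (auto simp: nxt_def adjacent_def)
  have B: "\<forall>\<^sub>F t in at t1. even (card {c \<in> classes (Suc M). lines c \<subseteq> T \<and> counted_class (Suc M) (H t) c})"
    unfolding T_def by (rule short_edge_even[OF T lt(5,6,4) nx])
  have onM: "dev \<sigma> h' a p = (\<sigma> i - \<sigma> a) * (Re p - Re q)" if "dev \<sigma> h' i p = 0" "dev \<sigma> h' i q = 0" "dev \<sigma> h' a q = 0" for h' a i p
    using that by (simp add: dev_def algebra_simps)
  have C: "\<forall>\<^sub>F t in at t1. \<forall>c\<in>classes (Suc M). M \<in> lines c \<and> \<not> lines c \<subseteq> T \<longrightarrow> \<not> counted_class (Suc M) (H t) c"
  proof (rule eventually_ball_finite[OF finite_classes], rule ballI)
    fix c assume "c \<in> classes (Suc M)"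
    then obtain \<tau> where t: "\<tau> \<in> tuples (Suc M)" "c = cyc \<tau>" by (auto simp: classes_def)
    have l: "lines c = set \<tau>" unfolding t(2) by (rule lines_cyc[OF tuples_length[OF t(1)]])
    have cc: "counted_class (Suc M) h' c \<longleftrightarrow> counted (Suc M) h' \<tau>" for h' using counted_class_cyc[OF solv[OF t(1)]] t(2) by simp
    show "\<forall>\<^sub>F t in at t1. M \<in> lines c \<and> \<not> lines c \<subseteq> T \<longrightarrow> \<not> counted_class (Suc M) (H t) c"
    proof (cases "M \<in> lines c \<and> \<not> lines c \<subseteq> T")
      case True
      then obtain j where j: "j < 4" "\<tau> ! j = M" using l tuples_length[OF t(1)] by (metis in_set_conv_nth)
      define p where "p = corner (Z \<tau>) j"
      have pM: "dev \<sigma> (H t1) M p = 0" using incident_dev[OF solv[OF t(1)] j(1), of "H t1"] by (simp add: p_def j)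
      have qH: "dev \<sigma> (H t1) (M - 1) q = 0" "dev \<sigma> (H t1) 0 q = 0" using q dev_H lt by simp_all
      have dp: "dev \<sigma> (H t1) (M - 1) p = (\<sigma> M - \<sigma> (M - 1)) * (Re p - Re q)" "dev \<sigma> (H t1) 0 p = (\<sigma> M - \<sigma> 0) * (Re p - Re q)"
        by (rule onM[OF pM qM], rule qH)+
      have sne: "\<sigma> M \<noteq> \<sigma> (M - 1)" "\<sigma> M \<noteq> \<sigma> 0" using slopes_distinct lt by metis+
      have pr: "prv (Suc M) M = M - 1" "nxt (Suc M) M = 0" using Mn by (auto simp: prv_def nxt_def)
      have "Re p \<noteq> Re q"
      proof
        assume "Re p = Re q"
        then have d0: "dev \<sigma> (H t1) (M - 1) p = 0" "dev \<sigma> (H t1) 0 p = 0" using dp by simp_all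
        then have z: "(j, M - 1) \<in> zeros \<tau>" "(j, 0) \<in> zeros \<tau>" using j pr by (auto simp: zeros_def p_def)
        show False
        proof (cases "snd (Z \<tau>) = 0")
          case False then show False using zeros_unique[OF t(1) False z] lt by simp
        next
          case w: True
          then have "p = fst (Z \<tau>)" by (simp add: p_def corner_def)
          moreover have "p = q" by (rule concurrent_point_unique[OF _ _ lt(4), of "H t1"]) (use d0 qH Mn in auto)
          ultimately have "dev \<sigma> (H t1) i q = 0" if "i \<in> set \<tau>" for i using degenerate_lines[OF t(1) w that] by simp
          then have "set \<tau> \<subseteq> T" using t(1) T by (auto simp: T_def tuples_def)
          then show False using True l by simp
        qed
      qed
      then have nz: "dev \<sigma> (H t1) (M - 1) p \<noteq> 0" "dev \<sigma> (H t1) 0 p \<noteq> 0" unfolding dp using sne by auto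
      have pos: "sgn (dev \<sigma> (H t1) (M - 1) p) * sgn (dev \<sigma> (H t1) 0 p) * sgn ((\<sigma> M - \<sigma> (M - 1)) * (\<sigma> M - \<sigma> 0)) = 1"
        unfolding dp sgn_mult[symmetric] sgn_1_pos
      proof -
        have "(\<sigma> M - \<sigma> (M - 1)) * (Re p - Re q) * ((\<sigma> M - \<sigma> 0) * (Re p - Re q)) * ((\<sigma> M - \<sigma> (M - 1)) * (\<sigma> M - \<sigma> 0))
            = ((\<sigma> M - \<sigma> (M - 1)) * (\<sigma> M - \<sigma> 0) * (Re p - Re q))\<^sup>2" by (simp add: power2_eq_square)
        also have "0 < \<dots>" using sne \<open>Re p \<noteq> Re q\<close> by simp
        finally show "0 < (\<sigma> M - \<sigma> (M - 1)) * (Re p - Re q) * ((\<sigma> M - \<sigma> 0) * (Re p - Re q)) * ((\<sigma> M - \<sigma> (M - 1)) * (\<sigma> M - \<sigma> 0))" .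
      qed
      have "\<forall>\<^sub>F t in at t1. \<not> counted (Suc M) (H t) \<tau>"
        unfolding eventually_at_filter using near_sgn[OF solv[OF t(1)]]
      proof eventually_elim
        case (elim t)
        have "sgn (dev \<sigma> (H t) (M - 1) (corner (sol (H t) \<tau>) j)) = sgn (dev \<sigma> (H t1) (M - 1) p)"
          "sgn (dev \<sigma> (H t) 0 (corner (sol (H t) \<tau>) j)) = sgn (dev \<sigma> (H t1) 0 p)"
          using elim j(1) nz unfolding p_def by auto
        then have "\<not> in_edge (Suc M) (H t) (\<tau> ! j) (corner (sol (H t) \<tau>) j)"
          unfolding in_edge_sgn j(2) pr using pos by simp
        then show ?case using j(1) by (auto simp: counted_def)
      qed
      then show ?thesis unfolding cc by eventually_elim simp
    next
      case False
      then show ?thesis by (intro always_eventually) blast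
    qed
  qed
  have cls: "classes M = {c \<in> classes (Suc M). \<not> M \<in> lines c \<and> \<not> lines c \<subseteq> T}"
  proof -
    have adj: "adjacent M a b \<longleftrightarrow> adjacent (Suc M) a b \<or> {a, b} = {M - 1, 0}" if "a < M" "b < M" for a b
      using that Mn by (auto simp: adjacent_def nxt_def doubleton_eq_iff split: if_splits)
    have tup: "\<tau> \<in> tuples M \<longleftrightarrow> \<tau> \<in> tuples (Suc M) \<and> M \<notin> set \<tau> \<and> \<not> set \<tau> \<subseteq> T" for \<tau>
    proof (cases "length \<tau> = 4 \<and> set \<tau> \<subseteq> {..<M}")
      case True
      then have M': "M \<notin> set \<tau>" and sub: "set \<tau> \<subseteq> {..<Suc M}" by auto
      have s2: "set \<tau> \<subseteq> T \<longleftrightarrow> set \<tau> \<subseteq> {M - 1, 0}" using M' by (auto simp: T_def)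
      show ?thesis
      proof (cases "3 \<le> card (set \<tau>)")
        case c3: True
        have "\<not> set \<tau> \<subseteq> {M - 1, 0}"
        proof
          assume "set \<tau> \<subseteq> {M - 1, 0}"
          then have "card (set \<tau>) \<le> card {M - 1, 0}" by (intro card_mono) auto
          then show False using c3 lt(4) by simp
        qed
        then show ?thesis using True c3 M' s2 sub unfolding tuples_def by simp
      next
        case c3: False
        show ?thesis
        proof (cases "crossing \<tau>")
          case False then show ?thesis using c3 by (simp add: tuples_def)
        next
          case cr: True
          then obtain a b where ab: "a \<noteq> b" "\<tau> = [a, b, a, b]" using crossing_iff True by blast
          have "set \<tau> \<subseteq> {M - 1, 0} \<longleftrightarrow> {a, b} = {M - 1, 0}" using ab by (auto simp: doubleton_eq_iff)
          then show ?thesis using adj[of a b] True c3 cr M' s2 sub ab(2) unfolding tuples_def by simp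
        qed
      qed
    next
      case False
      then have "\<tau> \<notin> tuples M" by (auto simp: tuples_def)
      moreover have "M \<in> set \<tau>" if "\<tau> \<in> tuples (Suc M)"
        using that False by (auto simp: tuples_def less_Suc_eq subset_iff)
      ultimately show ?thesis by blast
    qed
    show ?thesis
    proof (intro equalityI subsetI)
      fix c assume "c \<in> classes M"
      then obtain \<tau> where t: "\<tau> \<in> tuples M" "c = cyc \<tau>" by (auto simp: classes_def)
      then show "c \<in> {c \<in> classes (Suc M). \<not> M \<in> lines c \<and> \<not> lines c \<subseteq> T}"
        using tup[of \<tau>] lines_cyc[OF tuples_length[OF t(1)]] by (auto simp: classes_def)
    next
      fix c assume c: "c \<in> {c \<in> classes (Suc M). \<not> M \<in> lines c \<and> \<not> lines c \<subseteq> T}"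
      then obtain \<tau> where t: "\<tau> \<in> tuples (Suc M)" "c = cyc \<tau>" by (auto simp: classes_def)
      then show "c \<in> classes M"
        using tup[of \<tau>] c lines_cyc[OF tuples_length[OF t(1)]] by (auto simp: classes_def)
    qed
  qed
  have A: "\<forall>\<^sub>F t in at t1. \<forall>c\<in>classes M. counted_class (Suc M) (H t) c \<longleftrightarrow> counted_class M h c"
  proof (rule eventually_ball_finite[OF finite_classes], rule ballI)
    fix c assume c: "c \<in> classes M"
    then obtain \<tau> where t: "\<tau> \<in> tuples M" "c = cyc \<tau>" by (auto simp: classes_def)
    have mn: "M \<le> n" using Mn by simp
    have s: "solvable \<tau>" by (rule tuples_solvable[OF t(1) mn])
    have ltj: "\<tau> ! j < M" if "j < 4" for j by (rule tuples_nth[OF t(1) that])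
    have solH: "sol (H t) \<tau> = sol h \<tau>" for t
      by (rule sol_unique[OF s, symmetric]) (use ltj sol_incident[OF s, of _ h] in \<open>auto simp: H_def\<close>)
    define p where "p j = corner (sol h \<tau>) j" for j
    have p0: "dev \<sigma> h (\<tau> ! j) (p j) = 0" if "j < 4" for j using incident_dev[OF s that] by (simp add: p_def)
    have near: "\<forall>\<^sub>F t in at t1. sgn (dev \<sigma> (H t) M (p j)) = sgn (dev \<sigma> (H t1) M (p j))"
      if "dev \<sigma> (H t1) M (p j) \<noteq> 0" for j
    proof -
      have d: "dev \<sigma> (H t) M (p j) = dev \<sigma> (H t1) M (p j) - (t - t1)" for t by (simp add: dev_def H_def)
      have l: "((\<lambda>t. dev \<sigma> (H t1) M (p j) - (t - t1)) \<longlongrightarrow> dev \<sigma> (H t1) M (p j) - (t1 - t1)) (at t1)" by (intro tendsto_intros)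
      show ?thesis
      proof (cases "dev \<sigma> (H t1) M (p j) > 0")
        case True
        then have "\<forall>\<^sub>F t in at t1. 0 < dev \<sigma> (H t1) M (p j) - (t - t1)" using order_tendstoD(1)[OF l, of 0] by simp
        then show ?thesis by eventually_elim (simp add: d[symmetric] True)
      next
        case False
        then have "dev \<sigma> (H t1) M (p j) < 0" using that by simp
        then have "\<forall>\<^sub>F t in at t1. dev \<sigma> (H t1) M (p j) - (t - t1) < 0" using order_tendstoD(2)[OF l, of 0] by simp
        then show ?thesis by eventually_elim (simp add: d[symmetric] \<open>dev \<sigma> (H t1) M (p j) < 0\<close>)
      qed
    qed
    have key: "\<forall>\<^sub>F t in at t1. sgn (dev \<sigma> (H t) M (p j) * (\<sigma> i - \<sigma> M)) = sgn (dev \<sigma> h k (p j) * (\<sigma> i - \<sigma> k))"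
      if j: "j < 4" and i: "\<tau> ! j = i" and ik: "(i = 0 \<and> k = M - 1) \<or> (i = M - 1 \<and> k = 0)" for j i k
    proof -
      have kM: "k < n" "k \<noteq> i" "k \<noteq> M" "i \<noteq> M" "i < n" using ik Mn by auto
      have "adjacent M i k" using ik Mn by (auto simp: adjacent_def nxt_def)
      then have nz: "dev \<sigma> h k (p j) \<noteq> 0"
        unfolding p_def by (intro generic_off_neighbours[OF g mn t(1) j kM(1)]) (use i kM in auto)
      have qi: "dev \<sigma> h i q = 0" "dev \<sigma> h k q = 0" using ik q by auto
      have pi: "dev \<sigma> h i (p j) = 0" using p0[OF j] i by simp
      have dk: "dev \<sigma> h k (p j) = (\<sigma> i - \<sigma> k) * (Re (p j) - Re q)" by (rule onM[OF pi qi])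
      have "dev \<sigma> (H t1) i (p j) = 0" "dev \<sigma> (H t1) i q = 0" using pi qi dev_H kM by simp_all
      then have dM: "dev \<sigma> (H t1) M (p j) = (\<sigma> i - \<sigma> M) * (Re (p j) - Re q)" using onM qM by blast
      have sne: "\<sigma> i \<noteq> \<sigma> M" "\<sigma> i \<noteq> \<sigma> k" using slopes_distinct[of i M] slopes_distinct[of i k] kM lt by auto
      have "dev \<sigma> (H t1) M (p j) \<noteq> 0" using nz sne unfolding dk dM by simp
      from near[OF this] show ?thesis
      proof eventually_elim
        case (elim t)
        have "sgn (dev \<sigma> (H t) M (p j) * (\<sigma> i - \<sigma> M)) = sgn ((\<sigma> i - \<sigma> M) * (\<sigma> i - \<sigma> M)) * sgn (Re (p j) - Re q)"
          unfolding sgn_mult elim dM by simp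
        also have "\<dots> = sgn ((\<sigma> i - \<sigma> k) * (\<sigma> i - \<sigma> k)) * sgn (Re (p j) - Re q)"
          using sne by (simp add: sgn_mult)
        also have "\<dots> = sgn (dev \<sigma> h k (p j) * (\<sigma> i - \<sigma> k))" unfolding dk sgn_mult by simp
        finally show ?case .
      qed
    qed
    have o: "\<forall>\<^sub>F t in at t1. \<forall>j\<in>{..<4}. sgn (travel (Suc M) (H t) (\<tau> ! j) (p j)) = sgn (travel M h (\<tau> ! j) (p j))"
    proof (rule eventually_ball_finite, simp, rule ballI)
      fix j assume j: "j \<in> {..<4::nat}"
      show "\<forall>\<^sub>F t in at t1. sgn (travel (Suc M) (H t) (\<tau> ! j) (p j)) = sgn (travel M h (\<tau> ! j) (p j))"
      proof (cases "\<tau> ! j = 0")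
        case True
        then show ?thesis using key[of j 0 "M - 1"] j by (simp add: travel_def prv_def)
      next
        case False
        then have e: "prv (Suc M) (\<tau> ! j) = prv M (\<tau> ! j)" "prv M (\<tau> ! j) \<noteq> M" using ltj[of j] j by (auto simp: prv_def)
        show ?thesis unfolding travel_def e(1) dev_H[OF e(2)] by simp
      qed
    qed
    have x: "\<forall>\<^sub>F t in at t1. \<forall>j\<in>{..<4}. sgn (dev \<sigma> (H t) (nxt (Suc M) (\<tau> ! j)) (p j) * (\<sigma> (\<tau> ! j) - \<sigma> (nxt (Suc M) (\<tau> ! j))))
        = sgn (dev \<sigma> h (nxt M (\<tau> ! j)) (p j) * (\<sigma> (\<tau> ! j) - \<sigma> (nxt M (\<tau> ! j))))"
    proof (rule eventually_ball_finite, simp, rule ballI)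
      fix j assume j: "j \<in> {..<4::nat}"
      show "\<forall>\<^sub>F t in at t1. sgn (dev \<sigma> (H t) (nxt (Suc M) (\<tau> ! j)) (p j) * (\<sigma> (\<tau> ! j) - \<sigma> (nxt (Suc M) (\<tau> ! j))))
        = sgn (dev \<sigma> h (nxt M (\<tau> ! j)) (p j) * (\<sigma> (\<tau> ! j) - \<sigma> (nxt M (\<tau> ! j))))"
      proof (cases "\<tau> ! j = M - 1")
        case True
        then have e: "nxt (Suc M) (\<tau> ! j) = M" "nxt M (\<tau> ! j) = 0" using Mn by (auto simp: nxt_def)
        show ?thesis unfolding e using key[of j "M - 1" 0] j True by simp
      next
        case False
        then have e: "nxt (Suc M) (\<tau> ! j) = nxt M (\<tau> ! j)" "nxt M (\<tau> ! j) \<noteq> M" using ltj[of j] j Mn by (auto simp: nxt_def)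
        show ?thesis unfolding e(1) dev_H[OF e(2)] by simp
      qed
    qed
    show "\<forall>\<^sub>F t in at t1. counted_class (Suc M) (H t) c \<longleftrightarrow> counted_class M h c"
      using o x
    proof eventually_elim
      case (elim t)
      have "counted (Suc M) (H t) \<tau> \<longleftrightarrow> counted M h \<tau>"
        by (rule counted_agree[OF s solH]) (use elim in \<open>auto simp: solH p_def[symmetric]\<close>)
      then show ?case unfolding t(2) counted_class_cyc[OF s] .
    qed
  qed
  have "\<forall>\<^sub>F t in at t1. odd (square_count (Suc M) (H t)) = odd (square_count M h)"
    using A B C
  proof eventually_elim
    case (elim t)
    define S1 where "S1 = {c \<in> classes (Suc M). lines c \<subseteq> T \<and> counted_class (Suc M) (H t) c}"
    define S2 where "S2 = {c \<in> classes M. counted_class M h c}"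
    have "{c \<in> classes (Suc M). counted_class (Suc M) (H t) c} = S1 \<union> S2"
    proof (intro equalityI subsetI)
      fix c assume c: "c \<in> {c \<in> classes (Suc M). counted_class (Suc M) (H t) c}"
      show "c \<in> S1 \<union> S2"
      proof (cases "lines c \<subseteq> T")
        case True then show ?thesis using c by (simp add: S1_def)
      next
        case False
        then have "M \<notin> lines c" using elim(3) c by blast
        then have "c \<in> classes M" using c False cls by blast
        then show ?thesis using elim(1) c by (simp add: S2_def)
      qed
    next
      fix c assume "c \<in> S1 \<union> S2"
      then show "c \<in> {c \<in> classes (Suc M). counted_class (Suc M) (H t) c}"
        using elim(1) cls by (auto simp: S1_def S2_def)
    qed
    moreover have "S1 \<inter> S2 = {}" using cls by (auto simp: S1_def S2_def)
    moreover have "finite S1" "finite S2" using finite_classes by (simp_all add: S1_def S2_def)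
    ultimately have "square_count (Suc M) (H t) = card S1 + square_count M h"
      unfolding square_count_def[of "Suc M"] square_count_def[of M] by (simp add: card_Un_disjoint S2_def)
    then show ?case using elim(2) by (simp add: S1_def)
  qed
  then show ?thesis unfolding H_def by blast
qed

lemma start_parity:
  assumes g: "generic h" and m: "m \<le> n" "4 \<le> m" "M < m"
  shows "\<forall>\<^sub>F t in at (h M). odd (square_count m (h(M := t))) = odd (square_count m h)"
proof -
  interpret sweep \<sigma> n m M h "h M" by unfold_locales (use m g in auto)
  have z: "zeros \<tau> = {}" if t: "\<tau> \<in> tuples m" for \<tau>
  proof (rule ccontr)
    assume "zeros \<tau> \<noteq> {}"
    then obtain j k where jk: "(j, k) \<in> zeros \<tau>" by auto
    note b = zeros_bounds[OF t jk]
    have "adjacent m (\<tau> ! j) k" using jk adjacent_nxt adjacent_prv[OF tuples_nth[OF t b(1)]] by (auto simp: zeros_def)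
    then have "dev \<sigma> h k (corner (sol h \<tau>) j) \<noteq> 0"
      by (intro generic_off_neighbours[OF g m(1) t b(1) _ b(3)]) (use b(2) m in auto)
    then show False using jk by (simp add: zeros_def H_self)
  qed
  have "\<forall>\<^sub>F t in nhds (h M). \<forall>c\<in>classes m. counted_class m (H t) c = counted_class m h c"
  proof (rule eventually_ball_finite[OF finite_classes], rule ballI)
    fix c assume "c \<in> classes m"
    then obtain \<tau> where t: "\<tau> \<in> tuples m" "c = cyc \<tau>" by (auto simp: classes_def)
    show "\<forall>\<^sub>F t in nhds (h M). counted_class m (H t) c = counted_class m h c"
      using no_zeros_steady[OF t(1) z[OF t(1)]] unfolding t(2) counted_class_cyc[OF solv[OF t(1)]] H_self .
  qed
  then have "\<forall>\<^sub>F t in nhds (h M). odd (square_count m (H t)) = odd (square_count m h)"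
    by eventually_elim (simp add: square_count_def cong: conj_cong)
  then show ?thesis unfolding H_def eventually_at_filter by (rule eventually_mono) simp
qed

text \<open>A function on the real line that is constant in a punctured neighbourhood of every point has the same limit
  everywhere, by connectedness.\<close>
lemma sweep_parity_invariant:
  assumes g: "generic h" and m: "m \<le> n" "4 \<le> m" "M < m"
    and a: "\<forall>\<^sub>F t in at ta. odd (square_count m (h(M := t))) = A"
    and b: "\<forall>\<^sub>F t in at tb. odd (square_count m (h(M := t))) = B"
  shows "A = B"
proof -
  define E where "E t = odd (square_count m (h(M := t)))" for t
  have ex: "\<exists>b. \<forall>\<^sub>F t in at t0. E t = b" for t0
  proof -
    interpret sweep \<sigma> n m M h t0 by unfold_locales (use m g in auto)
    show ?thesis using parity_eventually_constant unfolding H_def E_def .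
  qed
  then obtain c where c: "\<And>t0. \<forall>\<^sub>F t in at t0. E t = c t0" by metis
  have uniq: "P = Q" if "\<forall>\<^sub>F t in at x. E t = P" "\<forall>\<^sub>F t in at x. E t = Q" for x :: real and P Q
  proof -
    have "\<forall>\<^sub>F t in at x. P = Q" using that by eventually_elim simp
    then show ?thesis by simp
  qed
  have loc: "\<forall>\<^sub>F y in at x. c x = c y" for x
  proof -
    have "\<forall>\<^sub>F y in at x. \<forall>\<^sub>F t in at y. E t = c x"
    proof -
      obtain S where S: "open S" "x \<in> S" "\<And>t. t \<in> S \<Longrightarrow> t \<noteq> x \<Longrightarrow> E t = c x"
        using c[of x] unfolding eventually_at_topological by blast
      have "\<forall>\<^sub>F t in at y. E t = c x" if "y \<in> S" "y \<noteq> x" for y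
        unfolding eventually_at_topological using S that by (intro exI[of _ "S - {x}"]) (auto intro: open_delete)
      then show ?thesis unfolding eventually_at_topological using S(1,2) by blast
    qed
    then show ?thesis by (rule eventually_mono) (use uniq c in blast)
  qed
  have "c ta = c tb"
    by (rule connected_local_const[of UNIV]) (use loc in auto)
  then show ?thesis using uniq[OF a[folded E_def] c] uniq[OF b[folded E_def] c] by simp
qed

text \<open>Delete the lines one by one until a triangle is left.\<close>
theorem odd_square_count:
  assumes g: "generic h" and m: "3 \<le> m" "m \<le> n"
  shows "odd (square_count m h)"
  using m
proof (induction m rule: nat_induct_at_least)
  case base
  then show ?case using triangle_odd g by blast
next
  case (Suc M)
  then have IH: "odd (square_count M h)" by simp
  obtain t1 where t1: "\<forall>\<^sub>F t in at t1. odd (square_count (Suc M) (h(M := t))) = odd (square_count M h)"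
    using remove_line[OF g] Suc by blast
  have M: "Suc M \<le> n" "4 \<le> Suc M" "M < Suc M" using Suc by auto
  have "odd (square_count (Suc M) h) = odd (square_count M h)"
    by (rule sweep_parity_invariant[OF g M start_parity[OF g M] t1])
  then show ?case using IH by simp
qed

end

section \<open>Generic lines are dense\<close>

lemma finite_quadratic_roots:
  fixes a b c :: real
  assumes "a \<noteq> 0 \<or> b \<noteq> 0 \<or> c \<noteq> 0"
  shows "finite {x. a * x\<^sup>2 + b * x + c = 0}"
proof -
  have "[:c, b, a:] \<noteq> 0" using assms by auto
  then have "finite {x. poly [:c, b, a:] x = 0}" by (rule poly_roots_finite)
  then show ?thesis by (simp add: power2_eq_square algebra_simps)
qed

lemma avoid_finite:
  fixes x \<delta> :: real
  assumes "finite S" "0 < \<delta>"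
  obtains y where "\<bar>y - x\<bar> < \<delta>" "x < y" "y \<notin> S"
proof -
  have "infinite {x<..<x + \<delta>}" using assms(2) by (simp add: infinite_Ioo)
  then have "\<not> {x<..<x + \<delta>} \<subseteq> S" using assms(1) finite_subset by blast
  then obtain y where "y \<in> {x<..<x + \<delta>}" "y \<notin> S" by blast
  then show ?thesis by (intro that[of y]) auto
qed

text \<open>The determinant of the four equations for the square with slopes \<open>s0\<close> to \<open>s3\<close>, in closed form.\<close>
lemma system_determinant:
  fixes s0 s1 s2 s3 a b c d :: real
  assumes "b + d - s0 * (a + c) = 0" "b + c - s1 * (a - d) = 0" "b - d - s2 * (a - c) = 0" "b - c - s3 * (a + d) = 0"
    and nz: "(s2 - s0) * (s3 - s1) - (s1 + s3) * (1 - s0 * s2) + (s0 + s2) * (1 - s1 * s3) \<noteq> 0"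
  shows "a = 0 \<and> b = 0 \<and> c = 0 \<and> d = 0"
proof -
  define D where "D = (s2 - s0) * (s3 - s1) - (s1 + s3) * (1 - s0 * s2) + (s0 + s2) * (1 - s1 * s3)"
  have "D * a = 0" "D * b = 0" "D * c = 0" "D * d = 0" unfolding D_def using assms(1-4) by algebra+
  then show ?thesis using nz by (simp add: D_def)
qed

text \<open>Regularity of tuples is the only condition on slopes that involves more than two lines. It fails for finitely
  many values of a new slope \<open>x\<close>, because the determinant is a nonzero polynomial in \<open>x\<close> of degree at most two.\<close>
definition irregular :: "(nat \<Rightarrow> real) \<Rightarrow> nat list \<Rightarrow> bool" where
  "irregular \<sigma> \<tau> \<longleftrightarrow> (\<exists>z. z \<noteq> 0 \<and> (\<forall>j<4. lin \<sigma> j (\<tau> ! j) z = 0))"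

lemma irregular_determinant:
  assumes "irregular \<sigma> [i0, i1, i2, i3]"
  shows "(\<sigma> i2 - \<sigma> i0) * (\<sigma> i3 - \<sigma> i1) - (\<sigma> i1 + \<sigma> i3) * (1 - \<sigma> i0 * \<sigma> i2) + (\<sigma> i0 + \<sigma> i2) * (1 - \<sigma> i1 * \<sigma> i3) = 0"
proof (rule ccontr)
  assume nz: "\<not> ?thesis"
  obtain z where z: "z \<noteq> 0" "\<forall>j<4. lin \<sigma> j ([i0, i1, i2, i3] ! j) z = 0" using assms by (auto simp: irregular_def)
  have "Re (fst z) = 0 \<and> Im (fst z) = 0 \<and> Re (snd z) = 0 \<and> Im (snd z) = 0"
    by (rule system_determinant[OF _ _ _ _ nz]) (use z(2) in \<open>simp_all add: all_less_4 lin_def corner_simps\<close>)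
  then show False using z(1) by (simp add: prod_eq_iff complex_eq_iff)
qed

lemma rot_eq_0: "rot z = 0 \<longleftrightarrow> z = 0"
  by (auto simp: rot_def prod_eq_iff)

lemma irregular_rotate: "irregular \<sigma> [b, c, d, a] \<longleftrightarrow> irregular \<sigma> [a, b, c, d]"
proof
  assume "irregular \<sigma> [a, b, c, d]"
  then obtain z where "z \<noteq> 0" "\<forall>j<4. lin \<sigma> j ([a, b, c, d] ! j) z = 0" by (auto simp: irregular_def)
  then show "irregular \<sigma> [b, c, d, a]" unfolding irregular_def
    by (intro exI[of _ "rot z"]) (simp add: all_less_4 lin_def corner_rot rot_eq_0)
next
  assume "irregular \<sigma> [b, c, d, a]"
  then obtain z where "z \<noteq> 0" "\<forall>j<4. lin \<sigma> j ([b, c, d, a] ! j) z = 0" by (auto simp: irregular_def)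
  then show "irregular \<sigma> [a, b, c, d]" unfolding irregular_def
    by (intro exI[of _ "rot (rot (rot z))"]) (simp add: all_less_4 lin_def corner_rot rot_eq_0)
qed

lemma finite_irregular_once:
  assumes lt: "a < n" "c < n" "d < n" and np: "a \<noteq> c \<Longrightarrow> 1 + \<sigma> a * \<sigma> c \<noteq> 0"
  shows "finite {x. irregular (\<sigma>(n := x)) [a, n, c, d]}"
proof -
  define p q r where "p = \<sigma> a" and "q = \<sigma> c" and "r = \<sigma> d"
  define A where "A = - (q - p) - (1 - p * q) - r * (p + q)"
  define B where "B = (q - p) * r - r * (1 - p * q) + (p + q)"
  have "A \<noteq> 0 \<or> B \<noteq> 0"
  proof (rule ccontr)
    assume "\<not> ?thesis"
    then have "(1 + p * q)\<^sup>2 = 0" unfolding A_def B_def by algebra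
    then have z: "1 + p * q = 0" by simp
    then have "a = c" using np by (auto simp: p_def q_def)
    then have "1 + p\<^sup>2 = 0" using z by (simp add: p_def q_def power2_eq_square)
    then show False by (smt (verit) zero_le_power2)
  qed
  then have "finite {x. 0 * x\<^sup>2 + A * x + B = 0}" by (intro finite_quadratic_roots) simp
  moreover have "{x. irregular (\<sigma>(n := x)) [a, n, c, d]} \<subseteq> {x. 0 * x\<^sup>2 + A * x + B = 0}"
  proof
    fix x assume "x \<in> {x. irregular (\<sigma>(n := x)) [a, n, c, d]}"
    then have "irregular (\<sigma>(n := x)) [a, n, c, d]" by simp
    from irregular_determinant[OF this]
    have "(q - p) * (r - x) - (x + r) * (1 - p * q) + (p + q) * (1 - x * r) = 0"
      using lt by (simp add: p_def q_def r_def)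
    then show "x \<in> {x. 0 * x\<^sup>2 + A * x + B = 0}" unfolding A_def B_def by (simp add: algebra_simps)
  qed
  ultimately show ?thesis by (rule finite_subset[rotated])
qed

lemma finite_irregular_side:
  assumes lt: "c < n" "d < n"
  shows "finite {x. irregular (\<sigma>(n := x)) [n, n, c, d]}"
proof -
  define q r where "q = \<sigma> c" and "r = \<sigma> d"
  have "1 + q - r \<noteq> 0 \<or> - (q + r) \<noteq> 0 \<or> q * r - r + q \<noteq> 0"
  proof (rule ccontr)
    assume "\<not> ?thesis"
    then have "r = 1 / 2" "q = - 1 / 2" "q * r - r + q = 0" by auto
    then show False by simp
  qed
  then have "finite {x. (1 + q - r) * x\<^sup>2 + (- (q + r)) * x + (q * r - r + q) = 0}" by (rule finite_quadratic_roots)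
  moreover have "{x. irregular (\<sigma>(n := x)) [n, n, c, d]} \<subseteq> {x. (1 + q - r) * x\<^sup>2 + (- (q + r)) * x + (q * r - r + q) = 0}"
  proof
    fix x assume "x \<in> {x. irregular (\<sigma>(n := x)) [n, n, c, d]}"
    then have "irregular (\<sigma>(n := x)) [n, n, c, d]" by simp
    from irregular_determinant[OF this]
    have "(q - x) * (r - x) - (x + r) * (1 - x * q) + (x + q) * (1 - x * r) = 0"
      using lt by (simp add: q_def r_def)
    then show "x \<in> {x. (1 + q - r) * x\<^sup>2 + (- (q + r)) * x + (q * r - r + q) = 0}"
      by (simp add: algebra_simps power2_eq_square)
  qed
  ultimately show ?thesis by (rule finite_subset[rotated])
qed

lemma finite_irregular_diagonal:
  assumes lt: "b < n" "d < n"
  shows "finite {x. irregular (\<sigma>(n := x)) [n, b, n, d]}"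
proof -
  define q r where "q = \<sigma> b" and "r = \<sigma> d"
  have "q + r \<noteq> 0 \<or> 2 * (1 - q * r) \<noteq> 0 \<or> - (q + r) \<noteq> 0"
  proof (rule ccontr)
    assume "\<not> ?thesis"
    then have "r = - q" "q * r = 1" by auto
    then have "- q\<^sup>2 = 1" by (simp add: power2_eq_square)
    then show False by (smt (verit) zero_le_power2)
  qed
  then have "finite {x. (q + r) * x\<^sup>2 + (2 * (1 - q * r)) * x + (- (q + r)) = 0}" by (rule finite_quadratic_roots)
  moreover have "{x. irregular (\<sigma>(n := x)) [n, b, n, d]} \<subseteq> {x. (q + r) * x\<^sup>2 + (2 * (1 - q * r)) * x + (- (q + r)) = 0}"
  proof
    fix x assume "x \<in> {x. irregular (\<sigma>(n := x)) [n, b, n, d]}"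
    then have "irregular (\<sigma>(n := x)) [n, b, n, d]" by simp
    from irregular_determinant[OF this]
    have "(x - x) * (r - q) - (q + r) * (1 - x * x) + (x + x) * (1 - q * r) = 0"
      using lt by (simp add: q_def r_def)
    then show "x \<in> {x. (q + r) * x\<^sup>2 + (2 * (1 - q * r)) * x + (- (q + r)) = 0}"
      by (simp add: algebra_simps power2_eq_square)
  qed
  ultimately show ?thesis by (rule finite_subset[rotated])
qed

text \<open>Up to rotation the new line is used once, twice at neighbouring corners, or twice at opposite corners; three times is
  impossible with three distinct lines.\<close>
lemma finite_irregular:
  assumes np: "\<And>a c. a < n \<Longrightarrow> c < n \<Longrightarrow> a \<noteq> c \<Longrightarrow> 1 + \<sigma> a * \<sigma> c \<noteq> 0"
    and t: "length \<tau> = 4" "set \<tau> \<subseteq> {..<Suc n}" "n \<in> set \<tau>" "3 \<le> card (set \<tau>)"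
  shows "finite {x. irregular (\<sigma>(n := x)) \<tau>}"
proof -
  obtain a b c d where tt: "\<tau> = [a, b, c, d]" using t(1) by (rule length4_obtain)
  have r: "finite {x. irregular (\<sigma>(n := x)) [a, b, c, d]} \<longleftrightarrow> finite {x. irregular (\<sigma>(n := x)) [b, c, d, a]}" for a b c d
    by (simp only: irregular_rotate)
  note once = finite_irregular_once[of _ n _ _ \<sigma>] and side = finite_irregular_side[of _ n _ \<sigma>] and diag = finite_irregular_diagonal[of _ n _ \<sigma>]
  have lt: "e < n" if "e \<in> set \<tau>" "e \<noteq> n" for e using t(2) that by auto
  have c3: "\<not> {a, b, c, d} \<subseteq> {n, e}" for e
  proof
    assume "{a, b, c, d} \<subseteq> {n, e}"
    then have "card (set \<tau>) \<le> card {n, e}" unfolding tt by (intro card_mono) auto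
    also have "\<dots> \<le> 2" by (simp add: card_insert_if)
    finally show False using t(4) by simp
  qed
  have l: "a \<noteq> n \<Longrightarrow> a < n" "b \<noteq> n \<Longrightarrow> b < n" "c \<noteq> n \<Longrightarrow> c < n" "d \<noteq> n \<Longrightarrow> d < n" using lt by (simp_all add: tt)
  show ?thesis
  proof (cases "a = n")
    case an: True
    show ?thesis
    proof (cases "b = n")
      case bn: True
      have "c \<noteq> n" "d \<noteq> n" using c3[of c] c3[of d] an bn by auto
      then show ?thesis using side[OF l(3,4)] an bn tt by simp
    next
      case bn: False
      show ?thesis
      proof (cases "c = n")
        case cn: True
        have "d \<noteq> n" using c3[of b] an cn by auto
        then show ?thesis using diag[OF l(2,4)] an bn cn tt by simp
      next
        case cn: False
        show ?thesis
        proof (cases "d = n")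
          case dn: True
          have "finite {x. irregular (\<sigma>(n := x)) [n, n, b, c]}" using side[OF l(2,3)] bn cn by simp
          then show ?thesis using r[of n b c n] r[of b c n n] r[of c n n b] unfolding tt an dn by blast
        next
          case dn: False
          have "finite {x. irregular (\<sigma>(n := x)) [d, n, b, c]}" using once[OF l(4,2,3)] bn cn dn np l by blast
          then show ?thesis using r[of n b c d] r[of b c d n] r[of c d n b] unfolding tt an by blast
        qed
      qed
    qed
  next
    case an: False
    show ?thesis
    proof (cases "b = n")
      case bn: True
      show ?thesis
      proof (cases "c = n")
        case cn: True
        have dn: "d \<noteq> n" using c3[of a] bn cn by auto
        have "finite {x. irregular (\<sigma>(n := x)) [n, n, d, a]}" using side[OF l(4,1)] an dn by simp
        then show ?thesis using r[of a n n d] unfolding tt bn cn by blast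
      next
        case cn: False
        show ?thesis
        proof (cases "d = n")
          case dn: True
          have "finite {x. irregular (\<sigma>(n := x)) [n, c, n, a]}" using diag[OF l(3,1)] an cn by simp
          then show ?thesis using r[of a n c n] unfolding tt bn dn by blast
        next
          case dn: False
          show ?thesis using once[OF l(1,3,4)] an cn dn np l bn tt by blast
        qed
      qed
    next
      case bn: False
      show ?thesis
      proof (cases "c = n")
        case cn: True
        show ?thesis
        proof (cases "d = n")
          case dn: True
          have "finite {x. irregular (\<sigma>(n := x)) [n, n, a, b]}" using side[OF l(1,2)] an bn by simp
          then show ?thesis using r[of a b n n] r[of b n n a] unfolding tt cn dn by blast
        next
          case dn: False
          have "finite {x. irregular (\<sigma>(n := x)) [b, n, d, a]}" using once[OF l(2,4,1)] an bn dn np l by blast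
          then show ?thesis using r[of a b n d] unfolding tt cn by blast
        qed
      next
        case cn: False
        then have dn: "d = n" using t(3) an bn tt by simp
        have "finite {x. irregular (\<sigma>(n := x)) [c, n, a, b]}" using once[OF l(3,1,2)] an bn cn np l by blast
        then show ?thesis using r[of a b c n] r[of b c n a] unfolding tt dn by blast
      qed
    qed
  qed
qed

lemma slopes_perturbation:
  fixes \<sigma>0 :: "nat \<Rightarrow> real"
  assumes "0 < \<delta>"
  shows "\<exists>\<sigma>. slopes \<sigma> n \<and> (\<forall>i<n. \<bar>\<sigma> i - \<sigma>0 i\<bar> < \<delta>)"
proof (induction n)
  case 0
  show ?case by (intro exI[of _ \<sigma>0]) (auto simp: slopes_def)
next
  case (Suc n)
  then obtain \<sigma> where s: "slopes \<sigma> n" and close: "\<forall>i<n. \<bar>\<sigma> i - \<sigma>0 i\<bar> < \<delta>" by blast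
  interpret slopes \<sigma> n by (rule s)
  define T where "T = {\<tau>. length \<tau> = 4 \<and> set \<tau> \<subseteq> {..<Suc n} \<and> n \<in> set \<tau> \<and> 3 \<le> card (set \<tau>)}"
  define Bad where "Bad = (\<Union>i<n. {\<sigma> i} \<union> {x. 0 * x\<^sup>2 + \<sigma> i * x + 1 = 0} \<union> {x. 0 * x\<^sup>2 + (1 + \<sigma> i) * x + (1 - \<sigma> i) = 0}
      \<union> {x. 0 * x\<^sup>2 + (\<sigma> i - 1) * x + (1 + \<sigma> i) = 0}) \<union> (\<Union>\<tau>\<in>T. {x. irregular (\<sigma>(n := x)) \<tau>})"
  have "finite T" unfolding T_def
    by (rule finite_subset[OF _ finite_lists_length_eq[of "{..<Suc n}" 4]]) auto
  moreover have "finite {x. irregular (\<sigma>(n := x)) \<tau>}" if "\<tau> \<in> T" for \<tau>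
    using that finite_irregular[of n \<sigma> \<tau>, OF not_perpendicular] unfolding T_def by blast
  moreover have "finite {x. 0 * x\<^sup>2 + \<sigma> i * x + 1 = 0}" "finite {x. 0 * x\<^sup>2 + (1 + \<sigma> i) * x + (1 - \<sigma> i) = 0}"
    "finite {x. 0 * x\<^sup>2 + (\<sigma> i - 1) * x + (1 + \<sigma> i) = 0}" for i
    by (rule finite_quadratic_roots, linarith)+
  ultimately have "finite Bad" unfolding Bad_def by (intro finite_UnI finite_UN_I finite_lessThan finite.intros)
  then obtain x where x: "\<bar>x - \<sigma>0 n\<bar> < \<delta>" "x \<notin> Bad" using avoid_finite[OF _ assms] by metis
  define \<sigma>' where "\<sigma>' = \<sigma>(n := x)"
  have old: "\<sigma>' i = \<sigma> i" if "i < n" for i using that by (simp add: \<sigma>'_def)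
  have new: "\<sigma>' n = x" by (simp add: \<sigma>'_def)
  have xb: "x \<noteq> \<sigma> i" "1 + \<sigma> i * x \<noteq> 0" "1 + \<sigma> i * x \<noteq> \<sigma> i - x" "1 + \<sigma> i * x \<noteq> x - \<sigma> i" if "i < n" for i
    using x(2) that unfolding Bad_def by (auto simp: algebra_simps)
  have "slopes \<sigma>' (Suc n)"
  proof
    fix i j :: nat assume ij: "i < Suc n" "j < Suc n" "i \<noteq> j"
    consider "i < n" "j < n" | "i = n" "j < n" | "i < n" "j = n" using ij by linarith
    then have "\<sigma>' i \<noteq> \<sigma>' j \<and> 1 + \<sigma>' i * \<sigma>' j \<noteq> 0 \<and> 1 + \<sigma>' i * \<sigma>' j \<noteq> \<sigma>' i - \<sigma>' j"
    proof cases
      case 1 then show ?thesis using slopes_distinct not_perpendicular not_diagonal ij(3) by (simp add: old)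
    next
      case 2 then show ?thesis using xb[of j] by (auto simp: old new mult.commute)
    next
      case 3 then show ?thesis using xb[of i] by (auto simp: old new)
    qed
    then show "\<sigma>' i \<noteq> \<sigma>' j" "1 + \<sigma>' i * \<sigma>' j \<noteq> 0" "1 + \<sigma>' i * \<sigma>' j \<noteq> \<sigma>' i - \<sigma>' j" by blast+
  next
    fix \<tau> z assume t: "length \<tau> = 4" "set \<tau> \<subseteq> {..<Suc n}" "3 \<le> card (set \<tau>)" "\<forall>j<4. lin \<sigma>' j (\<tau> ! j) z = 0"
    show "z = 0"
    proof (cases "n \<in> set \<tau>")
      case True
      then have "\<not> irregular \<sigma>' \<tau>" using x(2) t True unfolding Bad_def T_def \<sigma>'_def by blast
      then show ?thesis using t(4) unfolding irregular_def by blast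
    next
      case False
      then have sub: "set \<tau> \<subseteq> {..<n}" using t(2) by (auto simp: less_Suc_eq)
      have "lin \<sigma> j (\<tau> ! j) z = 0" if "j < 4" for j
      proof -
        have "\<tau> ! j \<in> set \<tau>" using that t(1) by simp
        then have "\<tau> ! j < n" using sub by blast
        then show ?thesis using t(4) that old by (simp add: lin_def)
      qed
      then show ?thesis using regular[OF t(1) sub t(3)] by blast
    qed
  qed
  moreover have "\<forall>i<Suc n. \<bar>\<sigma>' i - \<sigma>0 i\<bar> < \<delta>" using close x(1) by (auto simp: \<sigma>'_def less_Suc_eq)
  ultimately show ?case by blast
qed

text \<open>The property \<open>P\<close> holds only on a proper hyperplane of offsets.\<close>
definition forced :: "nat \<Rightarrow> ((nat \<Rightarrow> real) \<Rightarrow> bool) \<Rightarrow> bool" where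
  "forced n P \<longleftrightarrow> (\<exists>c. (\<exists>i<n. c i \<noteq> 0) \<and> (\<forall>h. P h \<longrightarrow> (\<Sum>i<n. c i * h i) = 0))"

text \<open>Along the curve \<open>h0 i + x^(i+1)\<close> a nonzero linear functional becomes a nonzero polynomial in \<open>x\<close>, so finitely many
  hyperplanes are avoided by all small \<open>x\<close> with finitely many exceptions.\<close>
lemma avoid_forced:
  fixes h0 :: "nat \<Rightarrow> real"
  assumes fin: "finite \<P>" and forced: "\<And>P. P \<in> \<P> \<Longrightarrow> forced n P" and \<delta>: "0 < \<delta>"
  obtains h where "\<And>i. i < n \<Longrightarrow> \<bar>h i - h0 i\<bar> < \<delta>" "\<And>P. P \<in> \<P> \<Longrightarrow> \<not> P h"
proof -
  have "\<forall>P\<in>\<P>. \<exists>c. (\<exists>i<n. c i \<noteq> 0) \<and> (\<forall>h. P h \<longrightarrow> (\<Sum>i<n. c i * h i) = 0)" using forced by (simp add: forced_def)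
  from bchoice[OF this] obtain c where cP: "\<forall>P\<in>\<P>. (\<exists>i<n. c P i \<noteq> 0) \<and> (\<forall>h. P h \<longrightarrow> (\<Sum>i<n. c P i * h i) = 0)" ..
  have c: "\<exists>i<n. c P i \<noteq> 0" "P h \<Longrightarrow> (\<Sum>i<n. c P i * h i) = 0" if "P \<in> \<P>" for P h
    using bspec[OF cP that] by simp_all
  \<comment> \<open>The condition along the curve \<open>x \<mapsto> h0 i + x^(i+1)\<close>, as a polynomial.\<close>
  define p where "p P = [:\<Sum>i<n. c P i * h0 i:] + (\<Sum>i<n. monom (c P i) (Suc i))" for P
  have "p P \<noteq> 0" if P: "P \<in> \<P>" for P
  proof
    assume z: "p P = 0"
    obtain i where i: "i < n" "c P i \<noteq> 0" using c(1)[OF P] by blast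
    have "coeff (p P) (Suc i) = (\<Sum>k<n. if k = i then c P k else 0)"
      by (simp add: p_def coeff_sum)
    also have "\<dots> = c P i" using i(1) by simp
    finally show False using z i(2) by simp
  qed
  then have roots: "finite (\<Union>P\<in>\<P>. {x. poly (p P) x = 0})" using fin poly_roots_finite by blast
  have "0 < min \<delta> 1" using \<delta> by simp
  then obtain x where x: "\<bar>x - 0\<bar> < min \<delta> 1" "0 < x" "x \<notin> (\<Union>P\<in>\<P>. {x. poly (p P) x = 0})"
    using avoid_finite[OF roots, of "min \<delta> 1" 0] by blast
  define h where "h i = h0 i + x ^ Suc i" for i
  show ?thesis
  proof (rule that[of h])
    fix i
    have "x ^ Suc i \<le> x ^ 1" using x by (intro power_decreasing) auto
    moreover have "h i - h0 i = x ^ Suc i" "0 < x ^ Suc i" using x(2) by (simp_all add: h_def)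
    ultimately show "\<bar>h i - h0 i\<bar> < \<delta>" using x(1,2) by (simp del: power_Suc)
  next
    fix P assume P: "P \<in> \<P>"
    have "(\<Sum>i<n. c P i * h i) = poly (p P) x"
      by (simp add: h_def p_def poly_sum poly_monom distrib_left sum.distrib)
    then show "\<not> P h" using c(2)[OF P] x(3) P by auto
  qed
qed

text \<open>More than four functionals on a space of dimension four.\<close>
lemma functionals_dependent:
  fixes \<phi> :: "'k \<Rightarrow> complex \<times> complex \<Rightarrow> real"
  assumes lin: "\<And>k. k \<in> K \<Longrightarrow> linear (\<phi> k)" and K: "finite K" "4 < card K"
  obtains c where "\<exists>k\<in>K. c k \<noteq> 0" "\<And>z. (\<Sum>k\<in>K. c k * \<phi> k z) = 0"
proof -
  define v where "v k = (\<Sum>b\<in>Basis. \<phi> k b *\<^sub>R b)" for k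
  have rep: "\<phi> k z = z \<bullet> v k" if "k \<in> K" for k z
  proof -
    have "\<phi> k z = \<phi> k (\<Sum>b\<in>Basis. (z \<bullet> b) *\<^sub>R b)" by (simp add: euclidean_representation)
    also have "\<dots> = (\<Sum>b\<in>Basis. (z \<bullet> b) * \<phi> k b)"
      using lin[OF that] by (simp add: linear_sum linear_scale)
    finally show ?thesis by (simp add: v_def inner_sum_right mult.commute)
  qed
  have "\<exists>c. (\<exists>k\<in>K. c k \<noteq> 0) \<and> (\<Sum>k\<in>K. c k *\<^sub>R v k) = 0"
  proof (cases "inj_on v K")
    case True
    have "DIM(complex \<times> complex) < card (v ` K)" using K card_image[OF True] by simp
    then have "dependent (v ` K)" by (intro dependent_biggerset)
    then obtain u where u: "\<exists>x\<in>v ` K. u x \<noteq> 0" "(\<Sum>x\<in>v ` K. u x *\<^sub>R x) = 0"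
      using dependent_finite[OF finite_imageI[OF K(1), of v]] by blast
    then have "(\<Sum>k\<in>K. (u \<circ> v) k *\<^sub>R v k) = 0" by (simp add: sum.reindex[OF True])
    then show ?thesis using u(1) by (intro exI[of _ "u \<circ> v"]) auto
  next
    case False
    then obtain a b where ab: "a \<in> K" "b \<in> K" "a \<noteq> b" "v a = v b" by (auto simp: inj_on_def)
    define c where "c k = (if k = a then 1 else if k = b then -1 else 0 :: real)" for k
    have "(\<Sum>k\<in>K. c k *\<^sub>R v k) = (\<Sum>k\<in>{a, b}. c k *\<^sub>R v k)"
      using K(1) ab by (intro sum.mono_neutral_right) (auto simp: c_def)
    also have "\<dots> = 0" using ab by (simp add: c_def)
    finally show ?thesis using ab(1) by (intro exI[of _ c]) (auto simp: c_def)
  qed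
  then obtain c where c: "\<exists>k\<in>K. c k \<noteq> 0" "(\<Sum>k\<in>K. c k *\<^sub>R v k) = 0" by blast
  have "(\<Sum>k\<in>K. c k * \<phi> k z) = z \<bullet> (\<Sum>k\<in>K. c k *\<^sub>R v k)" for z
    using rep by (simp add: inner_sum_right)
  then show ?thesis using c that by simp
qed

lemma sum_by_line:
  fixes c :: "nat \<times> nat \<Rightarrow> real"
  assumes J: "J \<subseteq> {..<4} \<times> {..<n}" and inj: "inj_on snd J"
  obtains c' where "\<And>h. (\<Sum>i<n. c' i * h i) = (\<Sum>k\<in>J. c k * h (snd k))" "\<And>k. k \<in> J \<Longrightarrow> c' (snd k) = c k"
proof -
  define c' where "c' i = (if i \<in> snd ` J then c (the_inv_into J snd i) else 0)" for i
  have eq: "c' (snd k) = c k" if "k \<in> J" for k using that by (simp add: c'_def the_inv_into_f_f[OF inj])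
  have "(\<Sum>i<n. c' i * h i) = (\<Sum>k\<in>J. c k * h (snd k))" for h
  proof -
    have "(\<Sum>i<n. c' i * h i) = (\<Sum>i\<in>snd ` J. c' i * h i)"
      using J by (intro sum.mono_neutral_right) (auto simp: c'_def)
    also have "\<dots> = (\<Sum>k\<in>J. c' (snd k) * h (snd k))" by (simp add: sum.reindex[OF inj])
    also have "\<dots> = (\<Sum>k\<in>J. c k * h (snd k))" by (rule sum.cong) (simp_all add: eq)
    finally show ?thesis .
  qed
  then show ?thesis using eq that by blast
qed

lemma chord_functional_nonzero:
  assumes "j < 4" "k < 4" "j \<noteq> k"
  obtains z where "lin \<sigma> j a z \<noteq> lin \<sigma> k a z"
proof (rule ccontr)
  assume "\<not> thesis"
  then have eq: "lin \<sigma> j a z = lin \<sigma> k a z" for z using that by blast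
  have "fst (chord_coefficients j k (\<sigma> a)) = 0" "snd (chord_coefficients j k (\<sigma> a)) = 0"
    using chord_equation[OF assms eq, of "(0, 1)"] chord_equation[OF assms eq, of "(0, \<i>)"] by simp_all
  then show False using chord_coefficients_cases[of j k "\<sigma> a"] by auto
qed

text \<open>Each condition in the definition of \<open>generic\<close> excludes offsets that satisfy a nontrivial linear relation: in the
  first two, five functionals of a square are dependent, and in the third the triangle of three lines has
  area zero. In the second one the relation must involve an offset, since the chord functional alone is
  not zero.\<close>
lemma (in slopes) generic_offsets:
  fixes h0 :: "nat \<Rightarrow> real"
  assumes \<delta>: "0 < \<delta>"
  obtains h where "generic h" "\<And>i. i < n \<Longrightarrow> \<bar>h i - h0 i\<bar> < \<delta>"
proof -
  define U where "U = ({..<4} \<times> {..<n} :: (nat \<times> nat) set)"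
  have finU: "finite U" by (simp add: U_def)
  define PA where "PA J h \<longleftrightarrow> (\<exists>z. \<forall>(j, i)\<in>J. lin \<sigma> j i z = h i)" for J :: "(nat \<times> nat) set" and h
  define PB where "PB = (\<lambda>(J :: (nat \<times> nat) set, j, k, a) h. \<exists>z. (\<forall>(j, i)\<in>J. lin \<sigma> j i z = h i) \<and> lin \<sigma> j a z = lin \<sigma> k a z)"
  define PC where "PC = (\<lambda>(a, b, c) h. \<exists>p. dev \<sigma> h a p = 0 \<and> dev \<sigma> h b p = 0 \<and> dev \<sigma> h c p = 0)"
  define IA where "IA = {J. J \<subseteq> U \<and> card J = 5 \<and> inj_on snd J}"
  define IB :: "((nat \<times> nat) set \<times> nat \<times> nat \<times> nat) set" where "IB = {(J, j, k, a). J \<subseteq> U \<and> card J = 4 \<and> inj_on snd J \<and> j < 4 \<and> k < 4 \<and> a < n \<and> j \<noteq> k}"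
  define IC where "IC = {(a, b, c). a < n \<and> b < n \<and> c < n \<and> a \<noteq> b \<and> a \<noteq> c \<and> b \<noteq> c}"
  have fin: "finite (PA ` IA \<union> PB ` IB \<union> PC ` IC)"
  proof -
    have "IA \<subseteq> Pow U" by (auto simp: IA_def)
    moreover have "IB \<subseteq> Pow U \<times> {..<4} \<times> {..<4} \<times> {..<n}" by (auto simp: IB_def)
    moreover have "IC \<subseteq> {..<n} \<times> {..<n} \<times> {..<n}" by (auto simp: IC_def)
    ultimately have "finite IA" "finite IB" "finite IC" using finU by (meson finite_Pow_iff finite_SigmaI finite_lessThan finite_subset)+
    then show ?thesis by simp
  qed
  have fA: "forced n (PA J)" if J: "J \<in> IA" for J
  proof -
    have J': "J \<subseteq> {..<4} \<times> {..<n}" "card J = 5" "inj_on snd J" using J by (auto simp: IA_def U_def)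
    have "finite J" using J'(2) by (metis card.infinite zero_neq_numeral)
    then obtain c where c: "\<exists>k\<in>J. c k \<noteq> 0" "\<And>z. (\<Sum>k\<in>J. c k * lin \<sigma> (fst k) (snd k) z) = 0"
      using functionals_dependent[of J "\<lambda>k. lin \<sigma> (fst k) (snd k)"] linear_lin J'(2) by auto
    obtain c' where c': "\<And>h. (\<Sum>i<n. c' i * h i) = (\<Sum>k\<in>J. c k * h (snd k))" "\<And>k. k \<in> J \<Longrightarrow> c' (snd k) = c k"
      using sum_by_line[OF J'(1,3), of c] by blast
    have "(\<Sum>i<n. c' i * h i) = 0" if P: "PA J h" for h
    proof -
      obtain z where z: "\<forall>(j, i)\<in>J. lin \<sigma> j i z = h i" using P unfolding PA_def by blast
      have "(\<Sum>k\<in>J. c k * h (snd k)) = (\<Sum>k\<in>J. c k * lin \<sigma> (fst k) (snd k) z)" by (rule sum.cong) (use z in auto)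
      then show ?thesis using c(2) c'(1) by simp
    qed
    moreover have "\<exists>i<n. c' i \<noteq> 0" using c(1) c'(2) J'(1) by fastforce
    ultimately show ?thesis unfolding forced_def by blast
  qed
  have fB: "forced n (PB (J, j, k, a))" if J: "(J, j, k, a) \<in> IB" for J j k a
  proof -
    have J': "J \<subseteq> {..<4} \<times> {..<n}" "card J = 4" "inj_on snd J" and jk: "j < 4" "k < 4" "j \<noteq> k"
      using J by (auto simp: IB_def U_def)
    have finJ: "finite J" using J'(2) by (metis card.infinite zero_neq_numeral)
    define \<phi> where "\<phi> x z = (case x of None \<Rightarrow> lin \<sigma> j a z - lin \<sigma> k a z | Some p \<Rightarrow> lin \<sigma> (fst p) (snd p) z)" for x z
    have \<phi>: "\<phi> None = (\<lambda>z. lin \<sigma> j a z - lin \<sigma> k a z)" "\<phi> (Some p) = lin \<sigma> (fst p) (snd p)" for p by (simp_all add: \<phi>_def fun_eq_iff)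
    have l: "linear (\<phi> x)" for x by (cases x) (simp_all add: \<phi> linear_lin linear_compose_sub)
    define K where "K = insert None (Some ` J)"
    have K: "finite K" "4 < card K" using finJ J'(2) by (simp_all add: K_def card_image)
    obtain c where c: "\<exists>x\<in>K. c x \<noteq> 0" "\<And>z. (\<Sum>x\<in>K. c x * \<phi> x z) = 0"
      using functionals_dependent[of K \<phi>, OF l K] by blast
    have split: "(\<Sum>x\<in>K. c x * \<phi> x z) = c None * \<phi> None z + (\<Sum>p\<in>J. c (Some p) * lin \<sigma> (fst p) (snd p) z)" for z
      unfolding K_def using finJ by (simp add: sum.reindex \<phi>)
    obtain c' where c': "\<And>h. (\<Sum>i<n. c' i * h i) = (\<Sum>p\<in>J. c (Some p) * h (snd p))" "\<And>p. p \<in> J \<Longrightarrow> c' (snd p) = c (Some p)"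
      using sum_by_line[OF J'(1,3), of "\<lambda>p. c (Some p)"] by blast
    have "(\<Sum>i<n. c' i * h i) = 0" if P: "PB (J, j, k, a) h" for h
    proof -
      obtain z where z: "\<forall>(j, i)\<in>J. lin \<sigma> j i z = h i" "lin \<sigma> j a z = lin \<sigma> k a z" using P unfolding PB_def prod.case by blast
      have "(\<Sum>p\<in>J. c (Some p) * h (snd p)) = (\<Sum>p\<in>J. c (Some p) * lin \<sigma> (fst p) (snd p) z)" by (rule sum.cong) (use z in auto)
      also have "\<dots> = 0" using c(2)[of z] split[of z] z(2) by (simp add: \<phi>)
      finally show ?thesis using c'(1) by simp
    qed
    moreover have "\<exists>p\<in>J. c (Some p) \<noteq> 0"
    proof (rule ccontr)
      assume "\<not> ?thesis"
      then have 0: "c (Some p) = 0" if "p \<in> J" for p using that by blast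
      then have "c None \<noteq> 0" using c(1) by (auto simp: K_def)
      obtain z where "lin \<sigma> j a z \<noteq> lin \<sigma> k a z" using chord_functional_nonzero[OF jk] by blast
      then show False using c(2)[of z] split[of z] 0 \<open>c None \<noteq> 0\<close> by (simp add: \<phi>)
    qed
    then have "\<exists>i<n. c' i \<noteq> 0" using c'(2) J'(1) by fastforce
    ultimately show ?thesis unfolding forced_def by blast
  qed
  have fC: "forced n (PC (x, y, z))" if "(x, y, z) \<in> IC" for x y z
  proof -
    have lt: "x < n" "y < n" "z < n" "x \<noteq> y" "x \<noteq> z" "y \<noteq> z" using that by (auto simp: IC_def)
    define c where "c i = (if i = x then - (\<sigma> z - \<sigma> y) else 0) + (if i = y then - (\<sigma> x - \<sigma> z) else 0) + (if i = z then - (\<sigma> y - \<sigma> x) else 0)" for i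
    have d: "(if i = u then r else 0) * (s :: real) = (if i = u then r * s else 0)" for i u :: nat and r s by simp
    have "(\<Sum>i<n. c i * h i) = area h x y z" for h
      unfolding c_def distrib_right sum.distrib d using lt by (simp add: area_def algebra_simps)
    moreover have "area h x y z = 0" if "PC (x, y, z) h" for h
    proof -
      obtain p where "dev \<sigma> h x p = 0" "dev \<sigma> h y p = 0" "dev \<sigma> h z p = 0" using \<open>PC (x, y, z) h\<close> by (auto simp: PC_def)
      then show ?thesis using bary_sum[of z y h x p] by simp
    qed
    moreover have "c x \<noteq> 0" using lt slopes_distinct[of y z] by (simp add: c_def)
    ultimately show ?thesis unfolding forced_def using lt(1) by (intro exI[of _ c]) auto
  qed
  have fB': "forced n (PB x)" if "x \<in> IB" for x using fB that by (cases x rule: prod_cases4) simp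
  have fC': "forced n (PC x)" if "x \<in> IC" for x using fC that by (cases x rule: prod_cases3) simp
  have "forced n P" if "P \<in> PA ` IA \<union> PB ` IB \<union> PC ` IC" for P
    using that fA fB' fC' by blast
  then obtain h where h: "\<And>i. i < n \<Longrightarrow> \<bar>h i - h0 i\<bar> < \<delta>" "\<And>P. P \<in> PA ` IA \<union> PB ` IB \<union> PC ` IC \<Longrightarrow> \<not> P h"
    using avoid_forced[OF fin _ \<delta>, of n h0] by blast
  have "generic h" unfolding generic_def
  proof (intro conjI allI impI)
    fix J :: "(nat \<times> nat) set" assume "J \<subseteq> {..<4} \<times> {..<n}" "card J = 5" "inj_on snd J"
    then have "J \<in> IA" by (simp add: IA_def U_def)
    then have "\<not> PA J h" using h(2) by blast
    then show "\<not> (\<exists>z. \<forall>(j, i)\<in>J. lin \<sigma> j i z = h i)" by (simp add: PA_def)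
  next
    fix J :: "(nat \<times> nat) set" and j k a :: nat assume "J \<subseteq> {..<4} \<times> {..<n}" "card J = 4" "inj_on snd J" "j < 4" "k < 4" "a < n" "j \<noteq> k"
    then have "(J, j, k, a) \<in> IB" by (simp add: IB_def U_def)
    then have "\<not> PB (J, j, k, a) h" using h(2) by blast
    then show "\<not> (\<exists>z. (\<forall>(j, i)\<in>J. lin \<sigma> j i z = h i) \<and> lin \<sigma> j a z = lin \<sigma> k a z)" by (simp add: PB_def)
  next
    fix a b c assume "a < n" "b < n" "c < n" "a \<noteq> b" "a \<noteq> c" "b \<noteq> c"
    then have "(a, b, c) \<in> IC" by (simp add: IC_def)
    then have "\<not> PC (a, b, c) h" using h(2) by blast
    then show "\<not> (\<exists>p. dev \<sigma> h a p = 0 \<and> dev \<sigma> h b p = 0 \<and> dev \<sigma> h c p = 0)" by (simp add: PC_def)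
  qed
  then show ?thesis using h(1) that by blast
qed

section \<open>From lines to arbitrary closed polygons\<close>

text \<open>The common point of lines \<open>i\<close> and \<open>prv n i\<close>.\<close>
definition vertex :: "nat \<Rightarrow> (nat \<Rightarrow> real) \<Rightarrow> (nat \<Rightarrow> real) \<Rightarrow> nat \<Rightarrow> complex" where
  "vertex n \<sigma> h i = (let x = (h i - h (prv n i)) / (\<sigma> (prv n i) - \<sigma> i) in Complex x (\<sigma> i * x + h i))"

lemma between_param:
  fixes x a b :: real
  assumes "(x - a) * (x - b) < 0"
  obtains u where "0 \<le> u" "u \<le> 1" "x = (1 - u) * a + u * b"
proof -
  have ab: "a \<noteq> b" using assms zero_le_square[of "x - a"] by auto
  define u where "u = (x - a) / (b - a)"
  have "u * (b - a) = x - a" using ab by (simp add: u_def)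
  then have x: "x = (1 - u) * a + u * b" by (simp add: algebra_simps)
  have "(x - a) * (x - b) = (b - a)\<^sup>2 * (u * (u - 1))" unfolding x by (simp add: power2_eq_square algebra_simps)
  then have "(b - a)\<^sup>2 * (u * (u - 1)) < 0" using assms by simp
  then have "u * (u - 1) < 0" by (simp add: mult_less_0_iff)
  then have "0 < u \<and> u < 1" by (auto simp: mult_less_0_iff)
  then show ?thesis by (intro that[of u] x) auto
qed

lemma (in slopes) in_edge_segment:
  assumes "2 \<le> n" "i < n" and e: "in_edge n h i p" and l: "dev \<sigma> h i p = 0"
  shows "p \<in> closed_segment (vertex n \<sigma> h i) (vertex n \<sigma> h (nxt n i))"
proof -
  define a b where "a = prv n i" and "b = nxt n i"
  have lt: "a < n" "b < n" "a \<noteq> i" "b \<noteq> i" using assms by (auto simp: a_def b_def nxt_def prv_def)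
  have ne: "\<sigma> a - \<sigma> i \<noteq> 0" "\<sigma> i - \<sigma> b \<noteq> 0"
    using slopes_distinct lt assms(2) by (metis eq_iff_diff_eq_0)+
  define v w where "v = (h i - h a) / (\<sigma> a - \<sigma> i)" and "w = (h b - h i) / (\<sigma> i - \<sigma> b)"
  have v: "h i - h a = (\<sigma> a - \<sigma> i) * v" and w: "h b - h i = (\<sigma> i - \<sigma> b) * w"
    using ne by (simp_all add: v_def w_def)
  have V: "vertex n \<sigma> h i = Complex v (\<sigma> i * v + h i)" by (simp add: vertex_def v_def a_def Let_def)
  have "vertex n \<sigma> h b = Complex w (\<sigma> b * w + h b)"
    using prv_nxt[OF assms(2)] by (simp add: vertex_def w_def b_def Let_def)
  moreover have "\<sigma> b * w + h b = \<sigma> i * w + h i" using w by (simp add: algebra_simps)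
  ultimately have W: "vertex n \<sigma> h b = Complex w (\<sigma> i * w + h i)" by simp
  have Im: "Im p = \<sigma> i * Re p + h i" using l by (simp add: dev_def)
  have da: "dev \<sigma> h a p = (\<sigma> i - \<sigma> a) * (Re p - v)" and db: "dev \<sigma> h b p = (\<sigma> i - \<sigma> b) * (Re p - w)"
    using v w Im by (simp_all add: dev_def algebra_simps)
  have "((\<sigma> i - \<sigma> a) * (\<sigma> i - \<sigma> b))\<^sup>2 * ((Re p - v) * (Re p - w)) < 0"
    using e unfolding in_edge_def a_def[symmetric] b_def[symmetric] da db by (simp add: power2_eq_square mult_ac)
  then have "(Re p - v) * (Re p - w) < 0" by (simp add: mult_less_0_iff)
  then obtain u where u: "0 \<le> u" "u \<le> 1" "Re p = (1 - u) * v + u * w" by (rule between_param)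
  have ImV: "Im p = (1 - u) * (\<sigma> i * v + h i) + u * (\<sigma> i * w + h i)" unfolding Im u(3) by (simp add: algebra_simps)
  have "p = (1 - u) *\<^sub>R Complex v (\<sigma> i * v + h i) + u *\<^sub>R Complex w (\<sigma> i * w + h i)"
    using u(3) ImV by (simp add: complex_eq_iff)
  then show ?thesis using u(1,2) unfolding V W[unfolded b_def] in_segment by blast
qed

lemma (in slopes) generic_square:
  assumes "generic h" "3 \<le> n"
  obtains \<tau> z where "\<tau> \<in> tuples n" "\<And>j. j < 4 \<Longrightarrow> corner z j \<in> closed_segment (vertex n \<sigma> h (\<tau> ! j)) (vertex n \<sigma> h (nxt n (\<tau> ! j)))"
proof -
  have "odd (square_count n h)" using odd_square_count assms by blast
  then have "{c \<in> classes n. counted_class n h c} \<noteq> {}" unfolding square_count_def by (metis card.empty even_zero)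
  then obtain \<tau> where t: "\<tau> \<in> tuples n" "counted_class n h (cyc \<tau>)" unfolding classes_def by blast
  have s: "solvable \<tau>" using tuples_solvable[OF t(1)] by simp
  then have c: "counted n h \<tau>" using counted_class_cyc t(2) by blast
  have "corner (sol h \<tau>) j \<in> closed_segment (vertex n \<sigma> h (\<tau> ! j)) (vertex n \<sigma> h (nxt n (\<tau> ! j)))" if "j < 4" for j
  proof (rule in_edge_segment)
    show "2 \<le> n" using assms by simp
    have "\<tau> ! j \<in> set \<tau>" "set \<tau> \<subseteq> {..<n}" using s that by (auto simp: solvable_def)
    then show "\<tau> ! j < n" by auto
    show "in_edge n h (\<tau> ! j) (corner (sol h \<tau>) j)" using c that by (simp add: counted_def)
    show "dev \<sigma> h (\<tau> ! j) (corner (sol h \<tau>) j) = 0" by (simp add: dev_corner sol_incident[OF s that])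
  qed
  then show ?thesis using that t(1) by blast
qed

lemma vertex_tendsto:
  assumes "\<And>i. i < n \<Longrightarrow> (\<lambda>k. s k i) \<longlonglongrightarrow> \<sigma> i" "\<And>i. i < n \<Longrightarrow> (\<lambda>k. g k i) \<longlonglongrightarrow> h i"
    and "i < n" "\<sigma> (prv n i) \<noteq> \<sigma> i"
  shows "(\<lambda>k. vertex n (s k) (g k) i) \<longlonglongrightarrow> vertex n \<sigma> h i"
  unfolding vertex_def Let_def
  by (intro tendsto_intros assms prv_less) (use assms(4) in simp_all)

text \<open>Moving the vertices along \<open>(i, i^2)\<close> with a small factor \<open>t\<close>: the leading coefficient of the determinant of
  consecutive edges is of Vandermonde type.\<close>
lemma general_position:
  fixes X :: "nat \<Rightarrow> complex"
  assumes "3 \<le> n" "0 < \<eta>"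
  obtains Y where "\<And>i. i < n \<Longrightarrow> norm (Y i - X i) < \<eta>" "\<And>i. i < n \<Longrightarrow> Re (Y (nxt n i)) \<noteq> Re (Y i)"
    "\<And>i. i < n \<Longrightarrow> (Im (Y (nxt n i)) - Im (Y i)) * (Re (Y i) - Re (Y (prv n i)))
      \<noteq> (Im (Y i) - Im (Y (prv n i))) * (Re (Y (nxt n i)) - Re (Y i))"
proof -
  define B where "B = 1 + (\<Sum>i<n. norm (Complex i (i\<^sup>2)))"
  have B: "norm (Complex i (i\<^sup>2)) < B" if "i < n" for i
    unfolding B_def using that member_le_sum[of i "{..<n}" "\<lambda>i. norm (Complex i (i\<^sup>2))"] by simp
  have Bpos: "0 < B" unfolding B_def by (intro add_pos_nonneg sum_nonneg) auto
  define x y where "x i = Re (X i)" and "y i = Im (X i)" for i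
  define N P where "N i = real (nxt n i)" and "P i = real (prv n i)" for i
  define qa where "qa i = (N i ^ 2 - real i ^ 2) * (i - P i) - (real i ^ 2 - P i ^ 2) * (N i - i)" for i
  define qb where "qb i = (N i ^ 2 - real i ^ 2) * (x i - x (prv n i)) + (y (nxt n i) - y i) * (i - P i)
     - (real i ^ 2 - P i ^ 2) * (x (nxt n i) - x i) - (y i - y (prv n i)) * (N i - i)" for i
  define qc where "qc i = (y (nxt n i) - y i) * (x i - x (prv n i)) - (y i - y (prv n i)) * (x (nxt n i) - x i)" for i
  define Bad where "Bad = (\<Union>i<n. {t. 0 * t\<^sup>2 + (N i - i) * t + (x (nxt n i) - x i) = 0} \<union> {t. qa i * t\<^sup>2 + qb i * t + qc i = 0})"
  have fin: "finite Bad" unfolding Bad_def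
  proof (intro finite_UN_I finite_lessThan finite_UnI finite_quadratic_roots)
    fix i assume "i \<in> {..<n}"
    then have ne: "N i \<noteq> i" "P i \<noteq> i" "N i \<noteq> P i" using assms(1) by (auto simp: N_def P_def nxt_def prv_def)
    show "(0 :: real) \<noteq> 0 \<or> N i - i \<noteq> 0 \<or> x (nxt n i) - x i \<noteq> 0" using ne(1) by simp
    have "qa i = (N i - i) * (i - P i) * (N i - P i)" by (simp add: qa_def power2_eq_square algebra_simps)
    then show "qa i \<noteq> 0 \<or> qb i \<noteq> 0 \<or> qc i \<noteq> 0" using ne by simp
  qed
  have "0 < \<eta> / B" using assms(2) Bpos by simp
  then obtain t where t: "\<bar>t - 0\<bar> < \<eta> / B" "0 < t" "t \<notin> Bad" using avoid_finite[OF fin, of "\<eta> / B" 0] by blast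
  define Y where "Y i = X i + t *\<^sub>R Complex i (i\<^sup>2)" for i
  show ?thesis
  proof (rule that[of Y])
    fix i assume i: "i < n"
    have "norm (Y i - X i) = t * norm (Complex i (i\<^sup>2))" using t(2) by (simp add: Y_def)
    also have "\<dots> \<le> t * B" using B[OF i] t(2) by simp
    also have "\<dots> < \<eta>" using t(1,2) Bpos by (simp add: field_simps)
    finally show "norm (Y i - X i) < \<eta>" .
    have nb: "0 * t\<^sup>2 + (N i - i) * t + (x (nxt n i) - x i) \<noteq> 0" "qa i * t\<^sup>2 + qb i * t + qc i \<noteq> 0"
      using t(3) i unfolding Bad_def by blast+
    show "Re (Y (nxt n i)) \<noteq> Re (Y i)" using nb(1) by (auto simp: Y_def N_def x_def algebra_simps)
    have "(Im (Y (nxt n i)) - Im (Y i)) * (Re (Y i) - Re (Y (prv n i))) - (Im (Y i) - Im (Y (prv n i))) * (Re (Y (nxt n i)) - Re (Y i))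
      = qa i * t\<^sup>2 + qb i * t + qc i"
      by (simp add: Y_def N_def P_def x_def y_def qa_def qb_def qc_def power2_eq_square algebra_simps)
    then show "(Im (Y (nxt n i)) - Im (Y i)) * (Re (Y i) - Re (Y (prv n i)))
      \<noteq> (Im (Y i) - Im (Y (prv n i))) * (Re (Y (nxt n i)) - Re (Y i))" using nb(2) by auto
  qed
qed

text \<open>First move the vertices so that every edge lies on a line with a slope and consecutive slopes are different; then
  choose generic lines so close to these lines that their vertices are close as well.\<close>
lemma approximate_square:
  fixes X :: "nat \<Rightarrow> complex"
  assumes n: "3 \<le> n" and \<eta>: "0 < \<eta>"
  obtains V \<tau> z where "\<And>i. i < n \<Longrightarrow> norm (V i - X i) < \<eta>" "\<tau> \<in> tuples n"
    "\<And>j. j < 4 \<Longrightarrow> corner z j \<in> closed_segment (V (\<tau> ! j)) (V (nxt n (\<tau> ! j)))"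
proof -
  obtain Y where Y: "\<And>i. i < n \<Longrightarrow> norm (Y i - X i) < \<eta> / 2" "\<And>i. i < n \<Longrightarrow> Re (Y (nxt n i)) \<noteq> Re (Y i)"
    "\<And>i. i < n \<Longrightarrow> (Im (Y (nxt n i)) - Im (Y i)) * (Re (Y i) - Re (Y (prv n i)))
      \<noteq> (Im (Y i) - Im (Y (prv n i))) * (Re (Y (nxt n i)) - Re (Y i))"
    using general_position[OF n, of "\<eta> / 2" X] \<eta> by auto
  define s where "s i = (Im (Y (nxt n i)) - Im (Y i)) / (Re (Y (nxt n i)) - Re (Y i))" for i
  define g where "g i = Im (Y i) - s i * Re (Y i)" for i
  have sY: "Im (Y (nxt n i)) - Im (Y i) = s i * (Re (Y (nxt n i)) - Re (Y i))" if "i < n" for i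
    using Y(2)[OF that] by (simp add: s_def)
  have sp: "Im (Y i) - Im (Y (prv n i)) = s (prv n i) * (Re (Y i) - Re (Y (prv n i)))" if "i < n" for i
    using sY[OF prv_less[OF that]] nxt_prv[OF that] by simp
  have ne: "s (prv n i) \<noteq> s i" if "i < n" for i
    using Y(3)[OF that] sY[OF that] sp[OF that] by auto
  have vY: "vertex n s g i = Y i" if "i < n" for i
  proof -
    have "g i - g (prv n i) = (s (prv n i) - s i) * Re (Y i)" using sp[OF that] by (simp add: g_def algebra_simps)
    then have "(g i - g (prv n i)) / (s (prv n i) - s i) = Re (Y i)" using ne[OF that] by simp
    then show ?thesis by (simp add: vertex_def g_def complex_eq_iff)
  qed
  have "\<forall>k. \<exists>\<sigma> h. slopes \<sigma> n \<and> slopes.generic \<sigma> n h \<and> (\<forall>i<n. \<bar>\<sigma> i - s i\<bar> < 1 / Suc k \<and> \<bar>h i - g i\<bar> < 1 / Suc k)"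
  proof
    fix k
    obtain \<sigma> where \<sigma>: "slopes \<sigma> n" "\<forall>i<n. \<bar>\<sigma> i - s i\<bar> < 1 / Suc k" using slopes_perturbation[of "1 / Suc k" n s] by auto
    obtain h where "slopes.generic \<sigma> n h" "\<And>i. i < n \<Longrightarrow> \<bar>h i - g i\<bar> < 1 / Suc k"
      using slopes.generic_offsets[OF \<sigma>(1), of "1 / Suc k" g] by auto
    then show "\<exists>\<sigma> h. slopes \<sigma> n \<and> slopes.generic \<sigma> n h \<and> (\<forall>i<n. \<bar>\<sigma> i - s i\<bar> < 1 / Suc k \<and> \<bar>h i - g i\<bar> < 1 / Suc k)"
      using \<sigma> by blast
  qed
  then obtain \<sigma> h where \<sigma>: "\<And>k. slopes (\<sigma> k) n" "\<And>k. slopes.generic (\<sigma> k) n (h k)"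
      "\<And>k i. i < n \<Longrightarrow> \<bar>\<sigma> k i - s i\<bar> < 1 / Suc k" "\<And>k i. i < n \<Longrightarrow> \<bar>h k i - g i\<bar> < 1 / Suc k"
    unfolding choice_iff by blast
  have lim: "f \<longlonglongrightarrow> l" if "\<And>k. \<bar>f k - l\<bar> < 1 / Suc k" for f :: "nat \<Rightarrow> real" and l
  proof (rule LIM_zero_cancel, rule tendsto_rabs_zero_cancel, rule tendsto_sandwich[OF _ _ tendsto_const LIMSEQ_inverse_real_of_nat])
    show "\<forall>\<^sub>F k in sequentially. \<bar>f k - l\<bar> \<le> inverse (real (Suc k))" using that by (intro always_eventually allI less_imp_le) (simp add: inverse_eq_divide)
  qed simp
  have "(\<lambda>k. vertex n (\<sigma> k) (h k) i) \<longlonglongrightarrow> Y i" if "i < n" for i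
    using vertex_tendsto[of n \<sigma> s h g i] lim \<sigma>(3,4) ne vY that by auto
  then have "\<forall>\<^sub>F k in sequentially. dist (vertex n (\<sigma> k) (h k) i) (Y i) < \<eta> / 2" if "i < n" for i
    using that tendstoD \<eta> by (metis half_gt_zero)
  then have "\<forall>\<^sub>F k in sequentially. \<forall>i\<in>{..<n}. dist (vertex n (\<sigma> k) (h k) i) (Y i) < \<eta> / 2"
    by (intro eventually_ball_finite) auto
  then obtain k where k: "\<And>i. i < n \<Longrightarrow> dist (vertex n (\<sigma> k) (h k) i) (Y i) < \<eta> / 2"
    using eventually_happens'[OF sequentially_bot] by blast
  obtain \<tau> z where tz: "\<tau> \<in> tuples n" "\<And>j. j < 4 \<Longrightarrow> corner z j \<in> closed_segment (vertex n (\<sigma> k) (h k) (\<tau> ! j)) (vertex n (\<sigma> k) (h k) (nxt n (\<tau> ! j)))"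
    using slopes.generic_square[OF \<sigma>(1,2) n] by blast
  have "norm (vertex n (\<sigma> k) (h k) i - X i) < \<eta>" if "i < n" for i
    using k[OF that] Y(1)[OF that] norm_triangle_ineq[of "vertex n (\<sigma> k) (h k) i - Y i" "Y i - X i"]
    by (simp add: dist_norm)
  then show ?thesis using that tz by blast
qed

lemma closed_segment_perturb:
  fixes v :: "'a::real_normed_vector"
  assumes "p \<in> closed_segment v v'" "norm (v - x) \<le> \<eta>" "norm (v' - x') \<le> \<eta>"
  shows "infdist p (closed_segment x x') \<le> \<eta>"
proof -
  obtain u where u: "0 \<le> u" "u \<le> 1" "p = (1 - u) *\<^sub>R v + u *\<^sub>R v'" using assms(1) by (auto simp: in_segment)
  have "p - ((1 - u) *\<^sub>R x + u *\<^sub>R x') = (1 - u) *\<^sub>R (v - x) + u *\<^sub>R (v' - x')" by (simp add: u(3) algebra_simps)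
  then have "dist p ((1 - u) *\<^sub>R x + u *\<^sub>R x') \<le> norm ((1 - u) *\<^sub>R (v - x)) + norm (u *\<^sub>R (v' - x'))"
    by (simp add: dist_norm norm_triangle_ineq del: norm_scaleR)
  also have "\<dots> \<le> (1 - u) * \<eta> + u * \<eta>" using u(1,2) assms(2,3) by (simp add: add_mono mult_left_mono)
  also have "\<dots> = \<eta>" by (simp add: algebra_simps)
  finally show ?thesis using u(1,2) by (intro infdist_le2[of "(1 - u) *\<^sub>R x + u *\<^sub>R x'"]) (auto simp: in_segment)
qed

text \<open>Otherwise the total distance of the corners from their edges would have a positive lower bound on a large ball of
  squares, uniformly in the finitely many tuples, contradicting the approximate squares.\<close>
lemma inscribed_tuple:
  fixes X :: "nat \<Rightarrow> complex"
  assumes n: "3 \<le> n"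
  obtains \<tau> z where "\<tau> \<in> tuples n" "\<And>j. j < 4 \<Longrightarrow> corner z j \<in> closed_segment (X (\<tau> ! j)) (X (nxt n (\<tau> ! j)))"
proof (rule ccontr)
  assume "\<not> thesis"
  then have no: "\<exists>j<4. corner z j \<notin> closed_segment (X (\<tau> ! j)) (X (nxt n (\<tau> ! j)))" if "\<tau> \<in> tuples n" for \<tau> z
    using that \<open>(\<And>\<tau> z. \<tau> \<in> tuples n \<Longrightarrow> (\<And>j. j < 4 \<Longrightarrow> corner z j \<in> closed_segment (X (\<tau> ! j)) (X (nxt n (\<tau> ! j)))) \<Longrightarrow> thesis)\<close> by blast
  define D where "D \<tau> z = (\<Sum>j<4. infdist (corner z j) (closed_segment (X (\<tau> ! j)) (X (nxt n (\<tau> ! j)))))" for \<tau> z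
  have pos: "0 < D \<tau> z" if t: "\<tau> \<in> tuples n" for \<tau> z
  proof -
    obtain j where j: "j < 4" "corner z j \<notin> closed_segment (X (\<tau> ! j)) (X (nxt n (\<tau> ! j)))" using no[OF t] by blast
    then have "0 < infdist (corner z j) (closed_segment (X (\<tau> ! j)) (X (nxt n (\<tau> ! j))))"
      by (intro infdist_pos_not_in_closed) auto
    also have "\<dots> \<le> D \<tau> z" unfolding D_def using j(1) by (intro member_le_sum) (auto simp: infdist_nonneg)
    finally show ?thesis .
  qed
  define B where "B = (\<Sum>i<n. norm (X i)) + 1"
  have Bpos: "0 < B" unfolding B_def by (intro add_nonneg_pos sum_nonneg) auto
  have cont: "continuous_on K (\<lambda>z. D \<tau> z)" for \<tau> K
    unfolding D_def corner_def by (intro continuous_intros)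
  have "\<exists>m>0. \<forall>z\<in>cball 0 (2 * B). m \<le> D \<tau> z" if t: "\<tau> \<in> tuples n" for \<tau>
  proof -
    obtain z0 where "\<forall>z\<in>cball 0 (2 * B). D \<tau> z0 \<le> D \<tau> z"
      using continuous_attains_inf[OF compact_cball _ cont, of "0 :: complex \<times> complex" "2 * B" \<tau>] Bpos by auto
    then show ?thesis using pos[OF t] by blast
  qed
  then have "\<forall>\<tau>\<in>tuples n. \<exists>m. 0 < m \<and> (\<forall>z\<in>cball 0 (2 * B). m \<le> D \<tau> z)" by blast
  from bchoice[OF this] obtain m where m: "\<And>\<tau>. \<tau> \<in> tuples n \<Longrightarrow> 0 < m \<tau>" "\<And>\<tau> z. \<tau> \<in> tuples n \<Longrightarrow> z \<in> cball 0 (2 * B) \<Longrightarrow> m \<tau> \<le> D \<tau> z"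
    by blast
  define \<mu> where "\<mu> = Min (insert 8 (m ` tuples n))"
  have \<mu>: "0 < \<mu>" "\<mu> \<le> 8" "\<And>\<tau>. \<tau> \<in> tuples n \<Longrightarrow> \<mu> \<le> m \<tau>"
    unfolding \<mu>_def using finite_tuples[of n] m(1) by auto
  have \<mu>8: "0 < \<mu> / 8" using \<mu>(1) by simp
  obtain V \<tau> z where V: "\<And>i. i < n \<Longrightarrow> norm (V i - X i) < \<mu> / 8" and t: "\<tau> \<in> tuples n"
    and z: "\<And>j. j < 4 \<Longrightarrow> corner z j \<in> closed_segment (V (\<tau> ! j)) (V (nxt n (\<tau> ! j)))"
    using approximate_square[OF n \<mu>8, of X] by blast
  have "norm (V i) \<le> B" if "i < n" for i
    using norm_triangle_ineq[of "V i - X i" "X i"] V[OF that] \<mu>(2) member_le_sum[of i "{..<n}" "\<lambda>i. norm (X i)"] that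
    by (simp add: B_def)
  then have "closed_segment (V (\<tau> ! j)) (V (nxt n (\<tau> ! j))) \<subseteq> cball 0 B" if "j < 4" for j
    using tuples_nth[OF t that] nxt_less by (intro closed_segment_subset) auto
  then have c: "norm (corner z j) \<le> B" if "j < 4" for j using z that by force
  have f: "fst z = (1 / 2) *\<^sub>R (corner z 0 + corner z 2)" and s: "snd z = (1 / 2) *\<^sub>R (corner z 0 - corner z 2)"
    by (simp_all add: corner_def)
  have "norm (fst z) \<le> B" unfolding f using norm_triangle_ineq[of "corner z 0" "corner z 2"] c[of 0] c[of 2] by simp
  moreover have "norm (snd z) \<le> B" unfolding s using norm_triangle_ineq4[of "corner z 0" "corner z 2"] c[of 0] c[of 2] by simp
  ultimately have "z \<in> cball 0 (2 * B)" using norm_Pair_le[of "fst z" "snd z"] by simp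
  then have "\<mu> \<le> D \<tau> z" using m(2)[OF t] \<mu>(3)[OF t] by fastforce
  also have "D \<tau> z \<le> (\<Sum>j<4::nat. \<mu> / 8)" unfolding D_def
  proof (rule sum_mono)
    fix j :: nat assume "j \<in> {..<4}"
    then have j: "j < 4" by simp
    show "infdist (corner z j) (closed_segment (X (\<tau> ! j)) (X (nxt n (\<tau> ! j)))) \<le> \<mu> / 8"
      using closed_segment_perturb[OF z[OF j]] V tuples_nth[OF t j] nxt_less by (meson less_imp_le)
  qed
  finally show False using \<mu>(1) by simp
qed

section \<open>Edges of a simple polygon\<close>

lemma arc_broken_line_distinct:
  "arc (broken_line ys) \<Longrightarrow> Suc i < length ys \<Longrightarrow> ys ! i \<noteq> ys ! Suc i"
proof (induction ys arbitrary: i rule: broken_line.induct)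
  case (3 x y)
  then show ?case using arc_distinct_ends[of "linepath x y"] by auto
next
  case (4 x y z zs)
  have "arc (linepath x y)" "arc (broken_line (y # z # zs))" using 4(2) by (simp_all add: arc_join_eq)
  then show ?case using 4(1,3) arc_distinct_ends[of "linepath x y"] by (cases i) auto
qed auto

lemma arc_broken_line_edges:
  "arc (broken_line ys) \<Longrightarrow> i < j \<Longrightarrow> Suc j < length ys \<Longrightarrow>
    p \<in> closed_segment (ys ! i) (ys ! Suc i) \<Longrightarrow> p \<in> closed_segment (ys ! j) (ys ! Suc j) \<Longrightarrow> j = Suc i \<and> p = ys ! j"
proof (induction ys arbitrary: i j rule: broken_line.induct)
  case (4 x y z zs)
  let ?R = "y # z # zs"
  have a: "arc (broken_line ?R)" and i: "closed_segment x y \<inter> path_image (broken_line ?R) \<subseteq> {y}"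
    using 4(2) by (simp_all add: arc_join_eq)
  obtain j' where j: "j = Suc j'" using 4(3) by (cases j) auto
  have pj: "p \<in> closed_segment (?R ! j') (?R ! Suc j')" and lj: "Suc j' < length ?R" using 4(4,6) j by auto
  show ?case
  proof (cases i)
    case (Suc i')
    then have "j' = Suc i' \<and> p = ?R ! j'" using 4(1)[OF a _ lj _ pj, of i'] 4(3,5) j by simp
    then show ?thesis using Suc j by simp
  next
    case 0
    have "p \<in> path_image (broken_line ?R)"
      using pj lj by (subst path_image_broken_line) auto
    then have p: "p = y" using i 4(5) 0 by auto
    have "j' = 0"
    proof (rule ccontr)
      assume "j' \<noteq> 0"
      then have "j' = Suc 0 \<and> p = ?R ! j'" using 4(1)[OF a _ lj _ pj, of 0] p by simp
      then show False using p arc_broken_line_distinct[OF a, of 0] by auto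
    qed
    then show ?thesis using p 0 j by simp
  qed
qed auto

text \<open>Two edges meet at most in a common vertex. The traversal splits into the first edge and an arc through all the others;
  injectivity of the loop says that the first edge meets this arc in its two end points only.\<close>
lemma simple_polygon_edges:
  assumes sp: "simple_polygon xs" and n: "n = length xs" and lt: "i < j" "j < n"
    and p: "p \<in> closed_segment (xs ! i) (xs ! nxt n i)" "p \<in> closed_segment (xs ! j) (xs ! nxt n j)"
  shows "j = Suc i \<and> p = xs ! j \<or> i = 0 \<and> j = n - 1 \<and> p = xs ! 0"
    and "xs ! i \<noteq> xs ! Suc i"
proof -
  define ys where "ys = xs @ [hd xs]"
  have n3: "3 \<le> n" and simple: "simple_path (broken_line ys)"
    using sp n by (auto simp: simple_polygon_def closed_polygon_path_def ys_def)
  have ne: "xs \<noteq> []" using n n3 by auto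
  have y: "ys ! i = xs ! i" "ys ! Suc i = xs ! nxt n i" if "i < n" for i
    using that n ne by (auto simp: ys_def nth_append nxt_def hd_conv_nth)
  have len: "length ys = Suc n" by (simp add: ys_def n)
  obtain x1 x2 x3 zs where xs: "xs = x1 # x2 # x3 # zs"
    using n3 n by (cases xs; cases "tl xs"; cases "tl (tl xs)") auto
  define R where "R = x2 # x3 # zs @ [x1]"
  have ysR: "ys = x1 # R" by (simp add: ys_def xs R_def)
  have "simple_path (linepath x1 x2 +++ broken_line R)" using simple by (simp add: ysR R_def)
  then have a: "arc (linepath x1 x2)" "arc (broken_line R)" and I: "closed_segment x1 x2 \<inter> path_image (broken_line R) \<subseteq> {x1, x2}"
    by (simp_all add: simple_path_join_loop_eq R_def)
  have lenR: "length R = n" using len by (simp add: ysR)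
  have dist: "ys ! i \<noteq> ys ! Suc i" if "i < n" for i
  proof (cases i)
    case 0 then show ?thesis using arc_distinct_ends[OF a(1)] by (simp add: ysR R_def)
  next
    case (Suc k) then show ?thesis using arc_broken_line_distinct[OF a(2), of k] that lenR by (simp add: ysR)
  qed
  have later: "j = Suc i \<and> p = ys ! j" if ij: "0 < i" "i < j" "j < n"
      "p \<in> closed_segment (ys ! i) (ys ! Suc i)" "p \<in> closed_segment (ys ! j) (ys ! Suc j)" for i j
  proof -
    obtain i' j' where "i = Suc i'" "j = Suc j'" using ij(1,2) by (cases i; cases j) auto
    then show ?thesis using arc_broken_line_edges[OF a(2), of i' j' p] ij lenR by (simp add: ysR)
  qed
  have first: "j = 1 \<and> p = ys ! 1 \<or> j = n - 1 \<and> p = ys ! 0" if j: "0 < j" "j < n"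
      and p: "p \<in> closed_segment (ys ! 0) (ys ! Suc 0)" "p \<in> closed_segment (ys ! j) (ys ! Suc j)" for j
  proof -
    obtain j' where j': "j = Suc j'" using j by (cases j) auto
    have "p \<in> path_image (broken_line R)"
      using p(2) j(2) j' lenR n3 by (subst path_image_broken_line) (auto simp: ysR)
    then have "p = ys ! 0 \<or> p = ys ! 1" using I p(1) by (auto simp: ysR R_def)
    moreover have "j = 1" if "p = ys ! 1"
    proof (rule ccontr)
      assume "j \<noteq> 1"
      then have "j = 2 \<and> p = ys ! 2" using later[of 1 j] j p(2) that by (simp add: numeral_2_eq_2)
      then show False using that dist[of 1] n3 by (simp add: numeral_2_eq_2)
    qed
    moreover have "j = n - 1" if 0: "p = ys ! 0"
    proof (rule ccontr)
      assume "j \<noteq> n - 1"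
      have e: "ys ! 0 = ys ! Suc (n - 1)" using n3 y[of "n - 1"] y[of 0] by (simp add: nxt_def)
      have "p = ys ! (n - 1)" using later[of j "n - 1"] j p(2) \<open>j \<noteq> n - 1\<close> e 0 by simp
      then show False using dist[of "n - 1"] e 0 n3 by simp
    qed
    ultimately show ?thesis by blast
  qed
  have il: "i < n" using lt by simp
  have "p \<in> closed_segment (ys ! i) (ys ! Suc i)" "p \<in> closed_segment (ys ! j) (ys ! Suc j)"
    using lt by (simp_all only: y[OF lt(2)] y[OF il] p)
  then have "j = Suc i \<and> p = ys ! j \<or> i = 0 \<and> j = n - 1 \<and> p = ys ! 0"
    using later[of i j] first[of j] lt by (cases "i = 0") auto
  then show "j = Suc i \<and> p = xs ! j \<or> i = 0 \<and> j = n - 1 \<and> p = xs ! 0" using y(1)[OF lt(2)] y(1)[of 0] lt by auto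
  show "xs ! i \<noteq> xs ! Suc i" using dist[of i] y[of i] lt by (simp add: nxt_def)
qed

lemma simple_polygon_nonadjacent:
  assumes "simple_polygon xs" "n = length xs" "i < n" "j < n" "i \<noteq> j" "\<not> adjacent n i j"
  shows "closed_segment (xs ! i) (xs ! nxt n i) \<inter> closed_segment (xs ! j) (xs ! nxt n j) = {}"
proof -
  have *: "nxt n i = j \<or> nxt n j = i" if "i < j" "j < n" "p \<in> closed_segment (xs ! i) (xs ! nxt n i)" "p \<in> closed_segment (xs ! j) (xs ! nxt n j)" for i j p
    using simple_polygon_edges(1)[OF assms(1,2) that] that(1,2) by (auto simp: nxt_def)
  show ?thesis using *[of i j] *[of j i] assms(3-6) unfolding adjacent_def by (meson disjoint_iff linorder_neqE_nat)
qed

lemma simple_polygon_three_edges: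
  assumes "simple_polygon xs" "n = length xs" "K \<subseteq> {..<n}" "3 \<le> card K"
  shows "\<not> (\<forall>i\<in>K. p \<in> closed_segment (xs ! i) (xs ! nxt n i))"
proof
  assume K: "\<forall>i\<in>K. p \<in> closed_segment (xs ! i) (xs ! nxt n i)"
  have *: "\<not> (i < j \<and> j < k)" if "i \<in> K" "j \<in> K" "k \<in> K" for i j k
  proof
    assume ijk: "i < j \<and> j < k"
    have "k < n" using that assms(3) by auto
    note e = simple_polygon_edges[OF assms(1,2) _ _ K[rule_format, OF that(1)] K[rule_format, OF that(2)]]
      simple_polygon_edges(1)[OF assms(1,2) _ _ K[rule_format, OF that(1)] K[rule_format, OF that(3)]]
    show False using e ijk \<open>k < n\<close> by auto
  qed
  obtain L where "L \<subseteq> K" "card L = 3" using assms(4) by (meson obtain_subset_with_card_n)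
  then obtain a b c where "a \<in> K" "b \<in> K" "c \<in> K" "a \<noteq> b" "a \<noteq> c" "b \<noteq> c" by (auto simp: card_3_iff)
  then show False using *[of a b c] *[of a c b] *[of b a c] *[of b c a] *[of c a b] *[of c b a] by linarith
qed

section \<open>Squares in the plane\<close>

definition to_complex :: "real^2 \<Rightarrow> complex" where "to_complex p = Complex (p $ 1) (p $ 2)"

lemma linear_to_complex: "linear to_complex"
  by (rule linearI) (simp_all add: to_complex_def complex_eq_iff)

lemma to_complex_diff: "to_complex (a - b) = to_complex a - to_complex b"
  by (rule linear_diff[OF linear_to_complex])

lemma to_complex_inner: "to_complex a \<bullet> to_complex b = a \<bullet> b"
  by (simp add: to_complex_def inner_complex_def inner_vec_def sum_2)

lemma to_complex_norm: "norm (to_complex a) = norm a"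
  by (simp add: norm_eq_sqrt_inner to_complex_inner)

lemma to_complex_inj: "to_complex a = to_complex b \<Longrightarrow> a = b"
  using to_complex_norm[of "a - b"] by (simp add: to_complex_diff)

text \<open>Consecutive corners differ by \<open>(1 - \<i>) * w\<close> and \<open>(1 + \<i>) * w\<close> alternately, up to sign, and these numbers have equal modulus.\<close>
lemma corners_square:
  assumes "snd z \<noteq> 0" and c: "to_complex a = corner z 0" "to_complex b = corner z 1" "to_complex c = corner z 2" "to_complex d = corner z 3"
  shows "is_square a b c d"
proof -
  have d: "dist p q = norm (to_complex p - to_complex q)" for p q
    by (simp add: dist_norm to_complex_norm[symmetric] to_complex_diff)
  have o: "orthogonal p q \<longleftrightarrow> to_complex p \<bullet> to_complex q = 0" for p q
    by (simp add: orthogonal_def to_complex_inner)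
  define r where "r = sqrt 2 * norm (snd z)"
  have "corner z 0 - corner z 1 = (1 - \<i>) * snd z" "corner z 1 - corner z 2 = (1 + \<i>) * snd z"
    "corner z 2 - corner z 3 = - ((1 - \<i>) * snd z)" "corner z 3 - corner z 0 = - ((1 + \<i>) * snd z)"
    by (simp_all add: corner_def ii_cubed algebra_simps)
  moreover have "norm (1 - \<i>) = sqrt 2" "norm (1 + \<i>) = sqrt 2" by (simp_all add: cmod_def)
  ultimately have "dist a b = r" "dist b c = r" "dist c d = r" "dist d a = r"
    by (simp_all add: d c r_def norm_mult)
  moreover have "0 < r" using assms(1) by (simp add: r_def)
  moreover have "orthogonal (b - a) (d - a)" "orthogonal (c - b) (a - b)" "orthogonal (d - c) (b - c)" "orthogonal (a - d) (c - d)"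
    unfolding o to_complex_diff c by (simp_all add: corner_def ii_cubed inner_complex_def algebra_simps)
  ultimately show ?thesis by (simp add: is_square_def)
qed

theorem mainTheorem1:
  fixes xs :: "(real^2) list"
  assumes "simple_polygon xs"
  shows "\<exists>a b c d. {a, b, c, d} \<subseteq> polygon_curve xs \<and> is_square a b c d"
proof -
  define n where "n = length xs"
  have n: "3 \<le> n" using assms by (simp add: simple_polygon_def n_def)
  define E where "E i = closed_segment (xs ! i) (xs ! nxt n i)" for i
  obtain \<tau> z where t: "\<tau> \<in> tuples n"
    and z: "\<And>j. j < 4 \<Longrightarrow> corner z j \<in> closed_segment (to_complex (xs ! (\<tau> ! j))) (to_complex (xs ! nxt n (\<tau> ! j)))"
    using inscribed_tuple[OF n, of "\<lambda>i. to_complex (xs ! i)"] by blast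
  have "\<exists>p. p \<in> E (\<tau> ! j) \<and> to_complex p = corner z j" if "j < 4" for j
    using z[OF that] unfolding E_def closed_segment_linear_image[OF linear_to_complex] by auto
  then obtain P where P: "\<And>j. j < 4 \<Longrightarrow> P j \<in> E (\<tau> ! j)" "\<And>j. j < 4 \<Longrightarrow> to_complex (P j) = corner z j" by metis
  have t3: "3 \<le> card (set \<tau>)"
  proof (rule ccontr)
    assume "\<not> ?thesis"
    then have cr: "crossing \<tau>" "\<not> adjacent n (\<tau> ! 0) (\<tau> ! 1)" using t by (auto simp: tuples_def)
    then have t02: "\<tau> ! 2 = \<tau> ! 0" "\<tau> ! 3 = \<tau> ! 1" "\<tau> ! 0 \<noteq> \<tau> ! 1" by (auto simp: crossing_def)
    \<comment> \<open>The diagonals have the same midpoint, so the two edges would meet.\<close>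
  have "midpoint (P 0) (P 2) \<in> E (\<tau> ! 0)" "midpoint (P 1) (P 3) \<in> E (\<tau> ! 1)"
      using P(1)[of 0] P(1)[of 1] P(1)[of 2] P(1)[of 3] t02(1,2) unfolding E_def
      by (auto intro!: subsetD[OF closed_segment_subset midpoint_in_closed_segment])
    moreover have "midpoint (P 0) (P 2) = midpoint (P 1) (P 3)"
    proof (rule to_complex_inj)
      have "to_complex (midpoint p q) = (1 / 2) *\<^sub>R (to_complex p + to_complex q)" for p q
        using linear_to_complex by (simp add: midpoint_def linear_scale linear_add)
      then show "to_complex (midpoint (P 0) (P 2)) = to_complex (midpoint (P 1) (P 3))"
        by (simp add: P(2) corner_def ii_cubed)
    qed
    moreover have "E (\<tau> ! 0) \<inter> E (\<tau> ! 1) = {}"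
      unfolding E_def using simple_polygon_nonadjacent[OF assms n_def] tuples_nth[OF t] t02(3) cr(2) by simp
    ultimately show False by auto
  qed
  have sub: "set \<tau> \<subseteq> {..<n}" and len: "length \<tau> = 4" using t by (auto simp: tuples_def)
  have w: "snd z \<noteq> 0"
  proof
    assume "snd z = 0"
    then have "to_complex (P j) = to_complex (P 0)" if "j < 4" for j using that P(2) by (simp add: corner_def)
    then have "P j = P 0" if "j < 4" for j using that to_complex_inj by blast
    then have "\<forall>j<4. P 0 \<in> E (\<tau> ! j)" using P(1) by metis
    then have "\<forall>i\<in>set \<tau>. P 0 \<in> E i" using len by (metis in_set_conv_nth)
    then show False using simple_polygon_three_edges[OF assms n_def sub t3] unfolding E_def by blast
  qed
  have "E i \<subseteq> polygon_curve xs" if "i < n" for i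
    using that unfolding E_def polygon_curve_def n_def
    by (auto simp: nxt_def intro!: bexI[of _ i])
  then have "P j \<in> polygon_curve xs" if "j < 4" for j using P(1)[OF that] tuples_nth[OF t that] by blast
  then have "{P 0, P 1, P 2, P 3} \<subseteq> polygon_curve xs" by simp
  moreover have "is_square (P 0) (P 1) (P 2) (P 3)" by (rule corners_square[OF w]) (simp_all add: P(2))
  ultimately show ?thesis by blast
qed

end
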